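(* Let $\Omega\subset\mathbb{R}^d$ be a bounded open interval when $d=1$, or a bounded connected $C^{1,1}$ open set when $d\ge 2$. Let $\beta\in(\tfrac12,1)$ and let $(D_t)_{t\ge0}$ be a subordinator whose Laplace exponent $\phi$ is regularly varying at $\infty$ with index $\beta$ and whose Lévy measure has an almost monotone density. Let $(W_t)_{t\ge0}$ be a Brownian motion in $\mathbb{R}^d$ independent of $(D_t)$. Then $$\lim_{t\downarrow 0}\frac{|\Omega|-\tilde Q^{W\circ D}_\Omega(t)}{[\phi^{-1}(1/t)]^{-1/2}}=\mathbb{E}\big[(S^{(\beta)}_1)^{1/2}\big]\cdot\frac{2|\partial\Omega|}{\sqrt{\pi}} \quad\text{and}\quad \lim_{t\downarrow 0}\frac{|\Omega|-\mathbb{H}^{W\circ D}_\Omega(t)}{[\phi^{-1}(1/t)]^{-1/2}}=\mathbb{E}\big[(S^{(\beta)}_1)^{1/2}\big]\cdot\frac{|\partial\Omega|}{\sqrt{\pi}},$$ where $(S^{(\beta)}_t)_{t\ge0}$ is a $\beta$-stable subordinator.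
   Context: Brownian motion: $(W_t)$ is normalized so that $\mathbb{E}_0[e^{-i\langle\xi,W_t\rangle}]=e^{-t|\xi|^2}$ (generator $\Delta$). Under $\mathbb{P}_x$ (the product of the law of $W$ started at $x$ and the law of the independent time change) $W_0=x$. Heat contents: $\tau^W_\Omega=\inf\{t>0: W_t\in\Omega^c\}$. The killed process is $W^\Omega_t=W_t$ for $t<\tau^W_\Omega$ and $W^\Omega_t=\partial$ (a cemetery state, not in $\Omega$) for $t\ge\tau^W_\Omega$. The spectral heat content of the subordinate killed process $(W^\Omega_{D_t})$ is $\tilde Q^{W\circ D}_\Omega(t)=\int_\Omega\mathbb{P}_x(\tau^{W^\Omega\circ D}_\Omega>t)\,dx$, where $\tau^{W^\Omega\circ D}_\Omega=\inf\{t>0: W^\Omega_{D_t}\notin\Omega\}$. The regular heat content is $\mathbb{H}^{W\circ D}_\Omega(t)=\int_\Omega\mathbb{P}_x(W_{D_t}\in\Omega)\,dx$. $|\Omega|$ is $d$-dimensional Lebesgue measure and $|\partial\Omega|$ is the $(d-1)$-dimensional measure of the boundary (number of boundary points when $d=1$). Subordinator: a subordinator $(D_t)$ with Laplace exponent $\phi$ is a strictly increasing one-dimensional Lévy process with càdlàg paths, $D_0=0$, killing rate $0$, drift $0$, and infinite Lévy measure $\nu$ ($\nu((0,\infty))=\infty$, $\int_0^\infty(y\wedge1)\,\nu(dy)<\infty$), with $\mathbb{E}[e^{-sD_t}]=e^{-t\phi(s)}$, $\phi(s)=\int_0^\infty(1-e^{-sy})\,\nu(dy)$. Then $\phi$ is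 a strictly increasing bijection of $(0,\infty)$ with inverse $\phi^{-1}$. A $\beta$-stable subordinator has Laplace exponent $s^\beta$. A function $f:(0,\infty)\to(0,\infty)$ is regularly varying at $\infty$ with index $\rho$ if $f(cs)/f(s)\to c^\rho$ as $s\to\infty$ for each $c>0$. The Lévy measure has an almost monotone density if $\nu(dx)=\nu(x)\,dx$ and there is $C\ge1$ with $\nu(y)\le C\nu(x)$ for all $0<x\le y$. *)

theory Defs
  imports "HOL-Probability.Probability"
begin

section \<open>Processes\<close>

text \<open>A process is a function \<open>X :: real \<Rightarrow> 'w \<Rightarrow> 'b\<close>; only the times \<open>t \<ge> 0\<close> are relevant.\<close>

definition cadlag :: "(real \<Rightarrow> 'b::topological_space) \<Rightarrow> bool" where
  "cadlag f \<longleftrightarrow>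
     (\<forall>t\<ge>0. (f \<longlongrightarrow> f t) (at_right t)) \<and> (\<forall>t>0. \<exists>l. (f \<longlongrightarrow> l) (at_left t))"

text \<open>The starting point is not fixed here. Path properties are required for every \<open>\<omega>\<close>, so that
  the exit times below are measurable without completing the probability space.\<close>

definition levy_process :: "'w measure \<Rightarrow> (real \<Rightarrow> 'w \<Rightarrow> 'b::euclidean_space) \<Rightarrow> bool" where
  "levy_process M X \<longleftrightarrow>
     prob_space M \<and>
     (\<forall>t\<ge>0. X t \<in> borel_measurable M) \<and>
     (\<forall>(n::nat) (t::nat \<Rightarrow> real). 0 \<le> t 0 \<and> (\<forall>i<n. t i \<le> t (Suc i)) \<longrightarrow>
        prob_space.indep_vars M (\<lambda>_. borel) (\<lambda>i \<omega>. X (t (Suc i)) \<omega> - X (t i) \<omega>) {..<n}) \<and>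
     (\<forall>s t. 0 \<le> s \<and> s \<le> t \<longrightarrow>
        distr M borel (\<lambda>\<omega>. X t \<omega> - X s \<omega>) = distr M borel (\<lambda>\<omega>. X (t - s) \<omega> - X 0 \<omega>)) \<and>
     (\<forall>\<omega>\<in>space M. cadlag (\<lambda>t. X t \<omega>))"

text \<open>The characteristic function fixes the normalization with generator \<open>\<Delta>\<close> (not \<open>\<Delta>/2\<close>).
  \<open>W 0 = x\<close> is only required almost surely because one function \<open>W\<close> serves all starting points.\<close>

definition brownian_motion :: "'w measure \<Rightarrow> 'a::euclidean_space \<Rightarrow> (real \<Rightarrow> 'w \<Rightarrow> 'a) \<Rightarrow> bool" where
  "brownian_motion M x W \<longleftrightarrow>
     levy_process M W \<and>
     (AE \<omega> in M. W 0 \<omega> = x) \<and>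
     (\<forall>\<omega>\<in>space M. continuous_on {0..} (\<lambda>t. W t \<omega>)) \<and>
     (\<forall>t\<ge>0. \<forall>\<xi>. (CLINT \<omega>|M. exp (- \<i> * complex_of_real (\<xi> \<bullet> (W t \<omega> - x))))
                 = complex_of_real (exp (- t * (norm \<xi>)\<^sup>2)))"

text \<open>The Levy measure lives on \<open>(0,\<infinity>)\<close> and is represented as a Borel measure on the real line
  that does not charge \<open>(-\<infinity>,0]\<close>.\<close>

definition infinite_levy_measure :: "real measure \<Rightarrow> bool" where
  "infinite_levy_measure \<nu> \<longleftrightarrow>
     sets \<nu> = sets borel \<and> emeasure \<nu> {..0} = 0 \<and> emeasure \<nu> {0<..} = \<infinity> \<and>
     (\<integral>\<^sup>+y. ennreal (min y 1) \<partial>\<nu>) < \<infinity>"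

text \<open>Zero killing rate and zero drift are expressed by the formula for \<open>\<phi>\<close>, which has neither a
  constant nor a linear term. Only the values of \<open>\<phi>\<close> on \<open>(0,\<infinity>)\<close> matter.\<close>

definition subordinator ::
  "'w measure \<Rightarrow> (real \<Rightarrow> 'w \<Rightarrow> real) \<Rightarrow> (real \<Rightarrow> real) \<Rightarrow> real measure \<Rightarrow> bool" where
  "subordinator M D \<phi> \<nu> \<longleftrightarrow>
     levy_process M D \<and>
     (\<forall>\<omega>\<in>space M. D 0 \<omega> = 0 \<and> strict_mono_on {0..} (\<lambda>t. D t \<omega>)) \<and>
     infinite_levy_measure \<nu> \<and>
     (\<forall>s>0. \<phi> s = (LINT y|\<nu>. 1 - exp (- s * y))) \<and>
     (\<forall>t\<ge>0. \<forall>s>0. (LINT \<omega>|M. exp (- s * D t \<omega>)) = exp (- t * \<phi> s))"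

definition stable_subordinator :: "'w measure \<Rightarrow> (real \<Rightarrow> 'w \<Rightarrow> real) \<Rightarrow> real \<Rightarrow> bool" where
  "stable_subordinator M S \<beta> \<longleftrightarrow> (\<exists>\<nu>. subordinator M S (\<lambda>s. s powr \<beta>) \<nu>)"

definition regularly_varying :: "(real \<Rightarrow> real) \<Rightarrow> real \<Rightarrow> bool" where
  "regularly_varying f \<rho> \<longleftrightarrow>
     (\<forall>s>0. f s > 0) \<and> (\<forall>c>0. ((\<lambda>s. f (c * s) / f s) \<longlongrightarrow> c powr \<rho>) at_top)"

definition almost_monotone_density :: "real measure \<Rightarrow> bool" where
  "almost_monotone_density \<nu> \<longleftrightarrow>
     (\<exists>(v::real \<Rightarrow> real) C. v \<in> borel_measurable borel \<and> (\<forall>x>0. v x \<ge> 0) \<and>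
        \<nu> = density lborel (\<lambda>x. ennreal (v x) * indicator {0<..} x) \<and>
        C \<ge> 1 \<and> (\<forall>x y. 0 < x \<and> x \<le> y \<longrightarrow> v y \<le> C * v x))"

definition path_sigma :: "'w measure \<Rightarrow> (real \<Rightarrow> 'w \<Rightarrow> 'b::topological_space) \<Rightarrow> 'w set set" where
  "path_sigma M X =
     sets (vimage_algebra (space M) (\<lambda>\<omega>. \<lambda>t\<in>{0..}. X t \<omega>) (Pi\<^sub>M {0..} (\<lambda>_. borel)))"

text \<open>The library's \<open>indep_var\<close> needs both variables to take values in the same type, hence the
  formulation with the generated sigma-algebras.\<close>

definition indep_processes ::
  "'w measure \<Rightarrow> (real \<Rightarrow> 'w \<Rightarrow> 'b::topological_space) \<Rightarrow> (real \<Rightarrow> 'w \<Rightarrow> 'c::topological_space) \<Rightarrow> bool"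
  where
  "indep_processes M X Y \<longleftrightarrow> prob_space.indep_set M (path_sigma M X) (path_sigma M Y)"


section \<open>Heat contents\<close>

text \<open>Extended real valued, so that the infimum of the empty set is \<open>\<infinity>\<close>.\<close>

definition exit_time :: "(real \<Rightarrow> 'w \<Rightarrow> 'b) \<Rightarrow> 'b set \<Rightarrow> 'w \<Rightarrow> ereal" where
  "exit_time X A \<omega> = Inf (ereal ` {t. 0 < t \<and> X t \<omega> \<notin> A})"

text \<open>\<open>None\<close> is the cemetery state.\<close>

definition killed :: "(real \<Rightarrow> 'w \<Rightarrow> 'a) \<Rightarrow> 'a set \<Rightarrow> real \<Rightarrow> 'w \<Rightarrow> 'a option" where
  "killed W \<Omega> t \<omega> = (if ereal t < exit_time W \<Omega> \<omega> then Some (W t \<omega>) else None)"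

definition time_changed :: "(real \<Rightarrow> 'w \<Rightarrow> 'b) \<Rightarrow> (real \<Rightarrow> 'w \<Rightarrow> real) \<Rightarrow> real \<Rightarrow> 'w \<Rightarrow> 'b" where
  "time_changed X D t \<omega> = X (D t \<omega>) \<omega>"

text \<open>\<open>P x\<close> is the probability under which \<open>W\<close> starts at \<open>x\<close>.\<close>

definition spectral_heat_content ::
  "('a::euclidean_space \<Rightarrow> 'w measure) \<Rightarrow> (real \<Rightarrow> 'w \<Rightarrow> 'a) \<Rightarrow> (real \<Rightarrow> 'w \<Rightarrow> real) \<Rightarrow> 'a set \<Rightarrow> real \<Rightarrow> real"
  where
  "spectral_heat_content P W D \<Omega> t =
     (LINT x:\<Omega>|lborel. measure (P x)
        {\<omega> \<in> space (P x). exit_time (time_changed (killed W \<Omega>) D) (Some ` \<Omega>) \<omega> > ereal t})"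

definition regular_heat_content ::
  "('a::euclidean_space \<Rightarrow> 'w measure) \<Rightarrow> (real \<Rightarrow> 'w \<Rightarrow> 'a) \<Rightarrow> (real \<Rightarrow> 'w \<Rightarrow> real) \<Rightarrow> 'a set \<Rightarrow> real \<Rightarrow> real"
  where
  "regular_heat_content P W D \<Omega> t =
     (LINT x:\<Omega>|lborel. measure (P x) {\<omega> \<in> space (P x). time_changed W D t \<omega> \<in> \<Omega>})"


section \<open>Domains\<close>

text \<open>Uniform local graphs of \<open>C\<^sup>1\<^sup>,\<^sup>1\<close> functions, with localization radius \<open>R\<close> and constant \<open>\<Lambda>\<close>. The
  coordinate system at \<open>z\<close> is given by its last axis, the unit vector \<open>e\<close>: a point \<open>y\<close> has
  last coordinate \<open>(y - z) \<bullet> e\<close>, and its first \<open>d - 1\<close> coordinates are represented by the orthogonal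
  projection of \<open>y - z\<close> to the hyperplane \<open>H\<close> orthogonal to \<open>e\<close>. The function \<open>\<psi>\<close> matters
  only on \<open>H\<close>, which stands for \<open>\<real>\<^sup>d\<^sup>-\<^sup>1\<close>; its gradient there is \<open>g\<close>.\<close>

definition C11_open_set :: "'a::euclidean_space set \<Rightarrow> bool" where
  "C11_open_set \<Omega> \<longleftrightarrow> open \<Omega> \<and>
     (\<exists>R>0. \<exists>\<Lambda>>0. \<forall>z\<in>frontier \<Omega>. \<exists>(e::'a) (\<psi>::'a \<Rightarrow> real) (g::'a \<Rightarrow> 'a).
        norm e = 1 \<and>
        (let H = {v. v \<bullet> e = 0} in
          \<psi> 0 = 0 \<and> g 0 = 0 \<and>
          (\<forall>v\<in>H. g v \<in> H \<and> (\<psi> has_derivative (\<lambda>h. g v \<bullet> h)) (at v within H) \<and> norm (g v) \<le> \<Lambda>) \<and>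
          \<Lambda>-lipschitz_on H g \<and>
          ball z R \<inter> \<Omega> =
            {y \<in> ball z R. (y - z) \<bullet> e > \<psi> ((y - z) - ((y - z) \<bullet> e) *\<^sub>R e)}))"

text \<open>The factor \<open>unit_ball_vol k\<close> normalizes the Hausdorff measure so that it agrees with Lebesgue
  measure on \<open>k\<close>-dimensional planes, and hence with surface measure on \<open>C\<^sup>1\<close> hypersurfaces.
  \<open>diameter\<close> is only meaningful for bounded sets.\<close>

definition hausdorff_measure :: "nat \<Rightarrow> 'a::euclidean_space set \<Rightarrow> ennreal" where
  "hausdorff_measure k A =
     (SUP \<delta>\<in>{0<..}. INF U \<in> {U :: nat \<Rightarrow> 'a set. A \<subseteq> (\<Union>i. U i) \<and> (\<forall>i. bounded (U i) \<and> diameter (U i) \<le> \<delta>)}.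
        (\<Sum>i. if U i = {} then 0 else ennreal (unit_ball_vol (real k) * (diameter (U i) / 2) ^ k)))"

definition boundary_measure :: "'a::euclidean_space set \<Rightarrow> real" where
  "boundary_measure \<Omega> =
     (if DIM('a) = 1 then real (card (frontier \<Omega>))
      else enn2real (hausdorff_measure (DIM('a) - 1) (frontier \<Omega>)))"

end

theory Submission imports Defs begin

text \<open>
  Let \<open>g u\<close> be the volume of heat lost by time \<open>u\<close> when Brownian motion is killed on leaving \<open>\<Omega>\<close>, and
  \<open>h u\<close> the volume lost when only the position at time \<open>u\<close> counts. A killed path that survives up to
  \<open>D t\<close> survives up to every earlier value of \<open>D\<close>, and right-continuity of \<open>D\<close> leaves a little room
  after \<open>t\<close>; hence, by independence, the two losses of the theorem are the averages of \<open>g\<close> and of \<open>h\<close>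
  over the law of \<open>D t\<close> (\<open>spectral_probability\<close>, \<open>regular_probability\<close>, \<open>content_loss_eq\<close>). What
  remains is the behaviour of \<open>g\<close> and \<open>h\<close> near \<open>0\<close>, and the passage from there to the averages.

  Write \<open>H\<close> for the measure of the boundary. By Fubini \<open>h u\<close> is the mean, over the Brownian increment \<open>z\<close>,
  of the volume of the points of \<open>\<Omega>\<close> that the translation by \<open>z\<close> pushes out of \<open>\<Omega>\<close>. Near a
  boundary point with inner normal \<open>e\<close> the domain is almost a half-space, and a piece of boundary of area
  \<open>a\<close> contributes about \<open>a\<close> times the negative part of \<open>z \<bullet> e\<close>, whose mean is \<open>sqrt (u / pi)\<close>. Since
  the boundary measure is given by coverings, the estimate is made on the sets of a covering, with no
  area formula: an efficient covering gives the upper bound, the isodiametric inequality controlling the area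
  of the shadow of each set by its diameter, and a disjoint Vitali family of balls gives the lower bound. The result is \<open>h u \<sim> H sqrt u / sqrt pi\<close> (\<open>heat_loss_asymptotics\<close>).

  A path that has reached the boundary is afterwards outside \<open>\<Omega>\<close> with probability nearly one half, for
  the same half-space reason, and symmetrically inside the closure with probability nearly one half. The
  Markov property at the hitting time, of which an inequality proved on dyadic time grids is enough
  (\<open>hitting_markov\<close>), therefore shows that \<open>g\<close> is asymptotically \<open>2 h\<close> (\<open>exit_loss_asymptotics\<close>).
  This is the factor \<open>2\<close> between the two limits.

  For the averages, \<open>sqrt u\<close> is a multiple of the integral of \<open>1 - exp (- s u)\<close> against
  \<open>s powr (-3/2)\<close>, so the mean of the square root is an integral of Laplace transforms. With
  \<open>a = \<phi>\<^sup>-\<^sup>1 (1/t)\<close> the substitution \<open>s = a r\<close> replaces \<open>exp (- t \<phi> s)\<close> by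
  \<open>exp (- \<phi> (a r) / \<phi> a)\<close>, which converges to \<open>exp (- r powr \<beta>)\<close> by regular variation; the index
  \<open>\<beta> > 1/2\<close> gives the integrable bound near \<open>0\<close>. The limiting exponential is the Laplace transform of the stable
  subordinator at time \<open>1\<close>, which is where its half moment enters (\<open>subordination_tauberian\<close>).
\<close>

section \<open>Square roots as mixtures of exponentials\<close>

text \<open>The kernel under which \<open>1 - exp (- s * u)\<close> integrates to a multiple of \<open>sqrt u\<close>. The lower cut-off
\<open>A\<close> makes the measure finite; only \<open>A = 0\<close> gives the exact square root.\<close>

definition power_weight :: "real \<Rightarrow> real measure" where
  "power_weight A = density lborel (\<lambda>s. ennreal (s powr (-3/2)) * indicator {A<..} s)"

lemma sets_power_weight [measurable_cong]: "sets (power_weight A) = sets borel"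
  by (simp add: power_weight_def)

lemma space_power_weight [simp]: "space (power_weight A) = UNIV"
  by (simp add: power_weight_def)

lemma integrable_powr_at_top:
  fixes a e :: real assumes "e < -1" "a > 0"
  shows "integrable lborel (\<lambda>x. x powr e * indicator {a..} x)"
proof -
  have eq: "(\<lambda>x. x powr e * indicator {a..} x) = (\<lambda>x. if x \<in> {a..} then x powr e else 0)"
    by (auto simp: fun_eq_iff)
  have "((\<lambda>x. x powr e * indicator {a..} x) has_integral (- (a powr (e+1)) / (e+1))) UNIV"
    using has_integral_powr_to_inf[OF assms]
    unfolding eq has_integral_restrict_UNIV by simp
  from nn_integral_has_integral_lborel[OF _ _ this]
  show ?thesis
    by (intro integrableI_nonneg) auto
qed

lemma integrable_powr_at_0:
  fixes a e :: real assumes "e > -1" "a \<ge> 0"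
  shows "integrable lborel (\<lambda>x. x powr e * indicator {0..a} x)"
    and "(\<integral>x. x powr e * indicator {0..a} x \<partial>lborel) = a powr (e+1) / (e+1)"
proof -
  have eq: "(\<lambda>x. x powr e * indicator {0..a} x) = (\<lambda>x. if x \<in> {0..a} then x powr e else 0)"
    by (auto simp: fun_eq_iff)
  have I: "((\<lambda>x. x powr e * indicator {0..a} x) has_integral (a powr (e+1) / (e+1))) UNIV"
    using has_integral_powr_from_0[OF assms]
    unfolding eq has_integral_restrict_UNIV by simp
  have nn: "integral\<^sup>N lborel (\<lambda>x. x powr e * indicator {0..a} x) = ennreal (a powr (e+1) / (e+1))"
    by (rule nn_integral_has_integral_lborel[OF _ _ I]) auto
  then show "integrable lborel (\<lambda>x. x powr e * indicator {0..a} x)"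
    by (intro integrableI_nonneg) auto
  show "(\<integral>x. x powr e * indicator {0..a} x \<partial>lborel) = a powr (e+1) / (e+1)"
    by (rule integral_eq_nn_integral[THEN trans]) (use nn assms in auto)
qed

lemma finite_power_weight:
  assumes "A > 0" shows "finite_measure (power_weight A)"
proof
  have "emeasure (power_weight A) (space (power_weight A))
      = (\<integral>\<^sup>+s. ennreal (s powr (-3/2) * indicator {A<..} s) \<partial>lborel)"
    unfolding power_weight_def
    by (subst emeasure_density) (auto simp: ennreal_mult' ennreal_indicator intro!: nn_integral_cong split: split_indicator)
  also have "\<dots> \<le> (\<integral>\<^sup>+s. ennreal (s powr (-3/2) * indicator {A..} s) \<partial>lborel)"
    by (intro nn_integral_mono) (auto split: split_indicator)
  also have "\<dots> < \<infinity>"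
    using integrable_powr_at_top[of "-3/2" A] assms by (simp add: integrable_iff_bounded)
  finally show "emeasure (power_weight A) (space (power_weight A)) \<noteq> \<infinity>" by simp
qed

lemma sigma_finite_power_weight: "A \<ge> 0 \<Longrightarrow> sigma_finite_measure (power_weight A)"
  unfolding power_weight_def
  by (subst sigma_finite_measure.sigma_finite_iff_density_finite[OF lborel.sigma_finite_measure_axioms])
     (auto split: split_indicator simp: ennreal_mult_eq_top_iff)

lemma integral_power_weight:
  assumes [measurable]: "f \<in> borel_measurable borel"
  shows "(\<integral>s. f s \<partial>power_weight A) = (\<integral>s. f s * (s powr (-3/2) * indicator {A<..} s) \<partial>lborel)"
    and "integrable (power_weight A) f \<longleftrightarrow> integrable lborel (\<lambda>s. f s * (s powr (-3/2) * indicator {A<..} s))"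
proof -
  have eq: "power_weight A = density lborel (\<lambda>s. ennreal (s powr (-3/2) * indicator {A<..} s))"
    unfolding power_weight_def by (intro density_cong) (auto split: split_indicator)
  show "(\<integral>s. f s \<partial>power_weight A) = (\<integral>s. f s * (s powr (-3/2) * indicator {A<..} s) \<partial>lborel)"
    unfolding eq by (subst integral_real_density) (auto simp: mult.commute)
  show "integrable (power_weight A) f \<longleftrightarrow> integrable lborel (\<lambda>s. f s * (s powr (-3/2) * indicator {A<..} s))"
    unfolding eq by (subst integrable_real_density) (auto simp: mult.commute)
qed

text \<open>Under the substitution of \<open>s / c\<close> for \<open>s\<close> the density contributes \<open>c powr (3/2)\<close> and the differential
\<open>1 / c\<close>. This homogeneity of degree one half is the source of every square root below.\<close>

lemma nn_integral_power_weight_scale: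
  fixes c :: real
  assumes [measurable]: "f \<in> borel_measurable borel" and c: "c > 0"
  shows "(\<integral>\<^sup>+s. f (c * s) \<partial>power_weight A) = ennreal (sqrt c) * (\<integral>\<^sup>+s. f s \<partial>power_weight (c * A))"
proof -
  have "(\<integral>\<^sup>+s. f s \<partial>power_weight (c * A))
      = (\<integral>\<^sup>+s. ennreal (s powr (-3/2)) * indicator {c * A<..} s * f s \<partial>lborel)"
    unfolding power_weight_def by (subst nn_integral_density) auto
  also have "\<dots> = ennreal \<bar>c\<bar> * (\<integral>\<^sup>+s. ennreal ((0 + c * s) powr (-3/2)) * indicator {c * A<..} (0 + c * s) * f (0 + c * s) \<partial>lborel)"
    by (rule nn_integral_real_affine) (use c in auto)
  also have "\<dots> = ennreal c * (\<integral>\<^sup>+s. ennreal (c powr (-3/2)) * (ennreal (s powr (-3/2)) * indicator {A<..} s * f (c * s)) \<partial>lborel)"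
    using c by (auto simp: powr_mult ennreal_mult mult.assoc indicator_def intro!: nn_integral_cong arg_cong2[where f="(*)"])
  also have "\<dots> = ennreal c * ennreal (c powr (-3/2)) * (\<integral>\<^sup>+s. f (c * s) \<partial>power_weight A)"
    unfolding power_weight_def by (subst nn_integral_cmult) (auto simp: nn_integral_density mult.assoc)
  also have "ennreal c * ennreal (c powr (-3/2)) = ennreal (1 / sqrt c)"
  proof -
    have "c * c powr (-3/2) = c powr (-1/2)" using c by (simp add: powr_mult_base)
    also have "\<dots> = 1 / sqrt c" 
      using c powr_minus_divide[of c "1/2"] by (simp add: powr_half_sqrt)
    finally show ?thesis using c by (simp add: ennreal_mult[symmetric])
  qed
  finally have "ennreal (sqrt c) * (\<integral>\<^sup>+s. f s \<partial>power_weight (c * A)) =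
     (ennreal (sqrt c) * ennreal (1 / sqrt c)) * (\<integral>\<^sup>+s. f (c * s) \<partial>power_weight A)"
    by (simp add: mult.assoc)
  also have "ennreal (sqrt c) * ennreal (1 / sqrt c) = 1"
    using c by (simp add: ennreal_mult[symmetric])
  finally show ?thesis by simp
qed

definition sqrt_const :: real where
  "sqrt_const = (\<integral>s. 1 - exp (- s) \<partial>power_weight 0)"

lemma one_minus_exp_bounds: fixes x::real assumes "x \<ge> 0" 
  shows "0 \<le> 1 - exp (- x)" "1 - exp (-x) \<le> x" "1 - exp (-x) \<le> 1"
  using assms exp_ge_add_one_self[of "-x"] by auto

text \<open>At infinity the kernel is integrable by itself; at \<open>0\<close> an exponent above one half compensates the
singularity of order three halves. This is the place where the threshold \<open>1/2\<close> for the index originates.\<close>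

lemma integrable_power_weight_bound:
  assumes [measurable]: "f \<in> borel_measurable borel" and "\<And>s. s > 0 \<Longrightarrow> 0 \<le> f s \<and> f s \<le> 1"
    and "\<And>s. 0 < s \<Longrightarrow> s \<le> 1 \<Longrightarrow> f s \<le> C * s powr \<gamma>" and \<gamma>: "\<gamma> > 1/2" and A: "A \<ge> 0"
  shows "integrable (power_weight A) f"
proof -
  let ?w = "\<lambda>s. C * (s powr (\<gamma> - 3/2) * indicator {0..1} s) + s powr (-3/2) * indicator {1..} s"
  have "integrable lborel ?w"
    using integrable_powr_at_top[of "-3/2" 1] integrable_powr_at_0(1)[of "\<gamma> - 3/2" 1] \<gamma> by auto
  moreover have "norm (f s * (s powr (-3/2) * indicator {A<..} s)) \<le> norm (C * (s powr (\<gamma> - 3/2) * indicator {0..1} s) + s powr (-3/2) * indicator {1..} s)" for s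
  proof (cases "s > A")
    case False then show ?thesis by simp
  next
    case True
    with A have s: "s > 0" by simp
    have p: "s powr (\<gamma> - 3/2) = s powr \<gamma> * s powr (-3/2)" by (simp add: powr_add[symmetric])
    show ?thesis
    proof (cases "s < 1")
      case True
      have C: "C \<ge> 0" using assms(2)[of 1] assms(3)[of 1] by auto
      from True assms(2,3)[of s] s have "0 \<le> f s" "f s \<le> C * s powr \<gamma>" by auto
      then have "f s * s powr (-3/2) \<le> C * s powr \<gamma> * s powr (-3/2)" by (intro mult_right_mono) auto
      moreover have "0 \<le> f s * s powr (-3/2)" using \<open>0 \<le> f s\<close> by simp
      ultimately show ?thesis using True s C \<open>s > A\<close> \<open>0 \<le> f s\<close> unfolding p by (simp add: abs_mult)
    next
      case False
      have C: "C \<ge> 0" using assms(2)[of 1] assms(3)[of 1] by auto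
      have "f s * s powr (-3/2) \<le> 1 * s powr (-3/2)" 
        using assms(2)[of s] s by (intro mult_right_mono) auto
      moreover have "0 \<le> C * (s powr (\<gamma> - 3/2) * indicator {0..1} s)" using C by simp
      moreover have "0 \<le> f s * s powr (-3/2)" using assms(2)[of s] s by simp
      moreover have "\<bar>f s\<bar> = f s" using assms(2)[of s] s by simp
      moreover have "indicator {1..} s = (1::real)" using False by simp
      ultimately show ?thesis using \<open>s > A\<close> by (simp add: abs_mult)
    qed
  qed
  ultimately have i: "integrable lborel ?w" and b: "\<And>s. norm (f s * (s powr (-3/2) * indicator {A<..} s)) \<le> norm (?w s)"
    by blast+
  show ?thesis
    unfolding integral_power_weight(2)[OF assms(1)]
    by (rule Bochner_Integration.integrable_bound[OF i _ AE_I2[OF b]]) simp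
qed

lemma integrable_power_weight_exp:
  assumes "A \<ge> 0" "u \<ge> 0" shows "integrable (power_weight A) (\<lambda>s. 1 - exp (- s * u))"
proof (rule integrable_power_weight_bound[where C=u and \<gamma>=1])
  fix s :: real assume s: "0 < s"
  with assms show "0 \<le> 1 - exp (- s * u) \<and> 1 - exp (- s * u) \<le> 1"
    by simp
  show "1 - exp (- s * u) \<le> u * s powr 1"
    using one_minus_exp_bounds(2)[of "s * u"] s assms by (simp add: mult.commute)
qed (use assms in auto)

lemma AE_power_weight: "(\<And>s. s > A \<Longrightarrow> P s) \<Longrightarrow> AE s in power_weight A. P s"
  unfolding power_weight_def by (subst AE_density) (auto split: split_indicator)

lemma sqrt_const_pos: "sqrt_const > 0"
proof -
  have i: "integrable (power_weight 0) (\<lambda>s. 1 - exp (- s))"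
    using integrable_power_weight_exp[of 0 1] by simp
  have "0 \<le> sqrt_const" unfolding sqrt_const_def
    by (intro integral_nonneg_AE AE_power_weight) auto
  moreover have "sqrt_const \<noteq> 0"
  proof
    assume "sqrt_const = 0"
    then have "AE s in power_weight 0. 1 - exp (- s) = 0"
      unfolding sqrt_const_def 
      by (subst (asm) integral_nonneg_eq_0_iff_AE[OF i]) (auto intro!: AE_power_weight)
    then have "AE s in lborel. 0 < s \<longrightarrow> (s::real) = 0"
      unfolding power_weight_def by (subst (asm) AE_density) (auto split: split_indicator elim!: eventually_mono)
    then have "AE s in lborel. \<not> (0 < (s::real))" by eventually_elim auto
    then have "emeasure lborel {s::real. 0 < s} = 0"
      by (subst (asm) AE_iff_null) (auto simp: null_sets_def)
    moreover have "emeasure lborel {0<..<1::real} \<le> emeasure lborel {s::real. 0 < s}"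
      by (intro emeasure_mono) auto
    ultimately show False by simp
  qed
  ultimately show ?thesis by simp
qed

text \<open>By homogeneity of the kernel the integral at \<open>u\<close> is \<open>sqrt u\<close> times the integral at \<open>1\<close>.\<close>

lemma sqrt_as_exponential_mixture:
  assumes "u \<ge> 0" shows "(\<integral>\<^sup>+s. ennreal (1 - exp (- s * u)) \<partial>power_weight 0) = ennreal (sqrt_const * sqrt u)"
proof (cases "u = 0")
  case False
  with assms have u: "u > 0" by simp
  have i: "integrable (power_weight 0) (\<lambda>s. 1 - exp (- s))"
    using integrable_power_weight_exp[of 0 1] by simp
  have "(\<integral>\<^sup>+s. ennreal (1 - exp (- s * u)) \<partial>power_weight 0) = (\<integral>\<^sup>+s. (\<lambda>s. ennreal (1 - exp (-s))) (u * s) \<partial>power_weight 0)"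
    by (simp add: mult.commute)
  also have "\<dots> = ennreal (sqrt u) * (\<integral>\<^sup>+s. ennreal (1 - exp (-s)) \<partial>power_weight (u * 0))"
    using u by (intro nn_integral_power_weight_scale) auto
  also have "(\<integral>\<^sup>+s. ennreal (1 - exp (-s)) \<partial>power_weight (u * 0)) = ennreal sqrt_const"
    unfolding sqrt_const_def using i
    by (simp, intro nn_integral_eq_integral AE_power_weight) auto
  finally show ?thesis using u sqrt_const_pos by (simp add: ennreal_mult' ac_simps)
qed simp

text \<open>A bounded stand-in for \<open>sqrt_const * sqrt u\<close>, equivalent to it at \<open>0\<close>. Boundedness matters because a
time change may have no moment of order one half, while the heat losses are bounded anyway.\<close>

definition trunc_sqrt :: "real \<Rightarrow> real \<Rightarrow> real" where
  "trunc_sqrt A u = (\<integral>s. 1 - exp (- s * u) \<partial>power_weight A)"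

text \<open>The missing part of the integral is over \<open>0 < s \<le> A\<close>, where \<open>1 - exp (- s * u) \<le> s * u\<close>. It is linear
in \<open>u\<close>, hence negligible against \<open>sqrt u\<close>.\<close>

lemma trunc_sqrt_bounds:
  assumes A: "A > 0" and u: "u \<ge> 0"
  shows "\<bar>trunc_sqrt A u - sqrt_const * sqrt u\<bar> \<le> 2 * sqrt A * u"
proof -
  let ?f = "\<lambda>s. (1 - exp (- s * u)) * s powr (-3/2)"
  have i0: "integrable lborel (\<lambda>s. (1 - exp (- s * u)) * (s powr (-3/2) * indicator {0<..} s))"
    using integrable_power_weight_exp[of 0 u] u by (subst (asm) integral_power_weight) auto
  have iA: "integrable lborel (\<lambda>s. (1 - exp (- s * u)) * (s powr (-3/2) * indicator {A<..} s))"
    using integrable_power_weight_exp[of A u] u A by (subst (asm) integral_power_weight) auto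
  have "sqrt_const * sqrt u = (\<integral>s. 1 - exp (- s * u) \<partial>power_weight 0)"
  proof -
    have "(\<integral>s. 1 - exp (- s * u) \<partial>power_weight 0) = enn2real (\<integral>\<^sup>+s. ennreal (1 - exp (- s * u)) \<partial>power_weight 0)"
      using u by (intro integral_eq_nn_integral) (auto intro!: AE_power_weight)
    then show ?thesis unfolding sqrt_as_exponential_mixture[OF u] using sqrt_const_pos u by simp
  qed
  also have "\<dots> = (\<integral>s. (1 - exp (- s * u)) * (s powr (-3/2) * indicator {0<..} s) \<partial>lborel)"
    by (subst integral_power_weight) auto
  finally have "sqrt_const * sqrt u - trunc_sqrt A u = 
     (\<integral>s. (1 - exp (- s * u)) * (s powr (-3/2) * indicator {0<..} s) - (1 - exp (- s * u)) * (s powr (-3/2) * indicator {A<..} s) \<partial>lborel)"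
    unfolding trunc_sqrt_def using i0 iA
    by (subst Bochner_Integration.integral_diff) (auto simp: integral_power_weight)
  moreover have "0 \<le> \<dots>"
    using A u by (intro integral_nonneg_AE) (auto split: split_indicator)
  moreover have "(\<integral>s. (1 - exp (- s * u)) * (s powr (-3/2) * indicator {0<..} s) - (1 - exp (- s * u)) * (s powr (-3/2) * indicator {A<..} s) \<partial>lborel)
     \<le> (\<integral>s. u * (s powr (-1/2) * indicator {0..A} s) \<partial>lborel)"
  proof (intro integral_mono)
    show "integrable lborel (\<lambda>s. u * (s powr (-1/2) * indicator {0..A} s))"
      using integrable_powr_at_0(1)[of "-1/2" A] A by auto
    fix s :: real
    show "(1 - exp (- s * u)) * (s powr (-3/2) * indicator {0<..} s) - (1 - exp (- s * u)) * (s powr (-3/2) * indicator {A<..} s)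
        \<le> u * (s powr (-1/2) * indicator {0..A} s)"
    proof (cases "0 < s \<and> s \<le> A")
      case True
      have "s * s powr (-3/2) = s powr (-1/2)" using True by (simp add: powr_mult_base)
      then have eq: "s * u * s powr (-3/2) = u * s powr (-1/2)" by (metis mult.assoc mult.commute)
      moreover have "(1 - exp (- s * u)) * s powr (-3/2) \<le> (s * u) * s powr (-3/2)"
        using one_minus_exp_bounds(2)[of "s * u"] True u by (intro mult_right_mono) auto
      ultimately have "(1 - exp (- s * u)) * s powr (-3/2) \<le> u * s powr (-1/2)" by linarith
      then show ?thesis using True by simp
    qed (use A u in \<open>auto split: split_indicator\<close>)
  qed (use i0 iA in auto)
  moreover have "(\<integral>s. u * (s powr (-1/2) * indicator {0..A} s) \<partial>lborel) = 2 * sqrt A * u"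
    using integrable_powr_at_0(2)[of "-1/2" A] A by (simp add: powr_half_sqrt)
  ultimately show ?thesis by linarith
qed

lemma trunc_sqrt_asymp:
  assumes "A > 0" shows "((\<lambda>u. trunc_sqrt A u / sqrt u) \<longlongrightarrow> sqrt_const) (at_right 0)"
proof (rule Lim_null[THEN iffD2], rule Lim_null_comparison)
  show "\<forall>\<^sub>F u in at_right 0. norm (trunc_sqrt A u / sqrt u - sqrt_const) \<le> 2 * sqrt A * sqrt u"
    unfolding eventually_at_right_field
  proof (intro exI[of _ 1] conjI allI impI)
    fix u :: real assume u: "0 < u" "u < 1"
    have "\<bar>trunc_sqrt A u - sqrt_const * sqrt u\<bar> / sqrt u \<le> (2 * sqrt A * u) / sqrt u"
      using trunc_sqrt_bounds[OF assms, of u] u by (intro divide_right_mono) auto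
    also have "(2 * sqrt A * u) / sqrt u = 2 * sqrt A * sqrt u"
      using real_div_sqrt[of u] u by (metis less_imp_le times_divide_eq_right)
    also have "\<bar>trunc_sqrt A u - sqrt_const * sqrt u\<bar> / sqrt u = norm (trunc_sqrt A u / sqrt u - sqrt_const)"
      using u by (simp add: field_simps abs_divide)
    finally show "norm (trunc_sqrt A u / sqrt u - sqrt_const) \<le> 2 * sqrt A * sqrt u" .
  qed simp
  show "((\<lambda>u. 2 * sqrt A * sqrt u) \<longlongrightarrow> 0) (at_right 0)"
    by (rule tendsto_eq_intros tendsto_mult_right_zero | simp)+
qed

lemma trunc_sqrt_measurable [measurable]: "A > 0 \<Longrightarrow> trunc_sqrt A \<in> borel_measurable borel"
  unfolding trunc_sqrt_def [abs_def]
  by (intro sigma_finite_measure.borel_measurable_lebesgue_integral sigma_finite_power_weight) (auto)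

text \<open>Fubini for nonnegative integrands; the Laplace transform \<open>L\<close> is known only for positive arguments, which
is all that the kernel sees.\<close>

lemma trunc_sqrt_integral:
  assumes "A > 0" "prob_space R" and [measurable_cong]: "sets R = sets borel" and pos: "AE u in R. 0 \<le> u"
    and [measurable]: "L \<in> borel_measurable borel"
    and L: "\<And>s. s > 0 \<Longrightarrow> (\<integral>u. exp (- s * u) \<partial>R) = L s"
  shows "integrable R (trunc_sqrt A)" "(\<integral>u. trunc_sqrt A u \<partial>R) = (\<integral>s. 1 - L s \<partial>power_weight A)"
proof -
  interpret R: prob_space R by fact
  interpret PW: finite_measure "power_weight A" by (rule finite_power_weight) fact
  interpret pair_sigma_finite R "power_weight A" ..
  have iR: "integrable R (\<lambda>u. exp (- s * u))" if "s > 0" for s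
    using pos that by (intro R.integrable_const_bound[where B=1]) (auto elim!: eventually_mono)
  have L01: "0 \<le> L s \<and> L s \<le> 1" if "s > 0" for s
  proof -
    have "0 \<le> L s" unfolding L[OF that, symmetric] by simp
    moreover have "L s \<le> (\<integral>u. 1 \<partial>R)" unfolding L[OF that, symmetric]
      using pos that by (intro integral_mono_AE iR) (auto elim!: eventually_mono)
    ultimately show ?thesis by (simp add: R.prob_space)
  qed
  define L' where "L' s = (\<integral>u. exp (- s * u) \<partial>R)" for s
  have [measurable]: "L' \<in> borel_measurable borel"
    unfolding L'_def[abs_def] by (intro R.borel_measurable_lebesgue_integral) measurable
  have L'L: "L' s = L s" if "s > 0" for s by (simp only: L'_def L[OF that])
  have LL': "AE s in power_weight A. L s = L' s"
    using assms(1) by (intro AE_power_weight) (auto simp: L'L)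
  have iL: "integrable (power_weight A) (\<lambda>s. 1 - L' s)"
    by (rule PW.integrable_const_bound[where B=1], rule AE_power_weight)
       (use assms(1) L01 in \<open>auto simp: L'L\<close>)
  have "(\<integral>\<^sup>+u. ennreal (trunc_sqrt A u) \<partial>R) = (\<integral>\<^sup>+u. \<integral>\<^sup>+s. ennreal (1 - exp (- s * u)) \<partial>power_weight A \<partial>R)"
  proof (intro nn_integral_cong_AE, use pos in eventually_elim)
    fix u :: real assume u: "0 \<le> u"
    show "ennreal (trunc_sqrt A u) = (\<integral>\<^sup>+s. ennreal (1 - exp (- s * u)) \<partial>power_weight A)"
      unfolding trunc_sqrt_def
      using u assms(1) by (intro nn_integral_eq_integral[symmetric] integrable_power_weight_exp AE_power_weight) auto
  qed
  also have "\<dots> = (\<integral>\<^sup>+s. \<integral>\<^sup>+u. ennreal (1 - exp (- s * u)) \<partial>R \<partial>power_weight A)"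
    by (rule Fubini'[symmetric]) measurable
  also have "\<dots> = (\<integral>\<^sup>+s. ennreal (1 - L' s) \<partial>power_weight A)"
  proof (intro nn_integral_cong_AE AE_power_weight)
    fix s assume "A < s"
    then have s: "s > 0" using assms(1) by simp
    have "(\<integral>\<^sup>+u. ennreal (1 - exp (- s * u)) \<partial>R) = ennreal (\<integral>u. 1 - exp (- s * u) \<partial>R)"
      using iR[OF s] pos s by (intro nn_integral_eq_integral) (auto elim!: eventually_mono)
    also have "(\<integral>u. 1 - exp (- s * u) \<partial>R) = 1 - L' s"
      unfolding L'_def using iR[OF s] by (subst Bochner_Integration.integral_diff) (auto simp: R.prob_space)
    finally show "(\<integral>\<^sup>+u. ennreal (1 - exp (- s * u)) \<partial>R) = ennreal (1 - L' s)" .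
  qed
  also have "\<dots> = ennreal (\<integral>s. 1 - L' s \<partial>power_weight A)"
    by (intro nn_integral_eq_integral iL AE_power_weight) (use assms(1) L01 in \<open>auto simp: L'L\<close>)
  finally have nn: "(\<integral>\<^sup>+u. ennreal (trunc_sqrt A u) \<partial>R) = ennreal (\<integral>s. 1 - L' s \<partial>power_weight A)" .
  have pos': "AE u in R. 0 \<le> trunc_sqrt A u"
    using pos by eventually_elim (use assms(1) in \<open>auto simp: trunc_sqrt_def intro!: integral_nonneg_AE AE_power_weight\<close>)
  show "integrable R (trunc_sqrt A)"
    using nn pos' assms(1) by (intro integrableI_nonneg) auto
  have "(\<integral>s. 1 - L' s \<partial>power_weight A) \<ge> 0"
    by (intro integral_nonneg_AE AE_power_weight) (use assms(1) L01 in \<open>auto simp: L'L\<close>)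
  then have "(\<integral>u. trunc_sqrt A u \<partial>R) = (\<integral>s. 1 - L' s \<partial>power_weight A)"
    using nn pos' assms(1) by (subst integral_eq_nn_integral) auto
  also have "\<dots> = (\<integral>s. 1 - L s \<partial>power_weight A)"
    using LL' by (intro integral_cong_AE) auto
  finally show "(\<integral>u. trunc_sqrt A u \<partial>R) = (\<integral>s. 1 - L s \<partial>power_weight A)" .
qed

section \<open>Regularly varying functions\<close>

text \<open>Regular variation at the single ratio \<open>2\<close> gives a factor at least \<open>2 powr \<gamma>\<close> per doubling; iterating over
the dyadic part of \<open>r\<close> and using monotonicity for the rest loses only the factor \<open>2 powr (-\<gamma>)\<close>.\<close>

lemma potter_lower:
  assumes rv: "regularly_varying \<phi> \<beta>" and mono: "mono_on {0<..} \<phi>" and \<gamma>: "0 < \<gamma>" "\<gamma> < \<beta>"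
  obtains A where "A > 0" "\<And>r a. r \<ge> 1 \<Longrightarrow> a \<ge> A \<Longrightarrow> \<phi> (r * a) \<ge> 2 powr (-\<gamma>) * r powr \<gamma> * \<phi> a"
proof -
  have pos: "\<phi> s > 0" if "s > 0" for s using rv that unfolding regularly_varying_def by auto
  have "((\<lambda>s. \<phi> (2 * s) / \<phi> s) \<longlongrightarrow> 2 powr \<beta>) at_top"
    using rv unfolding regularly_varying_def by simp
  moreover have "2 powr \<gamma> < (2::real) powr \<beta>" using \<gamma> by simp
  ultimately have "\<forall>\<^sub>F s in at_top. 2 powr \<gamma> < \<phi> (2 * s) / \<phi> s"
    by (rule order_tendstoD(1))
  then obtain A0 where A0: "\<And>s. s \<ge> A0 \<Longrightarrow> 2 powr \<gamma> < \<phi> (2 * s) / \<phi> s"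
    unfolding eventually_at_top_linorder by auto
  define A where "A = max A0 1"
  have step: "\<phi> (2 * s) \<ge> 2 powr \<gamma> * \<phi> s" if "s \<ge> A" for s
    using A0[of s] that pos[of s] by (auto simp: A_def field_simps)
  have iter: "\<phi> (2 ^ n * a) \<ge> (2 powr \<gamma>) ^ n * \<phi> a" if "a \<ge> A" for n a
  proof (induction n)
    case (Suc n)
    have "1 * A \<le> 2 ^ n * a" using that by (intro mult_mono) (auto simp: A_def)
    from step[of "2 ^ n * a"] this have "2 powr \<gamma> * \<phi> (2 ^ n * a) \<le> \<phi> (2 ^ Suc n * a)" by (simp add: mult.assoc)
    moreover have "2 powr \<gamma> * ((2 powr \<gamma>) ^ n * \<phi> a) \<le> 2 powr \<gamma> * \<phi> (2 ^ n * a)"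
      using Suc by (intro mult_left_mono) auto
    ultimately show ?case unfolding power_Suc mult.assoc by linarith
  qed simp
  show thesis
  proof (rule that[of A])
    show "A > 0" by (simp add: A_def)
    fix r a :: real assume l: "r \<ge> 1" and a: "a \<ge> A"
    then have a0: "a > 0" by (simp add: A_def)
    define n where "n = nat \<lfloor>log 2 r\<rfloor>"
    have lg: "0 \<le> log 2 r" using l by simp
    then have n: "real n \<le> log 2 r" "log 2 r < real n + 1" unfolding n_def by linarith+
    have "2 ^ n \<le> r" using n(1) l by (simp add: le_log_iff powr_realpow)
    then have "\<phi> (2 ^ n * a) \<le> \<phi> (r * a)"
      using a0 l by (intro mono_onD[OF mono]) auto
    moreover have "(r / 2) powr \<gamma> \<le> (2 powr \<gamma>) ^ n"
    proof -
      have "r < 2 powr (real n + 1)" using n(2) l by (simp add: log_less_iff)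
      then have "r / 2 \<le> 2 powr n" by (simp add: powr_add)
      then have "(r / 2) powr \<gamma> \<le> (2 powr n) powr \<gamma>" using l \<gamma> by (intro powr_mono2) auto
      also have "\<dots> = (2 powr \<gamma>) ^ n" by (simp add: powr_powr powr_realpow[symmetric] mult.commute)
      finally show ?thesis .
    qed
    then have "(r / 2) powr \<gamma> * \<phi> a \<le> (2 powr \<gamma>) ^ n * \<phi> a"
      using pos[OF a0] by (intro mult_right_mono) auto
    moreover have "(r / 2) powr \<gamma> = 2 powr (-\<gamma>) * r powr \<gamma>"
      using l powr_minus_divide[of 2 \<gamma>] by (simp add: powr_divide)
    ultimately show "2 powr (-\<gamma>) * r powr \<gamma> * \<phi> a \<le> \<phi> (r * a)"
      using iter[OF a, of n] by simp
  qed
qed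

text \<open>After the substitution \<open>s = a * r\<close> the integrand converges pointwise by regular variation. Potter's bound,
read downwards from \<open>a\<close>, gives \<open>\<phi> (r * a) / \<phi> a \<le> 2 powr \<gamma> * r powr \<gamma>\<close> for \<open>r \<le> 1\<close>, and since \<open>\<gamma> > 1/2\<close>
this is an integrable majorant. The cut-off at \<open>A\<close> keeps the arguments of \<open>\<phi>\<close> in the range of that bound and
disappears in the limit.\<close>

lemma scaled_laplace_limit:
  assumes rv: "regularly_varying \<phi> \<beta>" and mono: "mono_on {0<..} \<phi>" and \<gamma>: "1/2 < \<gamma>" "\<gamma> < \<beta>" 
    and [measurable]: "\<phi> \<in> borel_measurable borel" and A: "A > 0"
    and P: "\<And>r a. r \<ge> 1 \<Longrightarrow> a \<ge> A \<Longrightarrow> \<phi> (r * a) \<ge> 2 powr (-\<gamma>) * r powr \<gamma> * \<phi> a"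
  shows "integrable (power_weight 0) (\<lambda>s. 1 - exp (- (s powr \<beta>)))"
    "((\<lambda>a. sqrt a * (\<integral>s. 1 - exp (- (\<phi> s / \<phi> a)) \<partial>power_weight A)) \<longlongrightarrow> (\<integral>s. 1 - exp (- (s powr \<beta>)) \<partial>power_weight 0)) at_top"
    (is "?lim")
proof -
  have pos: "\<phi> s > 0" if "s > 0" for s using rv that unfolding regularly_varying_def by auto
  define C where "C = 2 powr \<gamma>"
  have bd: "\<phi> (s * a) / \<phi> a \<le> C * s powr \<gamma>" if "0 < s" "s \<le> 1" "s * a \<ge> A" for s a
  proof -
    have a: "a > 0" using that A by (metis less_le_trans zero_less_mult_pos)
    have "2 powr (-\<gamma>) * (1 / s) powr \<gamma> * \<phi> (s * a) \<le> \<phi> (1 / s * (s * a))"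
      using that by (intro P) auto
    also have "1 / s * (s * a) = a" using that by simp
    finally have "\<phi> (s * a) \<le> \<phi> a * (C * s powr \<gamma>)"
      using that by (simp add: C_def powr_minus powr_divide field_simps)
    then show ?thesis using pos[OF a] by (simp add: field_simps)
  qed
  have ib: "integrable (power_weight 0) (\<lambda>s. if s \<le> 1 then min 1 (C * s powr \<gamma>) else 1)"
    by (rule integrable_power_weight_bound[where C=C and \<gamma>=\<gamma>]) (use \<gamma> in \<open>auto simp: C_def\<close>)
  \<comment> \<open>The scaled integrand; the cut-off at \<open>A\<close> becomes a cut-off at \<open>A / a\<close>, which tends to \<open>0\<close>.\<close>
  define F where "F a s = indicator {A<..} (s * a) * (1 - exp (- (\<phi> (s * a) / \<phi> a)))" for a s :: real
  have lim: "((\<lambda>a. F a s) \<longlongrightarrow> 1 - exp (- (s powr \<beta>))) at_top" if s: "s > 0" for s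
  proof -
    have "((\<lambda>a. 1 - exp (- (\<phi> (s * a) / \<phi> a))) \<longlongrightarrow> 1 - exp (- (s powr \<beta>))) at_top"
      using rv s unfolding regularly_varying_def by (intro tendsto_intros) auto
    moreover have "\<forall>\<^sub>F a in at_top. 1 - exp (- (\<phi> (s * a) / \<phi> a)) = F a s"
      using eventually_gt_at_top[of "A / s"] eventually_gt_at_top[of 0]
      by eventually_elim (use s in \<open>auto simp: F_def field_simps\<close>)
    ultimately show ?thesis by (rule Lim_transform_eventually)
  qed
  have bound: "norm (F a s) \<le> (if s \<le> 1 then min 1 (C * s powr \<gamma>) else 1)" if "s > 0" "a > 0" for a s
  proof (cases "s * a > A")
    case True
    have q: "0 \<le> \<phi> (s * a) / \<phi> a" using pos[of a] pos[of "s * a"] that by simp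
    have "1 - exp (- (\<phi> (s * a) / \<phi> a)) \<le> C * s powr \<gamma>" if "s \<le> 1"
      using one_minus_exp_bounds(2)[OF q] bd[of s a] True \<open>s > 0\<close> that by simp
    then show ?thesis using one_minus_exp_bounds(1,3)[OF q] that True by (auto simp: F_def)
  qed (auto simp: F_def C_def)
  show i\<beta>: "integrable (power_weight 0) (\<lambda>s. 1 - exp (- (s powr \<beta>)))"
  proof (rule integrable_power_weight_bound[where C=1 and \<gamma>=\<beta>])
    show "\<beta> > 1/2" using \<gamma> by simp
  next
    fix s :: real assume s: "s > 0"
    show "0 \<le> 1 - exp (- (s powr \<beta>)) \<and> 1 - exp (- (s powr \<beta>)) \<le> 1" by simp
    show "1 - exp (- (s powr \<beta>)) \<le> 1 * s powr \<beta>" using one_minus_exp_bounds(2)[of "s powr \<beta>"] by simp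
  qed auto
  have L1: "((\<lambda>a. \<integral>s. F a s \<partial>power_weight 0) \<longlongrightarrow> (\<integral>s. 1 - exp (- (s powr \<beta>)) \<partial>power_weight 0)) at_top"
  proof (rule integral_dominated_convergence_at_top[where w="\<lambda>s. if s \<le> 1 then min 1 (C * s powr \<gamma>) else 1"])
    show "\<forall>\<^sub>F a in at_top. AE s in power_weight 0. norm (F a s) \<le> (if s \<le> 1 then min 1 (C * s powr \<gamma>) else 1)"
      using eventually_gt_at_top[of 0] by eventually_elim (intro AE_power_weight bound)
    show "AE s in power_weight 0. ((\<lambda>a. F a s) \<longlongrightarrow> 1 - exp (- (s powr \<beta>))) at_top"
      by (intro AE_power_weight lim)
  qed (auto simp: F_def intro!: ib)
  have eq: "(\<integral>s. F a s \<partial>power_weight 0) = sqrt a * (\<integral>s. 1 - exp (- (\<phi> s / \<phi> a)) \<partial>power_weight A)" if a: "a \<ge> 1" for a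
  proof -
    have nn: "0 \<le> 1 - exp (- (\<phi> s / \<phi> a))" if "s > 0" for s
      using a that pos[of a] pos[of s] by simp
    have "(\<integral>s. F a s \<partial>power_weight 0) = enn2real (\<integral>\<^sup>+s. ennreal (F a s) \<partial>power_weight 0)"
      by (rule integral_eq_nn_integral) (use a nn A in \<open>auto simp: F_def intro!: AE_power_weight split: split_indicator\<close>)
    also have "(\<integral>\<^sup>+s. ennreal (F a s) \<partial>power_weight 0) = (\<integral>\<^sup>+s. (\<lambda>s. indicator {A<..} s * ennreal (1 - exp (- (\<phi> s / \<phi> a)))) (a * s) \<partial>power_weight 0)"
      by (intro nn_integral_cong) (auto simp: F_def mult.commute split: split_indicator)
    also have "\<dots> = ennreal (sqrt a) * (\<integral>\<^sup>+s. indicator {A<..} s * ennreal (1 - exp (- (\<phi> s / \<phi> a))) \<partial>power_weight (a * 0))"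
      using a by (intro nn_integral_power_weight_scale) auto
    also have "(\<integral>\<^sup>+s. indicator {A<..} s * ennreal (1 - exp (- (\<phi> s / \<phi> a))) \<partial>power_weight (a * 0)) = (\<integral>\<^sup>+s. ennreal (1 - exp (- (\<phi> s / \<phi> a))) \<partial>power_weight A)"
      unfolding power_weight_def using A by (auto simp: nn_integral_density intro!: nn_integral_cong split: split_indicator)
    also have "enn2real (ennreal (sqrt a) * (\<integral>\<^sup>+s. ennreal (1 - exp (- (\<phi> s / \<phi> a))) \<partial>power_weight A))
       = sqrt a * (\<integral>s. 1 - exp (- (\<phi> s / \<phi> a)) \<partial>power_weight A)"
      using a A nn by (subst integral_eq_nn_integral) (auto intro!: AE_power_weight simp: enn2real_mult)
    finally show ?thesis .
  qed
  show ?lim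
    by (rule Lim_transform_eventually[OF L1])
       (use eventually_ge_at_top[of 1] in \<open>eventually_elim, simp add: eq\<close>)
qed

section \<open>Averages over a subordinated time\<close>

text \<open>Both properties are read off from the Laplace transform of a single law, by monotonicity and dominated
convergence.\<close>

lemma laplace_exponent_mono_cont:
  assumes "prob_space R" and [measurable_cong]: "sets R = sets borel" and pos: "AE u in R. 0 < u"
    and L: "\<And>s. s > 0 \<Longrightarrow> (\<integral>u. exp (- s * u) \<partial>R) = exp (- \<phi> s)"
  shows "mono_on {0<..} \<phi>" "continuous_on {0<..} (\<phi> :: real \<Rightarrow> real)"
proof -
  interpret R: prob_space R by fact
  have int: "integrable R (\<lambda>u. exp (- s * u))" if "s > 0" for s
    using pos that by (intro R.integrable_const_bound[where B=1]) (auto elim!: eventually_mono)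
  show "mono_on {0<..} \<phi>"
  proof (rule mono_onI)
    fix r s :: real assume rs: "r \<in> {0<..}" "s \<in> {0<..}" "r \<le> s"
    have "exp (- \<phi> s) \<le> exp (- \<phi> r)"
      using rs pos unfolding L[of r, symmetric, OF rs(1)[unfolded greaterThan_iff]] L[of s, symmetric, OF rs(2)[unfolded greaterThan_iff]]
      by (intro integral_mono_AE int) (auto elim!: eventually_mono intro: mult_right_mono)
    then show "\<phi> r \<le> \<phi> s" by simp
  qed
  have "continuous_on {0<..} (\<lambda>s. \<integral>u. exp (- s * u) \<partial>R)"
    unfolding continuous_on_sequentially comp_def
  proof (intro allI ballI impI, elim conjE)
    fix x :: "nat \<Rightarrow> real" and a :: real assume x: "\<forall>n. x n \<in> {0<..}" "x \<longlonglongrightarrow> a"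
    show "(\<lambda>n. \<integral>u. exp (- x n * u) \<partial>R) \<longlonglongrightarrow> (\<integral>u. exp (- a * u) \<partial>R)"
    proof (rule integral_dominated_convergence[where w="\<lambda>_. 1"])
      show "AE u in R. (\<lambda>n. exp (- x n * u)) \<longlonglongrightarrow> exp (- a * u)"
        by (intro AE_I2 tendsto_intros x)
      show "AE u in R. norm (exp (- x n * u)) \<le> 1" for n
        using pos x(1) by (auto elim!: eventually_mono intro!: mult_nonneg_nonneg simp: less_imp_le)
    qed auto
  qed
  moreover define h where "h s = (\<integral>u. exp (- s * u) \<partial>R)" for s
  ultimately have ch: "continuous_on {0<..} h" by (simp only: h_def[abs_def])
  have h: "h s = exp (- \<phi> s)" if "s \<in> {0<..}" for s unfolding h_def using that by (intro L) simp
  have "continuous_on {0<..} (\<lambda>s. - ln (h s))"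
    by (intro continuous_intros ch) (simp add: h)
  then show "continuous_on {0<..} \<phi>"
    by (rule continuous_on_cong[THEN iffD1, rotated -1]) (simp_all add: h)
qed

text \<open>Fubini for nonnegative integrands turns the mixture formula for the square root into one for its mean.\<close>

lemma stable_sqrt_moment:
  assumes "prob_space N" and [measurable]: "X \<in> borel_measurable N" and pos: "AE \<omega> in N. 0 \<le> X \<omega>"
    and L: "\<And>s. s > 0 \<Longrightarrow> (\<integral>\<omega>. exp (- s * X \<omega>) \<partial>N) = exp (- (s powr \<beta>))" and \<beta>: "\<beta> > 1/2"
  shows "(\<integral>s. 1 - exp (- (s powr \<beta>)) \<partial>power_weight 0) = sqrt_const * (\<integral>\<omega>. sqrt (X \<omega>) \<partial>N)"
proof -
  interpret N: prob_space N by fact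
  interpret PW: sigma_finite_measure "power_weight 0" by (rule sigma_finite_power_weight) simp
  interpret pair_sigma_finite N "power_weight 0" ..
  have int: "integrable N (\<lambda>\<omega>. exp (- s * X \<omega>))" if "s > 0" for s
    using pos that by (intro N.integrable_const_bound[where B=1]) (auto elim!: eventually_mono)
  have "(\<integral>\<^sup>+\<omega>. ennreal (sqrt_const * sqrt (X \<omega>)) \<partial>N) = (\<integral>\<^sup>+\<omega>. \<integral>\<^sup>+s. ennreal (1 - exp (- s * X \<omega>)) \<partial>power_weight 0 \<partial>N)"
    by (rule nn_integral_cong_AE) (use pos in \<open>auto elim!: eventually_mono simp: sqrt_as_exponential_mixture[simplified]\<close>)
  also have "\<dots> = (\<integral>\<^sup>+s. \<integral>\<^sup>+\<omega>. ennreal (1 - exp (- s * X \<omega>)) \<partial>N \<partial>power_weight 0)"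
    by (rule Fubini'[symmetric]) measurable
  also have "\<dots> = (\<integral>\<^sup>+s. ennreal (1 - exp (- (s powr \<beta>))) \<partial>power_weight 0)"
  proof (rule nn_integral_cong_AE, rule AE_power_weight)
    fix s :: real assume s: "0 < s"
    have "(\<integral>\<^sup>+\<omega>. ennreal (1 - exp (- s * X \<omega>)) \<partial>N) = ennreal (\<integral>\<omega>. 1 - exp (- s * X \<omega>) \<partial>N)"
      using int[OF s] pos s by (intro nn_integral_eq_integral) (auto elim!: eventually_mono)
    also have "(\<integral>\<omega>. 1 - exp (- s * X \<omega>) \<partial>N) = 1 - (\<integral>\<omega>. exp (- s * X \<omega>) \<partial>N)"
      using int[OF s] by (subst Bochner_Integration.integral_diff) (auto simp: N.prob_space)
    finally show "(\<integral>\<^sup>+\<omega>. ennreal (1 - exp (- s * X \<omega>)) \<partial>N) = ennreal (1 - exp (- (s powr \<beta>)))" unfolding L[OF s] .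
  qed
  finally have nn: "(\<integral>\<^sup>+\<omega>. ennreal (sqrt_const * sqrt (X \<omega>)) \<partial>N) = (\<integral>\<^sup>+s. ennreal (1 - exp (- (s powr \<beta>))) \<partial>power_weight 0)" .
  have "(\<integral>s. 1 - exp (- (s powr \<beta>)) \<partial>power_weight 0) = enn2real (\<integral>\<^sup>+s. ennreal (1 - exp (- (s powr \<beta>))) \<partial>power_weight 0)"
    by (rule integral_eq_nn_integral) (auto intro!: AE_power_weight)
  also have "\<dots> = (\<integral>\<omega>. sqrt_const * sqrt (X \<omega>) \<partial>N)"
    unfolding nn[symmetric] using pos sqrt_const_pos
    by (intro integral_eq_nn_integral[symmetric]) (auto elim!: eventually_mono)
  finally show ?thesis by simp
qed

text \<open>Near \<open>0\<close> both functions are asymptotic to \<open>c * sqrt u\<close>, so their difference is a small multiple of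
\<open>trunc_sqrt A u\<close>. Away from \<open>0\<close> both are bounded, and a bounded error is dominated by a multiple of
\<open>1 - exp (- u)\<close>, whose mean is explicit.\<close>

lemma comparison_with_trunc_sqrt:
  assumes [measurable]: "g \<in> borel_measurable borel" and g: "\<And>u. 0 \<le> g u \<and> g u \<le> G"
    and lim: "((\<lambda>u. g u / sqrt u) \<longlongrightarrow> c) (at_right 0)" and A: "A > 0" and \<epsilon>: "\<epsilon> > 0"
  obtains C where "C \<ge> 0" "\<And>u. u > 0 \<Longrightarrow> \<bar>g u - (c / sqrt_const) * trunc_sqrt A u\<bar> \<le> \<epsilon> * trunc_sqrt A u + C * (1 - exp (- u))"
proof -
  interpret PW: finite_measure "power_weight A" by (rule finite_power_weight[OF A])
  define F where "F = measure (power_weight A) UNIV"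
  have f0: "0 \<le> trunc_sqrt A u" if "u \<ge> 0" for u
    unfolding trunc_sqrt_def using that A by (intro integral_nonneg_AE AE_power_weight) auto
  have fF: "trunc_sqrt A u \<le> F" if "u \<ge> 0" for u
  proof -
    have "trunc_sqrt A u \<le> (\<integral>s. 1 \<partial>power_weight A)"
      unfolding trunc_sqrt_def using that A by (intro integral_mono_AE integrable_power_weight_exp AE_power_weight) auto
    then show ?thesis by (simp add: F_def)
  qed
  have \<kappa>: "sqrt_const > 0" by (rule sqrt_const_pos)
  have f: "((\<lambda>u. trunc_sqrt A u / sqrt u) \<longlongrightarrow> sqrt_const) (at_right 0)" by (rule trunc_sqrt_asymp[OF A])
  have "((\<lambda>u. (g u / sqrt u) / (trunc_sqrt A u / sqrt u)) \<longlongrightarrow> c / sqrt_const) (at_right 0)"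
    using \<kappa> by (intro tendsto_divide lim f) auto
  then have "\<forall>\<^sub>F u in at_right 0. dist ((g u / sqrt u) / (trunc_sqrt A u / sqrt u)) (c / sqrt_const) < \<epsilon>"
    using \<epsilon> by (rule tendstoD)
  moreover have "\<forall>\<^sub>F u in at_right 0. 0 < trunc_sqrt A u / sqrt u" by (rule order_tendstoD(1)[OF f \<kappa>])
  ultimately have "\<forall>\<^sub>F u in at_right 0. \<bar>g u - (c / sqrt_const) * trunc_sqrt A u\<bar> \<le> \<epsilon> * trunc_sqrt A u"
    using eventually_at_right_less[of 0]
  proof eventually_elim
    fix u :: real assume d: "dist ((g u / sqrt u) / (trunc_sqrt A u / sqrt u)) (c / sqrt_const) < \<epsilon>"
      and p: "0 < trunc_sqrt A u / sqrt u" and u: "0 < u"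
    have f: "trunc_sqrt A u > 0" using p u by (simp add: zero_less_divide_iff)
    have eq: "(g u / sqrt u) / (trunc_sqrt A u / sqrt u) = g u / trunc_sqrt A u" using u by simp
    have "\<bar>g u / trunc_sqrt A u - c / sqrt_const\<bar> \<le> \<epsilon>"
      using d unfolding eq dist_real_def by (rule less_imp_le)
    then have "\<bar>g u / trunc_sqrt A u - c / sqrt_const\<bar> * trunc_sqrt A u \<le> \<epsilon> * trunc_sqrt A u"
      using f by (intro mult_right_mono) auto
    moreover have "\<bar>g u / trunc_sqrt A u - c / sqrt_const\<bar> * trunc_sqrt A u = \<bar>(g u / trunc_sqrt A u - c / sqrt_const) * trunc_sqrt A u\<bar>"
      using f by (simp add: abs_mult)
    moreover have "(g u / trunc_sqrt A u - c / sqrt_const) * trunc_sqrt A u = g u - (c / sqrt_const) * trunc_sqrt A u"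
      using f by (simp add: left_diff_distrib)
    ultimately show "\<bar>g u - (c / sqrt_const) * trunc_sqrt A u\<bar> \<le> \<epsilon> * trunc_sqrt A u" by simp
  qed
  then obtain \<delta> where \<delta>: "\<delta> > 0" "\<And>u. 0 < u \<Longrightarrow> u < \<delta> \<Longrightarrow> \<bar>g u - (c / sqrt_const) * trunc_sqrt A u\<bar> \<le> \<epsilon> * trunc_sqrt A u"
    unfolding eventually_at_right_field by auto
  define H where "H = G + \<bar>c / sqrt_const\<bar> * F"
  have H: "H \<ge> 0" using g[of 0] fF[of 0] f0[of 0] by (auto simp: H_def intro!: add_nonneg_nonneg mult_nonneg_nonneg)
  define C where "C = H / (1 - exp (- \<delta>))"
  have \<delta>1: "1 - exp (- \<delta>) > 0" using \<delta> by simp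
  have C: "C \<ge> 0" using H \<delta>1 by (simp add: C_def)
  show thesis
  proof (rule that[OF C])
    fix u :: real assume u: "u > 0"
    have f0u: "0 \<le> \<epsilon> * trunc_sqrt A u" using f0[of u] u \<epsilon> by simp
    have e0u: "0 \<le> C * (1 - exp (- u))" using C u by simp
    show "\<bar>g u - (c / sqrt_const) * trunc_sqrt A u\<bar> \<le> \<epsilon> * trunc_sqrt A u + C * (1 - exp (- u))"
    proof (cases "u < \<delta>")
      case True then show ?thesis using \<delta>(2)[OF u True] e0u by linarith
    next
      case False
      have "\<bar>g u - (c / sqrt_const) * trunc_sqrt A u\<bar> \<le> \<bar>g u\<bar> + \<bar>(c / sqrt_const) * trunc_sqrt A u\<bar>" by (rule abs_triangle_ineq4)
      also have "\<dots> \<le> G + \<bar>c / sqrt_const\<bar> * F"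
      proof (rule add_mono)
        show "\<bar>g u\<bar> \<le> G" using g[of u] by simp
        have "\<bar>c / sqrt_const * trunc_sqrt A u\<bar> = \<bar>c / sqrt_const\<bar> * trunc_sqrt A u"
          using f0[of u] u by (subst abs_mult) (simp only: abs_of_nonneg less_imp_le)
        also have "\<dots> \<le> \<bar>c / sqrt_const\<bar> * F" using fF[of u] u by (intro mult_left_mono) auto
        finally show "\<bar>c / sqrt_const * trunc_sqrt A u\<bar> \<le> \<bar>c / sqrt_const\<bar> * F" .
      qed
      also have "\<dots> = C * (1 - exp (- \<delta>))" using \<delta>1 by (simp add: C_def H_def)
      also have "\<dots> \<le> C * (1 - exp (- u))" using False C by (intro mult_left_mono) auto
      finally show ?thesis using f0u by linarith
    qed
  qed
qed

text \<open>It suffices to treat \<open>trunc_sqrt A\<close>, whose mean is an integral of Laplace transforms and whose scaled limit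
is known; the error terms of the comparison are \<open>\<epsilon>\<close> times this mean and a multiple of
\<open>1 - exp (- t * \<phi> 1)\<close>, of order \<open>t\<close>. As \<open>\<phi>\<close> grows faster than \<open>s powr \<gamma>\<close> with \<open>\<gamma> > 1/2\<close>, the
order \<open>t\<close> is negligible against the normalization \<open>1 / sqrt (a t)\<close>.\<close>

theorem subordination_tauberian:
  fixes \<rho> :: "real \<Rightarrow> real measure"
  assumes rv: "regularly_varying \<phi> \<beta>" and \<beta>: "1/2 < \<beta>"
    and R: "\<And>t. t > 0 \<Longrightarrow> prob_space (\<rho> t)" "\<And>t. t > 0 \<Longrightarrow> sets (\<rho> t) = sets borel" "\<And>t. t > 0 \<Longrightarrow> AE u in \<rho> t. 0 < u"
    and L: "\<And>t s. t > 0 \<Longrightarrow> s > 0 \<Longrightarrow> (\<integral>u. exp (- s * u) \<partial>\<rho> t) = exp (- t * \<phi> s)"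
    and N: "prob_space N" "X \<in> borel_measurable N" "AE \<omega> in N. 0 \<le> X \<omega>"
      "\<And>s. s > 0 \<Longrightarrow> (\<integral>\<omega>. exp (- s * X \<omega>) \<partial>N) = exp (- (s powr \<beta>))"
    and gm: "g \<in> borel_measurable borel" and g: "\<And>u. 0 \<le> g u \<and> g u \<le> G"
    and lim: "((\<lambda>u. g u / sqrt u) \<longlongrightarrow> c) (at_right 0)"
  shows "((\<lambda>t. (\<integral>u. g u \<partial>\<rho> t) / (inv_into {0<..} \<phi> (1 / t)) powr (- 1 / 2)) \<longlongrightarrow> (\<integral>\<omega>. sqrt (X \<omega>) \<partial>N) * c) (at_right 0)"
proof -
  note gm[measurable]
  have pos: "\<phi> s > 0" if "s > 0" for s using rv that by (simp add: regularly_varying_def)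
  have mono: "mono_on {0<..} \<phi>" and cont: "continuous_on {0<..} \<phi>"
    using laplace_exponent_mono_cont[of "\<rho> 1" \<phi>] R[of 1] L[of 1] by auto
  \<comment> \<open>Any exponent strictly between \<open>1/2\<close> and \<open>\<beta>\<close> serves.\<close>
  define \<gamma> where "\<gamma> = (1/2 + \<beta>) / 2"
  have \<gamma>: "1/2 < \<gamma>" "\<gamma> < \<beta>" using \<beta> by (auto simp: \<gamma>_def)
  obtain A where A: "A > 0" and P: "\<And>r a. r \<ge> 1 \<Longrightarrow> a \<ge> A \<Longrightarrow> \<phi> (r * a) \<ge> 2 powr (-\<gamma>) * r powr \<gamma> * \<phi> a"
    using potter_lower[OF rv mono _ \<gamma>(2)] \<gamma>(1) by (metis less_trans zero_less_divide_1_iff zero_less_numeral)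
  \<comment> \<open>Only the values at positive arguments are constrained; extending them by \<open>0\<close> gives a Borel function.\<close>
  define \<phi>' where "\<phi>' s = (if s > 0 then \<phi> s else 0)" for s
  have \<phi>': "\<phi>' s = \<phi> s" if "s > 0" for s using that by (simp add: \<phi>'_def)
  have [measurable]: "\<phi>' \<in> borel_measurable borel"
  proof -
    have "(\<lambda>x. indicator {0<..} x *\<^sub>R \<phi> x) \<in> borel_measurable borel"
      by (rule borel_measurable_continuous_on_indicator[OF _ cont]) simp
    also have "(\<lambda>x. indicator {0<..} x *\<^sub>R \<phi> x) = \<phi>'" by (auto simp: \<phi>'_def indicator_def)
    finally show ?thesis .
  qed
  have rv': "regularly_varying \<phi>' \<beta>"
    unfolding regularly_varying_def
  proof (intro conjI allI impI)
    show "\<phi>' s > 0" if "s > 0" for s using pos that by (simp add: \<phi>')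
    fix k :: real assume k: "k > 0"
    have "((\<lambda>s. \<phi> (k * s) / \<phi> s) \<longlongrightarrow> k powr \<beta>) at_top" using rv k by (simp add: regularly_varying_def)
    moreover have "\<forall>\<^sub>F s in at_top. \<phi> (k * s) / \<phi> s = \<phi>' (k * s) / \<phi>' s"
      using eventually_gt_at_top[of 0] by eventually_elim (use k in \<open>simp add: \<phi>'\<close>)
    ultimately show "((\<lambda>s. \<phi>' (k * s) / \<phi>' s) \<longlongrightarrow> k powr \<beta>) at_top" by (rule Lim_transform_eventually)
  qed
  have mono': "mono_on {0<..} \<phi>'" using mono by (auto simp: mono_on_def \<phi>')
  have P': "\<phi>' (r * a) \<ge> 2 powr (-\<gamma>) * r powr \<gamma> * \<phi>' a" if "r \<ge> 1" "a \<ge> A" for r a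
    using P[OF that] that A by (simp add: \<phi>')
  define J where "J = (\<integral>s. 1 - exp (- (s powr \<beta>)) \<partial>power_weight 0)"
  have J: "J = sqrt_const * (\<integral>\<omega>. sqrt (X \<omega>) \<partial>N)" unfolding J_def by (rule stable_sqrt_moment[OF N \<beta>])
  have scaled: "((\<lambda>a. sqrt a * (\<integral>s. 1 - exp (- (\<phi>' s / \<phi>' a)) \<partial>power_weight A)) \<longlongrightarrow> J) at_top"
    unfolding J_def by (rule scaled_laplace_limit[OF rv' mono' \<gamma> _ A P']) auto
  define a where "a t = inv_into {0<..} \<phi> (1 / t)" for t
  define C0 where "C0 = 2 powr (-\<gamma>) * \<phi> A / A powr \<gamma>"
  have C0: "C0 > 0" using pos[OF A] A by (simp add: C0_def)
  have growth: "C0 * s powr \<gamma> \<le> \<phi> s" if "s \<ge> A" for s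
    using P[of "s / A" A] that A by (simp add: C0_def powr_divide field_simps)
  \<comment> \<open>Outside the range of \<open>\<phi>\<close> the inverse is arbitrary, so the preimage must be produced before \<open>a t\<close> can be used.\<close>
  have surj: "y \<in> \<phi> ` {0<..}" if y: "y \<ge> \<phi> 1" for y
  proof -
    define b where "b = max (max A 1) ((y / C0) powr (1 / \<gamma>))"
    have y0: "y > 0" using y pos[of 1] by simp
    have "((y / C0) powr (1 / \<gamma>)) powr \<gamma> \<le> b powr \<gamma>" using \<gamma> by (intro powr_mono2) (auto simp: b_def)
    then have "y / C0 \<le> b powr \<gamma>" using y0 C0 \<gamma> by (simp add: powr_powr)
    then have b: "y \<le> C0 * b powr \<gamma>" "A \<le> b" "1 \<le> b" using C0 by (auto simp: b_def field_simps)
    have "\<exists>x\<ge>1. x \<le> b \<and> \<phi> x = y"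
      using y b growth[OF b(2)] by (intro IVT') (auto intro: continuous_on_subset[OF cont])
    then show ?thesis by force
  qed
  have ev1: "\<forall>\<^sub>F t in at_right 0. \<phi> 1 \<le> 1 / t \<and> 0 < t"
  proof -
    have "\<forall>\<^sub>F t in at_right 0. t < 1 / \<phi> 1" using pos[of 1] by (intro order_tendstoD(2)[OF tendsto_ident_at]) auto
    then show ?thesis using eventually_at_right_less[of 0]
      by eventually_elim (use pos[of 1] in \<open>simp add: field_simps\<close>)
  qed
  have a_eq: "\<phi> (a t) = 1 / t" "a t > 0" if "\<phi> 1 \<le> 1 / t" for t
    using f_inv_into_f[OF surj[OF that]] inv_into_into[OF surj[OF that]] by (auto simp: a_def)
  have a_top: "filterlim a at_top (at_right 0)"
    unfolding filterlim_at_top_gt[where c=1]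
  proof (intro allI impI)
    fix K :: real assume K: "K > 1"
    have "\<forall>\<^sub>F t in at_right 0. t < 1 / \<phi> K" using pos[of K] K by (intro order_tendstoD(2)[OF tendsto_ident_at]) auto
    then show "\<forall>\<^sub>F t in at_right 0. K \<le> a t"
      using ev1
    proof eventually_elim
      fix t assume t: "t < 1 / \<phi> K" "\<phi> 1 \<le> 1 / t \<and> 0 < t"
      have "\<phi> K < 1 / t" using t pos[of K] K by (simp add: field_simps)
      show "K \<le> a t"
      proof (rule ccontr)
        assume "\<not> K \<le> a t"
        then have "\<phi> (a t) \<le> \<phi> K" using a_eq(2)[of t] t K by (intro mono_onD[OF mono]) auto
        then show False using a_eq(1)[of t] t \<open>\<phi> K < 1 / t\<close> by simp
      qed
    qed
  qed
  define Y where "Y t = sqrt (a t) * (\<integral>u. trunc_sqrt A u \<partial>\<rho> t)" for t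
  define Z where "Z t = sqrt (a t) * (1 - exp (- t * \<phi> 1))" for t
  define V where "V t = sqrt (a t) * (\<integral>u. g u \<partial>\<rho> t)" for t
  have Rn: "AE u in \<rho> t. 0 \<le> u" if "t > 0" for t using R(3)[OF that] by eventually_elim simp
  have L': "(\<integral>u. exp (- s * u) \<partial>\<rho> t) = exp (- t * \<phi>' s)" if "t > 0" "s > 0" for t s
    using L[OF that] that by (simp add: \<phi>')
  have tr: "integrable (\<rho> t) (trunc_sqrt A)" "(\<integral>u. trunc_sqrt A u \<partial>\<rho> t) = (\<integral>s. 1 - exp (- t * \<phi>' s) \<partial>power_weight A)" if t: "t > 0" for t
    by (rule trunc_sqrt_integral[OF A R(1,2)[OF t] Rn[OF t] _ L'[OF t]]; simp)+
  have Ylim: "(Y \<longlongrightarrow> J) (at_right 0)"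
  proof (rule Lim_transform_eventually[OF filterlim_compose[OF scaled a_top]])
    show "\<forall>\<^sub>F t in at_right 0. sqrt (a t) * (\<integral>s. 1 - exp (- (\<phi>' s / \<phi>' (a t))) \<partial>power_weight A) = Y t"
      using ev1
    proof eventually_elim
      fix t assume t: "\<phi> 1 \<le> 1 / t \<and> 0 < t"
      then have "\<phi>' (a t) = 1 / t" using a_eq[of t] by (simp add: \<phi>')
      then show "sqrt (a t) * (\<integral>s. 1 - exp (- (\<phi>' s / \<phi>' (a t))) \<partial>power_weight A) = Y t"
        unfolding Y_def using tr(2)[of t] t by (simp add: mult.commute)
    qed
  qed
  have Zlim: "(Z \<longlongrightarrow> 0) (at_right 0)"
  proof (rule Lim_null_comparison)
    have "((\<lambda>s. \<phi> 1 / C0 * s powr (1/2 - \<gamma>)) \<longlongrightarrow> \<phi> 1 / C0 * 0) at_top"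
      using \<gamma> by (intro tendsto_mult tendsto_const tendsto_neg_powr filterlim_ident) auto
    then show "((\<lambda>t. \<phi> 1 / C0 * a t powr (1/2 - \<gamma>)) \<longlongrightarrow> 0) (at_right 0)"
      using filterlim_compose[OF _ a_top] by fastforce
    have "\<forall>\<^sub>F t in at_right 0. A \<le> a t" using a_top by (simp add: filterlim_at_top)
    then show "\<forall>\<^sub>F t in at_right 0. norm (Z t) \<le> \<phi> 1 / C0 * a t powr (1/2 - \<gamma>)"
      using ev1
    proof eventually_elim
      fix t assume At: "A \<le> a t" and t: "\<phi> 1 \<le> 1 / t \<and> 0 < t"
      have a0: "a t > 0" using At A by simp
      have q: "0 \<le> t * \<phi> 1" using t pos[of 1] by simp
      have tC: "t \<le> 1 / (C0 * a t powr \<gamma>)"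
      proof -
        have "C0 * a t powr \<gamma> \<le> 1 / t" using growth[OF At] a_eq(1)[of t] t by simp
        moreover have "0 < C0 * a t powr \<gamma>" using C0 a0 by simp
        ultimately show ?thesis using t by (simp add: field_simps)
      qed
      have "norm (Z t) = sqrt (a t) * (1 - exp (- t * \<phi> 1))" using a0 q by (simp add: Z_def abs_mult)
      also have "\<dots> \<le> sqrt (a t) * (t * \<phi> 1)" using one_minus_exp_bounds(2)[OF q] a0 by (intro mult_left_mono) auto
      also have "\<dots> \<le> sqrt (a t) * (1 / (C0 * a t powr \<gamma>) * \<phi> 1)" using tC pos[of 1] a0 by (intro mult_left_mono mult_right_mono) auto
      also have "\<dots> = \<phi> 1 / C0 * a t powr (1/2 - \<gamma>)" using a0 by (simp add: powr_diff powr_half_sqrt)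
      finally show "norm (Z t) \<le> \<phi> 1 / C0 * a t powr (1/2 - \<gamma>)" .
    qed
  qed
  have "J \<ge> 0" unfolding J_def by (intro integral_nonneg_AE AE_power_weight) auto
  have diff: "((\<lambda>t. V t - (c / sqrt_const) * Y t) \<longlongrightarrow> 0) (at_right 0)"
  proof (rule tendstoI)
    fix e :: real assume e: "e > 0"
    define \<epsilon> where "\<epsilon> = e / (2 * (J + 1))"
    have \<epsilon>: "\<epsilon> > 0" using e \<open>J \<ge> 0\<close> by (simp add: \<epsilon>_def)
    obtain C where C: "C \<ge> 0" and cmp: "\<And>u. u > 0 \<Longrightarrow> \<bar>g u - (c / sqrt_const) * trunc_sqrt A u\<bar> \<le> \<epsilon> * trunc_sqrt A u + C * (1 - exp (- u))"
      using comparison_with_trunc_sqrt[OF gm g lim A \<epsilon>] by blast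
    have "((\<lambda>t. C * Z t) \<longlongrightarrow> C * 0) (at_right 0)" by (intro tendsto_intros Zlim)
    then have "\<forall>\<^sub>F t in at_right 0. C * Z t < e / 2" by (rule order_tendstoD(2)) (use e in simp)
    moreover have "\<forall>\<^sub>F t in at_right 0. Y t < J + 1" by (rule order_tendstoD(2)[OF Ylim]) simp
    ultimately show "\<forall>\<^sub>F t in at_right 0. dist (V t - (c / sqrt_const) * Y t) 0 < e"
      using ev1
    proof eventually_elim
      fix t assume CZ: "C * Z t < e / 2" and Yt: "Y t < J + 1" and t1: "\<phi> 1 \<le> 1 / t \<and> 0 < t"
      then have t: "t > 0" by simp
      interpret Rt: prob_space "\<rho> t" by (rule R(1)[OF t])
      note [measurable_cong] = R(2)[OF t]
      have ig: "integrable (\<rho> t) g" using g by (intro Rt.integrable_const_bound[where B=G]) auto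
      have ie: "integrable (\<rho> t) (\<lambda>u. exp (- u))"
        using Rn[OF t] by (intro Rt.integrable_const_bound[where B=1]) (auto elim!: eventually_mono)
      have le: "(\<integral>u. exp (- u) \<partial>\<rho> t) = exp (- t * \<phi> 1)" using L[OF t, of 1] by simp
      have "\<bar>(\<integral>u. g u - (c / sqrt_const) * trunc_sqrt A u \<partial>\<rho> t)\<bar> \<le> (\<integral>u. \<bar>g u - (c / sqrt_const) * trunc_sqrt A u\<bar> \<partial>\<rho> t)"
        by (rule integral_abs_bound)
      also have "\<dots> \<le> (\<integral>u. \<epsilon> * trunc_sqrt A u + C * (1 - exp (- u)) \<partial>\<rho> t)"
        using ig ie tr(1)[OF t] R(3)[OF t] cmp by (intro integral_mono_AE) (auto elim!: eventually_mono)
      also have "\<dots> = \<epsilon> * (\<integral>u. trunc_sqrt A u \<partial>\<rho> t) + C * (1 - exp (- t * \<phi> 1))"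
        using ie tr(1)[OF t] le by (simp add: Rt.prob_space)
      finally have "\<bar>(\<integral>u. g u \<partial>\<rho> t) - (c / sqrt_const) * (\<integral>u. trunc_sqrt A u \<partial>\<rho> t)\<bar> \<le> \<epsilon> * (\<integral>u. trunc_sqrt A u \<partial>\<rho> t) + C * (1 - exp (- t * \<phi> 1))"
        using ig tr(1)[OF t] by simp
      then have "sqrt (a t) * \<bar>(\<integral>u. g u \<partial>\<rho> t) - (c / sqrt_const) * (\<integral>u. trunc_sqrt A u \<partial>\<rho> t)\<bar>
         \<le> sqrt (a t) * (\<epsilon> * (\<integral>u. trunc_sqrt A u \<partial>\<rho> t) + C * (1 - exp (- t * \<phi> 1)))"
        using a_eq(2)[of t] t1 by (intro mult_left_mono) auto
      also have "\<dots> = \<epsilon> * Y t + C * Z t" by (simp add: Y_def Z_def algebra_simps)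
      also have "sqrt (a t) * \<bar>(\<integral>u. g u \<partial>\<rho> t) - (c / sqrt_const) * (\<integral>u. trunc_sqrt A u \<partial>\<rho> t)\<bar> = \<bar>V t - (c / sqrt_const) * Y t\<bar>"
      proof -
        have "V t - (c / sqrt_const) * Y t = sqrt (a t) * ((\<integral>u. g u \<partial>\<rho> t) - (c / sqrt_const) * (\<integral>u. trunc_sqrt A u \<partial>\<rho> t))"
          by (simp add: V_def Y_def algebra_simps)
        then show ?thesis using a_eq(2)[of t] t1 by (simp add: abs_mult)
      qed
      finally have "\<bar>V t - (c / sqrt_const) * Y t\<bar> \<le> \<epsilon> * Y t + C * Z t" .
      also have "\<dots> < \<epsilon> * (J + 1) + e / 2"
        using mult_strict_left_mono[OF Yt \<epsilon>] CZ by linarith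
      also have "\<dots> = e" using \<open>J \<ge> 0\<close> by (simp add: \<epsilon>_def field_simps)
      finally show "dist (V t - (c / sqrt_const) * Y t) 0 < e" by (simp add: dist_real_def)
    qed
  qed
  have "((\<lambda>t. (V t - (c / sqrt_const) * Y t) + (c / sqrt_const) * Y t) \<longlongrightarrow> 0 + (c / sqrt_const) * J) (at_right 0)"
    by (intro tendsto_add diff tendsto_mult tendsto_const Ylim)
  then have "(V \<longlongrightarrow> (\<integral>\<omega>. sqrt (X \<omega>) \<partial>N) * c) (at_right 0)" using sqrt_const_pos by (simp add: J mult.commute)
  then show ?thesis
  proof (rule Lim_transform_eventually)
    show "\<forall>\<^sub>F t in at_right 0. V t = (\<integral>u. g u \<partial>\<rho> t) / (inv_into {0<..} \<phi> (1 / t)) powr (- 1 / 2)"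
      using ev1
    proof eventually_elim
      fix t assume t: "\<phi> 1 \<le> 1 / t \<and> 0 < t"
      have a0: "a t > 0" using a_eq(2)[of t] t by simp
      have "a t powr (- 1 / 2) = 1 / sqrt (a t)" using a0 powr_minus_divide[of "a t" "1/2"] by (simp add: powr_half_sqrt)
      then show "V t = (\<integral>u. g u \<partial>\<rho> t) / (inv_into {0<..} \<phi> (1 / t)) powr (- 1 / 2)"
        unfolding a_def[symmetric] by (simp add: V_def mult.commute)
    qed
  qed
qed

section \<open>Reflections preserve volume\<close>

text \<open>A direct argument without determinants: the product of \<open>emeasure lborel (f -` A)\<close> with the volume of the unit
ball is a double integral of \<open>indicator A (f x) * indicator B y\<close>. Translating \<open>y\<close> by \<open>f x\<close>, then \<open>x\<close> by
\<open>- f y\<close>, moves \<open>f\<close> from \<open>A\<close> to the ball, which is invariant under \<open>f\<close>.\<close>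

lemma emeasure_lborel_involutive_isometry:
  fixes f :: "'a::euclidean_space \<Rightarrow> 'a"
  assumes lin: "linear f" and inv: "\<And>x. f (f x) = x" and nrm: "\<And>x. norm (f x) = norm x"
    and A[measurable]: "A \<in> sets borel"
  shows "emeasure lborel (f -` A) = emeasure lborel A"
proof -
  have [measurable]: "f \<in> borel_measurable borel"
    by (intro borel_measurable_continuous_onI linear_continuous_on linear_conv_bounded_linear[THEN iffD1] lin)
  define B where "B = ball (0::'a) 1"
  have [measurable]: "B \<in> sets borel" by (simp add: B_def)
  have shift: "(\<integral>\<^sup>+y. g (c + y) \<partial>lborel) = (\<integral>\<^sup>+y. g y \<partial>lborel)" if [measurable]: "g \<in> borel_measurable borel" for g and c :: 'a
  proof -
    have "(\<integral>\<^sup>+y. g y \<partial>lborel) = (\<integral>\<^sup>+y. g y \<partial>distr lborel borel ((+) c))" by (simp add: lborel_distr_plus)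
    also have "\<dots> = (\<integral>\<^sup>+y. g (c + y) \<partial>lborel)" by (subst nn_integral_distr) auto
    finally show ?thesis by simp
  qed
  have refl: "(\<integral>\<^sup>+y. g (- y) \<partial>lborel) = (\<integral>\<^sup>+y. g y \<partial>lborel)" if [measurable]: "g \<in> borel_measurable borel" for g :: "'a \<Rightarrow> ennreal"
  proof -
    have "(\<integral>\<^sup>+y. g y \<partial>lborel) = (\<integral>\<^sup>+y. g y \<partial>density (distr lborel borel (\<lambda>x. 0 + (-1) *\<^sub>R x)) (\<lambda>_. \<bar>-1::real\<bar> ^ DIM('a)))"
      using lborel_affine[of "-1" "0::'a"] by simp
    also have "\<dots> = (\<integral>\<^sup>+y. g (- y) \<partial>lborel)" by (simp add: density_1 nn_integral_distr)
    finally show ?thesis by simp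
  qed
  have "emeasure lborel (f -` A) * emeasure lborel B = (\<integral>\<^sup>+x. \<integral>\<^sup>+y. indicator A (f x) * indicator B y \<partial>lborel \<partial>lborel)"
  proof -
    have "(\<integral>\<^sup>+x. \<integral>\<^sup>+y. indicator A (f x) * indicator B y \<partial>lborel \<partial>lborel) = (\<integral>\<^sup>+x. indicator (f -` A) x * emeasure lborel B \<partial>lborel)"
      by (subst nn_integral_cmult) (auto intro!: nn_integral_cong simp: indicator_def)
    also have "f -` A \<in> sets borel" using measurable_sets[of f borel borel A] by simp
    then have "(\<integral>\<^sup>+x. indicator (f -` A) x * emeasure lborel B \<partial>lborel) = emeasure lborel (f -` A) * emeasure lborel B"
      by (subst nn_integral_multc) auto
    finally show ?thesis by simp
  qed
  also have "\<dots> = (\<integral>\<^sup>+x. \<integral>\<^sup>+y. indicator A (f x) * indicator B (f x + y) \<partial>lborel \<partial>lborel)"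
  proof (rule nn_integral_cong)
    fix x :: 'a
    show "(\<integral>\<^sup>+y. indicator A (f x) * indicator B y \<partial>lborel) = (\<integral>\<^sup>+y. indicator A (f x) * indicator B (f x + y) \<partial>lborel)"
      using shift[of "\<lambda>y. indicator A (f x) * indicator B y" "f x"] by simp
  qed
  also have "\<dots> = (\<integral>\<^sup>+y. \<integral>\<^sup>+x. indicator A (f x) * indicator B (f x + y) \<partial>lborel \<partial>lborel)"
    by (rule lborel_pair.Fubini') measurable
  also have "\<dots> = (\<integral>\<^sup>+y. \<integral>\<^sup>+x. indicator A (f x - y) * indicator B (f x) \<partial>lborel \<partial>lborel)"
  proof (rule nn_integral_cong)
    fix y :: 'a
    have fy: "f (- f y + x) = f x - y" for x
      using lin inv by (simp add: linear_diff)
    have "(\<integral>\<^sup>+x. indicator A (f x) * indicator B (f x + y) \<partial>lborel) = (\<integral>\<^sup>+x. indicator A (f (- f y + x)) * indicator B (f (- f y + x) + y) \<partial>lborel)"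
      by (rule shift[symmetric]) measurable
    then show "(\<integral>\<^sup>+x. indicator A (f x) * indicator B (f x + y) \<partial>lborel) = (\<integral>\<^sup>+x. indicator A (f x - y) * indicator B (f x) \<partial>lborel)"
      by (simp add: fy del: add_uminus_conv_diff uminus_add_conv_diff)
  qed
  also have "\<dots> = (\<integral>\<^sup>+x. \<integral>\<^sup>+y. indicator A (f x - y) * indicator B (f x) \<partial>lborel \<partial>lborel)"
    by (rule lborel_pair.Fubini') measurable
  also have "\<dots> = (\<integral>\<^sup>+x. emeasure lborel A * indicator B x \<partial>lborel)"
  proof (rule nn_integral_cong)
    fix x :: 'a
    have "(\<integral>\<^sup>+y. indicator A (f x - y) * indicator B (f x) \<partial>lborel) = (\<integral>\<^sup>+y. indicator A (f x - y) \<partial>lborel) * indicator B (f x)"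
      by (rule nn_integral_multc) measurable
    also have "(\<integral>\<^sup>+y. indicator A (f x - y) \<partial>lborel) = (\<integral>\<^sup>+y. indicator A (f x + y) \<partial>lborel)"
      using refl[of "\<lambda>y. indicator A (f x + y)"] by simp
    also have "\<dots> = emeasure lborel A" by (subst shift) auto
    finally have c: "(\<integral>\<^sup>+y. indicator A (f x - y) * indicator B (f x) \<partial>lborel) = emeasure lborel A * indicator B (f x)" .
    have "indicator B (f x) = (indicator B x :: ennreal)" using nrm by (auto simp: B_def indicator_def)
    with c show "(\<integral>\<^sup>+y. indicator A (f x - y) * indicator B (f x) \<partial>lborel) = emeasure lborel A * indicator B x" by simp
  qed
  also have "\<dots> = emeasure lborel A * emeasure lborel B" by (subst nn_integral_cmult) auto
  finally have "emeasure lborel (f -` A) * emeasure lborel B = emeasure lborel A * emeasure lborel B" .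
  moreover have "emeasure lborel B \<noteq> 0" "emeasure lborel B \<noteq> \<infinity>"
    using emeasure_ball[of 1 "0::'a"] less_imp_neq[OF unit_ball_vol_pos[of "real DIM('a)"]] by (auto simp: B_def)
  ultimately show ?thesis by (simp add: mult.commute[of _ "emeasure lborel B"] ennreal_mult_cancel_left)
qed

text \<open>The reflection in the hyperplane orthogonal to \<open>a - b\<close>.\<close>

lemma householder:
  fixes a b :: "'a::euclidean_space"
  assumes "norm a = 1" "norm b = 1"
  obtains f where "linear f" "\<And>x. f (f x) = x" "\<And>x. norm (f x) = norm x" "f a = b"
proof (cases "a = b")
  case True then show thesis by (intro that[of id]) (auto simp: id_def linear_ident)
next
  case False
  define w where "w = a - b"
  have w: "w \<bullet> w \<noteq> 0" using False by (simp add: w_def)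
  define f where "f x = x - (2 * (x \<bullet> w) / (w \<bullet> w)) *\<^sub>R w" for x
  show thesis
  proof (rule that[of f])
    show "linear f" 
      by (rule linearI) (auto simp: f_def inner_add_left scaleR_add_left algebra_simps add_divide_distrib)
    have fw: "f x \<bullet> w = - (x \<bullet> w)" for x using w by (simp add: f_def inner_diff_left)
    show "f (f x) = x" for x
      unfolding f_def[of "f x"] fw by (simp add: f_def)
    have "f x \<bullet> f x = x \<bullet> x" for x
    proof -
      have "f x \<bullet> f x = f x \<bullet> x - (2 * (x \<bullet> w) / (w \<bullet> w)) * (f x \<bullet> w)"
        by (subst (2) f_def) (simp add: inner_diff_right)
      also have "\<dots> = x \<bullet> x" unfolding fw by (simp add: f_def inner_diff_left inner_diff_right inner_commute)
      finally show ?thesis .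
    qed
    then show "norm (f x) = norm x" for x by (simp add: norm_eq_sqrt_inner)
    have "a \<bullet> a = 1" "b \<bullet> b = 1" using assms by (simp_all add: norm_eq_1)
    then have "2 * (a \<bullet> w) = w \<bullet> w" by (simp add: w_def algebra_simps inner_commute)
    then show "f a = b" using w by (simp add: f_def) (simp add: w_def)
  qed
qed

section \<open>The isodiametric inequality\<close>

abbreviation lebI :: "'i set \<Rightarrow> ('i \<Rightarrow> real) measure" where
  "lebI I \<equiv> Pi\<^sub>M I (\<lambda>_. lborel)"

definition slice :: "('i \<Rightarrow> real) set \<Rightarrow> 'i \<Rightarrow> ('i \<Rightarrow> real) \<Rightarrow> real set" where
  "slice N i f = {s. f(i := s) \<in> N}"

text \<open>Each line in direction \<open>i\<close> meets the symmetrized set in the centred open segment that is as long as the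
original slice. The length is a measure, so no shape of the slice is presupposed.\<close>

definition steiner :: "'i set \<Rightarrow> 'i \<Rightarrow> ('i \<Rightarrow> real) set \<Rightarrow> ('i \<Rightarrow> real) set" where
  "steiner I i N = {f \<in> space (lebI I). ennreal (2 * \<bar>f i\<bar>) < emeasure lborel (slice N i f)}"

lemma upd_measurable: "i \<in> I \<Longrightarrow> (\<lambda>(f, s). f(i := s)) \<in> lebI I \<Otimes>\<^sub>M lborel \<rightarrow>\<^sub>M lebI I"
proof -
  assume i: "i \<in> I"
  have "(\<lambda>(f, s). f(i := s)) \<in> Pi\<^sub>M I (\<lambda>_. lborel) \<Otimes>\<^sub>M lborel \<rightarrow>\<^sub>M Pi\<^sub>M (insert i I) (\<lambda>_. lborel)"
    by (rule measurable_add_dim)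
  then show ?thesis using i by (simp add: insert_absorb)
qed

lemma slice_measurable:
  assumes "i \<in> I" "N \<in> sets (lebI I)" "f \<in> space (lebI I)"
  shows "slice N i f \<in> sets borel"
proof -
  have "(\<lambda>s. f(i := s)) \<in> lborel \<rightarrow>\<^sub>M lebI I"
    using measurable_compose[OF measurable_Pair1'[OF assms(3)] upd_measurable[OF assms(1)]] by simp
  from measurable_sets[OF this assms(2)] show ?thesis by (simp add: slice_def vimage_def)
qed

lemma slice_len_measurable:
  assumes "i \<in> I" "N \<in> sets (lebI I)"
  shows "(\<lambda>f. emeasure lborel (slice N i f)) \<in> borel_measurable (lebI I)"
proof -
  have "(\<lambda>(f, s). f(i := s)) -` N \<inter> space (lebI I \<Otimes>\<^sub>M lborel) \<in> sets (lebI I \<Otimes>\<^sub>M lborel)"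
    by (rule measurable_sets[OF upd_measurable[OF assms(1)] assms(2)])
  from lborel.measurable_emeasure_Pair[OF this]
  show ?thesis
    by (rule measurable_cong[THEN iffD1, rotated]) (auto simp: slice_def space_pair_measure intro!: arg_cong[where f="emeasure lborel"])
qed

lemma steiner_sets [measurable]:
  assumes "i \<in> I" "N \<in> sets (lebI I)"
  shows "steiner I i N \<in> sets (lebI I)"
proof -
  have [measurable]: "(\<lambda>f. emeasure lborel (slice N i f)) \<in> borel_measurable (lebI I)"
    by (rule slice_len_measurable[OF assms])
  have [measurable]: "(\<lambda>f. f i) \<in> borel_measurable (lebI I)" 
    using measurable_component_singleton[OF assms(1), of "\<lambda>_. lborel"] by simp
  show ?thesis unfolding steiner_def by measurable
qed

lemma emeasure_eq_slices:
  assumes I: "finite I" "i \<in> I" and N: "N \<in> sets (lebI I)"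
  shows "emeasure (lebI I) N = (\<integral>\<^sup>+x. emeasure lborel (slice N i x) \<partial>lebI (I - {i}))"
proof -
  interpret product_sigma_finite "\<lambda>_::'a. lborel::real measure" ..
  have ins: "insert i (I - {i}) = I" using I by auto
  have "emeasure (lebI I) N = (\<integral>\<^sup>+x. indicator N x \<partial>lebI (insert i (I - {i})))"
    using N unfolding ins by simp
  also have "\<dots> = (\<integral>\<^sup>+x. \<integral>\<^sup>+s. indicator N (x(i := s)) \<partial>lborel \<partial>lebI (I - {i}))"
    using I N by (intro product_nn_integral_insert) (auto simp del: insert_Diff_single simp: ins)
  also have "\<dots> = (\<integral>\<^sup>+x. emeasure lborel (slice N i x) \<partial>lebI (I - {i}))"
  proof (rule nn_integral_cong)
    fix x assume x: "x \<in> space (lebI (I - {i}))"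
    have "x(i := 0) \<in> space (lebI I)" using x I by (auto simp: space_PiM PiE_iff extensional_def)
    from slice_measurable[OF I(2) N this] have [measurable]: "slice N i x \<in> sets borel" by (simp add: slice_def)
    have "(\<integral>\<^sup>+s. indicator N (x(i := s)) \<partial>lborel) = (\<integral>\<^sup>+s. indicator (slice N i x) s \<partial>lborel)"
      by (intro nn_integral_cong) (auto simp: slice_def indicator_def)
    then show "(\<integral>\<^sup>+s. indicator N (x(i := s)) \<partial>lborel) = emeasure lborel (slice N i x)" by simp
  qed
  finally show ?thesis .
qed

lemma emeasure_steiner:
  assumes I: "finite I" "i \<in> I" and N: "N \<in> sets (lebI I)"
  shows "emeasure (lebI I) (steiner I i N) = emeasure (lebI I) N"
  unfolding emeasure_eq_slices[OF I N] emeasure_eq_slices[OF I steiner_sets[OF I(2) N]]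
proof (rule nn_integral_cong)
  fix x assume x: "x \<in> space (lebI (I - {i}))"
  define l where "l = emeasure lborel (slice N i x)"
  have "x(i := s) \<in> space (lebI I)" for s using x I by (auto simp: space_PiM PiE_iff extensional_def)
  then have eq: "slice (steiner I i N) i x = {s. ennreal (2 * \<bar>s\<bar>) < l}"
    by (auto simp: slice_def steiner_def l_def)
  show "emeasure lborel (slice (steiner I i N) i x) = emeasure lborel (slice N i x)"
  proof (cases l)
    case (real r)
    have "{s. ennreal (2 * \<bar>s\<bar>) < l} = {- (r/2)<..<r/2}" using real by (auto simp: ennreal_less_iff)
    then show ?thesis unfolding eq l_def[symmetric] using real by simp
  next
    case top
    then show ?thesis unfolding eq l_def[symmetric] by simp
  qed
qed

text \<open>Otherwise both sets are bounded and each lies within \<open>a + b\<close> of the other's extreme points, so that their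
spans add up to at most \<open>2 * (a + b)\<close>, less than the sum of their measures.\<close>

lemma slices_far_apart:
  fixes p q :: "real set"
  assumes [measurable]: "p \<in> sets borel" "q \<in> sets borel"
    and a: "a \<ge> 0" "ennreal (2 * a) < emeasure lborel p" and b: "b \<ge> 0" "ennreal (2 * b) < emeasure lborel q"
  shows "\<exists>s\<in>p. \<exists>t\<in>q. a + b < \<bar>s - t\<bar>"
proof (rule ccontr)
  assume "\<not> ?thesis"
  then have le: "\<bar>s - t\<bar> \<le> a + b" if "s \<in> p" "t \<in> q" for s t using that by force
  have ne: "p \<noteq> {}" "q \<noteq> {}" using a b by auto
  then obtain s0 t0 where st: "s0 \<in> p" "t0 \<in> q" by auto
  have bp: "bdd_above p" "bdd_below p" 
    using le[OF _ st(2)] by (auto intro!: bdd_aboveI[of _ "t0 + (a+b)"] bdd_belowI[of _ "t0 - (a+b)"] simp: abs_le_iff) (smt (verit))+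
  have bq: "bdd_above q" "bdd_below q" 
    using le[OF st(1)] by (auto intro!: bdd_aboveI[of _ "s0 + (a+b)"] bdd_belowI[of _ "s0 - (a+b)"] simp: abs_le_iff) (smt (verit))+
  have len: "emeasure lborel r \<le> ennreal (Sup r - Inf r)" "Inf r \<le> Sup r" 
    if "r \<in> sets borel" "r \<noteq> {}" "bdd_above r" "bdd_below r" for r :: "real set"
  proof -
    have "r \<subseteq> {Inf r..Sup r}" using that by (auto intro: cInf_lower cSup_upper)
    moreover show "Inf r \<le> Sup r" using that by (simp add: cInf_le_cSup)
    ultimately show "emeasure lborel r \<le> ennreal (Sup r - Inf r)"
      using emeasure_mono[of r "{Inf r..Sup r}" lborel] by simp
  qed
  have "Sup p \<le> Inf q + (a + b)"
  proof -
    have "s - (a + b) \<le> Inf q" if "s \<in> p" for s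
      using ne le[OF that] by (intro cInf_greatest) (auto simp: abs_le_iff, smt (verit))
    then have "s \<le> Inf q + (a + b)" if "s \<in> p" for s using that by force
    then show ?thesis using ne by (intro cSup_least) auto
  qed
  moreover have "Sup q \<le> Inf p + (a + b)"
  proof -
    have "t - (a + b) \<le> Inf p" if "t \<in> q" for t
      using ne le[OF _ that] by (intro cInf_greatest) (auto simp: abs_le_iff, smt (verit))
    then have "t \<le> Inf p + (a + b)" if "t \<in> q" for t using that by force
    then show ?thesis using ne by (intro cSup_least) auto
  qed
  moreover have "2 * a < Sup p - Inf p" 
    using less_le_trans[OF a(2) len(1)[OF assms(1) ne(1) bp]] a len(2)[OF assms(1) ne(1) bp] by (simp add: ennreal_less_iff)
  moreover have "2 * b < Sup q - Inf q" 
    using less_le_trans[OF b(2) len(1)[OF assms(2) ne(2) bq]] b len(2)[OF assms(2) ne(2) bq] by (simp add: ennreal_less_iff)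
  ultimately show False by linarith
qed

definition diam_le :: "'i set \<Rightarrow> real \<Rightarrow> ('i \<Rightarrow> real) set \<Rightarrow> bool" where
  "diam_le I d N \<longleftrightarrow> (\<forall>f\<in>N. \<forall>g\<in>N. (\<Sum>i\<in>I. (f i - g i)\<^sup>2) \<le> d\<^sup>2)"

text \<open>Two points of the symmetrized set that differ by at most \<open>\<bar>f i\<bar> + \<bar>g i\<bar>\<close> in coordinate \<open>i\<close> come from
slices that contain points at least that far apart, with the other coordinates unchanged.\<close>

lemma steiner_diam_le:
  assumes I: "finite I" "i \<in> I" and N: "N \<in> sets (lebI I)" and d: "diam_le I d N"
  shows "diam_le I d (steiner I i N)"
  unfolding diam_le_def
proof (intro ballI)
  fix f g assume f: "f \<in> steiner I i N" and g: "g \<in> steiner I i N"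
  then have fg: "f \<in> space (lebI I)" "g \<in> space (lebI I)" by (auto simp: steiner_def)
  obtain s t where st: "f(i := s) \<in> N" "g(i := t) \<in> N" "\<bar>f i\<bar> + \<bar>g i\<bar> < \<bar>s - t\<bar>"
    using slices_far_apart[OF slice_measurable[OF I(2) N fg(1)] slice_measurable[OF I(2) N fg(2)], of "\<bar>f i\<bar>" "\<bar>g i\<bar>"] f g
    by (auto simp: steiner_def slice_def)
  have "(f i - g i)\<^sup>2 \<le> (s - t)\<^sup>2"
    using st(3) by (subst abs_le_square_iff[symmetric]) linarith
  then have "(\<Sum>j\<in>I. (f j - g j)\<^sup>2) \<le> (s - t)\<^sup>2 + (\<Sum>j\<in>I - {i}. (f j - g j)\<^sup>2)"
    using I by (subst sum.remove[of _ i]) auto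
  also have "\<dots> = (\<Sum>j\<in>I. ((f(i := s)) j - (g(i := t)) j)\<^sup>2)"
    using I by (subst sum.remove[of I i]) (auto intro!: sum.cong)
  also have "\<dots> \<le> d\<^sup>2" using d st(1,2) unfolding diam_le_def by blast
  finally show "(\<Sum>i\<in>I. (f i - g i)\<^sup>2) \<le> d\<^sup>2" .
qed

text \<open>Symmetrizing in one coordinate keeps the symmetry in the coordinates treated before, because reflecting
another coordinate does not change the slices.\<close>

lemma steiner_symmetrizes:
  assumes I: "finite I" "J \<subseteq> I" and N: "N \<in> sets (lebI I)" and d: "diam_le I d N"
  shows "\<exists>N'\<in>sets (lebI I). emeasure (lebI I) N' = emeasure (lebI I) N \<and> diam_le I d N' \<and>
      (\<forall>j\<in>J. \<forall>f\<in>N'. f(j := - f j) \<in> N')"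
proof -
  have "finite J" using I by (auto intro: finite_subset)
  then show ?thesis using I(2)
  proof (induction J)
    case empty then show ?case using N d by auto
  next
    case (insert i J)
    then obtain N' where N': "N' \<in> sets (lebI I)" "emeasure (lebI I) N' = emeasure (lebI I) N" "diam_le I d N'"
      "\<forall>j\<in>J. \<forall>f\<in>N'. f(j := - f j) \<in> N'" by blast
    have i: "i \<in> I" using insert by auto
    have sym: "f(j := - f j) \<in> steiner I i N'" if j: "j \<in> insert i J" and f: "f \<in> steiner I i N'" for j f
    proof (cases "j = i")
      case True
      then show ?thesis using f i by (auto simp: steiner_def slice_def space_PiM PiE_iff extensional_def)
    next
      case False
      then have jJ: "j \<in> J" and jI: "j \<in> I" using j insert.prems by auto
      have imp: "(h(j := - h j))(i := s) \<in> N'" if "h(i := s) \<in> N'" for h s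
        using N'(4)[rule_format, OF jJ that] False by (simp add: fun_upd_twist)
      have "slice N' i (f(j := - f j)) = slice N' i f"
        using imp[of f] imp[of "f(j := - f j)"] by (auto simp: slice_def)
      then show ?thesis using f jI False by (auto simp: steiner_def space_PiM PiE_iff extensional_def)
    qed
    show ?case
    proof (intro bexI[of _ "steiner I i N'"] conjI ballI)
      show "emeasure (lebI I) (steiner I i N') = emeasure (lebI I) N"
        using emeasure_steiner[OF I(1) i N'(1)] N'(2) by simp
    qed (use sym steiner_sets[OF i N'(1)] steiner_diam_le[OF I(1) i N'(1,3)] in blast)+
  qed
qed

text \<open>A set symmetric in all coordinates contains \<open>-f\<close> with every \<open>f\<close>; if its diameter is at most \<open>d\<close>, the norm of
\<open>f\<close> is at most \<open>d / 2\<close>. Steiner symmetrization in every coordinate brings any set into this position.\<close>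

theorem isodiametric:
  assumes I: "finite I" and N: "N \<in> sets (lebI I)" and d: "d > 0" "diam_le I d N"
  shows "emeasure (lebI I) N \<le> ennreal (unit_ball_vol (card I) * (d / 2) ^ card I)"
proof -
  obtain N' where N': "N' \<in> sets (lebI I)" "emeasure (lebI I) N' = emeasure (lebI I) N" "diam_le I d N'"
      "\<And>j f. j \<in> I \<Longrightarrow> f \<in> N' \<Longrightarrow> f(j := - f j) \<in> N'" 
    using steiner_symmetrizes[OF I order_refl N d(2)] by auto
  have "N' \<subseteq> {f. sqrt (\<Sum>i\<in>I. (f i)\<^sup>2) \<le> d / 2} \<inter> space (lebI I)"
  proof
    fix f assume f: "f \<in> N'"
    have neg: "(\<lambda>j. if j \<in> J then - f j else f j) \<in> N'" if "J \<subseteq> I" for J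
      using finite_subset[OF that I] that
    proof (induction J)
      case (insert i J)
      then have "(\<lambda>j. if j \<in> J then - f j else f j) \<in> N'" "i \<in> I" by auto
      from N'(4)[OF this(2,1)] show ?case
        by (rule back_subst[where P="\<lambda>x. x \<in> N'"]) (use insert in \<open>auto simp: fun_eq_iff\<close>)
    qed (use f in simp)
    have "(\<Sum>i\<in>I. (f i - (if i \<in> I then - f i else f i))\<^sup>2) \<le> d\<^sup>2"
      using N'(3)[unfolded diam_le_def, rule_format, OF f neg[OF order_refl]] by simp
    also have "(\<Sum>i\<in>I. (f i - (if i \<in> I then - f i else f i))\<^sup>2) = 4 * (\<Sum>i\<in>I. (f i)\<^sup>2)"
      unfolding sum_distrib_left by (intro sum.cong) (auto simp: power2_eq_square)
    finally have "(\<Sum>i\<in>I. (f i)\<^sup>2) \<le> (d / 2)\<^sup>2" by (simp add: power_divide)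
    then have "sqrt (\<Sum>i\<in>I. (f i)\<^sup>2) \<le> d / 2" using d by (intro real_le_lsqrt) (auto intro: sum_nonneg)
    moreover have "f \<in> space (lebI I)" using f N'(1) sets.sets_into_space by blast
    ultimately show "f \<in> {f. sqrt (\<Sum>i\<in>I. (f i)\<^sup>2) \<le> d / 2} \<inter> space (lebI I)" by simp
  qed
  moreover have "{f. sqrt (\<Sum>i\<in>I. (f i)\<^sup>2) \<le> d / 2} \<inter> space (lebI I) = {f \<in> space (lebI I). sqrt (\<Sum>i\<in>I. (f i)\<^sup>2) \<le> d / 2}" by auto
  moreover have "{f \<in> space (lebI I). sqrt (\<Sum>i\<in>I. (f i)\<^sup>2) \<le> d / 2} \<in> sets (lebI I)" by measurable
  ultimately have "emeasure (lebI I) N' \<le> emeasure (lebI I) ({f. sqrt (\<Sum>i\<in>I. (f i)\<^sup>2) \<le> d / 2} \<inter> space (lebI I))"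
    by (intro emeasure_mono) auto
  also have "\<dots> = ennreal (unit_ball_vol (card I) * (d / 2) ^ card I)"
    using I d by (intro emeasure_cball_aux) auto
  finally show ?thesis using N'(2) by simp
qed


section \<open>Volume by parallel lines\<close>

lemma nn_integral_lborel_split:
  fixes b :: "'a::euclidean_space" and g :: "'a \<Rightarrow> ennreal"
  assumes b: "b \<in> Basis" and [measurable]: "g \<in> borel_measurable borel"
  shows "(\<integral>\<^sup>+x. g x \<partial>lborel) = (\<integral>\<^sup>+x. \<integral>\<^sup>+s. g ((\<Sum>i\<in>Basis - {b}. x i *\<^sub>R i) + s *\<^sub>R b) \<partial>lborel \<partial>lebI (Basis - {b}))"
proof -
  interpret product_sigma_finite "\<lambda>_::'a. lborel::real measure" ..
  have ins: "insert b (Basis - {b}) = (Basis::'a set)" using b by auto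
  have [measurable]: "(\<lambda>f. \<Sum>i\<in>(Basis::'a set). f i *\<^sub>R i) \<in> lebI Basis \<rightarrow>\<^sub>M borel" by measurable
  have "(\<integral>\<^sup>+x. g x \<partial>lborel) = (\<integral>\<^sup>+f. g (\<Sum>i\<in>Basis. f i *\<^sub>R i) \<partial>lebI (insert b (Basis - {b})))"
    unfolding ins by (subst lborel_eq, subst nn_integral_distr) auto
  also have "\<dots> = (\<integral>\<^sup>+x. \<integral>\<^sup>+s. g (\<Sum>i\<in>Basis. (x(b := s)) i *\<^sub>R i) \<partial>lborel \<partial>lebI (Basis - {b}))"
    by (intro product_nn_integral_insert) (auto simp del: insert_Diff_single simp: ins)
  also have "\<dots> = (\<integral>\<^sup>+x. \<integral>\<^sup>+s. g ((\<Sum>i\<in>Basis - {b}. x i *\<^sub>R i) + s *\<^sub>R b) \<partial>lborel \<partial>lebI (Basis - {b}))"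
  proof (intro nn_integral_cong arg_cong[where f=g])
    fix x s
    have "(\<Sum>i\<in>Basis. (x(b := s)) i *\<^sub>R i) = (x(b := s)) b *\<^sub>R b + (\<Sum>i\<in>Basis - {b}. (x(b := s)) i *\<^sub>R i)"
      using b by (subst sum.remove[of _ b]) auto
    also have "(\<Sum>i\<in>Basis - {b}. (x(b := s)) i *\<^sub>R i) = (\<Sum>i\<in>Basis - {b}. x i *\<^sub>R i)"
      by (intro sum.cong) auto
    finally show "(\<Sum>i\<in>Basis. (x(b := s)) i *\<^sub>R i) = (\<Sum>i\<in>Basis - {b}. x i *\<^sub>R i) + s *\<^sub>R b" by (simp add: add.commute)
  qed
  finally show ?thesis .
qed

lemma inner_Basis_sum_minus:
  fixes b :: "'a::euclidean_space"
  assumes "b \<in> Basis" "j \<in> Basis"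
  shows "(\<Sum>i\<in>Basis - {b}. x i *\<^sub>R i) \<bullet> j = (if j = b then 0 else x j)"
  using assms by (simp add: inner_sum_left inner_Basis if_distrib sum.If_cases cong: if_cong)

lemma norm_sq_sum_Basis: "(norm (x::'a::euclidean_space))\<^sup>2 = (\<Sum>i\<in>Basis. (x \<bullet> i)\<^sup>2)"
  by (rule trans[OF power2_norm_eq_inner trans[OF euclidean_inner]]) (simp add: power2_eq_square)

text \<open>The set lies over its shadow along \<open>b\<close>, each fibre having length at most \<open>l\<close>, and the shadow has diameter at most
\<open>d\<close>. The shadow need not be measurable, so it is replaced by the set of base points whose fibre has positive length.\<close>

lemma emeasure_le_cylinder_Basis:
  fixes b :: "'a::euclidean_space"
  assumes b: "b \<in> Basis" and X[measurable]: "X \<in> sets borel" and d: "d > 0"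
    and diam: "\<And>x y. x \<in> X \<Longrightarrow> y \<in> X \<Longrightarrow> dist x y \<le> d"
    and slices: "\<And>x. emeasure lborel {s. x + s *\<^sub>R b \<in> X} \<le> l"
  shows "emeasure lborel X \<le> ennreal (unit_ball_vol (real (DIM('a) - 1)) * (d / 2) ^ (DIM('a) - 1)) * l"
proof -
  define I where "I = Basis - {b}"
  define v where "v x = (\<Sum>i\<in>I. x i *\<^sub>R i)" for x :: "'a \<Rightarrow> real"
  have I: "finite I" "card I = DIM('a) - 1" using b by (auto simp: I_def)
  have vm[measurable]: "v \<in> lebI I \<rightarrow>\<^sub>M borel" unfolding v_def[abs_def] by measurable
  have [measurable]: "{s. y + s *\<^sub>R b \<in> X} \<in> sets borel" for y :: 'a
    by measurable
  have ind: "(\<integral>\<^sup>+s. indicator X (y + s *\<^sub>R b) \<partial>lborel) = emeasure lborel {s. y + s *\<^sub>R b \<in> X}" for y :: 'a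
  proof -
    have "(\<integral>\<^sup>+s. indicator X (y + s *\<^sub>R b) \<partial>lborel) = (\<integral>\<^sup>+s. indicator {s. y + s *\<^sub>R b \<in> X} s \<partial>lborel)"
      by (intro nn_integral_cong) (auto simp: indicator_def)
    then show ?thesis by simp
  qed
  define m where "m x = (\<integral>\<^sup>+s. indicator X (v x + s *\<^sub>R b) \<partial>lborel)" for x
  have [measurable]: "m \<in> borel_measurable (lebI I)" unfolding m_def[abs_def] by measurable
  define N where "N = {x \<in> space (lebI I). m x \<noteq> 0}"
  have N: "N \<in> sets (lebI I)" unfolding N_def by measurable
  have "diam_le I d N"
    unfolding diam_le_def
  proof (intro ballI)
    fix x y assume "x \<in> N" "y \<in> N"
    then have "{s. v x + s *\<^sub>R b \<in> X} \<noteq> {}" "{s. v y + s *\<^sub>R b \<in> X} \<noteq> {}"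
      by (auto simp: N_def m_def ind simp del: Collect_empty_eq)
    then obtain s t where st: "v x + s *\<^sub>R b \<in> X" "v y + t *\<^sub>R b \<in> X" by auto
    let ?w = "(v x + s *\<^sub>R b) - (v y + t *\<^sub>R b)"
    have "(\<Sum>i\<in>I. (x i - y i)\<^sup>2) = (\<Sum>i\<in>I. (?w \<bullet> i)\<^sup>2)"
      using b by (intro sum.cong) (auto simp: I_def v_def inner_diff_left inner_add_left inner_Basis_sum_minus inner_Basis)
    also have "\<dots> \<le> (\<Sum>i\<in>Basis. (?w \<bullet> i)\<^sup>2)" by (intro sum_mono2) (auto simp: I_def)
    also have "\<dots> = (norm ?w)\<^sup>2"
      by (rule norm_sq_sum_Basis[symmetric])
    also have "\<dots> \<le> d\<^sup>2" using diam[OF st] by (intro power_mono) (auto simp: dist_norm)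
    finally show "(\<Sum>i\<in>I. (x i - y i)\<^sup>2) \<le> d\<^sup>2" .
  qed
  from isodiametric[OF I(1) N d this]
  have iso: "emeasure (lebI I) N \<le> ennreal (unit_ball_vol (real (DIM('a) - 1)) * (d / 2) ^ (DIM('a) - 1))"
    by (simp add: I(2))
  have "emeasure lborel X = (\<integral>\<^sup>+x. indicator X x \<partial>lborel)" by simp
  also have "\<dots> = (\<integral>\<^sup>+x. m x \<partial>lebI I)"
    unfolding m_def v_def I_def by (rule nn_integral_lborel_split[OF b]) auto
  also have "\<dots> \<le> (\<integral>\<^sup>+x. l * indicator N x \<partial>lebI I)"
  proof (rule nn_integral_mono)
    fix x assume "x \<in> space (lebI I)"
    moreover have "m x \<le> l" unfolding m_def ind by (rule slices)
    ultimately show "m x \<le> l * indicator N x" by (auto simp: N_def indicator_def)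
  qed
  also have "\<dots> = l * emeasure (lebI I) N" using N by (simp add: nn_integral_cmult)
  also have "\<dots> \<le> l * ennreal (unit_ball_vol (real (DIM('a) - 1)) * (d / 2) ^ (DIM('a) - 1))"
    by (intro mult_left_mono iso) auto
  finally show ?thesis by (simp add: mult.commute)
qed

lemma emeasure_ge_cylinder_Basis:
  fixes b :: "'a::euclidean_space"
  assumes b: "b \<in> Basis" and X[measurable]: "X \<in> sets borel" and r: "r > 0"
    and slices: "\<And>v. v \<bullet> b = 0 \<Longrightarrow> norm v \<le> r \<Longrightarrow> l \<le> emeasure lborel {s. v + s *\<^sub>R b \<in> X}"
  shows "ennreal (unit_ball_vol (real (DIM('a) - 1)) * r ^ (DIM('a) - 1)) * l \<le> emeasure lborel X"
proof -
  define I where "I = Basis - {b}"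
  define v where "v x = (\<Sum>i\<in>I. x i *\<^sub>R i)" for x :: "'a \<Rightarrow> real"
  have I: "finite I" "card I = DIM('a) - 1" using b by (auto simp: I_def)
  have vm[measurable]: "v \<in> lebI I \<rightarrow>\<^sub>M borel" unfolding v_def[abs_def] by measurable
  have [measurable]: "{s. y + s *\<^sub>R b \<in> X} \<in> sets borel" for y :: 'a
    by measurable
  have ind: "(\<integral>\<^sup>+s. indicator X (y + s *\<^sub>R b) \<partial>lborel) = emeasure lborel {s. y + s *\<^sub>R b \<in> X}" for y :: 'a
  proof -
    have "(\<integral>\<^sup>+s. indicator X (y + s *\<^sub>R b) \<partial>lborel) = (\<integral>\<^sup>+s. indicator {s. y + s *\<^sub>R b \<in> X} s \<partial>lborel)"
      by (intro nn_integral_cong) (auto simp: indicator_def)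
    then show ?thesis by simp
  qed
  let ?B = "{f. sqrt (\<Sum>i\<in>I. (f i)\<^sup>2) \<le> r} \<inter> space (lebI I)"
  have eqB: "?B = {f \<in> space (lebI I). sqrt (\<Sum>i\<in>I. (f i)\<^sup>2) \<le> r}" by auto
  have B: "?B \<in> sets (lebI I)" unfolding eqB by measurable
  have "ennreal (unit_ball_vol (real (DIM('a) - 1)) * r ^ (DIM('a) - 1)) * l = emeasure (lebI I) ?B * l"
    using emeasure_cball_aux[OF I(1) r] I(2) by simp
  also have "\<dots> = (\<integral>\<^sup>+x. l * indicator ?B x \<partial>lebI I)" using B by (simp add: nn_integral_cmult mult.commute)
  also have "\<dots> \<le> (\<integral>\<^sup>+x. \<integral>\<^sup>+s. indicator X (v x + s *\<^sub>R b) \<partial>lborel \<partial>lebI I)"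
  proof (intro nn_integral_mono)
    fix x assume "x \<in> space (lebI I)"
    show "l * indicator ?B x \<le> (\<integral>\<^sup>+s. indicator X (v x + s *\<^sub>R b) \<partial>lborel)"
    proof (cases "x \<in> ?B")
      case True
      have vb: "v x \<bullet> b = 0" using b by (simp add: v_def I_def inner_Basis_sum_minus)
      have "(norm (v x))\<^sup>2 = (\<Sum>i\<in>Basis. (v x \<bullet> i)\<^sup>2)"
        by (rule norm_sq_sum_Basis)
      also have "\<dots> = (v x \<bullet> b)\<^sup>2 + (\<Sum>i\<in>I. (v x \<bullet> i)\<^sup>2)" unfolding I_def using b by (subst sum.remove[of _ b]) auto
      also have "\<dots> = (\<Sum>i\<in>I. (x i)\<^sup>2)"
        using b vb by (auto simp: I_def v_def inner_Basis_sum_minus intro!: sum.cong)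
      finally have "norm (v x) = sqrt (\<Sum>i\<in>I. (x i)\<^sup>2)" by (metis norm_ge_zero real_sqrt_abs abs_of_nonneg)
      then have "norm (v x) \<le> r" using True by simp
      from slices[OF vb this] True show ?thesis by (simp add: ind)
    qed simp
  qed
  also have "\<dots> = (\<integral>\<^sup>+x. indicator X x \<partial>lborel)"
    unfolding v_def I_def by (rule nn_integral_lborel_split[OF b, symmetric]) auto
  finally show ?thesis by simp
qed

lemma cylinder_rotate:
  fixes e :: "'a::euclidean_space"
  assumes e: "norm e = 1" and X[measurable]: "X \<in> sets borel"
  obtains b f where "b \<in> Basis" "f -` X \<in> sets borel" "emeasure lborel (f -` X) = emeasure lborel X"
    "linear f" "\<And>x. norm (f x) = norm x" "\<And>x. f (f x) = x" "f b = e"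
    "\<And>x. {s. x + s *\<^sub>R b \<in> f -` X} = {s. f x + s *\<^sub>R e \<in> X}"
proof -
  obtain b :: 'a where b: "b \<in> Basis" using nonempty_Basis by blast
  obtain f where f: "linear f" "\<And>x. f (f x) = x" "\<And>x. norm (f x) = norm x" "f b = e"
    using householder[of b e] b e by auto
  have [measurable]: "f \<in> borel_measurable borel"
    by (intro borel_measurable_continuous_onI linear_continuous_on linear_conv_bounded_linear[THEN iffD1] f)
  show thesis
  proof (rule that[OF b _ _ f(1,3,2,4)])
    show "f -` X \<in> sets borel" using measurable_sets[of f borel borel X] by simp
    show "emeasure lborel (f -` X) = emeasure lborel X"
      by (rule emeasure_lborel_involutive_isometry[OF f(1,2,3) X])
    show "{s. x + s *\<^sub>R b \<in> f -` X} = {s. f x + s *\<^sub>R e \<in> X}" for x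
      using f by (simp add: linear_add linear_scale)
  qed
qed

text \<open>This is how a covering by sets of given diameter controls volume near a hypersurface: the constant is exactly the
weight of \<open>d\<close> in the Hausdorff measure.\<close>

lemma emeasure_le_cylinder:
  fixes e :: "'a::euclidean_space"
  assumes e: "norm e = 1" and X: "X \<in> sets borel" and d: "d > 0"
    and diam: "\<And>x y. x \<in> X \<Longrightarrow> y \<in> X \<Longrightarrow> dist x y \<le> d"
    and slices: "\<And>x. emeasure lborel {s. x + s *\<^sub>R e \<in> X} \<le> l"
  shows "emeasure lborel X \<le> ennreal (unit_ball_vol (real (DIM('a) - 1)) * (d / 2) ^ (DIM('a) - 1)) * l"
proof -
  obtain b :: 'a and f where bf: "b \<in> Basis" "f -` X \<in> sets borel" "emeasure lborel (f -` X) = emeasure lborel X"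
    "linear f" "\<And>x. norm (f x) = norm x"
    "\<And>x. f (f x) = x" "f b = e"
    "\<And>x. {s. x + s *\<^sub>R b \<in> f -` X} = {s. f x + s *\<^sub>R e \<in> X}" 
    by (rule cylinder_rotate[OF e X]) (rule that)
  have "dist (f x) (f y) = dist x y" for x y
    unfolding dist_norm linear_diff[OF bf(4), symmetric] bf(5) ..
  then have "\<And>x y. x \<in> f -` X \<Longrightarrow> y \<in> f -` X \<Longrightarrow> dist x y \<le> d" using diam by fastforce
  from emeasure_le_cylinder_Basis[OF bf(1,2) d this, of l] show ?thesis
    unfolding bf(3,8) using slices by auto
qed

lemma emeasure_ge_cylinder:
  fixes e :: "'a::euclidean_space"
  assumes e: "norm e = 1" and X: "X \<in> sets borel" and r: "r > 0"
    and slices: "\<And>v. v \<bullet> e = 0 \<Longrightarrow> norm v \<le> r \<Longrightarrow> l \<le> emeasure lborel {s. v + s *\<^sub>R e \<in> X}"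
  shows "ennreal (unit_ball_vol (real (DIM('a) - 1)) * r ^ (DIM('a) - 1)) * l \<le> emeasure lborel X"
proof -
  obtain b :: 'a and f where bf: "b \<in> Basis" "f -` X \<in> sets borel" "emeasure lborel (f -` X) = emeasure lborel X"
    "linear f" "\<And>x. norm (f x) = norm x" "\<And>x. f (f x) = x" "f b = e"
    "\<And>x. {s. x + s *\<^sub>R b \<in> f -` X} = {s. f x + s *\<^sub>R e \<in> X}" 
    by (rule cylinder_rotate[OF e X]) (rule that)
  have inner: "f x \<bullet> f y = x \<bullet> y" for x y
    unfolding dot_norm linear_add[OF bf(4), symmetric] bf(5) ..
  show ?thesis
    unfolding bf(3)[symmetric]
  proof (rule emeasure_ge_cylinder_Basis[OF bf(1,2) r])
    fix v assume "v \<bullet> b = 0" "norm v \<le> r"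
    then show "l \<le> emeasure lborel {s. v + s *\<^sub>R b \<in> f -` X}"
      unfolding bf(8) using inner[of v b] by (intro slices) (auto simp: bf(5,7))
  qed
qed

section \<open>Open sets with flat boundary\<close>

definition along :: "'a::euclidean_space \<Rightarrow> 'a \<Rightarrow> 'a" where
  "along e y = y - (y \<bullet> e) *\<^sub>R e"

text \<open>Inside the ball of radius \<open>\<rho>\<close> at \<open>p\<close> the set is the region above a graph in direction \<open>e\<close> whose slope is at most
\<open>\<eta>\<close>; \<open>e\<close> plays the inner normal.\<close>

definition flat_at :: "'a::euclidean_space set \<Rightarrow> real \<Rightarrow> real \<Rightarrow> 'a \<Rightarrow> 'a \<Rightarrow> bool" where
  "flat_at \<Omega> \<eta> \<rho> p e \<longleftrightarrow> norm e = 1 \<and>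
     (\<exists>\<psi>. \<psi> 0 = 0 \<and> \<eta>-lipschitz_on {v. v \<bullet> e = 0 \<and> norm v \<le> \<rho>} \<psi> \<and>
       (\<forall>y\<in>ball p \<rho>. y \<in> \<Omega> \<longleftrightarrow> \<psi> (along e (y - p)) < (y - p) \<bullet> e))"

text \<open>One radius for all boundary points at each tolerance: the consequence of regularity on which
the asymptotics rest. Intervals and \<open>C\<^sup>1\<^sup>,\<^sup>1\<close> domains share it.\<close>

definition flat_boundary :: "'a::euclidean_space set \<Rightarrow> bool" where
  "flat_boundary \<Omega> \<longleftrightarrow> open \<Omega> \<and> (\<forall>\<eta>>0. \<exists>\<rho>>0. \<forall>p\<in>frontier \<Omega>. \<exists>e. flat_at \<Omega> \<eta> \<rho> p e)"

definition crossing :: "'a::euclidean_space set \<Rightarrow> 'a \<Rightarrow> 'a set" where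
  "crossing \<Omega> z = {x \<in> \<Omega>. x + z \<notin> \<Omega>}"

lemma along_orthogonal: "norm e = 1 \<Longrightarrow> along e y \<bullet> e = 0"
  by (simp add: along_def inner_diff_left norm_eq_1)

lemma along_add: "along e (x + y) = along e x + along e y"
  by (simp add: along_def inner_add_left scaleR_add_left algebra_simps)

lemma along_scaleR_self: "norm e = 1 \<Longrightarrow> along e (s *\<^sub>R e) = 0"
  by (simp add: along_def norm_eq_1)

lemma along_fixed: "v \<bullet> e = 0 \<Longrightarrow> along e v = v"
  by (simp add: along_def)

lemma norm_along_le: assumes "norm e = 1" shows "norm (along e y) \<le> norm y"
proof -
  have "(norm (along e y))\<^sup>2 = (norm y)\<^sup>2 - (y \<bullet> e)\<^sup>2"
    unfolding along_def power2_norm_eq_inner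
    using assms by (simp add: inner_diff_left inner_diff_right norm_eq_1 power2_eq_square inner_commute)
  then have "(norm (along e y))\<^sup>2 \<le> (norm y)\<^sup>2" by simp
  then show ?thesis by (rule power2_le_imp_le) simp
qed

lemma abs_inner_unit_le: "norm e = 1 \<Longrightarrow> \<bar>y \<bullet> e\<bar> \<le> norm y"
  using Cauchy_Schwarz_ineq2[of y e] by simp

lemma crossing_borel: "open \<Omega> \<Longrightarrow> crossing \<Omega> z \<in> sets borel"
proof -
  assume "open \<Omega>"
  then have [measurable]: "\<Omega> \<in> sets borel" by simp
  show ?thesis unfolding crossing_def by measurable
qed

text \<open>On a line in direction \<open>e\<close>, a point of \<open>\<Omega>\<close> leaves \<open>\<Omega>\<close> under the shift only if its height above the graph is at
most \<open>- (z \<bullet> e)\<close> plus the change \<open>\<eta> * norm z\<close> of the graph.\<close>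

lemma emeasure_crossing_le:
  fixes \<Omega> :: "'a::euclidean_space set"
  assumes flat: "flat_at \<Omega> \<eta> \<rho> p e" and "open \<Omega>" "\<eta> \<ge> 0" and U: "U \<in> sets borel" "U \<subseteq> ball p (\<rho> / 2)"
    and d: "d > 0" "\<And>x y. x \<in> U \<Longrightarrow> y \<in> U \<Longrightarrow> dist x y \<le> d" and z: "norm z < \<rho> / 2"
  shows "emeasure lborel (U \<inter> crossing \<Omega> z)
     \<le> ennreal (unit_ball_vol (real (DIM('a) - 1)) * (d / 2) ^ (DIM('a) - 1) * (max 0 (- (z \<bullet> e)) + \<eta> * norm z))"
proof -
  from flat obtain \<psi> where e: "norm e = 1" and \<psi>: "\<eta>-lipschitz_on {v. v \<bullet> e = 0 \<and> norm v \<le> \<rho>} \<psi>"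
    "\<And>y. y \<in> ball p \<rho> \<Longrightarrow> y \<in> \<Omega> \<longleftrightarrow> \<psi> (along e (y - p)) < (y - p) \<bullet> e"
    unfolding flat_at_def by auto
  define l where "l = max 0 (- (z \<bullet> e)) + \<eta> * norm z"
  have l: "l \<ge> 0" using \<open>\<eta> \<ge> 0\<close> by (simp add: l_def)
  have "emeasure lborel (U \<inter> crossing \<Omega> z) \<le> ennreal (unit_ball_vol (real (DIM('a) - 1)) * (d / 2) ^ (DIM('a) - 1)) * ennreal l"
  proof (rule emeasure_le_cylinder[OF e _ d(1)])
    show "U \<inter> crossing \<Omega> z \<in> sets borel" using U crossing_borel[OF \<open>open \<Omega>\<close>] by auto
    show "dist x y \<le> d" if "x \<in> U \<inter> crossing \<Omega> z" "y \<in> U \<inter> crossing \<Omega> z" for x y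
      using that d(2) by auto
    fix x
    define v where "v = along e (x - p)"
    define c where "c = \<psi> v - (x - p) \<bullet> e"
    have "{s. x + s *\<^sub>R e \<in> U \<inter> crossing \<Omega> z} \<subseteq> {c..c + l}"
    proof
      fix s assume "s \<in> {s. x + s *\<^sub>R e \<in> U \<inter> crossing \<Omega> z}"
      then have q: "x + s *\<^sub>R e \<in> ball p (\<rho> / 2)" "x + s *\<^sub>R e \<in> \<Omega>" "x + s *\<^sub>R e + z \<notin> \<Omega>"
        using U by (auto simp: crossing_def)
      have eqs: "x + s *\<^sub>R e - p = (x - p) + s *\<^sub>R e" "x + s *\<^sub>R e + z - p = ((x - p) + z) + s *\<^sub>R e" by simp_all
      have al: "along e (x + s *\<^sub>R e - p) = v" "along e (x + s *\<^sub>R e + z - p) = v + along e z"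
        unfolding eqs along_add along_scaleR_self[OF e] v_def by simp_all
      have inn: "(x + s *\<^sub>R e - p) \<bullet> e = (x - p) \<bullet> e + s" "(x + s *\<^sub>R e + z - p) \<bullet> e = (x - p) \<bullet> e + z \<bullet> e + s"
        unfolding eqs using e by (simp_all add: inner_add_left norm_eq_1)
      have n1: "norm (x + s *\<^sub>R e - p) < \<rho> / 2" using q(1) by (simp add: dist_norm norm_minus_commute)
      have "norm (x + s *\<^sub>R e + z - p) \<le> norm (x + s *\<^sub>R e - p) + norm z"
        using norm_triangle_ineq[of "x + s *\<^sub>R e - p" z] by (simp add: algebra_simps)
      then have n2: "norm (x + s *\<^sub>R e + z - p) < \<rho>" using n1 z by simp
      have n1': "norm (x + s *\<^sub>R e - p) < \<rho>" using n1 norm_ge_zero[of "x + s *\<^sub>R e - p"] by linarith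
      have in1: "x + s *\<^sub>R e \<in> ball p \<rho>" using n1' by (simp add: dist_norm norm_minus_commute[of p])
      have in2: "x + s *\<^sub>R e + z \<in> ball p \<rho>" using n2 by (simp add: dist_norm norm_minus_commute[of p])
      have low: "\<psi> v < (x - p) \<bullet> e + s" using \<psi>(2)[OF in1] q(2) al inn by simp
      have high: "(x - p) \<bullet> e + z \<bullet> e + s \<le> \<psi> (v + along e z)" using \<psi>(2)[OF in2] q(3) al inn by simp
      have nv: "norm v \<le> \<rho>" using norm_along_le[OF e, of "x + s *\<^sub>R e - p"] n1' unfolding al by linarith
      have nvz: "norm (v + along e z) \<le> \<rho>" using norm_along_le[OF e, of "x + s *\<^sub>R e + z - p"] n2 unfolding al by linarith
      have "dist (\<psi> (v + along e z)) (\<psi> v) \<le> \<eta> * dist (v + along e z) v"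
        using nv nvz e by (intro lipschitz_onD[OF \<psi>(1)]) (auto simp: v_def inner_add_left along_orthogonal)
      also have "\<dots> \<le> \<eta> * norm z" using norm_along_le[OF e, of z] \<open>\<eta> \<ge> 0\<close> by (simp add: dist_norm mult_left_mono)
      finally have "\<psi> (v + along e z) \<le> \<psi> v + \<eta> * norm z" by (simp add: dist_real_def)
      then show "s \<in> {c..c + l}" using low high by (auto simp: c_def l_def)
    qed
    from emeasure_mono[OF this, of lborel] show "emeasure lborel {s. x + s *\<^sub>R e \<in> U \<inter> crossing \<Omega> z} \<le> ennreal l"
      using l by simp
  qed
  then show ?thesis using l d(1) by (simp add: l_def[symmetric] ennreal_mult)
qed

text \<open>Over the shrunken shadow of radius \<open>(1 - \<eta>) * r\<close> the graph and the shifted graph both stay inside the ball of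
radius \<open>r\<close>, so the whole segment between them is counted. The bound on \<open>norm z\<close> is what the margin \<open>\<eta> * r\<close>
leaves after the slope has used \<open>\<eta> * (1 - \<eta>) * r\<close>.\<close>

lemma emeasure_crossing_ge:
  fixes \<Omega> :: "'a::euclidean_space set"
  assumes flat: "flat_at \<Omega> \<eta> \<rho> p e" and op: "open \<Omega>" and \<eta>: "0 < \<eta>" "\<eta> < 1" and r: "0 < r" "r \<le> \<rho> / 2"
    and z: "norm z < \<eta>\<^sup>2 * r / 2"
  shows "ennreal (unit_ball_vol (real (DIM('a) - 1)) * ((1 - \<eta>) * r) ^ (DIM('a) - 1) * max 0 (- (z \<bullet> e) - \<eta> * norm z))
     \<le> emeasure lborel (ball p r \<inter> crossing \<Omega> z)"
proof -
  from flat obtain \<psi> where e: "norm e = 1" and \<psi>: "\<eta>-lipschitz_on {v. v \<bullet> e = 0 \<and> norm v \<le> \<rho>} \<psi>"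
    "\<And>y. y \<in> ball p \<rho> \<Longrightarrow> y \<in> \<Omega> \<longleftrightarrow> \<psi> (along e (y - p)) < (y - p) \<bullet> e" "\<psi> 0 = 0"
    unfolding flat_at_def by auto
  let ?X = "ball p r \<inter> crossing \<Omega> z"
  have X[measurable]: "?X \<in> sets borel" using crossing_borel[OF op] by auto
  have "{x. p + x \<in> ?X} \<in> sets borel" by measurable
  have "\<eta>\<^sup>2 * r / 2 \<le> r / 2" using \<eta> r by (simp add: power_le_one)
  with z have zr: "norm z < \<rho> / 2" using r by linarith
  define r' where "r' = (1 - \<eta>) * r"
  have r': "r' > 0" "r' < r" using \<eta> r by (auto simp: r'_def)
  have "ennreal (unit_ball_vol (real (DIM('a) - 1)) * r' ^ (DIM('a) - 1)) * ennreal (max 0 (- (z \<bullet> e) - \<eta> * norm z))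
      \<le> emeasure lborel {x. p + x \<in> ?X}"
  proof (rule emeasure_ge_cylinder[OF e _ r'(1)])
    fix v assume v: "v \<bullet> e = 0" "norm v \<le> r'"
    define vz where "vz = v + along e z"
    have nv: "norm v \<le> \<rho>" using v r r' by linarith
    have nz: "norm (along e z) \<le> norm z" by (rule norm_along_le[OF e])
    have nvz: "norm vz \<le> \<rho>" using norm_triangle_ineq[of v "along e z"] nz zr v r r' by (simp add: vz_def)
    have vze: "vz \<bullet> e = 0" using v along_orthogonal[OF e, of z] by (simp add: vz_def inner_add_left)
    have "dist (\<psi> vz) (\<psi> v) \<le> \<eta> * dist vz v"
      using nv nvz v vze by (intro lipschitz_onD[OF \<psi>(1)]) auto
    also have "\<dots> \<le> \<eta> * norm z" using nz \<eta> by (simp add: vz_def dist_norm mult_left_mono)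
    finally have L: "\<bar>\<psi> vz - \<psi> v\<bar> \<le> \<eta> * norm z" by (simp add: dist_real_def)
    have "dist (\<psi> v) (\<psi> 0) \<le> \<eta> * dist v 0"
      using nv v r by (intro lipschitz_onD[OF \<psi>(1)]) auto
    then have "\<bar>\<psi> v\<bar> \<le> \<eta> * norm v" using \<psi>(3) by (simp add: dist_real_def)
    moreover have "\<eta> * norm v \<le> \<eta> * r'" using v \<eta> by (intro mult_left_mono) auto
    ultimately have L0: "\<bar>\<psi> v\<bar> \<le> \<eta> * r'" by linarith
    have "{\<psi> v <..\<psi> vz - z \<bullet> e} \<subseteq> {s. v + s *\<^sub>R e \<in> {x. p + x \<in> ?X}}"
    proof
      fix s assume s: "s \<in> {\<psi> v <..\<psi> vz - z \<bullet> e}"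
      have "norm z * \<eta> \<le> norm z * 1" using \<eta> by (intro mult_left_mono) auto
      then have "\<bar>s\<bar> \<le> \<eta> * r' + 2 * norm z" using s L L0 abs_inner_unit_le[OF e, of z] by (auto simp: mult.commute)
      then have "norm (v + s *\<^sub>R e) \<le> r' + (\<eta> * r' + 2 * norm z)"
        using norm_triangle_ineq[of v "s *\<^sub>R e"] v e by simp
      also have "\<dots> < r" using z by (simp add: r'_def algebra_simps power2_eq_square)
      finally have n1: "norm (v + s *\<^sub>R e) < r" .
      then have n2: "norm (v + s *\<^sub>R e + z) < \<rho>" using norm_triangle_ineq[of "v + s *\<^sub>R e" z] zr r by linarith
      have dp: "dist p (p + w) = norm w" for w by (simp add: dist_norm)
      have in1: "p + (v + s *\<^sub>R e) \<in> ball p \<rho>" unfolding mem_ball dp using n1 r by linarith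
      have in2: "p + (v + s *\<^sub>R e) + z \<in> ball p \<rho>" unfolding mem_ball add.assoc[of p] dp by (rule n2)
      have eq: "p + (v + s *\<^sub>R e) + z - p = v + z + s *\<^sub>R e" by simp
      have "p + (v + s *\<^sub>R e) \<in> \<Omega>"
        using \<psi>(2)[OF in1] s v e by (simp add: along_add along_scaleR_self along_fixed inner_add_left norm_eq_1)
      moreover have "p + (v + s *\<^sub>R e) + z \<notin> \<Omega>"
        using \<psi>(2)[OF in2] s v e unfolding eq by (simp add: along_add along_scaleR_self along_fixed inner_add_left norm_eq_1 vz_def)
      ultimately show "s \<in> {s. v + s *\<^sub>R e \<in> {x. p + x \<in> ?X}}"
        using n1 unfolding crossing_def mem_Collect_eq Int_iff mem_ball dp by blast
    qed
    then have "emeasure lborel {\<psi> v <..\<psi> vz - z \<bullet> e} \<le> emeasure lborel {s. v + s *\<^sub>R e \<in> {x. p + x \<in> ?X}}"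
      by (rule emeasure_mono) measurable
    moreover have "ennreal (max 0 (- (z \<bullet> e) - \<eta> * norm z)) \<le> emeasure lborel {\<psi> v <..\<psi> vz - z \<bullet> e}"
    proof (cases "\<psi> v \<le> \<psi> vz - z \<bullet> e")
      case True then show ?thesis using L by (auto intro!: ennreal_leI)
    next
      case False
      then have "- (z \<bullet> e) - \<eta> * norm z \<le> 0" using L by linarith
      then show ?thesis by simp
    qed
    ultimately show "ennreal (max 0 (- (z \<bullet> e) - \<eta> * norm z)) \<le> emeasure lborel {s. v + s *\<^sub>R e \<in> {x. p + x \<in> ?X}}"
      by (rule order_trans[rotated])
  qed measurable
  also have "emeasure lborel {x. p + x \<in> ?X} = emeasure (distr lborel borel ((+) p)) ?X"
    by (subst emeasure_distr) (auto simp: vimage_def)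
  also have "\<dots> = emeasure lborel ?X" by (simp add: lborel_distr_plus)
  finally show ?thesis using r' by (simp add: r'_def[symmetric] ennreal_mult)
qed

lemma flat_at_frontier:
  assumes flat: "flat_at \<Omega> \<eta> \<rho> p e" and op: "open \<Omega>" and \<eta>: "\<eta> \<ge> 0"
  obtains \<psi> where "\<And>y. y \<in> frontier \<Omega> \<inter> ball p \<rho> \<Longrightarrow> (y - p) \<bullet> e = \<psi> (along e (y - p))"
proof -
  from flat obtain \<psi> where e: "norm e = 1" and \<psi>: "\<eta>-lipschitz_on {v. v \<bullet> e = 0 \<and> norm v \<le> \<rho>} \<psi>"
    "\<And>y. y \<in> ball p \<rho> \<Longrightarrow> y \<in> \<Omega> \<longleftrightarrow> \<psi> (along e (y - p)) < (y - p) \<bullet> e" 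
    unfolding flat_at_def by auto
  have "(y - p) \<bullet> e = \<psi> (along e (y - p))" if y: "y \<in> frontier \<Omega> \<inter> ball p \<rho>" for y
  proof (rule ccontr)
    assume ne: "(y - p) \<bullet> e \<noteq> \<psi> (along e (y - p))"
    have "y \<notin> \<Omega>" using y op by (auto simp: frontier_def interior_open)
    then have "(y - p) \<bullet> e < \<psi> (along e (y - p))" using ne \<psi>(2)[of y] y by auto
    define g where "g = \<psi> (along e (y - p)) - (y - p) \<bullet> e"
    have g: "g > 0" using \<open>(y - p) \<bullet> e < \<psi> (along e (y - p))\<close> by (simp add: g_def)
    define \<delta> where "\<delta> = min (g / (1 + \<eta>)) (\<rho> - dist p y)"
    have \<delta>: "\<delta> > 0" using g \<eta> y by (auto simp: \<delta>_def)
    have "y \<in> closure \<Omega>" using y by (auto simp: frontier_def)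
    then obtain y' where y': "y' \<in> \<Omega>" "dist y' y < \<delta>" using \<delta> unfolding closure_approachable by auto
    have d: "dist p y' < \<rho>" using dist_triangle[of p y' y] y' by (auto simp: \<delta>_def dist_commute)
    then have gt: "\<psi> (along e (y' - p)) < (y' - p) \<bullet> e" using \<psi>(2)[of y'] y' by auto
    have "along e (y' - p) - along e (y - p) = along e (y' - y)"
      by (simp add: along_def inner_diff_left algebra_simps)
    then have dd: "dist (along e (y' - p)) (along e (y - p)) \<le> dist y' y"
      using norm_along_le[OF e, of "y' - y"] by (simp add: dist_norm)
    have "dist (\<psi> (along e (y' - p))) (\<psi> (along e (y - p))) \<le> \<eta> * dist (along e (y' - p)) (along e (y - p))"
      using norm_along_le[OF e, of "y' - p"] norm_along_le[OF e, of "y - p"] d y e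
      by (intro lipschitz_onD[OF \<psi>(1)]) (auto simp: along_orthogonal dist_norm norm_minus_commute)
    also have "\<dots> \<le> \<eta> * dist y' y" using dd \<eta> by (intro mult_left_mono) auto
    finally have "\<psi> (along e (y - p)) \<le> \<psi> (along e (y' - p)) + \<eta> * dist y' y" by (simp add: dist_real_def)
    moreover have "(y' - p) \<bullet> e \<le> (y - p) \<bullet> e + dist y' y"
      using abs_inner_unit_le[OF e, of "y' - y"] by (simp add: inner_diff_left dist_norm)
    ultimately have "g < (1 + \<eta>) * dist y' y" using gt by (simp add: g_def algebra_simps)
    also have "\<dots> \<le> (1 + \<eta>) * (g / (1 + \<eta>))" using y' \<eta> by (intro mult_left_mono) (auto simp: \<delta>_def)
    also have "\<dots> = g" using \<eta> by simp
    finally show False by simp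
  qed
  then show thesis by (rule that)
qed

text \<open>Locally the boundary lies on a graph, so every line in the normal direction meets it at most once.\<close>

lemma flat_frontier_null:
  fixes \<Omega> :: "'a::euclidean_space set"
  assumes flat: "flat_boundary \<Omega>" and bd: "bounded \<Omega>"
  shows "emeasure lborel (frontier \<Omega>) = 0"
proof -
  have op: "open \<Omega>" using flat by (simp add: flat_boundary_def)
  obtain \<rho> where \<rho>: "\<rho> > 0" "\<And>p. p \<in> frontier \<Omega> \<Longrightarrow> \<exists>e. flat_at \<Omega> 1 \<rho> p e"
    using flat unfolding flat_boundary_def by (meson zero_less_one)
  have null: "frontier \<Omega> \<inter> ball p \<rho> \<in> null_sets lborel" if p: "p \<in> frontier \<Omega>" for p
  proof -
    obtain e where e: "flat_at \<Omega> 1 \<rho> p e" using \<rho>(2)[OF p] by auto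
    then have ne: "norm e = 1" by (simp add: flat_at_def)
    obtain \<psi> where \<psi>: "\<And>y. y \<in> frontier \<Omega> \<inter> ball p \<rho> \<Longrightarrow> (y - p) \<bullet> e = \<psi> (along e (y - p))"
      using flat_at_frontier[OF e op] by auto
    have "emeasure lborel (frontier \<Omega> \<inter> ball p \<rho>) \<le> ennreal (unit_ball_vol (real (DIM('a) - 1)) * (2 * \<rho> / 2) ^ (DIM('a) - 1)) * 0"
    proof (rule emeasure_le_cylinder[OF ne])
      show "dist x y \<le> 2 * \<rho>" if "x \<in> frontier \<Omega> \<inter> ball p \<rho>" "y \<in> frontier \<Omega> \<inter> ball p \<rho>" for x y
        using that dist_triangle2[of x y p] by (auto simp: dist_commute)
      show "2 * \<rho> > 0" using \<rho> by simp
      show "frontier \<Omega> \<inter> ball p \<rho> \<in> sets borel" by (simp add: borel_closed)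
      fix x
      have "{s. x + s *\<^sub>R e \<in> frontier \<Omega> \<inter> ball p \<rho>} \<subseteq> {\<psi> (along e (x - p)) - (x - p) \<bullet> e}"
      proof
        fix s assume "s \<in> {s. x + s *\<^sub>R e \<in> frontier \<Omega> \<inter> ball p \<rho>}"
        then have *: "(x + s *\<^sub>R e - p) \<bullet> e = \<psi> (along e (x + s *\<^sub>R e - p))" using \<psi> by blast
        have eq: "x + s *\<^sub>R e - p = (x - p) + s *\<^sub>R e" by simp
        show "s \<in> {\<psi> (along e (x - p)) - (x - p) \<bullet> e}"
          using * ne unfolding eq along_add by (simp add: along_scaleR_self inner_add_left norm_eq_1)
      qed
      from emeasure_mono[OF this, of lborel] show "emeasure lborel {s. x + s *\<^sub>R e \<in> frontier \<Omega> \<inter> ball p \<rho>} \<le> 0"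
        by simp
    qed
    then show ?thesis by (auto simp: null_sets_def)
  qed
  have comp: "compact (frontier \<Omega>)" using bd by (simp add: compact_frontier_bounded)
  have "frontier \<Omega> \<subseteq> (\<Union>p\<in>frontier \<Omega>. ball p \<rho>)" using \<rho> by auto
  from compactE_image[OF comp _ this] obtain F where F: "F \<subseteq> frontier \<Omega>" "finite F" "frontier \<Omega> \<subseteq> (\<Union>p\<in>F. ball p \<rho>)" 
    by (metis open_ball)
  have "(\<Union>p\<in>F. frontier \<Omega> \<inter> ball p \<rho>) \<in> null_sets lborel" using F null by (intro null_sets.finite_UN) auto
  moreover have "(\<Union>p\<in>F. frontier \<Omega> \<inter> ball p \<rho>) = frontier \<Omega>" using F by auto
  ultimately show ?thesis by auto
qed

text \<open>The gradient of the chart vanishes at the base point and is \<open>\<Lambda>\<close>-Lipschitz, so it is at most \<open>\<eta>\<close> within distance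
\<open>\<eta> / \<Lambda>\<close>.\<close>

lemma C11_imp_flat:
  fixes \<Omega> :: "'a::euclidean_space set"
  assumes "C11_open_set \<Omega>" shows "flat_boundary \<Omega>"
  unfolding flat_boundary_def
proof (intro conjI allI impI)
  show "open \<Omega>" using assms by (simp add: C11_open_set_def)
  fix \<eta> :: real assume \<eta>: "\<eta> > 0"
  from assms obtain R \<Lambda> where R: "R > 0" "\<Lambda> > 0" and ch: "\<forall>z\<in>frontier \<Omega>. \<exists>(e::'a) (\<psi>::'a \<Rightarrow> real) (g::'a \<Rightarrow> 'a).
        norm e = 1 \<and> \<psi> 0 = 0 \<and> g 0 = 0 \<and>
          (\<forall>v\<in>{v. v \<bullet> e = 0}. g v \<in> {v. v \<bullet> e = 0} \<and> (\<psi> has_derivative (\<lambda>h. g v \<bullet> h)) (at v within {v. v \<bullet> e = 0}) \<and> norm (g v) \<le> \<Lambda>) \<and>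
          \<Lambda>-lipschitz_on {v. v \<bullet> e = 0} g \<and>
          ball z R \<inter> \<Omega> = {y \<in> ball z R. (y - z) \<bullet> e > \<psi> ((y - z) - ((y - z) \<bullet> e) *\<^sub>R e)}"
    unfolding C11_open_set_def Let_def by (elim conjE exE) (rule that)
  define \<rho> where "\<rho> = min R (\<eta> / \<Lambda>)"
  have \<rho>: "\<rho> > 0" "\<rho> \<le> R" "\<Lambda> * \<rho> \<le> \<eta>" using R \<eta> by (auto simp: \<rho>_def min_def field_simps)
  show "\<exists>\<rho>>0. \<forall>p\<in>frontier \<Omega>. \<exists>e. flat_at \<Omega> \<eta> \<rho> p e"
  proof (intro exI[of _ \<rho>] conjI ballI \<rho>(1))
    fix p assume "p \<in> frontier \<Omega>"
    from bspec[OF ch this] obtain e \<psi> g where e: "norm (e::'a) = 1" and z: "\<psi> 0 = (0::real)" "g 0 = (0::'a)"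
      and der: "\<And>v. v \<bullet> e = 0 \<Longrightarrow> (\<psi> has_derivative (\<lambda>h. g v \<bullet> h)) (at v within {v. v \<bullet> e = 0})"
      and lip: "\<Lambda>-lipschitz_on {v. v \<bullet> e = 0} g"
      and gr: "ball p R \<inter> \<Omega> = {y \<in> ball p R. (y - p) \<bullet> e > \<psi> ((y - p) - ((y - p) \<bullet> e) *\<^sub>R e)}"
      by auto
    let ?S = "{v. v \<bullet> e = 0 \<and> norm v \<le> \<rho>}"
    have conv: "convex ?S"
    proof -
      have "?S = {v. e \<bullet> v = 0} \<inter> cball 0 \<rho>" by (auto simp: inner_commute)
      then show ?thesis by (simp add: convex_Int convex_hyperplane)
    qed
    have "\<eta>-lipschitz_on ?S \<psi>"
    proof (rule lipschitz_onI)
      fix x y assume xy: "x \<in> ?S" "y \<in> ?S"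
      have "norm (\<psi> x - \<psi> y) \<le> \<eta> * norm (x - y)"
      proof (rule differentiable_bound[OF conv _ _ xy])
        fix v assume v: "v \<in> ?S"
        show "(\<psi> has_derivative (\<lambda>h. g v \<bullet> h)) (at v within ?S)"
          using v by (intro has_derivative_subset[OF der]) auto
        have "dist (g v) (g 0) \<le> \<Lambda> * dist v 0" using v by (intro lipschitz_onD[OF lip]) auto
        then have "norm (g v) \<le> \<Lambda> * norm v" using z by simp
        also have "\<dots> \<le> \<Lambda> * \<rho>" using v R by (intro mult_left_mono) auto
        finally have gv: "norm (g v) \<le> \<eta>" using \<rho> by simp
        show "onorm (\<lambda>h. g v \<bullet> h) \<le> \<eta>"
        proof (rule onorm_le)
          fix h
          have "norm (g v \<bullet> h) \<le> norm (g v) * norm h" using Cauchy_Schwarz_ineq2[of "g v" h] by simp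
          also have "\<dots> \<le> \<eta> * norm h" using gv by (intro mult_right_mono) auto
          finally show "norm (g v \<bullet> h) \<le> \<eta> * norm h" .
        qed
      qed
      then show "dist (\<psi> x) (\<psi> y) \<le> \<eta> * dist x y" by (simp add: dist_norm)
    qed (use \<eta> in simp)
    moreover have "y \<in> \<Omega> \<longleftrightarrow> \<psi> (along e (y - p)) < (y - p) \<bullet> e" if "y \<in> ball p \<rho>" for y
    proof -
      have "y \<in> ball p R" using that \<rho> by auto
      then show ?thesis using gr unfolding along_def by blast
    qed
    ultimately show "\<exists>e. flat_at \<Omega> \<eta> \<rho> p e" unfolding flat_at_def using e z by blast
  qed
qed

section \<open>Heat loss and Hausdorff measure\<close>

definition hausdorff_content :: "nat \<Rightarrow> real \<Rightarrow> 'a::euclidean_space set \<Rightarrow> ennreal" where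
  "hausdorff_content k \<delta> A = (INF U \<in> {U :: nat \<Rightarrow> 'a set. A \<subseteq> (\<Union>i. U i) \<and> (\<forall>i. bounded (U i) \<and> diameter (U i) \<le> \<delta>)}.
        (\<Sum>i. if U i = {} then 0 else ennreal (unit_ball_vol (real k) * (diameter (U i) / 2) ^ k)))"

lemma hausdorff_measure_eq_SUP: "hausdorff_measure k A = (SUP \<delta>\<in>{0<..}. hausdorff_content k \<delta> A)"
  unfolding hausdorff_measure_def hausdorff_content_def ..

lemma crossing_meets_frontier:
  assumes "x \<in> crossing \<Omega> z" obtains y where "y \<in> frontier \<Omega>" "dist x y \<le> norm z"
proof -
  have c: "connected (closed_segment x (x + z))" by simp
  have "closed_segment x (x + z) \<inter> frontier \<Omega> \<noteq> {}"
    using assms by (intro connected_Int_frontier[OF c]) (auto simp: crossing_def)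
  then obtain y where y: "y \<in> closed_segment x (x + z)" "y \<in> frontier \<Omega>" by auto
  have "dist x y \<le> dist x (x + z)" using y(1) by (metis dist_in_closed_segment dist_commute)
  then show thesis using that[OF y(2)] by (simp add: dist_norm)
qed

text \<open>The properties of the Gaussian increments that govern the loss: the mean of the negative part of every
one-dimensional projection, and second moments of order \<open>u\<close>, which make large increments negligible.\<close>

locale heat_family =
  fixes \<mu> :: "real \<Rightarrow> 'a::euclidean_space measure" and C :: real
  assumes prob: "u > 0 \<Longrightarrow> prob_space (\<mu> u)" and sets_\<mu>: "u > 0 \<Longrightarrow> sets (\<mu> u) = sets borel"
    and pos_part: "u > 0 \<Longrightarrow> norm e = 1 \<Longrightarrow> has_bochner_integral (\<mu> u) (\<lambda>z. max 0 (- (z \<bullet> e))) (sqrt (u / pi))"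
    and second_moment: "u > 0 \<Longrightarrow> integrable (\<mu> u) (\<lambda>z. (norm z)\<^sup>2)" "u > 0 \<Longrightarrow> (\<integral>z. (norm z)\<^sup>2 \<partial>\<mu> u) \<le> C * u"
begin

definition heat_loss :: "'a set \<Rightarrow> real \<Rightarrow> ennreal" where
  "heat_loss \<Omega> u = (\<integral>\<^sup>+z. emeasure lborel (crossing \<Omega> z) \<partial>\<mu> u)"

lemma C_nonneg: "C \<ge> 0"
proof -
  have "0 \<le> (\<integral>z. (norm z)\<^sup>2 \<partial>\<mu> 1)" by simp
  also have "\<dots> \<le> C * 1" by (rule second_moment) simp
  finally show ?thesis by simp
qed

lemma first_moment:
  assumes u: "u > 0"
  shows "integrable (\<mu> u) norm" "(\<integral>z. norm z \<partial>\<mu> u) \<le> (C + 1) * sqrt u"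
proof -
  interpret prob_space "\<mu> u" by (rule prob[OF u])
  note [measurable_cong] = sets_\<mu>[OF u]
  let ?g = "\<lambda>z::'a. (norm z)\<^sup>2 / sqrt u + sqrt u"
  have i: "integrable (\<mu> u) ?g" using second_moment(1)[OF u] by simp
  have b: "norm z \<le> ?g z" for z :: 'a
  proof -
    have "0 \<le> (norm z - sqrt u)\<^sup>2 + norm z * sqrt u" using u by simp
    then have "norm z * sqrt u \<le> (norm z)\<^sup>2 + u" using u by (simp add: power2_diff mult.commute)
    then have "norm z * sqrt u / sqrt u \<le> ((norm z)\<^sup>2 + u) / sqrt u" using u by (intro divide_right_mono) auto
    also have "((norm z)\<^sup>2 + u) / sqrt u = ?g z" using u by (simp add: add_divide_distrib real_div_sqrt)
    finally show ?thesis using u by simp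
  qed
  show 1: "integrable (\<mu> u) norm"
    by (rule Bochner_Integration.integrable_bound[OF i]) (use b u in auto)
  have "(\<integral>z. norm z \<partial>\<mu> u) \<le> (\<integral>z. ?g z \<partial>\<mu> u)" by (intro integral_mono 1 i b)
  also have "\<dots> = (\<integral>z. (norm z)\<^sup>2 \<partial>\<mu> u) / sqrt u + sqrt u"
    using second_moment(1)[OF u] by (simp add: prob_space)
  also have "\<dots> \<le> (C * u) / sqrt u + sqrt u"
    using second_moment(2)[OF u] u by (intro add_mono divide_right_mono) auto
  also have "\<dots> = (C + 1) * sqrt u" using u by (simp add: real_div_sqrt algebra_simps flip: times_divide_eq_right)
  finally show "(\<integral>z. norm z \<partial>\<mu> u) \<le> (C + 1) * sqrt u" .
qed

text \<open>Take a covering of the boundary by sets of diameter below \<open>\<rho> / 4\<close> with total weight below \<open>L\<close>, enlarge its members to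
open sets at arbitrarily small cost and choose a finite subcovering by compactness. It covers a neighbourhood of the
boundary, so for small increments every crossing point is in some member and the cylinder estimate applies to each
member. Increments that are not small contribute at most the volume of \<open>\<Omega>\<close> times a probability of order \<open>u\<close>.\<close>

lemma heat_loss_le_content:
  fixes \<Omega> :: "'a set"
  assumes flat: "flat_boundary \<Omega>" and bd: "bounded \<Omega>" and \<eta>: "\<eta> > 0"
  obtains \<delta> where "\<delta> > 0" "\<And>L. L \<ge> 0 \<Longrightarrow> hausdorff_content (DIM('a) - 1) \<delta> (frontier \<Omega>) < ennreal L \<Longrightarrow>
     \<forall>\<^sub>F u in at_right 0. heat_loss \<Omega> u \<le> ennreal ((L * (1 / sqrt pi + \<eta>) + \<eta>) * sqrt u)"
proof -
  have op: "open \<Omega>" using flat by (simp add: flat_boundary_def)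
  define k where "k = DIM('a) - 1"
  define \<eta>' where "\<eta>' = \<eta> / (C + 1)"
  have \<eta>': "\<eta>' > 0" using \<eta> C_nonneg by (simp add: \<eta>'_def)
  obtain \<rho> where \<rho>: "\<rho> > 0" "\<And>p. p \<in> frontier \<Omega> \<Longrightarrow> \<exists>e. flat_at \<Omega> \<eta>' \<rho> p e"
    using flat \<eta>' unfolding flat_boundary_def by meson
  show thesis
  proof (rule that[of "\<rho> / 4"])
    show "\<rho> / 4 > 0" using \<rho> by simp
    fix L :: real assume L: "L \<ge> 0" and hc: "hausdorff_content (DIM('a) - 1) (\<rho> / 4) (frontier \<Omega>) < ennreal L"
    have comp: "compact (frontier \<Omega>)" using bd by (simp add: compact_frontier_bounded)
    define hterm where "hterm U = (if U = {} then 0 else unit_ball_vol (real k) * (diameter U / 2) ^ k)" for U :: "'a set"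
    have hterm0: "hterm U \<ge> 0" if "bounded U" for U using diameter_ge_0[OF that] by (auto simp: hterm_def)
    obtain U :: "nat \<Rightarrow> 'a set" where U: "frontier \<Omega> \<subseteq> (\<Union>i. U i)" "\<And>i. bounded (U i)" "\<And>i. diameter (U i) \<le> \<rho> / 4"
      and sumU: "(\<Sum>i. ennreal (hterm (U i))) < ennreal L"
      using hc unfolding hausdorff_content_def INF_less_iff
      by (auto simp: hterm_def k_def if_distrib[where f=ennreal] cong: if_cong)
    have sm: "summable (\<lambda>i. hterm (U i))"
      by (rule summable_suminf_not_top[OF hterm0[OF U(2)]])
         (use less_trans[OF sumU ennreal_less_top] in simp)
    have s0: "suminf (\<lambda>i. hterm (U i)) < L"
      using sumU suminf_nonneg[OF sm hterm0[OF U(2)]]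
      unfolding suminf_ennreal_eq[OF hterm0[OF U(2)] summable_sums[OF sm]]
      by (subst (asm) ennreal_less_iff)
    define s where "s = L - suminf (\<lambda>i. hterm (U i))"
    have s: "s > 0" using s0 by (simp add: s_def)
    \<comment> \<open>The gap \<open>s\<close> between the total weight and \<open>L\<close> is distributed geometrically over the enlargements.\<close>
    have "\<exists>\<epsilon>>0. \<epsilon> < \<rho> / 16 \<and> unit_ball_vol (real k) * ((diameter (U i) + 2 * \<epsilon>) / 2) ^ k \<le> unit_ball_vol (real k) * (diameter (U i) / 2) ^ k + s * (1/2) ^ Suc i" for i
    proof -
      have "((\<lambda>\<epsilon>. unit_ball_vol (real k) * ((diameter (U i) + 2 * \<epsilon>) / 2) ^ k) \<longlongrightarrow> unit_ball_vol (real k) * ((diameter (U i) + 2 * 0) / 2) ^ k) (at_right 0)"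
        by (intro tendsto_intros) simp_all
      then have "\<forall>\<^sub>F \<epsilon> in at_right 0. unit_ball_vol (real k) * ((diameter (U i) + 2 * \<epsilon>) / 2) ^ k < unit_ball_vol (real k) * (diameter (U i) / 2) ^ k + s * (1/2) ^ Suc i"
        by (rule order_tendstoD(2)) (use s in simp)
      moreover have "\<forall>\<^sub>F \<epsilon> in at_right 0. 0 < \<epsilon> \<and> \<epsilon> < \<rho> / 16"
        using \<rho> by (intro eventually_at_right_less eventually_conj order_tendstoD(2)[OF tendsto_ident_at]) auto
      ultimately have "\<forall>\<^sub>F \<epsilon> in at_right 0. 0 < \<epsilon> \<and> \<epsilon> < \<rho> / 16 \<and> unit_ball_vol (real k) * ((diameter (U i) + 2 * \<epsilon>) / 2) ^ k < unit_ball_vol (real k) * (diameter (U i) / 2) ^ k + s * (1/2) ^ Suc i"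
        by eventually_elim auto
      from eventually_happens'[OF _ this] show ?thesis by (auto intro: less_imp_le)
    qed
    then obtain \<epsilon> where \<epsilon>: "\<And>i. \<epsilon> i > 0" "\<And>i. \<epsilon> i < \<rho> / 16"
      "\<And>i. unit_ball_vol (real k) * ((diameter (U i) + 2 * \<epsilon> i) / 2) ^ k \<le> unit_ball_vol (real k) * (diameter (U i) / 2) ^ k + s * (1/2) ^ Suc i"
      by metis
    define V where "V i = (\<Union>x\<in>U i. ball x (\<epsilon> i))" for i
    define d where "d i = diameter (U i) + 2 * \<epsilon> i" for i
    define c where "c i = unit_ball_vol (real k) * (d i / 2) ^ k" for i
    have d0: "d i > 0" for i using \<epsilon>(1)[of i] diameter_ge_0[OF U(2)[of i]] by (simp add: d_def)
    have c0: "c i \<ge> 0" for i using d0[of i] by (simp add: c_def)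
    have Vop: "open (V i)" for i by (auto simp: V_def)
    have Vd: "dist x y \<le> d i" if V: "x \<in> V i" "y \<in> V i" for x y i
    proof -
      obtain x' y' where xy: "x' \<in> U i" "dist x' x < \<epsilon> i" "y' \<in> U i" "dist y' y < \<epsilon> i"
        using V unfolding V_def UN_iff mem_ball by blast
      have "dist x y \<le> dist x x' + dist x' y' + dist y' y" by (metis add_mono_thms_linordered_semiring(3) dist_triangle order_trans)
      also have "dist x' y' \<le> diameter (U i)" using diameter_bounded_bound[OF U(2) xy(1,3)] .
      finally show ?thesis using xy by (simp add: d_def dist_commute)
    qed
    define J where "J = {i. U i \<inter> frontier \<Omega> \<noteq> {}}"
    have cover: "frontier \<Omega> \<subseteq> (\<Union>i\<in>J. V i)"
    proof
      fix y assume y: "y \<in> frontier \<Omega>"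
      then obtain i where "y \<in> U i" using U(1) by auto
      then show "y \<in> (\<Union>i\<in>J. V i)" using y \<epsilon>(1)[of i] by (auto simp: J_def V_def intro!: exI[of _ i] bexI[of _ y])
    qed
    obtain F where F: "F \<subseteq> J" "finite F" "frontier \<Omega> \<subseteq> (\<Union>i\<in>F. V i)"
      using compactE_image[OF comp, of J V] Vop cover by metis
    have "\<exists>p e. p \<in> U i \<inter> frontier \<Omega> \<and> flat_at \<Omega> \<eta>' \<rho> p e" if "i \<in> F" for i
      using that F(1) \<rho>(2) unfolding J_def by blast
    then obtain p e where pe: "\<And>i. i \<in> F \<Longrightarrow> p i \<in> U i \<inter> frontier \<Omega>" "\<And>i. i \<in> F \<Longrightarrow> flat_at \<Omega> \<eta>' \<rho> (p i) (e i)"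
      by metis
    have e1: "norm (e i) = 1" if "i \<in> F" for i using pe(2)[OF that] by (simp add: flat_at_def)
    have Vball: "V i \<subseteq> ball (p i) (\<rho> / 2)" if "i \<in> F" for i
    proof
      fix x assume x: "x \<in> V i"
      have "p i \<in> V i" using pe(1)[OF that] \<epsilon>(1)[of i] by (auto simp: V_def intro!: bexI[of _ "p i"])
      from Vd[OF this x] have "dist (p i) x \<le> \<rho> / 4 + 2 * \<epsilon> i" using U(3)[of i] by (simp add: d_def)
      then show "x \<in> ball (p i) (\<rho> / 2)" using \<epsilon>(2)[of i] \<rho> by simp
    qed
    obtain \<kappa>0 where \<kappa>0: "\<kappa>0 > 0" "\<And>y. y \<in> frontier \<Omega> \<Longrightarrow> ball y \<kappa>0 \<subseteq> (\<Union>i\<in>F. V i)"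
    proof (cases "frontier \<Omega> = {}")
      case False
      from compact_subset_open_imp_ball_epsilon_subset[OF comp _ F(3)] Vop
      obtain \<kappa>0 where "\<kappa>0 > 0" "(\<Union>y\<in>frontier \<Omega>. ball y \<kappa>0) \<subseteq> (\<Union>i\<in>F. V i)" by blast
      then show thesis by (intro that[of \<kappa>0]) auto
    qed (use that[of 1] in auto)
    define \<kappa> where "\<kappa> = min \<kappa>0 (\<rho> / 2)"
    have \<kappa>: "\<kappa> > 0" using \<kappa>0 \<rho> by (simp add: \<kappa>_def)
    define A where "A = measure lborel \<Omega>"
    have Afin: "emeasure lborel \<Omega> = ennreal A"
      using emeasure_bounded_finite[OF bd] by (auto simp: A_def emeasure_eq_ennreal_measure)
    have A0: "A \<ge> 0" by (simp add: A_def)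
    \<comment> \<open>The last summand is at least the volume of \<open>\<Omega>\<close> as soon as \<open>norm z \<ge> \<kappa>\<close>.\<close>
    have bound: "emeasure lborel (crossing \<Omega> z) \<le> ennreal ((\<Sum>i\<in>F. c i * (max 0 (- (z \<bullet> e i)) + \<eta>' * norm z)) + A / \<kappa>\<^sup>2 * (norm z)\<^sup>2)" for z
    proof (cases "norm z < \<kappa>")
      case True
      have "crossing \<Omega> z \<subseteq> (\<Union>i\<in>F. V i \<inter> crossing \<Omega> z)"
      proof
        fix x assume x: "x \<in> crossing \<Omega> z"
        then obtain y where "y \<in> frontier \<Omega>" "dist x y \<le> norm z" by (rule crossing_meets_frontier)
        then have "x \<in> ball y \<kappa>0" using True by (simp add: \<kappa>_def dist_commute)
        then show "x \<in> (\<Union>i\<in>F. V i \<inter> crossing \<Omega> z)" using x \<kappa>0(2)[OF \<open>y \<in> frontier \<Omega>\<close>] by blast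
      qed
      then have "emeasure lborel (crossing \<Omega> z) \<le> emeasure lborel (\<Union>i\<in>F. V i \<inter> crossing \<Omega> z)"
        using crossing_borel[OF op, of z] Vop F(2) by (intro emeasure_mono) auto
      also have "\<dots> \<le> (\<Sum>i\<in>F. emeasure lborel (V i \<inter> crossing \<Omega> z))"
        using crossing_borel[OF op, of z] Vop F(2) by (intro emeasure_subadditive_finite) auto
      also have "\<dots> \<le> (\<Sum>i\<in>F. ennreal (c i * (max 0 (- (z \<bullet> e i)) + \<eta>' * norm z)))"
      proof (intro sum_mono)
        fix i assume i: "i \<in> F"
        show "emeasure lborel (V i \<inter> crossing \<Omega> z) \<le> ennreal (c i * (max 0 (- (z \<bullet> e i)) + \<eta>' * norm z))"
          unfolding c_def k_def
        proof (rule emeasure_crossing_le[OF pe(2)[OF i] op])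
          show "V i \<in> sets borel" using Vop[of i] by simp
        qed (use \<eta>' Vball[OF i] d0[of i] Vd[of _ i] True in \<open>auto simp: \<kappa>_def\<close>)
      qed
      also have "\<dots> = ennreal (\<Sum>i\<in>F. c i * (max 0 (- (z \<bullet> e i)) + \<eta>' * norm z))"
        using c0 \<eta>' by (intro sum_ennreal) auto
      also have "\<dots> \<le> ennreal ((\<Sum>i\<in>F. c i * (max 0 (- (z \<bullet> e i)) + \<eta>' * norm z)) + A / \<kappa>\<^sup>2 * (norm z)\<^sup>2)"
        using A0 by (intro ennreal_leI) auto
      finally show ?thesis .
    next
      case False
      have "emeasure lborel (crossing \<Omega> z) \<le> emeasure lborel \<Omega>"
        using op by (intro emeasure_mono) (auto simp: crossing_def)
      also have "\<dots> = ennreal (A * 1)" by (simp add: Afin)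
      also have "\<dots> \<le> ennreal (A * ((norm z)\<^sup>2 / \<kappa>\<^sup>2))"
        using False \<kappa> A0 by (intro ennreal_leI mult_left_mono) (auto simp: divide_simps power_mono)
      also have "\<dots> \<le> ennreal ((\<Sum>i\<in>F. c i * (max 0 (- (z \<bullet> e i)) + \<eta>' * norm z)) + A / \<kappa>\<^sup>2 * (norm z)\<^sup>2)"
        using c0 \<eta>' by (intro ennreal_leI) (auto intro!: sum_nonneg mult_nonneg_nonneg add_nonneg_nonneg)
      finally show ?thesis .
    qed
    have sumc: "(\<Sum>i\<in>F. c i) \<le> L"
    proof -
      have "(\<Sum>i\<in>F. c i) \<le> (\<Sum>i\<in>F. hterm (U i) + s * (1/2) ^ Suc i)"
      proof (intro sum_mono)
        fix i assume "i \<in> F"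
        then have "U i \<noteq> {}" using pe(1) by auto
        then show "c i \<le> hterm (U i) + s * (1/2) ^ Suc i" using \<epsilon>(3)[of i] by (simp add: c_def d_def hterm_def)
      qed
      also have "\<dots> = (\<Sum>i\<in>F. hterm (U i)) + (\<Sum>i\<in>F. s * (1/2) ^ Suc i)" by (simp add: sum.distrib)
      also have "(\<Sum>i\<in>F. hterm (U i)) \<le> suminf (\<lambda>i. hterm (U i))"
        using hterm0 U(2) by (intro sum_le_suminf sm F(2)) auto
      also have "(\<Sum>i\<in>F. s * (1/2) ^ Suc i) \<le> suminf (\<lambda>i. s * (1/2) ^ Suc i)"
        using s power_half_series by (intro sum_le_suminf F(2) summable_mult) (auto simp: sums_iff)
      also have "suminf (\<lambda>i. s * (1/2) ^ Suc i) = s"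
        using sums_mult[OF power_half_series, of s] by (simp add: sums_iff)
      finally show ?thesis by (simp add: s_def)
    qed
    have est: "heat_loss \<Omega> u \<le> ennreal (L * (1 / sqrt pi + \<eta>) * sqrt u + A / \<kappa>\<^sup>2 * (C * u))" if u: "u > 0" for u
    proof -
      interpret prob_space "\<mu> u" by (rule prob[OF u])
      note [measurable_cong] = sets_\<mu>[OF u]
      let ?g = "\<lambda>z. (\<Sum>i\<in>F. c i * (max 0 (- (z \<bullet> e i)) + \<eta>' * norm z)) + A / \<kappa>\<^sup>2 * (norm z)\<^sup>2"
      have pp: "integrable (\<mu> u) (\<lambda>z. max 0 (- (z \<bullet> e i)))" "(\<integral>z. max 0 (- (z \<bullet> e i)) \<partial>\<mu> u) = sqrt u / sqrt pi" if "i \<in> F" for i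
        using pos_part[OF u e1[OF that]] by (auto simp: has_bochner_integral_iff real_sqrt_divide)
      have i1: "integrable (\<mu> u) (\<lambda>z. c i * (max 0 (- (z \<bullet> e i)) + \<eta>' * norm z))" if "i \<in> F" for i
        using pp[OF that] first_moment(1)[OF u] by auto
      have i2: "integrable (\<mu> u) ?g"
        using i1 second_moment(1)[OF u] by auto
      have "heat_loss \<Omega> u \<le> (\<integral>\<^sup>+z. ennreal (?g z) \<partial>\<mu> u)"
        unfolding heat_loss_def by (intro nn_integral_mono bound)
      also have "\<dots> = ennreal (\<integral>z. ?g z \<partial>\<mu> u)"
        using c0 \<eta>' A0 by (intro nn_integral_eq_integral i2 AE_I2) (auto intro!: sum_nonneg mult_nonneg_nonneg add_nonneg_nonneg)
      also have "(\<integral>z. ?g z \<partial>\<mu> u) = (\<Sum>i\<in>F. c i * (sqrt u / sqrt pi + \<eta>' * (\<integral>z. norm z \<partial>\<mu> u))) + A / \<kappa>\<^sup>2 * (\<integral>z. (norm z)\<^sup>2 \<partial>\<mu> u)"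
        using i1 second_moment(1)[OF u] pp first_moment(1)[OF u]
        by (subst Bochner_Integration.integral_add) (auto simp: Bochner_Integration.integral_sum)
      also have "\<dots> \<le> (\<Sum>i\<in>F. c i * (sqrt u / sqrt pi + \<eta>' * ((C + 1) * sqrt u))) + A / \<kappa>\<^sup>2 * (C * u)"
        using c0 A0 \<eta>' first_moment(2)[OF u] second_moment(2)[OF u]
        by (intro add_mono sum_mono mult_left_mono) auto
      also have "(\<Sum>i\<in>F. c i * (sqrt u / sqrt pi + \<eta>' * ((C + 1) * sqrt u))) = (\<Sum>i\<in>F. c i) * ((1 / sqrt pi + \<eta>) * sqrt u)"
      proof -
        have "\<eta>' * ((C + 1) * sqrt u) = \<eta> * sqrt u" using C_nonneg by (simp add: \<eta>'_def)
        then have "sqrt u / sqrt pi + \<eta>' * ((C + 1) * sqrt u) = (1 / sqrt pi + \<eta>) * sqrt u" by (simp add: algebra_simps)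
        then show ?thesis by (simp only: sum_distrib_right)
      qed
      also have "\<dots> \<le> L * ((1 / sqrt pi + \<eta>) * sqrt u)"
        using sumc \<eta> u by (intro mult_right_mono) auto
      finally show ?thesis by (simp add: mult.assoc ennreal_leI)
    qed
    have "((\<lambda>u. A / \<kappa>\<^sup>2 * C * sqrt u) \<longlongrightarrow> A / \<kappa>\<^sup>2 * C * sqrt 0) (at_right 0)"
      by (intro tendsto_intros)
    then have "\<forall>\<^sub>F u in at_right 0. A / \<kappa>\<^sup>2 * C * sqrt u < \<eta>"
      by (rule order_tendstoD(2)) (use \<eta> in simp)
    then show "\<forall>\<^sub>F u in at_right 0. heat_loss \<Omega> u \<le> ennreal ((L * (1 / sqrt pi + \<eta>) + \<eta>) * sqrt u)"
      using eventually_at_right_less[of 0]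
    proof eventually_elim
      fix u :: real assume u: "A / \<kappa>\<^sup>2 * C * sqrt u < \<eta>" "0 < u"
      have "A / \<kappa>\<^sup>2 * (C * u) = (A / \<kappa>\<^sup>2 * C * sqrt u) * sqrt u" using u(2) by simp
      also have "\<dots> \<le> \<eta> * sqrt u" using u by (intro mult_right_mono) auto
      finally have "L * (1 / sqrt pi + \<eta>) * sqrt u + A / \<kappa>\<^sup>2 * (C * u) \<le> (L * (1 / sqrt pi + \<eta>) + \<eta>) * sqrt u"
        by (simp add: algebra_simps)
      then show "heat_loss \<Omega> u \<le> ennreal ((L * (1 / sqrt pi + \<eta>) + \<eta>) * sqrt u)"
        using est[OF u(2)] by (meson ennreal_leI order_trans)
    qed
  qed
qed

lemma hausdorff_content_finite:
  fixes K :: "'a set"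
  assumes "compact K" "\<delta> > 0" shows "hausdorff_content k \<delta> K < \<infinity>"
proof -
  have "K \<subseteq> (\<Union>x\<in>K. ball x (\<delta> / 2))" using assms by auto
  from compactE_image[OF assms(1) _ this] obtain F where F: "F \<subseteq> K" "finite F" "K \<subseteq> (\<Union>x\<in>F. ball x (\<delta> / 2))" 
    by (metis open_ball)
  obtain xs where xs: "set xs = F" using finite_list[OF F(2)] by auto
  define U where "U i = (if i < length xs then ball (xs ! i) (\<delta> / 2) else {})" for i
  have "K \<subseteq> (\<Union>i. U i)"
  proof
    fix x assume "x \<in> K"
    then obtain y where "y \<in> F" "x \<in> ball y (\<delta> / 2)" using F by auto
    moreover then obtain i where "i < length xs" "xs ! i = y" using xs by (metis in_set_conv_nth)
    ultimately show "x \<in> (\<Union>i. U i)" by (auto simp: U_def intro!: exI[of _ i])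
  qed
  moreover have "bounded (U i) \<and> diameter (U i) \<le> \<delta>" for i
    using assms by (auto simp: U_def diameter_ball)
  ultimately have "hausdorff_content k \<delta> K \<le> (\<Sum>i. if U i = {} then 0 else ennreal (unit_ball_vol (real k) * (diameter (U i) / 2) ^ k))"
    unfolding hausdorff_content_def by (intro INF_lower) auto
  also have "\<dots> = (\<Sum>i<length xs. if U i = {} then 0 else ennreal (unit_ball_vol (real k) * (diameter (U i) / 2) ^ k))"
    by (intro suminf_finite) (auto simp: U_def)
  also have "\<dots> < \<infinity>" by (auto simp: less_top[symmetric])
  finally show ?thesis .
qed

text \<open>The balls of a Vitali family cover only after enlargement by \<open>5\<close>, but finitely many of them need no enlargement. Taking
more and more balls unenlarged, the enlarged rest costs \<open>5 ^ k\<close> times the tail of a convergent series.\<close>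

lemma hausdorff_content_le_vitali:
  fixes K :: "'a set"
  assumes r: "\<And>p. p \<in> C' \<Longrightarrow> 0 < r p \<and> r p \<le> \<delta> / 10" and C': "countable C'" and \<delta>: "\<delta> > 0"
    and cov: "\<And>F. finite F \<Longrightarrow> F \<subseteq> C' \<Longrightarrow> K \<subseteq> (\<Union>p\<in>F. cball (a p) (r p)) \<union> (\<Union>p\<in>C' - F. ball (a p) (5 * r p))"
    and B: "\<And>F. finite F \<Longrightarrow> F \<subseteq> C' \<Longrightarrow> (\<Sum>p\<in>F. unit_ball_vol (real k) * r p ^ k) \<le> B"
  shows "hausdorff_content k \<delta> K \<le> ennreal B"
proof -
  define f where "f = to_nat_on C'"
  have inj: "inj_on f C'" unfolding f_def by (rule inj_on_to_nat_on[OF C'])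
  define g where "g = inv_into C' f"
  have gf: "g (f p) = p" if "p \<in> C'" for p using inj that by (simp add: g_def)
  have gC: "g n \<in> C'" if "n \<in> f ` C'" for n using that by (simp add: g_def inv_into_into)
  have fg: "f (g n) = n" if "n \<in> f ` C'" for n using that by (simp add: g_def f_inv_into_f)
  define c where "c n = (if n \<in> f ` C' then unit_ball_vol (real k) * r (g n) ^ k else 0)" for n
  have c0: "c n \<ge> 0" for n using r[OF gC[of n]] by (auto simp: c_def)
  have part: "(\<Sum>n<m. c n) \<le> B" for m
  proof -
    have "(\<Sum>n<m. c n) = (\<Sum>n\<in>{..<m} \<inter> f ` C'. unit_ball_vol (real k) * r (g n) ^ k)"
      by (simp add: c_def sum.inter_restrict)
    also have "\<dots> = (\<Sum>p\<in>g ` ({..<m} \<inter> f ` C'). unit_ball_vol (real k) * r p ^ k)"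
    proof (subst sum.reindex)
      show "inj_on g ({..<m} \<inter> f ` C')" by (rule inj_on_inverseI[where g=f]) (use fg in auto)
    qed simp
    also have "\<dots> \<le> B" using gC by (intro B) auto
    finally show ?thesis .
  qed
  have sm: "summable c"
    using c0 part by (intro summableI_nonneg_bounded)
  have tail: "(\<lambda>m. \<Sum>n. c (n + m)) \<longlonglongrightarrow> 0" using suminf_exist_split2[OF sm] .
  have step: "hausdorff_content k \<delta> K \<le> ennreal (B + 5 ^ k * (\<Sum>n. c (n + m)))" for m
  proof -
    define U where "U n = (if n \<in> f ` C' then if n < m then cball (a (g n)) (r (g n)) else ball (a (g n)) (5 * r (g n)) else {})" for n
    define t where "t n = (if n < m then c n else 5 ^ k * c n)" for n
    have t0: "t n \<ge> 0" for n using c0 by (simp add: t_def)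
    have "K \<subseteq> (\<Union>n. U n)"
    proof
      fix x assume "x \<in> K"
      let ?F = "g ` ({..<m} \<inter> f ` C')"
      have "?F \<subseteq> C'" using gC by auto
      with cov[of ?F] \<open>x \<in> K\<close> consider n where "n < m" "n \<in> f ` C'" "x \<in> cball (a (g n)) (r (g n))"
        | p where "p \<in> C'" "p \<notin> ?F" "x \<in> ball (a p) (5 * r p)" by auto
      then show "x \<in> (\<Union>n. U n)"
      proof cases
        case 1 then show ?thesis by (intro UN_I[of n]) (auto simp: U_def)
      next
        case 2
        then have "\<not> f p < m" using gf by force
        then show ?thesis using 2 gf by (intro UN_I[of "f p"]) (auto simp: U_def)
      qed
    qed
    moreover have bd: "bounded (U n)" for n by (auto simp: U_def)
    moreover have diam: "diameter (U n) \<le> (if n < m then 2 * r (g n) else 10 * r (g n))" if "n \<in> f ` C'" for n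
      using that r[OF gC[OF that]] by (auto simp: U_def diameter_cball diameter_ball)
    have "diameter (U n) \<le> \<delta>" for n
    proof (cases "n \<in> f ` C'")
      case True then show ?thesis using diam[OF True] r[OF gC[OF True]] by (auto split: if_splits)
    next
      case False then show ?thesis using \<delta> by (simp add: U_def)
    qed
    ultimately have "hausdorff_content k \<delta> K \<le> (\<Sum>i. if U i = {} then 0 else ennreal (unit_ball_vol (real k) * (diameter (U i) / 2) ^ k))"
      unfolding hausdorff_content_def by (intro INF_lower) auto
    also have "\<dots> \<le> (\<Sum>i. ennreal (t i))"
    proof (intro suminf_le)
      fix i
      show "(if U i = {} then 0 else ennreal (unit_ball_vol (real k) * (diameter (U i) / 2) ^ k)) \<le> ennreal (t i)"
      proof (cases "i \<in> f ` C'")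
        case True
        have "(diameter (U i) / 2) ^ k \<le> ((if i < m then 1 else 5) * r (g i)) ^ k"
          using diam[OF True] diameter_ge_0[OF bd, of i] by (intro power_mono) auto
        then have "unit_ball_vol (real k) * (diameter (U i) / 2) ^ k \<le> t i"
          using True mult_left_mono[of "(diameter (U i) / 2) ^ k" "((if i < m then 1 else 5) * r (g i)) ^ k" "unit_ball_vol (real k)"]
          by (auto simp: t_def c_def power_mult_distrib split: if_splits)
        then show ?thesis by (auto intro: ennreal_leI)
      qed (simp add: U_def)
    qed auto
    also have "\<dots> \<le> ennreal (B + 5 ^ k * (\<Sum>n. c (n + m)))"
    proof -
      have s1: "summable (\<lambda>n. t (n + m))" using summable_ignore_initial_segment[OF sm, of m] by (simp add: t_def)
      then have s2: "summable t" by (simp add: summable_iff_shift)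
      have "suminf t = (\<Sum>n. t (n + m)) + (\<Sum>n<m. t n)" by (rule suminf_split_initial_segment[OF s2])
      also have "(\<Sum>n. t (n + m)) = 5 ^ k * (\<Sum>n. c (n + m))"
        using summable_ignore_initial_segment[OF sm, of m] by (simp add: t_def suminf_mult)
      also have "(\<Sum>n<m. t n) = (\<Sum>n<m. c n)" by (intro sum.cong) (auto simp: t_def)
      finally have "suminf t \<le> B + 5 ^ k * (\<Sum>n. c (n + m))" using part[of m] by simp
      then show ?thesis using suminf_ennreal_eq[OF t0 summable_sums[OF s2]] by (simp add: ennreal_leI)
    qed
    finally show ?thesis .
  qed
  have "(\<lambda>m. ennreal (B + 5 ^ k * (\<Sum>n. c (n + m)))) \<longlonglongrightarrow> ennreal (B + 5 ^ k * 0)"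
    by (intro tendsto_intros tendsto_ennrealI tail)
  then have "hausdorff_content k \<delta> K \<le> ennreal (B + 5 ^ k * 0)"
    by (rule LIMSEQ_le_const) (use step in auto)
  then show ?thesis by simp
qed

text \<open>Disjointness adds the losses inside the balls. The estimate in each ball holds for small \<open>z\<close> only; subtracting
\<open>(norm z)\<^sup>2 / \<kappa>\<close> makes the right-hand side nonpositive for the other \<open>z\<close>, at a cost of order \<open>u\<close>.\<close>

lemma heat_loss_ge_disjoint_balls:
  fixes \<Omega> :: "'a set" and F :: "('a \<times> real) set"
  assumes op: "open \<Omega>" and \<eta>: "0 < \<eta>" "\<eta> < 1" and F: "finite F"
    and flat: "\<And>p. p \<in> F \<Longrightarrow> flat_at \<Omega> \<eta> \<rho> (fst p) (e p)"
    and r: "\<And>p. p \<in> F \<Longrightarrow> 0 < snd p \<and> snd p \<le> \<rho> / 2"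
    and disj: "pairwise (\<lambda>p q. disjnt (cball (fst p) (snd p)) (cball (fst q) (snd q))) F"
  shows "\<exists>K. \<forall>u>0. ennreal ((\<Sum>p\<in>F. unit_ball_vol (real (DIM('a) - 1)) * ((1 - \<eta>) * snd p) ^ (DIM('a) - 1))
       * (1 / sqrt pi - \<eta> * (C + 1)) * sqrt u - K * u) \<le> heat_loss \<Omega> u"
proof (cases "F = {}")
  case True then show ?thesis by (intro exI[of _ 0]) simp
next
  case False
  define k where "k = DIM('a) - 1"
  define a where "a p = unit_ball_vol (real k) * ((1 - \<eta>) * snd p) ^ k" for p :: "'a \<times> real"
  have a0: "a p \<ge> 0" if "p \<in> F" for p using r[OF that] \<eta> by (simp add: a_def)
  define \<kappa> where "\<kappa> = Min ((\<lambda>p. \<eta>\<^sup>2 * snd p / 2) ` F)"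
  have \<kappa>: "\<kappa> > 0" "\<kappa> \<le> \<eta>\<^sup>2 * snd p / 2" if "p \<in> F" for p
  proof -
    show "\<kappa> > 0" unfolding \<kappa>_def using F False r \<eta> by auto
    show "\<kappa> \<le> \<eta>\<^sup>2 * snd p / 2" unfolding \<kappa>_def by (rule Min_le) (use F that in auto)
  qed
  have \<kappa>0: "\<kappa> > 0" using \<kappa>(1) False by blast
  have e1: "norm (e p) = 1" if "p \<in> F" for p using flat[OF that] by (simp add: flat_at_def)
  let ?g = "\<lambda>z. \<Sum>p\<in>F. a p * (max 0 (- (z \<bullet> e p)) - \<eta> * norm z - (norm z)\<^sup>2 / \<kappa>)"
  have bound: "ennreal (?g z) \<le> emeasure lborel (crossing \<Omega> z)" for z
  proof -
    have "ennreal (?g z) \<le> (\<Sum>p\<in>F. emeasure lborel (ball (fst p) (snd p) \<inter> crossing \<Omega> z))"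
    proof -
      have "?g z \<le> (\<Sum>p\<in>F. if norm z < \<kappa> then a p * max 0 (- (z \<bullet> e p) - \<eta> * norm z) else 0)"
      proof (intro sum_mono)
        fix p assume p: "p \<in> F"
        show "a p * (max 0 (- (z \<bullet> e p)) - \<eta> * norm z - (norm z)\<^sup>2 / \<kappa>) \<le> (if norm z < \<kappa> then a p * max 0 (- (z \<bullet> e p) - \<eta> * norm z) else 0)"
        proof (cases "norm z < \<kappa>")
          case True
          have "0 \<le> (norm z)\<^sup>2 / \<kappa>" "0 \<le> \<eta> * norm z" using \<kappa>0 \<eta> by auto
          then have "max 0 (- (z \<bullet> e p)) - \<eta> * norm z - (norm z)\<^sup>2 / \<kappa> \<le> max 0 (- (z \<bullet> e p) - \<eta> * norm z)" by (simp add: max_def)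
          then show ?thesis using True a0[OF p] by (simp add: mult_left_mono)
        next
          case False
          then have "norm z * \<kappa> \<le> norm z * norm z" by (intro mult_left_mono) auto
          then have "norm z \<le> (norm z)\<^sup>2 / \<kappa>" using \<kappa>0 by (simp add: field_simps power2_eq_square)
          moreover have "max 0 (- (z \<bullet> e p)) \<le> norm z" using abs_inner_unit_le[OF e1[OF p], of z] by auto
          moreover have "0 \<le> \<eta> * norm z" using \<eta> by auto
          ultimately have "max 0 (- (z \<bullet> e p)) - \<eta> * norm z - (norm z)\<^sup>2 / \<kappa> \<le> 0" by linarith
          then show ?thesis using False a0[OF p] by (simp add: mult_nonneg_nonpos)
        qed
      qed
      then have "ennreal (?g z) \<le> ennreal (\<Sum>p\<in>F. if norm z < \<kappa> then a p * max 0 (- (z \<bullet> e p) - \<eta> * norm z) else 0)" by (rule ennreal_leI)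
      also have "\<dots> = (\<Sum>p\<in>F. ennreal (if norm z < \<kappa> then a p * max 0 (- (z \<bullet> e p) - \<eta> * norm z) else 0))"
        using a0 by (intro sum_ennreal[symmetric]) auto
      also have "\<dots> \<le> (\<Sum>p\<in>F. emeasure lborel (ball (fst p) (snd p) \<inter> crossing \<Omega> z))"
      proof (intro sum_mono)
        fix p assume p: "p \<in> F"
        show "ennreal (if norm z < \<kappa> then a p * max 0 (- (z \<bullet> e p) - \<eta> * norm z) else 0) \<le> emeasure lborel (ball (fst p) (snd p) \<inter> crossing \<Omega> z)"
          using emeasure_crossing_ge[OF flat[OF p] op \<eta>, of "snd p" z] r[OF p] \<kappa>(2)[OF p] by (auto simp: a_def k_def)
      qed
      finally show ?thesis .
    qed
    also have "\<dots> = emeasure lborel (\<Union>p\<in>F. ball (fst p) (snd p) \<inter> crossing \<Omega> z)"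
    proof (rule sum_emeasure)
      show "disjoint_family_on (\<lambda>p. ball (fst p) (snd p) \<inter> crossing \<Omega> z) F"
        unfolding disjoint_family_on_def
      proof (intro ballI impI)
        fix p q assume "p \<in> F" "q \<in> F" "p \<noteq> q"
        then have "cball (fst p) (snd p) \<inter> cball (fst q) (snd q) = {}"
          using disj unfolding pairwise_def disjnt_def by blast
        then show "ball (fst p) (snd p) \<inter> crossing \<Omega> z \<inter> (ball (fst q) (snd q) \<inter> crossing \<Omega> z) = {}"
          using ball_subset_cball[of "fst p" "snd p"] ball_subset_cball[of "fst q" "snd q"] by blast
      qed
    qed (use F crossing_borel[OF op] in auto)
    also have "\<dots> \<le> emeasure lborel (crossing \<Omega> z)"
      using crossing_borel[OF op, of z] by (intro emeasure_mono) auto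
    finally show ?thesis .
  qed
  define K where "K = (\<Sum>p\<in>F. a p) * (C / \<kappa>)"
  have "ennreal ((\<Sum>p\<in>F. a p) * (1 / sqrt pi - \<eta> * (C + 1)) * sqrt u - K * u) \<le> heat_loss \<Omega> u" if u: "u > 0" for u
  proof -
    interpret prob_space "\<mu> u" by (rule prob[OF u])
    note [measurable_cong] = sets_\<mu>[OF u]
    have pp: "integrable (\<mu> u) (\<lambda>z. max 0 (- (z \<bullet> e p)))" "(\<integral>z. max 0 (- (z \<bullet> e p)) \<partial>\<mu> u) = sqrt u / sqrt pi" if "p \<in> F" for p
      using pos_part[OF u e1[OF that]] by (auto simp: has_bochner_integral_iff real_sqrt_divide)
    have i1: "integrable (\<mu> u) (\<lambda>z. a p * (max 0 (- (z \<bullet> e p)) - \<eta> * norm z - (norm z)\<^sup>2 / \<kappa>))" if "p \<in> F" for p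
      using pp[OF that] first_moment(1)[OF u] second_moment(1)[OF u] by auto
    have "(\<Sum>p\<in>F. a p) * (1 / sqrt pi - \<eta> * (C + 1)) * sqrt u - K * u
        = (\<Sum>p\<in>F. a p * (sqrt u / sqrt pi - \<eta> * ((C + 1) * sqrt u) - (C * u) / \<kappa>))"
      unfolding sum_distrib_right[symmetric] by (simp add: K_def algebra_simps)
    also have "\<dots> \<le> (\<Sum>p\<in>F. a p * (sqrt u / sqrt pi - \<eta> * (\<integral>z. norm z \<partial>\<mu> u) - (\<integral>z. (norm z)\<^sup>2 \<partial>\<mu> u) / \<kappa>))"
      using a0 \<eta> \<kappa>0 first_moment(2)[OF u] second_moment(2)[OF u]
      by (intro sum_mono mult_left_mono diff_mono divide_right_mono) auto
    also have "\<dots> = (\<integral>z. ?g z \<partial>\<mu> u)"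
      using i1 pp first_moment(1)[OF u] second_moment(1)[OF u] by (simp add: Bochner_Integration.integral_sum)
    finally have "ennreal ((\<Sum>p\<in>F. a p) * (1 / sqrt pi - \<eta> * (C + 1)) * sqrt u - K * u) \<le> ennreal (\<integral>z. ?g z \<partial>\<mu> u)"
      by (rule ennreal_leI)
    also have "\<dots> \<le> ennreal (\<integral>z. max 0 (?g z) \<partial>\<mu> u)"
      using i1 by (intro ennreal_leI integral_mono) auto
    also have "\<dots> = (\<integral>\<^sup>+z. ennreal (max 0 (?g z)) \<partial>\<mu> u)"
      using i1 by (intro nn_integral_eq_integral[symmetric]) auto
    also have "\<dots> \<le> heat_loss \<Omega> u"
      unfolding heat_loss_def using bound by (intro nn_integral_mono) (simp add: max_def)
    finally show ?thesis .
  qed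
  then show ?thesis unfolding a_def k_def by blast
qed

text \<open>Vitali's covering lemma, applied to all sufficiently small balls centred on the boundary, yields a disjoint family.
Along the times at which the loss is small, the disjoint-ball estimate bounds the total weight of every finite
subfamily, and hence the Hausdorff content.\<close>

lemma hausdorff_measure_le_heat_loss:
  fixes \<Omega> :: "'a set"
  assumes flat: "flat_boundary \<Omega>" and L: "L \<ge> 0"
    and freq: "\<exists>\<^sub>F u in at_right 0. heat_loss \<Omega> u \<le> ennreal (L / sqrt pi * sqrt u)"
  shows "hausdorff_measure (DIM('a) - 1) (frontier \<Omega>) \<le> ennreal L"
  unfolding hausdorff_measure_eq_SUP
proof (rule SUP_least)
  fix \<delta> :: real assume "\<delta> \<in> {0<..}"
  then have \<delta>: "\<delta> > 0" by simp
  have op: "open \<Omega>" using flat by (simp add: flat_boundary_def)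
  define k where "k = DIM('a) - 1"
  \<comment> \<open>The bound on the weight that the loss implies at flatness \<open>\<eta>\<close>; it tends to \<open>L\<close> with \<open>\<eta>\<close>.\<close>
  define B where "B \<eta> = (L / sqrt pi + \<eta>) / ((1 - \<eta>) ^ k * (1 / sqrt pi - \<eta> * (C + 1)))" for \<eta>
  have step: "hausdorff_content k \<delta> (frontier \<Omega>) \<le> ennreal (B \<eta>)" if \<eta>: "0 < \<eta>" "\<eta> < 1" "\<eta> * (C + 1) < 1 / sqrt pi" for \<eta>
  proof -
    obtain \<rho> where \<rho>: "\<rho> > 0" "\<And>p. p \<in> frontier \<Omega> \<Longrightarrow> \<exists>e. flat_at \<Omega> \<eta> \<rho> p e"
      using flat \<eta> unfolding flat_boundary_def by meson
    define r0 where "r0 = min (\<rho> / 2) (\<delta> / 10)"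
    have r0: "r0 > 0" using \<rho> \<delta> by (simp add: r0_def)
    define K where "K = frontier \<Omega> \<times> {0<..r0}"
    obtain C' where C': "countable C'" "C' \<subseteq> K"
      "pairwise (\<lambda>i j. disjnt (cball (fst i) (snd i)) (cball (fst j) (snd j))) C'"
      "\<And>i. i \<in> K \<Longrightarrow> \<exists>j. j \<in> C' \<and> \<not> disjnt (cball (fst i) (snd i)) (cball (fst j) (snd j)) \<and>
                        cball (fst i) (snd i) \<subseteq> ball (fst j) (5 * snd j)"
    proof (rule Vitali_covering_lemma_cballs_balls[where a = fst and r = snd and K = K and B = r0])
      show "0 < snd i \<and> snd i \<le> r0" if "i \<in> K" for i using that by (auto simp: K_def)
    qed (rule that; assumption)
    have "\<exists>e. flat_at \<Omega> \<eta> \<rho> (fst p) e" if "p \<in> C'" for p using that C'(2) \<rho>(2) by (auto simp: K_def)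
    then obtain e where e: "\<And>p. p \<in> C' \<Longrightarrow> flat_at \<Omega> \<eta> \<rho> (fst p) (e p)" by metis
    show ?thesis
    proof (rule hausdorff_content_le_vitali[OF _ C'(1) \<delta>])
      show "0 < snd p \<and> snd p \<le> \<delta> / 10" if "p \<in> C'" for p using that C'(2) by (auto simp: K_def r0_def)
      show "frontier \<Omega> \<subseteq> (\<Union>p\<in>F. cball (fst p) (snd p)) \<union> (\<Union>p\<in>C' - F. ball (fst p) (5 * snd p))"
        if F: "finite F" "F \<subseteq> C'" for F
      proof
        fix x assume x: "x \<in> frontier \<Omega>"
        show "x \<in> (\<Union>p\<in>F. cball (fst p) (snd p)) \<union> (\<Union>p\<in>C' - F. ball (fst p) (5 * snd p))"
        proof (cases "x \<in> (\<Union>p\<in>F. cball (fst p) (snd p))")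
          case False
          have "closed (\<Union>p\<in>F. cball (fst p) (snd p))" using F by (intro closed_UN) auto
          then have "open (- (\<Union>p\<in>F. cball (fst p) (snd p)))" by (rule open_Compl)
          moreover have "x \<in> - (\<Union>p\<in>F. cball (fst p) (snd p))" using False by simp
          ultimately obtain s where s: "s > 0" "ball x s \<subseteq> - (\<Union>p\<in>F. cball (fst p) (snd p))"
            by (rule openE)
          define t where "t = min (s / 2) r0"
          have t: "t > 0" "cball x t \<subseteq> ball x s" "(x, t) \<in> K" using s r0 x by (auto simp: t_def K_def)
          obtain j where j: "j \<in> C'" "\<not> disjnt (cball x t) (cball (fst j) (snd j))" "cball x t \<subseteq> ball (fst j) (5 * snd j)"
            using C'(4)[OF t(3)] by auto
          have "j \<notin> F" using j(2) t(2) s(2) unfolding disjnt_def by blast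
          moreover have "x \<in> ball (fst j) (5 * snd j)" using subsetD[OF j(3), of x] t(1) by simp
          ultimately show ?thesis using j(1) by blast
        qed simp
      qed
      fix F assume F: "finite F" "F \<subseteq> C'"
      define Sg where "Sg = (\<Sum>p\<in>F. unit_ball_vol (real k) * ((1 - \<eta>) * snd p) ^ k)"
      obtain K1 where K1: "\<And>u. u > 0 \<Longrightarrow> ennreal (Sg * (1 / sqrt pi - \<eta> * (C + 1)) * sqrt u - K1 * u) \<le> heat_loss \<Omega> u"
      proof -
        have "\<exists>K. \<forall>u>0. ennreal (Sg * (1 / sqrt pi - \<eta> * (C + 1)) * sqrt u - K * u) \<le> heat_loss \<Omega> u"
          unfolding Sg_def k_def
        proof (rule heat_loss_ge_disjoint_balls[OF op \<eta>(1,2) F(1)])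
          show "flat_at \<Omega> \<eta> \<rho> (fst p) (e p)" if "p \<in> F" for p using e F(2) that by blast
          show "0 < snd p \<and> snd p \<le> \<rho> / 2" if "p \<in> F" for p using F(2) C'(2) that by (auto simp: K_def r0_def)
          show "pairwise (\<lambda>p q. disjnt (cball (fst p) (snd p)) (cball (fst q) (snd q))) F"
            using C'(3) F(2) by (rule pairwise_subset)
        qed
        then show thesis using that by blast
      qed
      have "((\<lambda>u. K1 * sqrt u) \<longlongrightarrow> K1 * sqrt 0) (at_right 0)" by (intro tendsto_intros)
      then have "\<forall>\<^sub>F u in at_right 0. K1 * sqrt u < \<eta>" by (rule order_tendstoD(2)) (use \<eta> in simp)
      from frequently_eventually_frequently[OF freq eventually_conj[OF this eventually_at_right_less[of 0]]]
      obtain u where u: "heat_loss \<Omega> u \<le> ennreal (L / sqrt pi * sqrt u)" "K1 * sqrt u < \<eta>" "u > 0"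
        by (auto dest: frequently_ex)
      have "ennreal (Sg * (1 / sqrt pi - \<eta> * (C + 1)) * sqrt u - K1 * u) \<le> ennreal (L / sqrt pi * sqrt u)"
        using K1[OF u(3)] u(1) by (rule order_trans)
      then have "Sg * (1 / sqrt pi - \<eta> * (C + 1)) * sqrt u - K1 * u \<le> L / sqrt pi * sqrt u"
        using L u by (subst (asm) ennreal_le_iff) auto
      moreover have "K1 * u = (K1 * sqrt u) * sqrt u" using u by simp
      ultimately have "(Sg * (1 / sqrt pi - \<eta> * (C + 1)) - K1 * sqrt u) * sqrt u \<le> (L / sqrt pi) * sqrt u" by (simp add: algebra_simps)
      then have "Sg * (1 / sqrt pi - \<eta> * (C + 1)) - K1 * sqrt u \<le> L / sqrt pi" 
        by (rule mult_right_le_imp_le) (use u in simp)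
      then have le: "Sg * (1 / sqrt pi - \<eta> * (C + 1)) \<le> L / sqrt pi + \<eta>" using u(2) by linarith
      have Sg: "Sg = (1 - \<eta>) ^ k * (\<Sum>p\<in>F. unit_ball_vol (real k) * snd p ^ k)"
        by (simp add: Sg_def sum_distrib_left power_mult_distrib mult_ac)
      have "0 < (1 - \<eta>) ^ k * (1 / sqrt pi - \<eta> * (C + 1))" using \<eta> by simp
      then show "(\<Sum>p\<in>F. unit_ball_vol (real k) * snd p ^ k) \<le> B \<eta>"
        using le unfolding B_def Sg by (subst pos_le_divide_eq) (auto simp: mult_ac)
    qed
  qed
  have "(B \<longlongrightarrow> (L / sqrt pi + 0) / ((1 - 0) ^ k * (1 / sqrt pi - 0 * (C + 1)))) (at_right 0)"
    unfolding B_def by (intro tendsto_intros) auto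
  then have "(B \<longlongrightarrow> L) (at_right 0)" by simp
  then have lim: "((\<lambda>\<eta>. ennreal (B \<eta>)) \<longlongrightarrow> ennreal L) (at_right 0)" by (rule tendsto_ennrealI)
  have "((\<lambda>\<eta>. \<eta> * (C + 1)) \<longlongrightarrow> 0 * (C + 1)) (at_right 0)" by (intro tendsto_intros)
  then have "\<forall>\<^sub>F \<eta> in at_right 0. \<eta> * (C + 1) < 1 / sqrt pi" by (rule order_tendstoD(2)) simp
  moreover have "\<forall>\<^sub>F \<eta> in at_right (0::real). \<eta> < 1" by (intro order_tendstoD(2)[OF tendsto_ident_at]) auto
  ultimately have "\<forall>\<^sub>F \<eta> in at_right 0. hausdorff_content k \<delta> (frontier \<Omega>) \<le> ennreal (B \<eta>)"
    using eventually_at_right_less[of 0] by eventually_elim (rule step)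
  then show "hausdorff_content (DIM('a) - 1) \<delta> (frontier \<Omega>) \<le> ennreal L"
    using lim unfolding k_def by (intro tendsto_lowerbound[OF lim]) auto
qed

text \<open>The upper estimate with a finite content, fed into the lower one, shows that the Hausdorff measure of the boundary is
finite; after that both estimates are used with it.\<close>

theorem heat_loss_asymptotics:
  fixes \<Omega> :: "'a set"
  assumes flat: "flat_boundary \<Omega>" and bd: "bounded \<Omega>"
  shows "((\<lambda>u. enn2real (heat_loss \<Omega> u) / sqrt u) \<longlongrightarrow> enn2real (hausdorff_measure (DIM('a) - 1) (frontier \<Omega>)) / sqrt pi) (at_right 0)"
proof -
  define k where "k = DIM('a) - 1"
  have comp: "compact (frontier \<Omega>)" using bd by (simp add: compact_frontier_bounded)
  have fin: "hausdorff_measure k (frontier \<Omega>) < \<infinity>"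
  proof -
    obtain \<delta> where \<delta>: "\<delta> > 0" "\<And>L. L \<ge> 0 \<Longrightarrow> hausdorff_content (DIM('a) - 1) \<delta> (frontier \<Omega>) < ennreal L \<Longrightarrow>
       \<forall>\<^sub>F u in at_right 0. heat_loss \<Omega> u \<le> ennreal ((L * (1 / sqrt pi + 1) + 1) * sqrt u)"
      using heat_loss_le_content[OF flat bd zero_less_one] by metis
    obtain L0 where L0: "L0 \<ge> 0" "hausdorff_content (DIM('a) - 1) \<delta> (frontier \<Omega>) = ennreal L0"
      using hausdorff_content_finite[OF comp \<delta>(1), of "DIM('a) - 1"] by (cases "hausdorff_content (DIM('a) - 1) \<delta> (frontier \<Omega>)") auto
    define L1 where "L1 = (((L0 + 1) * (1 / sqrt pi + 1) + 1)) * sqrt pi"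
    have L1: "L1 \<ge> 0" using L0 by (simp add: L1_def)
    have "\<forall>\<^sub>F u in at_right 0. heat_loss \<Omega> u \<le> ennreal (L1 / sqrt pi * sqrt u)"
      using \<delta>(2)[of "L0 + 1"] L0 by (simp add: L1_def ennreal_less_iff)
    then have "\<exists>\<^sub>F u in at_right 0. heat_loss \<Omega> u \<le> ennreal (L1 / sqrt pi * sqrt u)"
      by (intro eventually_frequently) auto
    from hausdorff_measure_le_heat_loss[OF flat L1 this] show ?thesis
      by (metis ennreal_less_top infinity_ennreal_def k_def le_less_trans)
  qed
  then obtain H where H: "H \<ge> 0" "hausdorff_measure k (frontier \<Omega>) = ennreal H"
    by (cases "hausdorff_measure k (frontier \<Omega>)") auto
  show ?thesis
    unfolding k_def[symmetric] H(2) enn2real_ennreal[OF H(1)]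
  proof (rule order_tendstoI)
    fix a assume a: "a < H / sqrt pi"
    show "\<forall>\<^sub>F u in at_right 0. a < enn2real (heat_loss \<Omega> u) / sqrt u"
    proof (cases "a < 0")
      case True
      have "\<forall>\<^sub>F u in at_right (0::real). 0 < u" by (rule eventually_at_right_less)
      then show ?thesis
      proof eventually_elim
        fix u :: real assume "0 < u"
        then have "0 \<le> enn2real (heat_loss \<Omega> u) / sqrt u" by simp
        then show "a < enn2real (heat_loss \<Omega> u) / sqrt u" using True by linarith
      qed
    next
      case False
      then have "a * sqrt pi \<ge> 0" by simp
      have "\<not> (\<exists>\<^sub>F u in at_right 0. heat_loss \<Omega> u \<le> ennreal (a * sqrt pi / sqrt pi * sqrt u))"
      proof
        assume "\<exists>\<^sub>F u in at_right 0. heat_loss \<Omega> u \<le> ennreal (a * sqrt pi / sqrt pi * sqrt u)"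
        from hausdorff_measure_le_heat_loss[OF flat \<open>a * sqrt pi \<ge> 0\<close> this]
        have "ennreal H \<le> ennreal (a * sqrt pi)" using H(2) by (simp add: k_def)
        then have "H \<le> a * sqrt pi" using \<open>a * sqrt pi \<ge> 0\<close> by (simp add: ennreal_le_iff)
        then show False using a by (simp add: field_simps)
      qed
      then have "\<forall>\<^sub>F u in at_right 0. ennreal (a * sqrt u) < heat_loss \<Omega> u"
        unfolding not_frequently by simp (simp add: not_le)
      moreover have "\<forall>\<^sub>F u in at_right 0. heat_loss \<Omega> u < \<infinity>"
      proof -
        obtain \<delta> where \<delta>: "\<delta> > 0" "\<And>L. L \<ge> 0 \<Longrightarrow> hausdorff_content (DIM('a) - 1) \<delta> (frontier \<Omega>) < ennreal L \<Longrightarrow>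
           \<forall>\<^sub>F u in at_right 0. heat_loss \<Omega> u \<le> ennreal ((L * (1 / sqrt pi + 1) + 1) * sqrt u)"
          using heat_loss_le_content[OF flat bd zero_less_one] by metis
        have "hausdorff_content (DIM('a) - 1) \<delta> (frontier \<Omega>) \<le> ennreal H"
          unfolding H(2)[symmetric] k_def hausdorff_measure_eq_SUP using \<delta>(1) by (intro SUP_upper) auto
        also have "\<dots> < ennreal (H + 1)" using H by (simp add: ennreal_less_iff)
        finally have "\<forall>\<^sub>F u in at_right 0. heat_loss \<Omega> u \<le> ennreal (((H + 1) * (1 / sqrt pi + 1) + 1) * sqrt u)"
          using H by (intro \<delta>(2)) auto
        then show ?thesis by eventually_elim (simp add: le_less_trans)
      qed
      ultimately show ?thesis using eventually_at_right_less[of 0]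
      proof eventually_elim
        fix u :: real assume u: "ennreal (a * sqrt u) < heat_loss \<Omega> u" "heat_loss \<Omega> u < \<infinity>" "0 < u"
        have "a * sqrt u < enn2real (heat_loss \<Omega> u)"
          using u False by (cases "heat_loss \<Omega> u") (auto simp: ennreal_less_iff)
        then show "a < enn2real (heat_loss \<Omega> u) / sqrt u" using u(3) by (simp add: field_simps)
      qed
    qed
  next
    fix a assume a: "H / sqrt pi < a"
    have "((\<lambda>\<eta>. (H + \<eta>) * (1 / sqrt pi + \<eta>) + \<eta>) \<longlongrightarrow> (H + 0) * (1 / sqrt pi + 0) + 0) (at_right 0)"
      by (intro tendsto_intros)
    then have "\<forall>\<^sub>F \<eta> in at_right 0. (H + \<eta>) * (1 / sqrt pi + \<eta>) + \<eta> < a"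
      by (rule order_tendstoD(2)) (use a in simp)
    from eventually_happens'[OF _ eventually_conj[OF this eventually_at_right_less[of 0]]]
    obtain \<eta> where \<eta>: "(H + \<eta>) * (1 / sqrt pi + \<eta>) + \<eta> < a" "\<eta> > 0" by auto
    obtain \<delta> where \<delta>: "\<delta> > 0" "\<And>L. L \<ge> 0 \<Longrightarrow> hausdorff_content (DIM('a) - 1) \<delta> (frontier \<Omega>) < ennreal L \<Longrightarrow>
       \<forall>\<^sub>F u in at_right 0. heat_loss \<Omega> u \<le> ennreal ((L * (1 / sqrt pi + \<eta>) + \<eta>) * sqrt u)"
      using heat_loss_le_content[OF flat bd \<eta>(2)] by metis
    have "hausdorff_content (DIM('a) - 1) \<delta> (frontier \<Omega>) \<le> ennreal H"
      unfolding H(2)[symmetric] k_def hausdorff_measure_eq_SUP using \<delta>(1) by (intro SUP_upper) auto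
    also have "\<dots> < ennreal (H + \<eta>)" using H \<eta> by (simp add: ennreal_less_iff)
    finally have "\<forall>\<^sub>F u in at_right 0. heat_loss \<Omega> u \<le> ennreal (((H + \<eta>) * (1 / sqrt pi + \<eta>) + \<eta>) * sqrt u)"
      using H \<eta> by (intro \<delta>(2)) auto
    then show "\<forall>\<^sub>F u in at_right 0. enn2real (heat_loss \<Omega> u) / sqrt u < a"
      using eventually_at_right_less[of 0]
    proof eventually_elim
      fix u :: real assume u: "heat_loss \<Omega> u \<le> ennreal (((H + \<eta>) * (1 / sqrt pi + \<eta>) + \<eta>) * sqrt u)" "0 < u"
      have "enn2real (heat_loss \<Omega> u) \<le> ((H + \<eta>) * (1 / sqrt pi + \<eta>) + \<eta>) * sqrt u"
        using enn2real_mono[OF u(1)] H \<eta> u(2) by simp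
      also have "\<dots> < a * sqrt u" using \<eta> u by (intro mult_strict_right_mono) auto
      finally show "enn2real (heat_loss \<Omega> u) / sqrt u < a" using u(2) by (simp add: field_simps)
    qed
  qed
qed

end

section \<open>Measures determined by transforms\<close>

text \<open>Closed sets are decreasing limits of continuous functions of the distance, and they generate the Borel sets.\<close>

lemma measure_eqI_continuous:
  fixes M N :: "'b::metric_space measure"
  assumes sM: "sets M = sets borel" and sN: "sets N = sets borel" and pM: "prob_space M" and pN: "prob_space N"
    and eq: "\<And>f. continuous_on UNIV f \<Longrightarrow> (\<And>x. 0 \<le> f x \<and> f x \<le> 1) \<Longrightarrow> (\<integral>x. f x \<partial>M) = (\<integral>x. (f x::real) \<partial>N)"
  shows "M = N"
proof -
  interpret M: prob_space M by fact
  interpret N: prob_space N by fact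
  note [measurable_cong] = sM sN
  have cl: "measure M F = measure N F" if F: "closed F" "F \<noteq> {}" for F
  proof -
    have [measurable]: "F \<in> sets borel" using F by simp
    define f where "f n x = max 0 (1 - real n * infdist x F)" for n x
    have cf: "continuous_on UNIV (f n)" for n unfolding f_def by (intro continuous_intros)
    have f01: "0 \<le> f n x \<and> f n x \<le> 1" for n x by (auto simp: f_def infdist_nonneg)
    have [measurable]: "f n \<in> borel_measurable borel" for n by (intro borel_measurable_continuous_onI cf)
    have lim: "(\<lambda>n. f n x) \<longlonglongrightarrow> indicator F x" for x
    proof (cases "x \<in> F")
      case True then show ?thesis using F by (simp add: f_def)
    next
      case False
      then have pos: "infdist x F > 0" using F in_closed_iff_infdist_zero[OF F, of x] infdist_nonneg[of x F] by auto
      obtain n0 where n0: "1 / infdist x F < real n0" using reals_Archimedean2 by blast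
      have "f n x = 0" if "n \<ge> n0" for n
      proof -
        have "1 / infdist x F < real n" using n0 that by linarith
        then show ?thesis using pos by (simp add: f_def field_simps)
      qed
      then have "(\<lambda>n. f n x) \<longlonglongrightarrow> 0" by (intro tendsto_eventually eventually_sequentiallyI)
      then show ?thesis using False by simp
    qed
    have e: "(\<integral>x. f n x \<partial>M) = (\<integral>x. f n x \<partial>N)" for n by (rule eq[OF cf f01])
    have l1: "(\<lambda>n. \<integral>x. f n x \<partial>M) \<longlonglongrightarrow> (\<integral>x. indicator F x \<partial>M)"
      by (rule integral_dominated_convergence[where w="\<lambda>_. 1"]) (use f01 lim in auto)
    have l2: "(\<lambda>n. \<integral>x. f n x \<partial>N) \<longlonglongrightarrow> (\<integral>x. indicator F x \<partial>N)"
      by (rule integral_dominated_convergence[where w="\<lambda>_. 1"]) (use f01 lim in auto)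
    have "(\<integral>x. indicator F x \<partial>M) = (\<integral>x. (indicator F x::real) \<partial>N)"
      by (rule LIMSEQ_unique[OF l1[unfolded e] l2])
    then show ?thesis using sets_eq_imp_space_eq[OF sM] sets_eq_imp_space_eq[OF sN] by simp
  qed
  show ?thesis
  proof (rule measure_eqI_generator_eq[where E="Collect closed" and \<Omega>=UNIV and A="\<lambda>_. UNIV"])
    show "Int_stable (Collect closed)" by (auto simp: Int_stable_def)
    show "sets M = sigma_sets UNIV (Collect closed)" "sets N = sigma_sets UNIV (Collect closed)"
      unfolding sM sN borel_eq_closed by simp_all
    show "emeasure M X = emeasure N X" if "X \<in> Collect closed" for X
      using cl[of X] that by (cases "X = {}") (auto simp: M.emeasure_eq_measure N.emeasure_eq_measure)
  qed auto
qed

text \<open>Under \<open>x \<mapsto> exp (- x)\<close> the Laplace transforms at the integers become moments on the unit interval, which determine the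
law by Weierstrass approximation.\<close>

lemma measure_eqI_laplace:
  fixes M N :: "real measure"
  assumes sM: "sets M = sets borel" and sN: "sets N = sets borel" and pM: "prob_space M" and pN: "prob_space N"
    and aeM: "AE x in M. 0 \<le> x" and aeN: "AE x in N. 0 \<le> x"
    and eq: "\<And>s. s > 0 \<Longrightarrow> (\<integral>x. exp (- s * x) \<partial>M) = (\<integral>x. exp (- s * x) \<partial>N)"
  shows "M = N"
proof -
  interpret M: prob_space M by fact
  interpret N: prob_space N by fact
  note [measurable_cong] = sM sN
  let ?e = "\<lambda>x::real. exp (- x)"
  have ints: "integrable M (\<lambda>x. p (?e x))" "integrable N (\<lambda>x. p (?e x))" 
    if "continuous_on {0..1} p" and [measurable]: "p \<in> borel_measurable borel" for p :: "real \<Rightarrow> real"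
  proof -
    have "compact (p ` {0..1})" using that by (intro compact_continuous_image) auto
    then obtain B where B: "\<And>y. y \<in> {0..1} \<Longrightarrow> \<bar>p y\<bar> \<le> B"
      by (metis bounded_iff compact_imp_bounded image_eqI real_norm_def)
    show "integrable M (\<lambda>x. p (?e x))"
      using aeM by (intro M.integrable_const_bound[where B=B]) (auto elim!: eventually_mono intro!: B)
    show "integrable N (\<lambda>x. p (?e x))"
      using aeN by (intro N.integrable_const_bound[where B=B]) (auto elim!: eventually_mono intro!: B)
  qed
  have pow: "(\<integral>x. ?e x ^ n \<partial>M) = (\<integral>x. ?e x ^ n \<partial>N)" for n
  proof (cases "n = 0")
    case True then show ?thesis by (simp add: M.prob_space N.prob_space)
  next
    case False
    then show ?thesis using eq[of "real n"] by (simp add: exp_of_nat_mult[symmetric])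
  qed
  have poly: "(\<integral>x. p (?e x) \<partial>M) = (\<integral>x. p (?e x) \<partial>N)" if p: "real_polynomial_function p" for p
  proof -
    obtain a n where p: "p = (\<lambda>x. \<Sum>i\<le>n. a i * x^i)" using p real_polynomial_function_iff_sum by auto
    have "integrable M (\<lambda>x. a i * ?e x ^ i)" "integrable N (\<lambda>x. a i * ?e x ^ i)" for i
      by (intro ints[of "\<lambda>y. a i * y ^ i"] continuous_intros borel_measurable_continuous_onI)+
    then show ?thesis unfolding p using pow by (simp add: Bochner_Integration.integral_sum)
  qed
  have "distr M borel ?e = distr N borel ?e"
  proof (rule measure_eqI_continuous)
    show "prob_space (distr M borel ?e)" "prob_space (distr N borel ?e)"
      by (intro M.prob_space_distr N.prob_space_distr; measurable)+
    fix f :: "real \<Rightarrow> real" assume f: "continuous_on UNIV f" "\<And>x. 0 \<le> f x \<and> f x \<le> 1"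
    have [measurable]: "f \<in> borel_measurable borel" by (intro borel_measurable_continuous_onI f)
    have f': "continuous_on {0..1} f" using f(1) by (rule continuous_on_subset) auto
    have "\<bar>(\<integral>x. f (?e x) \<partial>M) - (\<integral>x. f (?e x) \<partial>N)\<bar> \<le> \<epsilon>" if \<epsilon>: "\<epsilon> > 0" for \<epsilon>
    proof -
      have \<epsilon>2: "0 < \<epsilon> / 2" using \<epsilon> by simp
      obtain p where p: "real_polynomial_function p" "\<And>x. x \<in> {0..1} \<Longrightarrow> \<bar>f x - p x\<bar> < \<epsilon> / 2"
        by (rule Stone_Weierstrass_real_polynomial_function[OF compact_Icc f' \<epsilon>2]) (rule that)
      have pc: "continuous_on UNIV p" using p(1) by (auto intro: continuous_on_polymonial_function simp: real_polynomial_function_eq)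
      have pc': "continuous_on {0..1} p" using pc by (rule continuous_on_subset) auto
      have [measurable]: "p \<in> borel_measurable borel" by (intro borel_measurable_continuous_onI pc)
      note i = ints[OF f'] ints[OF pc']
      have "\<bar>(\<integral>x. f (?e x) \<partial>M) - (\<integral>x. p (?e x) \<partial>M)\<bar> \<le> \<epsilon> / 2"
      proof -
        have "\<bar>(\<integral>x. f (?e x) - p (?e x) \<partial>M)\<bar> \<le> (\<integral>x. \<bar>f (?e x) - p (?e x)\<bar> \<partial>M)" by (rule integral_abs_bound)
        also have "\<dots> \<le> (\<integral>x. \<epsilon> / 2 \<partial>M)"
        proof (rule integral_mono_AE)
          show "AE x in M. \<bar>f (?e x) - p (?e x)\<bar> \<le> \<epsilon> / 2"
            by (rule eventually_mono[OF aeM], rule less_imp_le, rule p(2)) simp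
        qed (use i in auto)
        finally show ?thesis using i by (simp add: M.prob_space)
      qed
      moreover have "\<bar>(\<integral>x. f (?e x) \<partial>N) - (\<integral>x. p (?e x) \<partial>N)\<bar> \<le> \<epsilon> / 2"
      proof -
        have "\<bar>(\<integral>x. f (?e x) - p (?e x) \<partial>N)\<bar> \<le> (\<integral>x. \<bar>f (?e x) - p (?e x)\<bar> \<partial>N)" by (rule integral_abs_bound)
        also have "\<dots> \<le> (\<integral>x. \<epsilon> / 2 \<partial>N)"
        proof (rule integral_mono_AE)
          show "AE x in N. \<bar>f (?e x) - p (?e x)\<bar> \<le> \<epsilon> / 2"
            by (rule eventually_mono[OF aeN], rule less_imp_le, rule p(2)) simp
        qed (use i in auto)
        finally show ?thesis using i by (simp add: N.prob_space)
      qed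
      ultimately show ?thesis using poly[OF p(1)] by linarith
    qed
    then have "\<bar>(\<integral>x. f (?e x) \<partial>M) - (\<integral>x. f (?e x) \<partial>N)\<bar> \<le> 0"
      by (rule field_le_epsilon) simp
    then show "(\<integral>x. f x \<partial>distr M borel ?e) = (\<integral>x. f x \<partial>distr N borel ?e)"
      by (simp add: integral_distr)
  qed simp_all
  then have "distr (distr M borel ?e) borel (\<lambda>y. - ln y) = distr (distr N borel ?e) borel (\<lambda>y. - ln y)" by simp
  then have "distr M borel (\<lambda>x. x) = distr N borel (\<lambda>x. x)"
    by (simp add: distr_distr comp_def)
  moreover have "distr M borel (\<lambda>x. x) = M" by (rule distr_id2[OF sM[symmetric]])
  moreover have "distr N borel (\<lambda>x. x) = N" by (rule distr_id2[OF sN[symmetric]])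
  ultimately show ?thesis by simp
qed

lemma nn_integral_lborel_affine:
  fixes t :: "'a::euclidean_space"
  assumes [measurable]: "h \<in> borel_measurable borel" and c: "c > 0"
  shows "(\<integral>\<^sup>+y. h y \<partial>lborel) = ennreal (c ^ DIM('a)) * (\<integral>\<^sup>+w. h (t + c *\<^sub>R w) \<partial>lborel)"
proof -
  have "(\<integral>\<^sup>+y. h y \<partial>lborel) = (\<integral>\<^sup>+y. h y \<partial>density (distr lborel borel (\<lambda>x. t + c *\<^sub>R x)) (\<lambda>_. \<bar>c\<bar>^DIM('a)))"
    using lborel_affine[of c t] c by simp
  also have "\<dots> = ennreal (c ^ DIM('a)) * (\<integral>\<^sup>+w. h (t + c *\<^sub>R w) \<partial>lborel)"
    using c by (simp add: nn_integral_density nn_integral_distr nn_integral_cmult)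
  finally show ?thesis .
qed

lemma nn_integral_exp_norm_sq:
  fixes dummy :: "'a::euclidean_space"
  shows "(\<integral>\<^sup>+w. ennreal (exp (- (norm (w::'a))\<^sup>2)) \<partial>lborel) < \<infinity>" "(\<integral>\<^sup>+w. ennreal (exp (- (norm (w::'a))\<^sup>2)) \<partial>lborel) > 0"
proof -
  interpret product_sigma_finite "\<lambda>_::'a. lborel::real measure" ..
  have "(\<integral>\<^sup>+w. ennreal (exp (- (norm (w::'a))\<^sup>2)) \<partial>lborel)
      = (\<integral>\<^sup>+x. ennreal (exp (- (norm (\<Sum>b\<in>Basis. x b *\<^sub>R b :: 'a))\<^sup>2)) \<partial>Pi\<^sub>M (Basis::'a set) (\<lambda>_. lborel))"
    by (subst lborel_eq, subst nn_integral_distr) auto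
  also have "\<dots> = (\<integral>\<^sup>+x. (\<Prod>b\<in>Basis. ennreal (exp (- (x b)\<^sup>2))) \<partial>Pi\<^sub>M (Basis::'a set) (\<lambda>_. lborel))"
  proof (intro nn_integral_cong)
    fix x :: "'a \<Rightarrow> real"
    have "(norm (\<Sum>b\<in>Basis. x b *\<^sub>R b :: 'a))\<^sup>2 = (\<Sum>b\<in>Basis. (x b)\<^sup>2)"
      by (rule trans[OF power2_norm_eq_inner trans[OF euclidean_inner]]) (simp add: power2_eq_square)
    then show "ennreal (exp (- (norm (\<Sum>b\<in>Basis. x b *\<^sub>R b :: 'a))\<^sup>2)) = (\<Prod>b\<in>Basis. ennreal (exp (- (x b)\<^sup>2)))"
      by (simp add: prod_ennreal exp_sum sum_negf[symmetric])
  qed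
  also have "\<dots> = (\<Prod>b\<in>(Basis::'a set). \<integral>\<^sup>+t. ennreal (exp (- t\<^sup>2)) \<partial>lborel)"
    by (rule product_nn_integral_prod) auto
  finally have eq: "(\<integral>\<^sup>+w. ennreal (exp (- (norm (w::'a))\<^sup>2)) \<partial>lborel) = (\<integral>\<^sup>+t. ennreal (exp (- t\<^sup>2)) \<partial>(lborel::real measure)) ^ DIM('a)"
    by simp
  have "exp (- t\<^sup>2) = sqrt pi * normal_density 0 (1 / sqrt 2) t" for t
    by (simp add: normal_density_def power_divide)
  then have "(\<integral>\<^sup>+t. ennreal (exp (- t\<^sup>2)) \<partial>lborel) = (\<integral>\<^sup>+t. ennreal (sqrt pi) * ennreal (normal_density 0 (1 / sqrt 2) t) \<partial>lborel)"
    by (simp add: ennreal_mult)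
  also have "\<dots> = ennreal (sqrt pi)"
    by (subst nn_integral_cmult) (auto simp: nn_integral_eq_integral)
  finally have one: "(\<integral>\<^sup>+t. ennreal (exp (- t\<^sup>2)) \<partial>(lborel::real measure)) = ennreal (sqrt pi)" .
  show "(\<integral>\<^sup>+w. ennreal (exp (- (norm (w::'a))\<^sup>2)) \<partial>lborel) < \<infinity>" "(\<integral>\<^sup>+w. ennreal (exp (- (norm (w::'a))\<^sup>2)) \<partial>lborel) > 0"
    unfolding eq one by (simp_all add: ennreal_power)
qed

text \<open>A Gaussian kernel is the transform of a Gaussian law, so Fubini expresses its integral against \<open>M\<close> through the
transform of \<open>M\<close>. The law of Brownian motion at time \<open>1\<close> will serve as \<open>G\<close>.\<close>

lemma gaussian_kernel_integral:
  fixes M G :: "'a::euclidean_space measure"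
  assumes G: "prob_space G" "sets G = sets borel" and M: "prob_space M" "sets M = sets borel"
    and charG: "\<And>\<xi>. (CLINT z|G. exp (- \<i> * complex_of_real (\<xi> \<bullet> z))) = complex_of_real (exp (- (norm \<xi>)\<^sup>2))"
  shows "complex_of_real (\<integral>x. exp (- (norm (\<sigma> *\<^sub>R (y - x)))\<^sup>2) \<partial>M) =
     (CLINT z|G. exp (- \<i> * complex_of_real ((\<sigma> *\<^sub>R y) \<bullet> z)) * (CLINT x|M. exp (- \<i> * complex_of_real ((- \<sigma> *\<^sub>R z) \<bullet> x))))"
proof -
  interpret G: prob_space G by fact
  interpret M: prob_space M by fact
  interpret pair_prob_space G M ..
  note [measurable_cong] = G(2) M(2)
  have "complex_of_real (\<integral>x. exp (- (norm (\<sigma> *\<^sub>R (y - x)))\<^sup>2) \<partial>M) = (CLINT x|M. complex_of_real (exp (- (norm (\<sigma> *\<^sub>R (y - x)))\<^sup>2)))"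
    by simp
  also have "\<dots> = (CLINT x|M. (CLINT z|G. exp (- \<i> * complex_of_real ((\<sigma> *\<^sub>R (y - x)) \<bullet> z))))"
    unfolding charG ..
  also have "\<dots> = (CLINT z|G. (CLINT x|M. exp (- \<i> * complex_of_real ((\<sigma> *\<^sub>R (y - x)) \<bullet> z))))"
  proof (rule Fubini_integral)
    show "integrable (G \<Otimes>\<^sub>M M) (\<lambda>(z, x). exp (- \<i> * complex_of_real ((\<sigma> *\<^sub>R (y - x)) \<bullet> z)))"
    proof (rule integrable_const_bound[where B=1])
      show "AE x in G \<Otimes>\<^sub>M M. norm (case x of (z, x) \<Rightarrow> exp (- \<i> * complex_of_real ((\<sigma> *\<^sub>R (y - x)) \<bullet> z))) \<le> 1"
        by (intro AE_I2) (auto simp: norm_exp_eq_Re)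
    qed measurable
  qed
  also have "\<dots> = (CLINT z|G. exp (- \<i> * complex_of_real ((\<sigma> *\<^sub>R y) \<bullet> z)) * (CLINT x|M. exp (- \<i> * complex_of_real ((- \<sigma> *\<^sub>R z) \<bullet> x))))"
  proof (rule Bochner_Integration.integral_cong[OF refl])
    fix z :: 'a
    have "exp (- \<i> * complex_of_real ((\<sigma> *\<^sub>R (y - x)) \<bullet> z)) = exp (- \<i> * complex_of_real ((\<sigma> *\<^sub>R y) \<bullet> z)) * exp (- \<i> * complex_of_real ((- \<sigma> *\<^sub>R z) \<bullet> x))" for x
      unfolding exp_add[symmetric] by (rule arg_cong[where f=exp]) (simp add: inner_diff_left inner_commute algebra_simps)
    then show "(CLINT x|M. exp (- \<i> * complex_of_real ((\<sigma> *\<^sub>R (y - x)) \<bullet> z))) =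
       exp (- \<i> * complex_of_real ((\<sigma> *\<^sub>R y) \<bullet> z)) * (CLINT x|M. exp (- \<i> * complex_of_real ((- \<sigma> *\<^sub>R z) \<bullet> x)))"
      by simp
  qed
  finally show ?thesis .
qed

text \<open>By the previous formula \<open>M\<close> and \<open>N\<close> have the same convolution with every Gaussian kernel, and convolution with
narrow kernels approximates the integral of a continuous function.\<close>

lemma measure_eqI_char:
  fixes M N G :: "'a::euclidean_space measure"
  assumes G: "prob_space G" "sets G = sets borel" and M: "prob_space M" "sets M = sets borel" and N: "prob_space N" "sets N = sets borel"
    and charG: "\<And>\<xi>. (CLINT z|G. exp (- \<i> * complex_of_real (\<xi> \<bullet> z))) = complex_of_real (exp (- (norm \<xi>)\<^sup>2))"
    and eq: "\<And>\<xi>. (CLINT z|M. exp (- \<i> * complex_of_real (\<xi> \<bullet> z))) = (CLINT z|N. exp (- \<i> * complex_of_real (\<xi> \<bullet> z)))"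
  shows "M = N"
proof (rule measure_eqI_continuous[OF M(2) N(2) M(1) N(1)])
  interpret M: prob_space M by fact
  interpret N: prob_space N by fact
  note [measurable_cong] = N(2) M(2)
  have kern: "(\<integral>x. exp (- (norm (\<sigma> *\<^sub>R (y - x)))\<^sup>2) \<partial>M) = (\<integral>x. exp (- (norm (\<sigma> *\<^sub>R (y - x)))\<^sup>2) \<partial>N)" for \<sigma> y
    using gaussian_kernel_integral[OF G M charG, of \<sigma> y]
    unfolding eq gaussian_kernel_integral[OF G N charG, of \<sigma> y, symmetric] of_real_eq_iff .
  fix f :: "'a \<Rightarrow> real" assume f: "continuous_on UNIV f" "\<And>x. 0 \<le> f x \<and> f x \<le> 1"
  have [measurable]: "f \<in> borel_measurable borel" by (intro borel_measurable_continuous_onI f)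
  define \<kappa> where "\<kappa> = (\<integral>w. exp (- (norm (w::'a))\<^sup>2) \<partial>lborel)"
  have iE: "integrable lborel (\<lambda>w::'a. exp (- (norm w)\<^sup>2))"
    using nn_integral_exp_norm_sq(1)[where 'a='a] by (intro integrableI_nonneg) auto
  have \<kappa>: "\<kappa> > 0"
  proof -
    have "ennreal \<kappa> = (\<integral>\<^sup>+w. ennreal (exp (- (norm (w::'a))\<^sup>2)) \<partial>lborel)"
      unfolding \<kappa>_def by (rule nn_integral_eq_integral[symmetric, OF iE]) simp
    then have "0 < ennreal \<kappa>" using nn_integral_exp_norm_sq(2)[where 'a='a] by (simp only:)
    then show ?thesis by (simp only: ennreal_less_zero_iff)
  qed
  define A where "A R n = (\<integral>x. (\<integral>w. f (x + (1 / real (Suc n)) *\<^sub>R w) * exp (- (norm w)\<^sup>2) \<partial>lborel) \<partial>R)" for R :: "'a measure" and n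
  have iw: "integrable lborel (\<lambda>w. f (x + c *\<^sub>R w) * exp (- (norm w)\<^sup>2))" for x c
    by (rule Bochner_Integration.integrable_bound[OF iE]) (use f(2) in \<open>auto simp: abs_mult mult_left_le_one_le\<close>)
  have main: "(\<lambda>n. A R n) \<longlonglongrightarrow> \<kappa> * (\<integral>x. f x \<partial>R)" 
    "A R n = enn2real (ennreal (real (Suc n) ^ DIM('a)) * (\<integral>\<^sup>+y. ennreal (f y) * ennreal (\<integral>x. exp (- (norm (real (Suc n) *\<^sub>R (y - x)))\<^sup>2) \<partial>R) \<partial>lborel))"
    if R: "prob_space R" "sets R = sets borel" for R n
  proof -
    interpret R: prob_space R by fact
    note [measurable_cong] = R(2)
    have bound: "norm (\<integral>w. f (x + c *\<^sub>R w) * exp (- (norm w)\<^sup>2) \<partial>lborel) \<le> \<kappa>" for x c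
    proof -
      have "norm (\<integral>w. f (x + c *\<^sub>R w) * exp (- (norm w)\<^sup>2) \<partial>lborel) \<le> (\<integral>w. norm (f (x + c *\<^sub>R w) * exp (- (norm w)\<^sup>2)) \<partial>lborel)"
        by (rule integral_norm_bound)
      also have "\<dots> \<le> \<kappa>" unfolding \<kappa>_def
        using f(2) by (intro integral_mono integrable_norm iw iE) (auto simp: abs_mult mult_left_le_one_le)
      finally show ?thesis .
    qed
    have inner_lim: "(\<lambda>n. \<integral>w. f (x + (1 / real (Suc n)) *\<^sub>R w) * exp (- (norm w)\<^sup>2) \<partial>lborel) \<longlonglongrightarrow> (\<integral>w. f x * exp (- (norm (w::'a))\<^sup>2) \<partial>lborel)" for x
    proof (rule integral_dominated_convergence[where w="\<lambda>w. exp (- (norm w)\<^sup>2)", OF _ _ iE])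
      show "AE w in lborel. (\<lambda>n. f (x + (1 / real (Suc n)) *\<^sub>R w) * exp (- (norm w)\<^sup>2)) \<longlonglongrightarrow> f x * exp (- (norm w)\<^sup>2)"
      proof (intro AE_I2 tendsto_intros)
        fix w :: 'a
        have "(\<lambda>n. x + (1 / real (Suc n)) *\<^sub>R w) \<longlonglongrightarrow> x + 0 *\<^sub>R w"
          by (intro tendsto_intros LIMSEQ_Suc lim_1_over_n)
        moreover have "isCont f x" using f(1) by (simp add: continuous_on_eq_continuous_at)
        ultimately show "(\<lambda>n. f (x + (1 / real (Suc n)) *\<^sub>R w)) \<longlonglongrightarrow> f x" by (intro isCont_tendsto_compose[of x f]) simp_all
      qed
    qed (use f(2) in \<open>auto simp: abs_mult mult_left_le_one_le\<close>)
    have "(\<lambda>n. A R n) \<longlonglongrightarrow> (\<integral>x. (\<integral>w. f x * exp (- (norm (w::'a))\<^sup>2) \<partial>lborel) \<partial>R)"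
      unfolding A_def
      by (rule integral_dominated_convergence[where w="\<lambda>_. \<kappa>"]) (use bound inner_lim in auto)
    then show "(\<lambda>n. A R n) \<longlonglongrightarrow> \<kappa> * (\<integral>x. f x \<partial>R)" by (simp add: \<kappa>_def mult.commute)
    define c where "c = real (Suc n)"
    have c: "c > 0" by (simp add: c_def)
    have iexp: "integrable R (\<lambda>x. exp (- (norm (c *\<^sub>R (y - x)))\<^sup>2))" for y
      by (intro R.integrable_const_bound[where B=1]) auto
    have "A R n = enn2real (\<integral>\<^sup>+x. ennreal (\<integral>w. f (x + (1 / c) *\<^sub>R w) * exp (- (norm w)\<^sup>2) \<partial>lborel) \<partial>R)"
      unfolding A_def c_def[symmetric]
      using f(2) by (intro integral_eq_nn_integral) (auto intro!: integral_nonneg_AE)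
    also have "(\<integral>\<^sup>+x. ennreal (\<integral>w. f (x + (1 / c) *\<^sub>R w) * exp (- (norm w)\<^sup>2) \<partial>lborel) \<partial>R) = (\<integral>\<^sup>+x. \<integral>\<^sup>+w. ennreal (f (x + (1 / c) *\<^sub>R w) * exp (- (norm w)\<^sup>2)) \<partial>lborel \<partial>R)"
      using f(2) by (intro nn_integral_cong nn_integral_eq_integral[symmetric] iw) auto
    also have "\<dots> = (\<integral>\<^sup>+x. ennreal (c ^ DIM('a)) * (\<integral>\<^sup>+y. ennreal (f y * exp (- (norm (c *\<^sub>R (y - x)))\<^sup>2)) \<partial>lborel) \<partial>R)"
    proof (rule nn_integral_cong)
      fix x
      have "(\<integral>\<^sup>+y. ennreal (f y * exp (- (norm (c *\<^sub>R (y - x)))\<^sup>2)) \<partial>lborel) =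
        ennreal ((1 / c) ^ DIM('a)) * (\<integral>\<^sup>+w. ennreal (f (x + (1 / c) *\<^sub>R w) * exp (- (norm (c *\<^sub>R (x + (1 / c) *\<^sub>R w - x)))\<^sup>2)) \<partial>lborel)"
        by (rule nn_integral_lborel_affine) (use c in auto)
      then have "ennreal (c ^ DIM('a)) * (\<integral>\<^sup>+y. ennreal (f y * exp (- (norm (c *\<^sub>R (y - x)))\<^sup>2)) \<partial>lborel) =
        (ennreal (c ^ DIM('a)) * ennreal ((1 / c) ^ DIM('a))) * (\<integral>\<^sup>+w. ennreal (f (x + (1 / c) *\<^sub>R w) * exp (- (norm w)\<^sup>2)) \<partial>lborel)"
        using c by (simp add: mult.assoc)
      also have "ennreal (c ^ DIM('a)) * ennreal ((1 / c) ^ DIM('a)) = 1"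
        using c by (simp add: ennreal_mult[symmetric] power_mult_distrib[symmetric])
      finally show "(\<integral>\<^sup>+w. ennreal (f (x + (1 / c) *\<^sub>R w) * exp (- (norm w)\<^sup>2)) \<partial>lborel) =
         ennreal (c ^ DIM('a)) * (\<integral>\<^sup>+y. ennreal (f y * exp (- (norm (c *\<^sub>R (y - x)))\<^sup>2)) \<partial>lborel)" by simp
    qed
    also have "\<dots> = ennreal (c ^ DIM('a)) * (\<integral>\<^sup>+x. \<integral>\<^sup>+y. ennreal (f y * exp (- (norm (c *\<^sub>R (y - x)))\<^sup>2)) \<partial>lborel \<partial>R)"
      by (rule nn_integral_cmult) measurable
    also have "(\<integral>\<^sup>+x. \<integral>\<^sup>+y. ennreal (f y * exp (- (norm (c *\<^sub>R (y - x)))\<^sup>2)) \<partial>lborel \<partial>R) = (\<integral>\<^sup>+y. \<integral>\<^sup>+x. ennreal (f y * exp (- (norm (c *\<^sub>R (y - x)))\<^sup>2)) \<partial>R \<partial>lborel)"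
    proof -
      interpret pair_sigma_finite lborel R ..
      show ?thesis by (rule Fubini') measurable
    qed
    also have "\<dots> = (\<integral>\<^sup>+y. ennreal (f y) * ennreal (\<integral>x. exp (- (norm (c *\<^sub>R (y - x)))\<^sup>2) \<partial>R) \<partial>lborel)"
    proof (rule nn_integral_cong)
      fix y
      have "(\<integral>\<^sup>+x. ennreal (f y * exp (- (norm (c *\<^sub>R (y - x)))\<^sup>2)) \<partial>R) = ennreal (f y) * (\<integral>\<^sup>+x. ennreal (exp (- (norm (c *\<^sub>R (y - x)))\<^sup>2)) \<partial>R)"
        using f(2) by (subst nn_integral_cmult[symmetric]) (auto simp: ennreal_mult)
      then show "(\<integral>\<^sup>+x. ennreal (f y * exp (- (norm (c *\<^sub>R (y - x)))\<^sup>2)) \<partial>R) = ennreal (f y) * ennreal (\<integral>x. exp (- (norm (c *\<^sub>R (y - x)))\<^sup>2) \<partial>R)"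
        by (simp only: nn_integral_eq_integral[OF iexp AE_I2[OF exp_ge_zero]])
    qed
    finally show "A R n = enn2real (ennreal (real (Suc n) ^ DIM('a)) * (\<integral>\<^sup>+y. ennreal (f y) * ennreal (\<integral>x. exp (- (norm (real (Suc n) *\<^sub>R (y - x)))\<^sup>2) \<partial>R) \<partial>lborel))"
      by (simp add: c_def)
  qed
  have AMN: "A M = A N" by (rule ext) (simp only: main(2)[OF M] main(2)[OF N] kern)
  have "\<kappa> * (\<integral>x. f x \<partial>M) = \<kappa> * (\<integral>x. f x \<partial>N)"
    by (rule LIMSEQ_unique[OF main(1)[OF M, unfolded AMN] main(1)[OF N]])
  then show "(\<integral>x. f x \<partial>M) = (\<integral>x. f x \<partial>N)" using \<kappa> by simp
qed

section \<open>One-dimensional Gaussian projections\<close>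

lemma gaussian_marginal:
  fixes M :: "'a::euclidean_space measure"
  assumes M: "prob_space M" "sets M = sets borel" and u: "u > 0" and e: "norm e = 1"
    and charM: "\<And>\<xi>. (CLINT z|M. exp (- \<i> * complex_of_real (\<xi> \<bullet> z))) = complex_of_real (exp (- u * (norm \<xi>)\<^sup>2))"
  shows "distr M borel (\<lambda>z. (z \<bullet> e) / sqrt (2 * u)) = std_normal_distribution"
proof -
  interpret M: prob_space M by fact
  note [measurable_cong] = M(2)
  let ?X = "\<lambda>z. (z \<bullet> e) / sqrt (2 * u)"
  interpret D: real_distribution "distr M borel ?X"
    by (intro real_distribution.intro M.prob_space_distr real_distribution_axioms.intro) auto
  show ?thesis
  proof (rule Levy_uniqueness[OF D.real_distribution_axioms real_dist_normal_dist], rule ext)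
    fix t :: real
    let ?c = "t / sqrt (2 * u)"
    have "char (distr M borel ?X) t = (CLINT z|M. exp (- \<i> * complex_of_real ((- ?c *\<^sub>R e) \<bullet> z)))"
      unfolding char_def by (subst integral_distr) (auto simp: inner_commute intro!: Bochner_Integration.integral_cong)
    also have "\<dots> = complex_of_real (exp (- u * (norm (- ?c *\<^sub>R e))\<^sup>2))" by (rule charM)
    also have "- u * (norm (- ?c *\<^sub>R e))\<^sup>2 = - (t\<^sup>2) / 2"
      using e u by (simp add: power_divide power_mult_distrib)
    finally show "char (distr M borel ?X) t = char std_normal_distribution t" by (simp add: char_std_normal_distribution)
  qed
qed

lemma std_normal_pos_part: 
  "integrable std_normal_distribution (\<lambda>x. max 0 (- x))" "(\<integral>x. max 0 (- x) \<partial>std_normal_distribution) = 1 / sqrt (2 * pi)"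
proof -
  have eq: "max 0 (- x) = (\<bar>x\<bar> - x) / 2" for x :: real by auto
  have i: "integrable std_normal_distribution (\<lambda>x. x)" "integrable std_normal_distribution (\<lambda>x::real. \<bar>x\<bar>)"
    using integrable_std_normal_distribution_moment[of 1] by auto
  then show "integrable std_normal_distribution (\<lambda>x. max 0 (- x))" unfolding eq by auto
  have 1: "(\<integral>x. x \<partial>std_normal_distribution) = 0" using integral_std_normal_distribution_moment_odd[of 1] by simp
  have 2: "(\<integral>x. \<bar>x\<bar> \<partial>std_normal_distribution) = sqrt (2 / pi)" using std_normal_distribution_odd_moments_abs[of 0] by simp
  have "(\<integral>x. max 0 (- x) \<partial>std_normal_distribution) = (sqrt (2 / pi) - 0) / 2"
    unfolding eq using i 1 2 by simp
  also have "\<dots> = 1 / sqrt (2 * pi)" by (simp add: real_sqrt_divide real_sqrt_mult field_simps)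
  finally show "(\<integral>x. max 0 (- x) \<partial>std_normal_distribution) = 1 / sqrt (2 * pi)" .
qed

text \<open>The density is at most \<open>1\<close> and half of the mass is positive.\<close>

lemma std_normal_tail:
  assumes "c \<ge> 0" shows "measure std_normal_distribution {c<..} \<ge> 1/2 - c"
proof -
  interpret real_distribution std_normal_distribution by (rule real_dist_normal_dist)
  have dens: "emeasure std_normal_distribution {x} = 0" for x
    by (subst emeasure_density) (auto intro!: nn_integral_0_iff_AE[THEN iffD2] AE_I'[of "{x}"] simp: indicator_def)
  have "emeasure std_normal_distribution {..<0} = (\<integral>\<^sup>+x. ennreal (std_normal_density x) * indicator {..<0} x \<partial>lborel)"
    by (rule emeasure_density) auto
  also have "\<dots> = ennreal \<bar>-1\<bar> * (\<integral>\<^sup>+x. ennreal (std_normal_density (0 + (-1) * x)) * indicator {..<0} (0 + (-1) * x) \<partial>lborel)"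
    by (rule nn_integral_real_affine) auto
  also have "\<dots> = (\<integral>\<^sup>+x. ennreal (std_normal_density x) * indicator {0<..} x \<partial>lborel)"
    by (auto simp: std_normal_density_def indicator_def intro!: nn_integral_cong)
  also have "\<dots> = emeasure std_normal_distribution {0<..}" by (rule emeasure_density[symmetric]) auto
  finally have sym: "measure std_normal_distribution {..<0} = measure std_normal_distribution {0<..}" by (simp add: measure_def)
  have z: "measure std_normal_distribution {0} = 0" using dens by (simp add: measure_def)
  have "1 = measure std_normal_distribution ({..<0} \<union> ({0} \<union> {0<..}))"
  proof -
    have "{..<0} \<union> ({0} \<union> {0<..}) = (UNIV::real set)" by auto
    then show ?thesis using prob_space by simp
  qed
  also have "\<dots> = measure std_normal_distribution {..<0} + (measure std_normal_distribution {0} + measure std_normal_distribution {0<..})"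
  proof -
    have "{..<0::real} \<inter> ({0} \<union> {0<..}) = {}" "{0::real} \<inter> {0<..} = {}" by (auto simp: disjoint_iff)
    then show ?thesis by (simp add: finite_measure_Union del: Un_insert_left Un_insert_right)
  qed
  finally have half: "measure std_normal_distribution {0<..} = 1 / 2" using sym z by simp
  have "emeasure std_normal_distribution {0<..c} = (\<integral>\<^sup>+x. ennreal (std_normal_density x) * indicator {0<..c} x \<partial>lborel)"
    by (rule emeasure_density) auto
  also have "\<dots> \<le> (\<integral>\<^sup>+x. indicator {0<..c} x \<partial>lborel)"
  proof (rule nn_integral_mono)
    fix x :: real
    have "1 \<le> sqrt (2 * pi)" by (rule real_le_rsqrt) (use pi_gt3 in simp)
    then have "1 / sqrt (2 * pi) \<le> 1" by (simp add: divide_le_eq_1)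
    then have "std_normal_density x \<le> 1" unfolding std_normal_density_def by (intro mult_le_one) auto
    then have "ennreal (std_normal_density x) \<le> 1" by simp
    then show "ennreal (std_normal_density x) * indicator {0<..c} x \<le> indicator {0<..c} x" by (auto simp: indicator_def)
  qed
  also have "\<dots> = ennreal c" using assms by simp
  finally have "measure std_normal_distribution {0<..c} \<le> c" using assms by (simp add: emeasure_eq_measure)
  moreover have "measure std_normal_distribution {0<..} = measure std_normal_distribution {0<..c} + measure std_normal_distribution {c<..}"
  proof -
    have eq: "{0<..} = {0<..c} \<union> {c<..}" using assms by auto
    show ?thesis unfolding eq by (rule finite_measure_Union) auto
  qed
  ultimately show ?thesis using half by simp
qed

section \<open>Brownian motion on a time grid\<close>

text \<open>The law of the displacement, which depends neither on the starting point nor on the space that carries the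
process.\<close>

definition heat_law :: "'w measure \<Rightarrow> (real \<Rightarrow> 'w \<Rightarrow> 'a::euclidean_space) \<Rightarrow> 'a \<Rightarrow> real \<Rightarrow> 'a measure" where
  "heat_law M W x u = distr M borel (\<lambda>\<omega>. W u \<omega> - x)"

locale brownian = prob_space M for M :: "'w measure" and W :: "real \<Rightarrow> 'w \<Rightarrow> 'a::euclidean_space" and x :: 'a +
  assumes bm: "brownian_motion M x W"
begin

lemma W_measurable [measurable]: "t \<ge> 0 \<Longrightarrow> W t \<in> borel_measurable M"
  using bm by (simp add: brownian_motion_def levy_process_def)

lemma start: "AE \<omega> in M. W 0 \<omega> = x"
  using bm by (simp add: brownian_motion_def)

lemma paths: "\<omega> \<in> space M \<Longrightarrow> continuous_on {0..} (\<lambda>t. W t \<omega>)"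
  using bm by (simp add: brownian_motion_def)

lemma W_char: "t \<ge> 0 \<Longrightarrow> (CLINT \<omega>|M. exp (- \<i> * complex_of_real (\<xi> \<bullet> (W t \<omega> - x)))) = complex_of_real (exp (- t * (norm \<xi>)\<^sup>2))"
  using bm by (simp add: brownian_motion_def)

lemma heat_law_prob: "t \<ge> 0 \<Longrightarrow> prob_space (heat_law M W x t)"
  unfolding heat_law_def by (intro prob_space_distr) measurable

lemma heat_law_sets [simp, measurable_cong]: "sets (heat_law M W x t) = sets borel"
  by (simp add: heat_law_def)

lemma heat_law_space [simp]: "space (heat_law M W x t) = UNIV"
  by (simp add: heat_law_def)

lemma heat_law_char: "t \<ge> 0 \<Longrightarrow> (CLINT z|heat_law M W x t. exp (- \<i> * complex_of_real (\<xi> \<bullet> z))) = complex_of_real (exp (- t * (norm \<xi>)\<^sup>2))"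
proof -
  assume t: "t \<ge> 0"
  have [measurable]: "W t \<in> borel_measurable M" using t by (rule W_measurable)
  have "(CLINT z|heat_law M W x t. exp (- \<i> * complex_of_real (\<xi> \<bullet> z))) = (CLINT \<omega>|M. exp (- \<i> * complex_of_real (\<xi> \<bullet> (W t \<omega> - x))))"
    unfolding heat_law_def by (rule integral_distr) measurable
  also have "\<dots> = complex_of_real (exp (- t * (norm \<xi>)\<^sup>2))" by (rule W_char[OF t])
  finally show ?thesis .
qed

lemma increment_law:
  assumes "0 \<le> s" "s \<le> t"
  shows "distr M borel (\<lambda>\<omega>. W t \<omega> - W s \<omega>) = heat_law M W x (t - s)"
proof -
  have "\<forall>s t. 0 \<le> s \<and> s \<le> t \<longrightarrow> distr M borel (\<lambda>\<omega>. W t \<omega> - W s \<omega>) = distr M borel (\<lambda>\<omega>. W (t - s) \<omega> - W 0 \<omega>)"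
    using bm unfolding brownian_motion_def levy_process_def by (elim conjE)
  then have "distr M borel (\<lambda>\<omega>. W t \<omega> - W s \<omega>) = distr M borel (\<lambda>\<omega>. W (t - s) \<omega> - W 0 \<omega>)"
    using assms by blast
  also have "\<dots> = heat_law M W x (t - s)"
    unfolding heat_law_def using start assms
    by (intro distr_cong_AE) (auto elim!: eventually_mono)
  finally show ?thesis .
qed

lemma increments_indep:
  assumes "0 \<le> t 0" "\<And>i. i < n \<Longrightarrow> t i \<le> t (Suc i)"
  shows "indep_vars (\<lambda>_. borel) (\<lambda>i \<omega>. W (t (Suc i)) \<omega> - W (t i) \<omega>) {..<n}"
  using bm assms unfolding brownian_motion_def levy_process_def by blast

lemma position_eq:
  assumes "t 0 = 0"
  shows "AE \<omega> in M. \<forall>i. W (t i) \<omega> = x + (\<Sum>l<i. W (t (Suc l)) \<omega> - W (t l) \<omega>)"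
  using start
proof eventually_elim
  fix \<omega> assume "W 0 \<omega> = x"
  then show "\<forall>i. W (t i) \<omega> = x + (\<Sum>l<i. W (t (Suc l)) \<omega> - W (t l) \<omega>)"
    using sum_lessThan_telescope[of "\<lambda>i. W (t i) \<omega>"] assms by simp
qed

lemma grid_nonneg:
  assumes "t 0 = 0" "\<And>i. i < n \<Longrightarrow> t i \<le> t (Suc i)" shows "i \<le> n \<Longrightarrow> (0::real) \<le> t i"
proof (induction i)
  case (Suc i) then show ?case using assms(2)[of i] by simp
qed (use assms in simp)

text \<open>On a grid the positions are partial sums of independent increments, so the event is one about a product measure. Two
Brownian motions thus hit a set on a grid with the same probability.\<close>

lemma grid_hit_law:
  assumes t: "t 0 = 0" "\<And>i. i < n \<Longrightarrow> t i \<le> t (Suc i)" and n: "n > 0" and A[measurable]: "A \<in> sets borel"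
  shows "measure M {\<omega>\<in>space M. \<exists>i\<le>n. y + W (t i) \<omega> \<in> A} =
    measure (Pi\<^sub>M {..<n} (\<lambda>i. heat_law M W x (t (Suc i) - t i)))
      {f\<in>space (Pi\<^sub>M {..<n} (\<lambda>_. borel)). \<exists>i\<le>n. y + x + (\<Sum>l<i. f l) \<in> A}"
proof -
  let ?X = "\<lambda>i \<omega>. W (t (Suc i)) \<omega> - W (t i) \<omega>"
  have rv[measurable]: "?X i \<in> borel_measurable M" if "i < n" for i
  proof -
    have "0 \<le> t i" "0 \<le> t (Suc i)" using grid_nonneg[OF t, where i=i] grid_nonneg[OF t, where i="Suc i"] that by auto
    then show ?thesis by measurable
  qed
  have tm[measurable]: "W (t i) \<in> borel_measurable M" if "i \<le> n" for i
    using grid_nonneg[OF t that] by measurable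
  have "distr M (Pi\<^sub>M {..<n} (\<lambda>_. borel)) (\<lambda>\<omega>. \<lambda>i\<in>{..<n}. ?X i \<omega>) = Pi\<^sub>M {..<n} (\<lambda>i. distr M borel (?X i))"
    by (rule indep_vars_iff_distr_eq_PiM'[THEN iffD1]) (use n t in \<open>auto intro!: increments_indep rv\<close>)
  also have "\<dots> = Pi\<^sub>M {..<n} (\<lambda>i. heat_law M W x (t (Suc i) - t i))"
    by (intro PiM_cong refl increment_law) (use grid_nonneg[OF t] t(2) in auto)
  finally have D: "Pi\<^sub>M {..<n} (\<lambda>i. heat_law M W x (t (Suc i) - t i)) = distr M (Pi\<^sub>M {..<n} (\<lambda>_. borel)) (\<lambda>\<omega>. \<lambda>i\<in>{..<n}. ?X i \<omega>)" ..
  let ?S = "{f\<in>space (Pi\<^sub>M {..<n} (\<lambda>_. borel)). \<exists>i\<le>n. y + x + (\<Sum>l<i. f l) \<in> A}"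
  have S: "?S \<in> sets (Pi\<^sub>M {..<n} (\<lambda>_. borel))"
  proof -
    have "(\<lambda>f. y + x + (\<Sum>l<i. f l)) \<in> borel_measurable (Pi\<^sub>M {..<n} (\<lambda>_. borel))" if "i \<le> n" for i
      using that by (intro borel_measurable_add borel_measurable_const borel_measurable_sum measurable_component_singleton) auto
    then have "{f\<in>space (Pi\<^sub>M {..<n} (\<lambda>_. borel)). y + x + (\<Sum>l<i. f l) \<in> A} \<in> sets (Pi\<^sub>M {..<n} (\<lambda>_. borel))" if "i \<le> n" for i
      using that by measurable
    then have "(\<Union>i\<le>n. {f\<in>space (Pi\<^sub>M {..<n} (\<lambda>_. borel)). y + x + (\<Sum>l<i. f l) \<in> A}) \<in> sets (Pi\<^sub>M {..<n} (\<lambda>_. borel))"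
      by (intro sets.finite_UN) auto
    also have "(\<Union>i\<le>n. {f\<in>space (Pi\<^sub>M {..<n} (\<lambda>_. borel)). y + x + (\<Sum>l<i. f l) \<in> A}) = ?S" by auto
    finally show ?thesis .
  qed
  have Xm: "(\<lambda>\<omega>. \<lambda>i\<in>{..<n}. ?X i \<omega>) \<in> M \<rightarrow>\<^sub>M Pi\<^sub>M {..<n} (\<lambda>_. borel)"
    by (intro measurable_restrict rv) auto
  have "measure (Pi\<^sub>M {..<n} (\<lambda>i. heat_law M W x (t (Suc i) - t i))) ?S = measure M ((\<lambda>\<omega>. \<lambda>i\<in>{..<n}. ?X i \<omega>) -` ?S \<inter> space M)"
    unfolding D by (rule measure_distr[OF Xm S])
  also have "\<dots> = measure M {\<omega>\<in>space M. \<exists>i\<le>n. y + W (t i) \<omega> \<in> A}"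
  proof (rule finite_measure_eq_AE)
    show "(\<lambda>\<omega>. \<lambda>i\<in>{..<n}. ?X i \<omega>) -` ?S \<inter> space M \<in> sets M" by (rule measurable_sets[OF Xm S])
    show "{\<omega>\<in>space M. \<exists>i\<le>n. y + W (t i) \<omega> \<in> A} \<in> sets M"
    proof -
      have "{\<omega>\<in>space M. \<exists>i\<le>n. y + W (t i) \<omega> \<in> A} = (\<Union>i\<le>n. {\<omega>\<in>space M. y + W (t i) \<omega> \<in> A})" by auto
      also have "\<dots> \<in> sets M" by (intro sets.finite_UN) auto
      finally show ?thesis .
    qed
    show "AE \<omega> in M. \<omega> \<in> (\<lambda>\<omega>. \<lambda>i\<in>{..<n}. ?X i \<omega>) -` ?S \<inter> space M \<longleftrightarrow> \<omega> \<in> {\<omega>\<in>space M. \<exists>i\<le>n. y + W (t i) \<omega> \<in> A}"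
      using position_eq[of t, OF t(1)] AE_space
    proof eventually_elim
      fix \<omega> assume pos: "\<forall>i. W (t i) \<omega> = x + (\<Sum>l<i. ?X l \<omega>)" and \<omega>: "\<omega> \<in> space M"
      define F where "F = (\<lambda>i\<in>{..<n}. ?X i \<omega>)"
      have 1: "F \<in> space (Pi\<^sub>M {..<n} (\<lambda>_. borel))" unfolding F_def using measurable_space[OF Xm \<omega>] .
      have 2: "y + x + (\<Sum>l<i. F l) = y + W (t i) \<omega>" if "i \<le> n" for i
      proof -
        have "(\<Sum>l<i. F l) = (\<Sum>l<i. ?X l \<omega>)"
          by (rule sum.cong[OF refl]) (use that in \<open>auto simp: F_def\<close>)
        then have "y + x + (\<Sum>l<i. F l) = y + (x + (\<Sum>l<i. ?X l \<omega>))" by (simp only: add.assoc)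
        also have "x + (\<Sum>l<i. ?X l \<omega>) = W (t i) \<omega>" by (rule pos[rule_format, symmetric])
        finally show ?thesis .
      qed
      have "F \<in> ?S \<longleftrightarrow> (\<exists>i\<le>n. y + W (t i) \<omega> \<in> A)" using 1 by (auto simp: 2)
      then show "\<omega> \<in> (\<lambda>\<omega>. \<lambda>i\<in>{..<n}. ?X i \<omega>) -` ?S \<inter> space M \<longleftrightarrow> \<omega> \<in> {\<omega>\<in>space M. \<exists>i\<le>n. y + W (t i) \<omega> \<in> A}"
        using \<omega> unfolding F_def vimage_def Int_iff mem_Collect_eq by blast
    qed
  qed
  finally show ?thesis ..
qed

text \<open>The event of a first hit at \<open>t i\<close> concerns the increments before \<open>t i\<close>, which are independent of the single
increment from \<open>t i\<close> to \<open>t n\<close>.\<close>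

lemma markov_at_first_hit:
  assumes t: "t 0 = 0" "\<And>i. i < n \<Longrightarrow> t i \<le> t (Suc i)" and i: "i \<le> n" and [measurable]: "A \<in> sets borel" "T \<in> sets borel"
    and q0: "q \<ge> 0" and q: "\<And>z. z \<in> A \<Longrightarrow> q \<le> measure (heat_law M W x (t n - t i)) {w. z + w \<in> T}"
  shows "q * measure M {\<omega>\<in>space M. y + W (t i) \<omega> \<in> A \<and> (\<forall>j<i. y + W (t j) \<omega> \<notin> A)}
     \<le> measure M {\<omega>\<in>space M. (y + W (t i) \<omega> \<in> A \<and> (\<forall>j<i. y + W (t j) \<omega> \<notin> A)) \<and> y + W (t n) \<omega> \<in> T}"
proof -
  have mono: "t j \<le> t k" if "j \<le> k" "k \<le> n" for j k
    using that
  proof (induction k)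
    case (Suc k) then show ?case using t(2)[of k] by (cases "j = Suc k") auto
  qed simp
  have nn: "0 \<le> t j" if "j \<le> n" for j using grid_nonneg[OF t that] .
  have tm[measurable]: "W (t j) \<in> borel_measurable M" if "j \<le> n" for j
    using nn[OF that] by measurable
  \<comment> \<open>The grid up to \<open>t i\<close>, followed by one jump to the final time.\<close>
  define s where "s j = (if j \<le> i then t j else t n)" for j
  define X where "X j \<omega> = W (s (Suc j)) \<omega> - W (s j) \<omega>" for j \<omega>
  have s: "s 0 = 0" "\<And>j. j < Suc i \<Longrightarrow> s j \<le> s (Suc j)" using t i mono by (auto simp: s_def)
  have Xm[measurable]: "X j \<in> borel_measurable M" if "j \<le> i" for j
    unfolding X_def[abs_def] s_def using that i by (auto intro!: borel_measurable_diff tm)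
  have ind: "indep_vars (\<lambda>_. borel) X {..<Suc i}"
    unfolding X_def[abs_def] by (rule increments_indep) (use s in auto)
  let ?P1 = "Pi\<^sub>M {..<i} (\<lambda>_. borel :: 'a measure)" and ?P2 = "Pi\<^sub>M {i} (\<lambda>_. borel :: 'a measure)"
  let ?X1 = "\<lambda>\<omega>. restrict (\<lambda>j. X j \<omega>) {..<i}" and ?X2 = "\<lambda>\<omega>. restrict (\<lambda>j. X j \<omega>) {i}"
  have "indep_var ?P1 ?X1 ?P2 ?X2" by (rule indep_var_restrict[OF ind]) auto
  then have J: "distr M ?P1 ?X1 \<Otimes>\<^sub>M distr M ?P2 ?X2 = distr M (?P1 \<Otimes>\<^sub>M ?P2) (\<lambda>\<omega>. (?X1 \<omega>, ?X2 \<omega>))"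
    and X1[measurable]: "?X1 \<in> M \<rightarrow>\<^sub>M ?P1" and X2[measurable]: "?X2 \<in> M \<rightarrow>\<^sub>M ?P2"
    unfolding indep_var_distribution_eq by auto
  define pos where "pos j f = y + x + (\<Sum>l<j. f l)" for j and f :: "nat \<Rightarrow> 'a"
  have posm[measurable]: "pos j \<in> borel_measurable ?P1" if "j \<le> i" for j
    unfolding pos_def[abs_def] using that
    by (intro borel_measurable_add borel_measurable_const borel_measurable_sum measurable_component_singleton) auto
  define S where "S = {f\<in>space ?P1. pos i f \<in> A \<and> (\<forall>j<i. pos j f \<notin> A)}"
  have S[measurable]: "S \<in> sets ?P1"
  proof -
    have "S = {f\<in>space ?P1. pos i f \<in> A} \<inter> (space ?P1 - (\<Union>j<i. {f\<in>space ?P1. pos j f \<in> A}))" by (auto simp: S_def)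
    also have "\<dots> \<in> sets ?P1" by (intro sets.Int sets.Diff sets.finite_UN sets.top) auto
    finally show ?thesis .
  qed
  define T' where "T' = {p\<in>space (?P1 \<Otimes>\<^sub>M ?P2). fst p \<in> S \<and> pos i (fst p) + snd p i \<in> T}"
  have gm[measurable]: "(\<lambda>g. g i) \<in> borel_measurable ?P2" by (rule measurable_component_singleton) simp
  have T'[measurable]: "T' \<in> sets (?P1 \<Otimes>\<^sub>M ?P2)" unfolding T'_def by measurable
  interpret D1: prob_space "distr M ?P1 ?X1" by (rule prob_space_distr) measurable
  interpret D2: prob_space "distr M ?P2 ?X2" by (rule prob_space_distr) measurable
  interpret D: pair_prob_space "distr M ?P1 ?X1" "distr M ?P2 ?X2" ..
  have X1S: "?X1 -` S \<inter> space M \<in> sets M" by (rule measurable_sets[OF X1 S])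
  have ae: "AE \<omega> in M. (\<omega> \<in> ?X1 -` S \<inter> space M \<longleftrightarrow> \<omega> \<in> {\<omega>\<in>space M. y + W (t i) \<omega> \<in> A \<and> (\<forall>j<i. y + W (t j) \<omega> \<notin> A)})
      \<and> (\<omega> \<in> (\<lambda>\<omega>. (?X1 \<omega>, ?X2 \<omega>)) -` T' \<inter> space M \<longleftrightarrow> \<omega> \<in> {\<omega>\<in>space M. (y + W (t i) \<omega> \<in> A \<and> (\<forall>j<i. y + W (t j) \<omega> \<notin> A)) \<and> y + W (t n) \<omega> \<in> T})"
    using position_eq[of s, OF s(1)] AE_space
  proof eventually_elim
    fix \<omega> assume p: "\<forall>j. W (s j) \<omega> = x + (\<Sum>l<j. W (s (Suc l)) \<omega> - W (s l) \<omega>)" and \<omega>: "\<omega> \<in> space M"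
    have 1: "?X1 \<omega> \<in> space ?P1" "?X2 \<omega> \<in> space ?P2" using measurable_space[OF X1 \<omega>] measurable_space[OF X2 \<omega>] .
    have 2: "pos j (?X1 \<omega>) = y + W (t j) \<omega>" if "j \<le> i" for j
    proof -
      have "(\<Sum>l<j. ?X1 \<omega> l) = (\<Sum>l<j. X l \<omega>)" using that by (intro sum.cong) auto
      moreover have "W (t j) \<omega> = x + (\<Sum>l<j. X l \<omega>)" 
      proof -
        have sj: "s j = t j" using that by (simp add: s_def)
        show ?thesis using p[rule_format, of j] by (simp only: X_def sj)
      qed
      ultimately show ?thesis by (simp add: pos_def add.assoc)
    qed
    have 3: "?X2 \<omega> i = W (t n) \<omega> - W (t i) \<omega>" by (simp add: X_def s_def)
    have 4: "?X1 \<omega> \<in> S \<longleftrightarrow> y + W (t i) \<omega> \<in> A \<and> (\<forall>j<i. y + W (t j) \<omega> \<notin> A)"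
      unfolding S_def using 1 2 by simp
    have 5: "pos i (?X1 \<omega>) + ?X2 \<omega> i = y + W (t n) \<omega>" using 2[of i] unfolding 3 by simp
    have 6: "(?X1 \<omega>, ?X2 \<omega>) \<in> T' \<longleftrightarrow> ?X1 \<omega> \<in> S \<and> y + W (t n) \<omega> \<in> T"
      unfolding T'_def using 1 5 by (simp add: space_pair_measure)
    show "(\<omega> \<in> ?X1 -` S \<inter> space M \<longleftrightarrow> \<omega> \<in> {\<omega>\<in>space M. y + W (t i) \<omega> \<in> A \<and> (\<forall>j<i. y + W (t j) \<omega> \<notin> A)})
      \<and> (\<omega> \<in> (\<lambda>\<omega>. (?X1 \<omega>, ?X2 \<omega>)) -` T' \<inter> space M \<longleftrightarrow> \<omega> \<in> {\<omega>\<in>space M. (y + W (t i) \<omega> \<in> A \<and> (\<forall>j<i. y + W (t j) \<omega> \<notin> A)) \<and> y + W (t n) \<omega> \<in> T})"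
      using \<omega> unfolding vimage_def Int_iff mem_Collect_eq 6 4 by blast
  qed
  have E: "{\<omega>\<in>space M. y + W (t i) \<omega> \<in> A \<and> (\<forall>j<i. y + W (t j) \<omega> \<notin> A)} \<in> sets M"
  proof -
    have "{\<omega>\<in>space M. y + W (t i) \<omega> \<in> A \<and> (\<forall>j<i. y + W (t j) \<omega> \<notin> A)} =
       {\<omega>\<in>space M. y + W (t i) \<omega> \<in> A} \<inter> (space M - (\<Union>j<i. {\<omega>\<in>space M. y + W (t j) \<omega> \<in> A}))" by auto
    also have "\<dots> \<in> sets M" using i by (intro sets.Int sets.Diff sets.finite_UN sets.top) auto
    finally show ?thesis .
  qed
  have ET: "{\<omega>\<in>space M. (y + W (t i) \<omega> \<in> A \<and> (\<forall>j<i. y + W (t j) \<omega> \<notin> A)) \<and> y + W (t n) \<omega> \<in> T} \<in> sets M"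
  proof -
    have "{\<omega>\<in>space M. (y + W (t i) \<omega> \<in> A \<and> (\<forall>j<i. y + W (t j) \<omega> \<notin> A)) \<and> y + W (t n) \<omega> \<in> T} =
       {\<omega>\<in>space M. y + W (t i) \<omega> \<in> A \<and> (\<forall>j<i. y + W (t j) \<omega> \<notin> A)} \<inter> {\<omega>\<in>space M. y + W (t n) \<omega> \<in> T}" by auto
    also have "\<dots> \<in> sets M" using E by (intro sets.Int) auto
    finally show ?thesis .
  qed
  have m1: "measure M {\<omega>\<in>space M. y + W (t i) \<omega> \<in> A \<and> (\<forall>j<i. y + W (t j) \<omega> \<notin> A)} = measure (distr M ?P1 ?X1) S"
    unfolding measure_distr[OF X1 S] by (rule finite_measure_eq_AE[OF _ E X1S], rule eventually_mono[OF ae], blast)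
  have pairm: "(\<lambda>\<omega>. (?X1 \<omega>, ?X2 \<omega>)) \<in> M \<rightarrow>\<^sub>M ?P1 \<Otimes>\<^sub>M ?P2" by measurable
  have m2: "measure M {\<omega>\<in>space M. (y + W (t i) \<omega> \<in> A \<and> (\<forall>j<i. y + W (t j) \<omega> \<notin> A)) \<and> y + W (t n) \<omega> \<in> T}
     = measure (distr M ?P1 ?X1 \<Otimes>\<^sub>M distr M ?P2 ?X2) T'"
    unfolding J measure_distr[OF pairm T']
    by (rule finite_measure_eq_AE[OF _ ET measurable_sets[OF pairm T']], rule eventually_mono[OF ae], blast)
  have "ennreal (q * measure (distr M ?P1 ?X1) S) = (\<integral>\<^sup>+f. ennreal q * indicator S f \<partial>distr M ?P1 ?X1)"
    using q0 by (simp add: nn_integral_cmult_indicator ennreal_mult D1.emeasure_eq_measure)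
  also have "\<dots> \<le> (\<integral>\<^sup>+f. emeasure (distr M ?P2 ?X2) (Pair f -` T') \<partial>distr M ?P1 ?X1)"
  proof (rule nn_integral_mono)
    fix f assume f: "f \<in> space (distr M ?P1 ?X1)"
    show "ennreal q * indicator S f \<le> emeasure (distr M ?P2 ?X2) (Pair f -` T')"
    proof (cases "f \<in> S")
      case True
      have [measurable]: "Pair f -` T' \<in> sets ?P2" by (rule sets_Pair1[OF T'])
      have "q \<le> measure (heat_law M W x (t n - t i)) {w. pos i f + w \<in> T}"
        using True by (intro q) (simp add: S_def)
      also have "\<dots> = measure (distr M borel (X i)) {w. pos i f + w \<in> T}"
        using increment_law[of "t i" "t n"] nn[OF i] mono[OF i] by (simp add: X_def[abs_def] s_def)
      also have "\<dots> = measure M (X i -` {w. pos i f + w \<in> T} \<inter> space M)"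
        by (rule measure_distr) measurable
      also have "X i -` {w. pos i f + w \<in> T} \<inter> space M = ?X2 -` (Pair f -` T') \<inter> space M"
        using True f measurable_space[OF X2] by (auto simp: T'_def space_pair_measure)
      also have "measure M (?X2 -` (Pair f -` T') \<inter> space M) = measure (distr M ?P2 ?X2) (Pair f -` T')"
        by (rule measure_distr[symmetric]) measurable
      finally show ?thesis using True by (simp add: D2.emeasure_eq_measure ennreal_leI)
    qed simp
  qed
  also have "\<dots> = emeasure (distr M ?P1 ?X1 \<Otimes>\<^sub>M distr M ?P2 ?X2) T'"
    by (rule D2.emeasure_pair_measure_alt[symmetric]) simp
  also have "\<dots> = ennreal (measure (distr M ?P1 ?X1 \<Otimes>\<^sub>M distr M ?P2 ?X2) T')" by (rule D.emeasure_eq_measure)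
  finally show ?thesis unfolding m1 m2 by (simp add: ennreal_le_iff)
qed

text \<open>Sum over the index of the first hit.\<close>

lemma grid_markov:
  assumes t: "t 0 = 0" "\<And>i. i < n \<Longrightarrow> t i \<le> t (Suc i)" and [measurable]: "A \<in> sets borel" "T \<in> sets borel"
    and q0: "q \<ge> 0" and q: "\<And>z i. i \<le> n \<Longrightarrow> z \<in> A \<Longrightarrow> q \<le> measure (heat_law M W x (t n - t i)) {w. z + w \<in> T}"
  shows "q * measure M {\<omega>\<in>space M. \<exists>i\<le>n. y + W (t i) \<omega> \<in> A}
     \<le> measure M {\<omega>\<in>space M. (\<exists>i\<le>n. y + W (t i) \<omega> \<in> A) \<and> y + W (t n) \<omega> \<in> T}"
proof -
  have tm[measurable]: "W (t j) \<in> borel_measurable M" if "j \<le> n" for j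
    using grid_nonneg[OF t that] by measurable
  define E where "E i = {\<omega>\<in>space M. y + W (t i) \<omega> \<in> A \<and> (\<forall>j<i. y + W (t j) \<omega> \<notin> A)}" for i
  define G where "G = {\<omega>\<in>space M. y + W (t n) \<omega> \<in> T}"
  have G: "G \<in> sets M" unfolding G_def by measurable
  have E: "E i \<in> sets M" if "i \<le> n" for i
  proof -
    have "E i = {\<omega>\<in>space M. y + W (t i) \<omega> \<in> A} \<inter> (space M - (\<Union>j<i. {\<omega>\<in>space M. y + W (t j) \<omega> \<in> A}))" by (auto simp: E_def)
    also have "\<dots> \<in> sets M" using that by (intro sets.Int sets.Diff sets.finite_UN sets.top) auto
    finally show ?thesis .
  qed
  have disj: "disjoint_family_on E {..n}"
    unfolding disjoint_family_on_def E_def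
  proof (intro ballI impI)
    fix i j :: nat assume "i \<noteq> j"
    then have "i < j \<or> j < i" by auto
    then show "{\<omega>\<in>space M. y + W (t i) \<omega> \<in> A \<and> (\<forall>j<i. y + W (t j) \<omega> \<notin> A)} \<inter> {\<omega>\<in>space M. y + W (t j) \<omega> \<in> A \<and> (\<forall>i<j. y + W (t i) \<omega> \<notin> A)} = {}"
      by blast
  qed
  have UN: "{\<omega>\<in>space M. \<exists>i\<le>n. y + W (t i) \<omega> \<in> A} = (\<Union>i\<in>{..n}. E i)"
  proof (intro set_eqI iffI)
    fix \<omega> assume "\<omega> \<in> {\<omega>\<in>space M. \<exists>i\<le>n. y + W (t i) \<omega> \<in> A}"
    then have \<omega>: "\<omega> \<in> space M" "\<exists>i. i \<le> n \<and> y + W (t i) \<omega> \<in> A" by auto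
    define i where "i = (LEAST i. i \<le> n \<and> y + W (t i) \<omega> \<in> A)"
    have "i \<le> n \<and> y + W (t i) \<omega> \<in> A" unfolding i_def by (rule LeastI_ex[OF \<omega>(2)])
    moreover have "y + W (t j) \<omega> \<notin> A" if "j < i" for j
      using not_less_Least[OF that[unfolded i_def]] calculation that by auto
    ultimately show "\<omega> \<in> (\<Union>i\<in>{..n}. E i)" using \<omega>(1) by (auto simp: E_def)
  qed (auto simp: E_def)
  have "q * measure M {\<omega>\<in>space M. \<exists>i\<le>n. y + W (t i) \<omega> \<in> A} = (\<Sum>i\<in>{..n}. q * measure M (E i))"
    unfolding UN sum_distrib_left[symmetric]
    using E disj by (subst finite_measure_finite_Union) auto
  also have "\<dots> \<le> (\<Sum>i\<in>{..n}. measure M (E i \<inter> G))"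
  proof (rule sum_mono)
    fix i assume "i \<in> {..n}"
    then have i: "i \<le> n" by simp
    have eq: "E i \<inter> G = {\<omega>\<in>space M. (y + W (t i) \<omega> \<in> A \<and> (\<forall>j<i. y + W (t j) \<omega> \<notin> A)) \<and> y + W (t n) \<omega> \<in> T}"
      by (auto simp: E_def G_def)
    show "q * measure M (E i) \<le> measure M (E i \<inter> G)"
      unfolding eq unfolding E_def by (rule markov_at_first_hit[OF t i _ _ q0 q[OF i]]) auto
  qed
  also have "\<dots> = measure M (\<Union>i\<in>{..n}. E i \<inter> G)"
    using E G disj by (subst finite_measure_finite_Union) (auto simp: disjoint_family_on_def)
  also have "(\<Union>i\<in>{..n}. E i \<inter> G) = {\<omega>\<in>space M. (\<exists>i\<le>n. y + W (t i) \<omega> \<in> A) \<and> y + W (t n) \<omega> \<in> T}"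
    using UN by (auto simp: G_def)
  finally show ?thesis .
qed

end

section \<open>Hitting a closed set\<close>

definition hits :: "(real \<Rightarrow> 'a) \<Rightarrow> real \<Rightarrow> 'a set \<Rightarrow> bool" where
  "hits f u K \<longleftrightarrow> (\<exists>s\<in>{0..u}. f s \<in> K)"

text \<open>Dyadic grids are nested, so these events increase with \<open>n\<close>. Nearness replaces hitting because a path that touches a
thin set may miss it on every grid.\<close>

definition grid_near :: "(real \<Rightarrow> 'a::metric_space) \<Rightarrow> real \<Rightarrow> 'a set \<Rightarrow> real \<Rightarrow> nat \<Rightarrow> bool" where
  "grid_near f u K c n \<longleftrightarrow> (\<exists>i\<le>(2::nat)^n. f (real i * (u / 2^n)) \<in> {z. infdist z K < c})"

lemma grid_near_mono: "grid_near f u K c n \<Longrightarrow> grid_near f u K c (Suc n)"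
proof -
  assume "grid_near f u K c n"
  then obtain i where i: "i \<le> 2^n" "infdist (f (real i * (u / 2^n))) K < c" by (auto simp: grid_near_def)
  have "real (2 * i) * (u / 2 ^ Suc n) = real i * (u / 2^n)" by simp
  then show ?thesis unfolding grid_near_def using i by (intro exI[of _ "2 * i"]) auto
qed

lemma near_iff_grid_near:
  assumes cont: "continuous_on {0..u} f" and u: "u > 0"
  shows "(\<exists>s\<in>{0..u}. infdist (f s) K < c) \<longleftrightarrow> (\<exists>n. grid_near f u K c n)"
proof
  assume "\<exists>n. grid_near f u K c n"
  then obtain n i where i: "i \<le> (2::nat)^n" "infdist (f (real i * (u / 2^n))) K < c" by (auto simp: grid_near_def)
  have "real i \<le> 2 ^ n" using i(1) by (metis of_nat_le_iff of_nat_numeral of_nat_power)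
  then have "real i * (u / 2^n) \<le> 2 ^ n * (u / 2^n)" using u by (intro mult_right_mono) auto
  then have "real i * (u / 2^n) \<in> {0..u}" using u by simp
  then show "\<exists>s\<in>{0..u}. infdist (f s) K < c" using i(2) by blast
next
  assume "\<exists>s\<in>{0..u}. infdist (f s) K < c"
  then obtain s where s: "s \<in> {0..u}" "infdist (f s) K < c" by auto
  have ci: "continuous_on {0..u} (\<lambda>s. infdist (f s) K)" by (intro continuous_intros cont)
  define \<epsilon> where "\<epsilon> = c - infdist (f s) K"
  have "\<epsilon> > 0" using s by (simp add: \<epsilon>_def)
  with ci s(1) obtain d where d: "d > 0" "\<And>s'. s' \<in> {0..u} \<Longrightarrow> dist s' s < d \<Longrightarrow> dist (infdist (f s') K) (infdist (f s) K) < \<epsilon>"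
    unfolding continuous_on_iff by metis
  obtain n where n: "u / d < 2 ^ n" using real_arch_pow[of 2 "u / d"] by auto
  have un: "u / 2 ^ n < d" using n d by (simp add: field_simps)
  define i where "i = nat \<lfloor>s / (u / 2^n)\<rfloor>"
  have nn: "0 \<le> s / (u / 2 ^ n)" using s u by auto
  have i: "real i \<le> s / (u / 2^n)" "s / (u / 2^n) < real i + 1" using nn unfolding i_def by linarith+
  have i1: "real i * (u / 2^n) \<le> s" using i(1) u by (simp add: field_simps)
  have "s < (real i + 1) * (u / 2^n)" using i(2) u by (simp add: field_simps)
  moreover have "(real i + 1) * (u / 2^n) = real i * (u / 2^n) + u / 2^n" by (simp only: distrib_right mult_1_left)
  ultimately have i2: "s - real i * (u / 2^n) < d" using un by linarith
  have "s / (u / 2^n) \<le> u / (u / 2^n)" using s u by (intro divide_right_mono) auto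
  moreover have "u / (u / 2^n) = 2 ^ n" using u by simp
  ultimately have "real i \<le> 2 ^ n" using i(1) by linarith
  then have i3: "i \<le> 2 ^ n" by (metis of_nat_le_iff of_nat_numeral of_nat_power)
  have m: "real i * (u / 2^n) \<in> {0..u}" using i1 s u by auto
  have "dist (infdist (f (real i * (u / 2^n))) K) (infdist (f s) K) < \<epsilon>"
    using i1 i2 by (intro d(2)[OF m]) (simp add: dist_real_def)
  then have "infdist (f (real i * (u / 2^n))) K < c" by (simp add: \<epsilon>_def dist_real_def)
  then show "\<exists>n. grid_near f u K c n" using i3 unfolding grid_near_def by blast
qed

lemma hits_iff_near:
  assumes cont: "continuous_on {0..u} f" and u: "u > 0" and K: "closed K" "K \<noteq> {}"
  shows "hits f u K \<longleftrightarrow> (\<forall>m. \<exists>s\<in>{0..u}. infdist (f s) K < 1 / real (Suc m))"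
proof
  assume "hits f u K"
  then obtain s where "s \<in> {0..u}" "f s \<in> K" by (auto simp: hits_def)
  then show "\<forall>m. \<exists>s\<in>{0..u}. infdist (f s) K < 1 / real (Suc m)" by (intro allI bexI[of _ s]) auto
next
  assume *: "\<forall>m. \<exists>s\<in>{0..u}. infdist (f s) K < 1 / real (Suc m)"
  have ci: "continuous_on {0..u} (\<lambda>s. infdist (f s) K)" by (intro continuous_intros cont)
  obtain s where s: "s \<in> {0..u}" "\<And>s'. s' \<in> {0..u} \<Longrightarrow> infdist (f s) K \<le> infdist (f s') K"
    using continuous_attains_inf[OF _ _ ci] u by auto
  have "infdist (f s) K < 1 / real (Suc m)" for m using * s(2) by (meson le_less_trans)
  then have "infdist (f s) K \<le> 0"
    by (metis not_le reals_Archimedean inverse_eq_divide less_asym)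
  then have "infdist (f s) K = 0" using infdist_nonneg[of "f s" K] by linarith
  then have "f s \<in> K" using in_closed_iff_infdist_zero[OF K] by simp
  then show "hits f u K" using s(1) by (auto simp: hits_def)
qed

lemma borel_measurable_infdist_set [measurable (raw)]:
  "f \<in> borel_measurable N \<Longrightarrow> (\<lambda>z. infdist (f z) K) \<in> borel_measurable N"
  by (rule borel_measurable_continuous_on[of "\<lambda>z. infdist z K"]) (intro continuous_intros)

lemma grid_near_measurable:
  fixes Z :: "real \<Rightarrow> 'z \<Rightarrow> 'a::euclidean_space"
  assumes Z: "\<And>s. 0 \<le> s \<Longrightarrow> s \<le> u \<Longrightarrow> Z s \<in> borel_measurable N" and u: "u > 0"
  shows "{z\<in>space N. grid_near (\<lambda>s. Z s z) u K c n} \<in> sets N"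
proof -
  have "{z\<in>space N. grid_near (\<lambda>s. Z s z) u K c n} = (\<Union>i\<in>{..2^n}. {z\<in>space N. infdist (Z (real i * (u / 2^n)) z) K < c})"
    by (auto simp: grid_near_def)
  also have "\<dots> \<in> sets N"
  proof (intro sets.finite_UN)
    fix i :: nat assume "i \<in> {..2^n}"
    then have "real i \<le> 2 ^ n" by (metis atMost_iff of_nat_le_iff of_nat_numeral of_nat_power)
    then have "real i * (u / 2^n) \<le> 2 ^ n * (u / 2^n)" using u by (intro mult_right_mono) auto
    then have [measurable]: "Z (real i * (u / 2^n)) \<in> borel_measurable N" using u by (intro Z) auto
    show "{z\<in>space N. infdist (Z (real i * (u / 2^n)) z) K < c} \<in> sets N" by measurable
  qed simp
  finally show ?thesis .
qed

lemma near_measurable: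
  fixes Z :: "real \<Rightarrow> 'z \<Rightarrow> 'a::euclidean_space"
  assumes Z: "\<And>s. 0 \<le> s \<Longrightarrow> s \<le> u \<Longrightarrow> Z s \<in> borel_measurable N" and u: "u > 0"
    and cont: "\<And>z. z \<in> space N \<Longrightarrow> continuous_on {0..u} (\<lambda>s. Z s z)"
  shows "{z\<in>space N. \<exists>s\<in>{0..u}. infdist (Z s z) K < c} \<in> sets N"
proof -
  have "{z\<in>space N. \<exists>s\<in>{0..u}. infdist (Z s z) K < c} = (\<Union>n. {z\<in>space N. grid_near (\<lambda>s. Z s z) u K c n})"
    using near_iff_grid_near[OF cont u, where K = K and c = c] by blast
  also have "\<dots> \<in> sets N" using grid_near_measurable[OF Z u] by auto
  finally show ?thesis .
qed

lemma hits_measurable: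
  fixes Z :: "real \<Rightarrow> 'z \<Rightarrow> 'a::euclidean_space"
  assumes Z: "\<And>s. 0 \<le> s \<Longrightarrow> s \<le> u \<Longrightarrow> Z s \<in> borel_measurable N" and u: "u > 0"
    and cont: "\<And>z. z \<in> space N \<Longrightarrow> continuous_on {0..u} (\<lambda>s. Z s z)" and K: "closed K"
  shows "{z\<in>space N. hits (\<lambda>s. Z s z) u K} \<in> sets N"
proof (cases "K = {}")
  case True then show ?thesis by (simp add: hits_def)
next
  case False
  have "{z\<in>space N. hits (\<lambda>s. Z s z) u K} = (\<Inter>m. {z\<in>space N. \<exists>s\<in>{0..u}. infdist (Z s z) K < 1 / real (Suc m)})"
    using hits_iff_near[OF cont u K False] by blast
  also have "\<dots> \<in> sets N" using near_measurable[OF Z u cont] by (intro sets.countable_INT') auto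
  finally show ?thesis .
qed

context brownian
begin

lemma shifted_path: 
  "0 \<le> s \<Longrightarrow> (\<lambda>\<omega>. y + W s \<omega>) \<in> borel_measurable M" "\<omega> \<in> space M \<Longrightarrow> continuous_on {0..u} (\<lambda>s. y + W s \<omega>)"
  by (auto intro!: continuous_intros continuous_on_subset[OF paths])

lemma near_prob_limit:
  assumes u: "u > 0" and G: "G \<in> sets M"
  shows "(\<lambda>n. measure M ({\<omega>\<in>space M. grid_near (\<lambda>s. y + W s \<omega>) u K c n} \<inter> G))
      \<longlonglongrightarrow> measure M ({\<omega>\<in>space M. \<exists>s\<in>{0..u}. infdist (y + W s \<omega>) K < c} \<inter> G)"
proof -
  have eq: "{\<omega>\<in>space M. \<exists>s\<in>{0..u}. infdist (y + W s \<omega>) K < c} \<inter> G = (\<Union>n. {\<omega>\<in>space M. grid_near (\<lambda>s. y + W s \<omega>) u K c n} \<inter> G)"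
    using near_iff_grid_near[OF shifted_path(2) u, where K = K and c = c] by blast
  show ?thesis unfolding eq
    using grid_near_measurable[OF shifted_path(1) u] G grid_near_mono
    by (intro finite_Lim_measure_incseq) (auto intro!: incseq_SucI)
qed

lemma hits_prob_limit:
  assumes u: "u > 0" and K: "closed K" "K \<noteq> {}" and G: "\<And>m. G m \<in> sets M" "decseq G"
  shows "(\<lambda>m. measure M ({\<omega>\<in>space M. \<exists>s\<in>{0..u}. infdist (y + W s \<omega>) K < 1 / real (Suc m)} \<inter> G m))
      \<longlonglongrightarrow> measure M ({\<omega>\<in>space M. hits (\<lambda>s. y + W s \<omega>) u K} \<inter> (\<Inter>m. G m))"
proof -
  have eq: "{\<omega>\<in>space M. hits (\<lambda>s. y + W s \<omega>) u K} \<inter> (\<Inter>m. G m) = (\<Inter>m. {\<omega>\<in>space M. \<exists>s\<in>{0..u}. infdist (y + W s \<omega>) K < 1 / real (Suc m)} \<inter> G m)"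
    using hits_iff_near[OF shifted_path(2) u K] by blast
  have dec: "decseq (\<lambda>m. {\<omega>\<in>space M. \<exists>s\<in>{0..u}. infdist (y + W s \<omega>) K < 1 / real (Suc m)})"
  proof (rule decseq_SucI, safe)
    fix m \<omega> s assume "s \<in> {0..u}" "infdist (y + W s \<omega>) K < 1 / real (Suc (Suc m))"
    moreover have "1 / real (Suc (Suc m)) \<le> 1 / real (Suc m)" by (simp add: field_simps)
    ultimately show "\<exists>s\<in>{0..u}. infdist (y + W s \<omega>) K < 1 / real (Suc m)" by (meson less_le_trans)
  qed
  show ?thesis unfolding eq
  proof (rule finite_Lim_measure_decseq)
    show "range (\<lambda>m. {\<omega>\<in>space M. \<exists>s\<in>{0..u}. infdist (y + W s \<omega>) K < 1 / real (Suc m)} \<inter> G m) \<subseteq> sets M"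
      using near_measurable[OF shifted_path(1) u shifted_path(2)] G(1) by auto
    show "decseq (\<lambda>m. {\<omega>\<in>space M. \<exists>s\<in>{0..u}. infdist (y + W s \<omega>) K < 1 / real (Suc m)} \<inter> G m)"
      using dec G(2) unfolding decseq_def by blast
  qed
qed

text \<open>On a grid the first time at which the path is within \<open>c\<close> of \<open>K\<close> satisfies the Markov property, and there a point of
\<open>K\<close> at distance below \<open>c\<close> transfers the hypothesis to the \<open>c\<close>-neighbourhood of \<open>F\<close>. Refining the grid and then letting
\<open>c\<close> tend to \<open>0\<close> gives the claim, without stopping times or a filtration.\<close>

theorem hitting_markov:
  assumes u: "u > 0" and K: "closed K" "K \<noteq> {}" and F: "closed F" "F \<noteq> {}" and q0: "q \<ge> 0"
    and q: "\<And>p s. p \<in> K \<Longrightarrow> 0 \<le> s \<Longrightarrow> s \<le> u \<Longrightarrow> q \<le> measure (heat_law M W x s) {w. p + w \<in> F}"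
  shows "q * measure M {\<omega>\<in>space M. hits (\<lambda>s. y + W s \<omega>) u K}
     \<le> measure M {\<omega>\<in>space M. hits (\<lambda>s. y + W s \<omega>) u K \<and> y + W u \<omega> \<in> F}"
proof -
  have u0: "u \<ge> 0" using u by simp
  have [measurable]: "F \<in> sets borel" using F by simp
  have [measurable]: "W u \<in> borel_measurable M" by (rule W_measurable[OF u0])
  define G where "G c = {\<omega>\<in>space M. infdist (y + W u \<omega>) F \<le> c}" for c
  have G[measurable]: "G c \<in> sets M" for c unfolding G_def by measurable
  have step: "q * measure M ({\<omega>\<in>space M. \<exists>s\<in>{0..u}. infdist (y + W s \<omega>) K < c} \<inter> space M)
     \<le> measure M ({\<omega>\<in>space M. \<exists>s\<in>{0..u}. infdist (y + W s \<omega>) K < c} \<inter> G c)" for c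
  proof (rule LIMSEQ_le[OF tendsto_mult[OF tendsto_const near_prob_limit[OF u sets.top]] near_prob_limit[OF u G]], intro exI allI impI)
    fix n :: nat
    let ?A = "{z. infdist z K < c}" and ?T = "{z. infdist z F \<le> c}"
    define t where "t i = real i * (u / 2^n)" for i
    have t: "t 0 = 0" "\<And>i. i < (2::nat)^n \<Longrightarrow> t i \<le> t (Suc i)" using u by (auto simp: t_def field_simps)
    have tn: "t (2^n) = u" by (simp add: t_def)
    have "q * measure M {\<omega>\<in>space M. \<exists>i\<le>2^n. y + W (t i) \<omega> \<in> ?A}
       \<le> measure M {\<omega>\<in>space M. (\<exists>i\<le>2^n. y + W (t i) \<omega> \<in> ?A) \<and> y + W (t (2^n)) \<omega> \<in> ?T}"
    proof (rule grid_markov[OF t _ _ q0])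
      show "?A \<in> sets borel" "?T \<in> sets borel" by measurable
      fix z i assume i: "i \<le> (2::nat)^n" and z: "z \<in> ?A"
      have "real i \<le> 2 ^ n" using i by (metis of_nat_le_iff of_nat_numeral of_nat_power)
      then have "real i * (u / 2^n) \<le> 2 ^ n * (u / 2^n)" using u by (intro mult_right_mono) auto
      then have s: "0 \<le> t (2^n) - t i" "t (2^n) - t i \<le> u" using u unfolding tn by (auto simp: t_def)
      obtain p where p: "p \<in> K" "dist z p < c"
        using z K(2) infdist_attains_inf[OF K] by (metis mem_Collect_eq)
      interpret H: prob_space "heat_law M W x (t (2^n) - t i)" by (rule heat_law_prob[OF s(1)])
      have "q \<le> measure (heat_law M W x (t (2^n) - t i)) {w. p + w \<in> F}" using q[OF p(1) s] .
      also have "\<dots> \<le> measure (heat_law M W x (t (2^n) - t i)) {w. z + w \<in> ?T}"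
      proof (rule H.finite_measure_mono)
        show "{w. p + w \<in> F} \<subseteq> {w. z + w \<in> ?T}"
        proof safe
          fix w assume "p + w \<in> F"
          then have "infdist (z + w) F \<le> dist (z + w) (p + w)" by (rule infdist_le)
          then show "infdist (z + w) F \<le> c" using p(2) by simp
        qed
      qed measurable
      finally show "q \<le> measure (heat_law M W x (t (2^n) - t i)) {w. z + w \<in> ?T}" .
    qed
    moreover have "{\<omega>\<in>space M. \<exists>i\<le>2^n. y + W (t i) \<omega> \<in> ?A} = {\<omega>\<in>space M. grid_near (\<lambda>s. y + W s \<omega>) u K c n} \<inter> space M"
      unfolding grid_near_def t_def by blast
    moreover have "{\<omega>\<in>space M. (\<exists>i\<le>2^n. y + W (t i) \<omega> \<in> ?A) \<and> y + W (t (2^n)) \<omega> \<in> ?T}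
        = {\<omega>\<in>space M. grid_near (\<lambda>s. y + W s \<omega>) u K c n} \<inter> G c"
      unfolding tn unfolding grid_near_def t_def G_def by blast
    ultimately show "q * measure M ({\<omega>\<in>space M. grid_near (\<lambda>s. y + W s \<omega>) u K c n} \<inter> space M)
       \<le> measure M ({\<omega>\<in>space M. grid_near (\<lambda>s. y + W s \<omega>) u K c n} \<inter> G c)"
      by simp
  qed
  have dec: "decseq (\<lambda>m. G (1 / real (Suc m)))"
    unfolding decseq_def G_def by (auto intro: order_trans simp: frac_le)
  have "q * measure M ({\<omega>\<in>space M. hits (\<lambda>s. y + W s \<omega>) u K} \<inter> (\<Inter>m::nat. space M))
    \<le> measure M ({\<omega>\<in>space M. hits (\<lambda>s. y + W s \<omega>) u K} \<inter> (\<Inter>m. G (1 / real (Suc m))))"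
    by (rule LIMSEQ_le[OF tendsto_mult[OF tendsto_const hits_prob_limit[OF u K sets.top]] hits_prob_limit[OF u K G dec]])
       (use step in \<open>auto simp: decseq_def\<close>)
  moreover have "{\<omega>\<in>space M. hits (\<lambda>s. y + W s \<omega>) u K} \<inter> (\<Inter>m::nat. space M) = {\<omega>\<in>space M. hits (\<lambda>s. y + W s \<omega>) u K}" by auto
  moreover have "{\<omega>\<in>space M. hits (\<lambda>s. y + W s \<omega>) u K} \<inter> (\<Inter>m. G (1 / real (Suc m))) = {\<omega>\<in>space M. hits (\<lambda>s. y + W s \<omega>) u K \<and> y + W u \<omega> \<in> F}"
  proof -
    have "z \<in> F" if "\<And>m. infdist z F \<le> 1 / real (Suc m)" for z
    proof -
      have "infdist z F \<le> 0" using that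
        by (intro tendsto_lowerbound[OF LIMSEQ_Suc[OF lim_1_over_n]]) auto
      then have "infdist z F = 0" using infdist_nonneg[of z F] by linarith
      then show ?thesis using in_closed_iff_infdist_zero[OF F] by simp
    qed
    then show ?thesis by (auto simp: G_def)
  qed
  ultimately show ?thesis by simp
qed

end

text \<open>The law at time \<open>1\<close> provides the Gaussian that the uniqueness of transforms asks for.\<close>

lemma heat_law_unique:
  assumes "brownian M W x" "brownian M' W' x'" "t \<ge> 0"
  shows "heat_law M W x t = heat_law M' W' x' t"
proof -
  interpret A: brownian M W x by fact
  interpret B: brownian M' W' x' by fact
  show ?thesis
  proof (rule measure_eqI_char[where G="heat_law M W x 1"])
    show "(CLINT z|heat_law M W x 1. exp (- \<i> * complex_of_real (\<xi> \<bullet> z))) = complex_of_real (exp (- (norm \<xi>)\<^sup>2))" for \<xi>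
      using A.heat_law_char[of 1 \<xi>] by simp
    show "(CLINT z|heat_law M W x t. exp (- \<i> * complex_of_real (\<xi> \<bullet> z))) = (CLINT z|heat_law M' W' x' t. exp (- \<i> * complex_of_real (\<xi> \<bullet> z)))" for \<xi>
      unfolding A.heat_law_char[OF assms(3)] B.heat_law_char[OF assms(3)] ..
  qed (use assms in \<open>auto intro: A.heat_law_prob B.heat_law_prob\<close>)
qed

text \<open>Hitting probabilities are double limits of probabilities of grid events, and these depend only on the heat laws.\<close>

lemma hits_prob_transfer:
  assumes "brownian M W x" "brownian M' W' 0" and u: "u > 0" and K: "closed K"
  shows "measure M {\<omega>\<in>space M. hits (\<lambda>s. W s \<omega>) u K} = measure M' {\<omega>\<in>space M'. hits (\<lambda>s. x + W' s \<omega>) u K}"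
proof (cases "K = {}")
  case True then show ?thesis by (simp add: hits_def)
next
  case False
  interpret A: brownian M W x by fact
  interpret B: brownian M' W' 0 by fact
  have grid: "measure M {\<omega>\<in>space M. grid_near (\<lambda>s. W s \<omega>) u K c n} = measure M' {\<omega>\<in>space M'. grid_near (\<lambda>s. x + W' s \<omega>) u K c n}" for c n
  proof -
    define t where "t i = real i * (u / 2^n)" for i
    have t: "t 0 = 0" "\<And>i. i < (2::nat)^n \<Longrightarrow> t i \<le> t (Suc i)" using u by (auto simp: t_def field_simps)
    have A: "{z. infdist z K < c} \<in> sets borel" by measurable
    have n: "0 < (2::nat) ^ n" by simp
    have "Pi\<^sub>M {..<2^n} (\<lambda>i. heat_law M W x (t (Suc i) - t i)) = Pi\<^sub>M {..<2^n} (\<lambda>i. heat_law M' W' 0 (t (Suc i) - t i))"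
      using t(2) by (intro PiM_cong refl heat_law_unique[OF assms(1,2)]) auto
    then have "measure M {\<omega>\<in>space M. \<exists>i\<le>2^n. 0 + W (t i) \<omega> \<in> {z. infdist z K < c}} = measure M' {\<omega>\<in>space M'. \<exists>i\<le>2^n. x + W' (t i) \<omega> \<in> {z. infdist z K < c}}"
      using A.grid_hit_law[where n="2^n" and t=t and y=0, OF t n A] B.grid_hit_law[where n="2^n" and t=t and y=x, OF t n A] by simp
    then show ?thesis by (simp add: grid_near_def t_def)
  qed
  have near: "measure M {\<omega>\<in>space M. \<exists>s\<in>{0..u}. infdist (W s \<omega>) K < c} = measure M' {\<omega>\<in>space M'. \<exists>s\<in>{0..u}. infdist (x + W' s \<omega>) K < c}" for c
  proof (rule LIMSEQ_unique)
    show "(\<lambda>n. measure M {\<omega>\<in>space M. grid_near (\<lambda>s. W s \<omega>) u K c n}) \<longlonglongrightarrow> measure M {\<omega>\<in>space M. \<exists>s\<in>{0..u}. infdist (W s \<omega>) K < c}"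
      using A.near_prob_limit[OF u sets.top, of 0 K c] by (simp add: Int_absorb2 Collect_conj_eq[symmetric])
    show "(\<lambda>n. measure M {\<omega>\<in>space M. grid_near (\<lambda>s. W s \<omega>) u K c n}) \<longlonglongrightarrow> measure M' {\<omega>\<in>space M'. \<exists>s\<in>{0..u}. infdist (x + W' s \<omega>) K < c}"
      unfolding grid using B.near_prob_limit[OF u sets.top, of x K c] by (simp add: Int_absorb2 Collect_conj_eq[symmetric])
  qed
  show ?thesis
  proof (rule LIMSEQ_unique)
    show "(\<lambda>m. measure M {\<omega>\<in>space M. \<exists>s\<in>{0..u}. infdist (W s \<omega>) K < 1 / real (Suc m)}) \<longlonglongrightarrow> measure M {\<omega>\<in>space M. hits (\<lambda>s. W s \<omega>) u K}"
      using A.hits_prob_limit[OF u K False, of "\<lambda>_. space M" 0] by (simp add: decseq_def Int_absorb2)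
    show "(\<lambda>m. measure M {\<omega>\<in>space M. \<exists>s\<in>{0..u}. infdist (W s \<omega>) K < 1 / real (Suc m)}) \<longlonglongrightarrow> measure M' {\<omega>\<in>space M'. hits (\<lambda>s. x + W' s \<omega>) u K}"
      unfolding near using B.hits_prob_limit[OF u K False, of "\<lambda>_. space M'" x] by (simp add: decseq_def Int_absorb2)
  qed
qed

section \<open>Exit loss of Brownian motion\<close>

context brownian
begin

lemma marginal_distr:
  assumes "u > 0" "norm e = 1"
  shows "distr (heat_law M W x u) borel (\<lambda>z. (z \<bullet> e) / sqrt (2 * u)) = std_normal_distribution"
  using assms by (intro gaussian_marginal heat_law_prob heat_law_char) auto

lemma marginal_square:
  assumes u: "u > 0" and e: "norm e = 1"
  shows "integrable (heat_law M W x u) (\<lambda>z. (z \<bullet> e)\<^sup>2)" "(\<integral>z. (z \<bullet> e)\<^sup>2 \<partial>heat_law M W x u) = 2 * u"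
proof -
  let ?X = "\<lambda>z. (z \<bullet> e) / sqrt (2 * u)"
  have eq: "(z \<bullet> e)\<^sup>2 = 2 * u * (?X z)\<^sup>2" for z using u by (simp add: power_divide)
  have [measurable]: "?X \<in> borel_measurable (heat_law M W x u)" by measurable
  have "integrable (distr (heat_law M W x u) borel ?X) (\<lambda>y. y\<^sup>2)"
    unfolding marginal_distr[OF u e] using integrable_std_normal_distribution_moment[of 2] .
  then have i: "integrable (heat_law M W x u) (\<lambda>z. (?X z)\<^sup>2)" by (subst (asm) integrable_distr_eq) auto
  then show "integrable (heat_law M W x u) (\<lambda>z. (z \<bullet> e)\<^sup>2)" unfolding eq by (rule integrable_mult_right)
  have "(\<integral>z. (?X z)\<^sup>2 \<partial>heat_law M W x u) = (\<integral>y. y\<^sup>2 \<partial>distr (heat_law M W x u) borel ?X)"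
    by (subst integral_distr) auto
  also have "\<dots> = 1" unfolding marginal_distr[OF u e] using std_normal_distribution_even_moments(1)[of 1] by simp
  finally show "(\<integral>z. (z \<bullet> e)\<^sup>2 \<partial>heat_law M W x u) = 2 * u"
    unfolding eq using i by simp
qed

lemma heat_law_family: "heat_family (heat_law M W x) (2 * real DIM('a))"
proof (rule heat_family.intro)
  fix u :: real assume u: "u > 0"
  show "prob_space (heat_law M W x u)" using u by (intro heat_law_prob) simp
  show "sets (heat_law M W x u) = sets borel" by simp
  have nsq: "(norm z)\<^sup>2 = (\<Sum>b\<in>Basis. (z \<bullet> b)\<^sup>2)" for z :: 'a by (rule norm_sq_sum_Basis)
  show "integrable (heat_law M W x u) (\<lambda>z. (norm z)\<^sup>2)"
    unfolding nsq using marginal_square(1)[OF u] by (intro Bochner_Integration.integrable_sum) auto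
  have "(\<integral>z. (norm z)\<^sup>2 \<partial>heat_law M W x u) = (\<Sum>b\<in>(Basis::'a set). 2 * u)"
    unfolding nsq using marginal_square[OF u] by (subst Bochner_Integration.integral_sum) auto
  then show "(\<integral>z. (norm z)\<^sup>2 \<partial>heat_law M W x u) \<le> 2 * real DIM('a) * u" by simp
next
  fix u :: real and e :: 'a assume u: "u > 0" and e: "norm e = 1"
  let ?X = "\<lambda>z. (z \<bullet> e) / sqrt (2 * u)"
  have eq: "max 0 (- (z \<bullet> e)) = sqrt (2 * u) * max 0 (- ?X z)" for z using u by (auto simp: max_def zero_le_divide_iff field_simps)
  have [measurable]: "?X \<in> borel_measurable (heat_law M W x u)" by measurable
  have "integrable (distr (heat_law M W x u) borel ?X) (\<lambda>y. max 0 (- y))"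
    unfolding marginal_distr[OF u e] by (rule std_normal_pos_part)
  then have i: "integrable (heat_law M W x u) (\<lambda>z. max 0 (- ?X z))" by (subst (asm) integrable_distr_eq) auto
  have "(\<integral>z. max 0 (- ?X z) \<partial>heat_law M W x u) = (\<integral>y. max 0 (- y) \<partial>distr (heat_law M W x u) borel ?X)"
    by (subst integral_distr) auto
  also have "\<dots> = 1 / sqrt (2 * pi)" unfolding marginal_distr[OF u e] by (rule std_normal_pos_part)
  finally have v: "(\<integral>z. max 0 (- ?X z) \<partial>heat_law M W x u) = 1 / sqrt (2 * pi)" .
  have "sqrt (2 * u) * (1 / sqrt (2 * pi)) = sqrt (u / pi)" by (simp add: real_sqrt_mult real_sqrt_divide)
  then show "has_bochner_integral (heat_law M W x u) (\<lambda>z. max 0 (- (z \<bullet> e))) (sqrt (u / pi))"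
    unfolding eq has_bochner_integral_iff using i v by simp
qed

sublocale heat: heat_family "heat_law M W x" "2 * real DIM('a)"
  by (rule heat_law_family)

lemma half_space_prob:
  assumes u: "u > 0" and e: "norm e = 1" and a: "a \<ge> 0"
  shows "1/2 - a \<le> measure (heat_law M W x u) {z. a * sqrt u < z \<bullet> e}"
proof -
  let ?X = "\<lambda>z. (z \<bullet> e) / sqrt (2 * u)"
  have "1/2 - a \<le> 1/2 - a / sqrt 2"
  proof -
    have "a / sqrt 2 \<le> a / 1" using a by (intro divide_left_mono) auto
    then show ?thesis by simp
  qed
  also have "\<dots> \<le> measure std_normal_distribution {a / sqrt 2<..}" using a by (intro std_normal_tail) auto
  also have "\<dots> = measure (heat_law M W x u) (?X -` {a / sqrt 2<..} \<inter> space (heat_law M W x u))"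
    unfolding marginal_distr[OF u e, symmetric] by (rule measure_distr) auto
  also have "?X -` {a / sqrt 2<..} \<inter> space (heat_law M W x u) = {z. a * sqrt u < z \<bullet> e}"
    using u by (auto simp: real_sqrt_mult field_simps)
  finally show ?thesis .
qed

lemma heat_law_0:
  assumes "closed F" "p \<in> F" shows "measure (heat_law M W x 0) {w. p + w \<in> F} = 1"
proof -
  have [measurable]: "F \<in> sets borel" using assms by simp
  have "measure (heat_law M W x 0) {w. p + w \<in> F} = measure M ((\<lambda>\<omega>. W 0 \<omega> - x) -` {w. p + w \<in> F} \<inter> space M)"
    unfolding heat_law_def by (rule measure_distr) measurable
  also have "\<dots> = measure M (space M)"
    by (rule finite_measure_eq_AE) (use start assms in \<open>auto elim!: eventually_mono\<close>)
  finally show ?thesis by (simp add: prob_space)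
qed

lemma chebyshev_far:
  assumes u: "u > 0" and T: "T > 0"
  shows "measure (heat_law M W x u) {z. T * sqrt u \<le> norm z} \<le> 2 * real DIM('a) / T\<^sup>2"
proof -
  interpret H: prob_space "heat_law M W x u" by (rule heat.prob[OF u])
  have "measure (heat_law M W x u) {z\<in>space (heat_law M W x u). T\<^sup>2 * u \<le> (norm z)\<^sup>2} \<le> (\<integral>z. (norm z)\<^sup>2 \<partial>heat_law M W x u) / (T\<^sup>2 * u)"
    by (rule integral_Markov_inequality_measure[where A="{}"]) (use heat.second_moment[OF u] u T in auto)
  also have "\<dots> \<le> (2 * real DIM('a) * u) / (T\<^sup>2 * u)"
    using heat.second_moment(2)[OF u] u by (intro divide_right_mono) auto
  also have "\<dots> = 2 * real DIM('a) / T\<^sup>2" using u by simp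
  also have "{z\<in>space (heat_law M W x u). T\<^sup>2 * u \<le> (norm z)\<^sup>2} = {z. T * sqrt u \<le> norm z}"
  proof -
    have "T\<^sup>2 * u \<le> (norm z)\<^sup>2 \<longleftrightarrow> T * sqrt u \<le> norm z" for z :: 'a
      using abs_le_square_iff[of "T * sqrt u" "norm z"] u T by (simp add: power_mult_distrib)
    then show ?thesis by simp
  qed
  finally show ?thesis .
qed

text \<open>At scale \<open>sqrt s\<close> the boundary near \<open>p\<close> stays within \<open>\<eta> * T * sqrt s\<close> of a hyperplane except for displacements larger than
\<open>T * sqrt s\<close>, which are unlikely; and a half-space at distance \<open>\<eta> * T * sqrt s\<close> has mass nearly one half. The flatness
\<open>\<eta>\<close> is chosen after \<open>T\<close>, and both are uniform in \<open>p\<close>.\<close>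

lemma half_mass_at_boundary:
  assumes flat: "flat_boundary \<Omega>" and \<epsilon>: "\<epsilon> > 0"
  obtains u0 where "u0 > 0" "\<And>p s. p \<in> frontier \<Omega> \<Longrightarrow> 0 \<le> s \<Longrightarrow> s \<le> u0 \<Longrightarrow> 1/2 - \<epsilon> \<le> measure (heat_law M W x s) {w. p + w \<in> - \<Omega>}"
    "\<And>p s. p \<in> frontier \<Omega> \<Longrightarrow> 0 \<le> s \<Longrightarrow> s \<le> u0 \<Longrightarrow> 1/2 - \<epsilon> \<le> measure (heat_law M W x s) {w. p + w \<in> closure \<Omega>}"
proof -
  have op: "open \<Omega>" using flat by (simp add: flat_boundary_def)
  have [measurable]: "\<Omega> \<in> sets borel" "closure \<Omega> \<in> sets borel" using op by simp_all
  define C where "C = 2 * real DIM('a)"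
  have C: "C > 0" by (simp add: C_def)
  define T where "T = sqrt (2 * C / \<epsilon>)"
  have T: "T > 0" "C / T\<^sup>2 = \<epsilon> / 2" using C \<epsilon> by (simp_all add: T_def)
  define \<eta> where "\<eta> = \<epsilon> / (2 * T)"
  have \<eta>: "\<eta> > 0" "\<eta> * T = \<epsilon> / 2" using T \<epsilon> by (simp_all add: \<eta>_def)
  obtain \<rho> where \<rho>: "\<rho> > 0" "\<And>p. p \<in> frontier \<Omega> \<Longrightarrow> \<exists>e. flat_at \<Omega> \<eta> \<rho> p e"
    using flat \<eta> unfolding flat_boundary_def by meson
  define u0 where "u0 = (\<rho> / (2 * T))\<^sup>2"
  have u0: "u0 > 0" using \<rho> T by (simp add: u0_def)
  have core: "1/2 - \<epsilon> \<le> measure (heat_law M W x s) {w. p + w \<notin> \<Omega>} \<and> 1/2 - \<epsilon> \<le> measure (heat_law M W x s) {w. p + w \<in> \<Omega>}"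
    if p: "p \<in> frontier \<Omega>" and s: "0 < s" "s \<le> u0" for p s
  proof -
    interpret H: prob_space "heat_law M W x s" by (rule heat.prob[OF s(1)])
    obtain e \<psi> where e: "norm e = 1" and \<psi>: "\<psi> 0 = 0" "\<eta>-lipschitz_on {v. v \<bullet> e = 0 \<and> norm v \<le> \<rho>} \<psi>"
      "\<And>y. y \<in> ball p \<rho> \<Longrightarrow> y \<in> \<Omega> \<longleftrightarrow> \<psi> (along e (y - p)) < (y - p) \<bullet> e"
      using \<rho>(2)[OF p] unfolding flat_at_def by auto
    have "sqrt s \<le> \<rho> / (2 * T)" using s \<rho> T by (intro real_le_lsqrt) (auto simp: u0_def)
    then have "T * sqrt s \<le> \<rho> / 2" using T by (simp add: field_simps)
    then have Ts: "T * sqrt s < \<rho>" using \<rho> by simp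
    have near: "p + w \<in> \<Omega> \<longleftrightarrow> \<psi> (along e w) < w \<bullet> e" "\<bar>\<psi> (along e w)\<bar> \<le> \<eta> * T * sqrt s" if w: "norm w < T * sqrt s" for w
    proof -
      have "p + w \<in> ball p \<rho>" using w Ts by (simp add: dist_norm)
      from \<psi>(3)[OF this] show "p + w \<in> \<Omega> \<longleftrightarrow> \<psi> (along e w) < w \<bullet> e" by simp
      have nl: "norm (along e w) \<le> norm w" by (rule norm_along_le[OF e])
      have "dist (\<psi> (along e w)) (\<psi> 0) \<le> \<eta> * dist (along e w) 0"
        using nl w Ts e \<rho> by (intro lipschitz_onD[OF \<psi>(2)]) (auto simp: along_orthogonal)
      then have "\<bar>\<psi> (along e w)\<bar> \<le> \<eta> * norm (along e w)" using \<psi>(1) by (simp add: dist_real_def)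
      also have "\<dots> \<le> \<eta> * (T * sqrt s)" using nl w \<eta> by (intro mult_left_mono) auto
      finally show "\<bar>\<psi> (along e w)\<bar> \<le> \<eta> * T * sqrt s" by (simp add: mult.assoc)
    qed
    have far: "measure (heat_law M W x s) {z. T * sqrt s \<le> norm z} \<le> \<epsilon> / 2"
      using chebyshev_far[OF s(1) T(1)] T(2) by (simp add: C_def)
    have sub: "measure (heat_law M W x s) A \<le> measure (heat_law M W x s) B + measure (heat_law M W x s) {z. T * sqrt s \<le> norm z}"
      if "A \<subseteq> B \<union> {z. T * sqrt s \<le> norm z}" "B \<in> sets borel" for A B
    proof -
      have F: "{z. T * sqrt s \<le> norm z} \<in> sets (heat_law M W x s)" by measurable
      have "measure (heat_law M W x s) A \<le> measure (heat_law M W x s) (B \<union> {z. T * sqrt s \<le> norm z})"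
        using that F by (intro H.finite_measure_mono) auto
      also have "\<dots> \<le> measure (heat_law M W x s) B + measure (heat_law M W x s) {z. T * sqrt s \<le> norm z}"
        using that(2) F by (intro measure_Un_le) auto
      finally show ?thesis .
    qed
    have \<eta>T: "\<eta> * T \<ge> 0" using \<eta> T by simp
    have "1/2 - \<eta> * T \<le> measure (heat_law M W x s) {z. \<eta> * T * sqrt s < z \<bullet> e}"
      using half_space_prob[OF s(1) e \<eta>T] .
    also have "\<dots> \<le> measure (heat_law M W x s) {w. p + w \<in> \<Omega>} + measure (heat_law M W x s) {z. T * sqrt s \<le> norm z}"
      by (rule sub) (use near in \<open>fastforce simp: not_le\<close>, measurable)
    finally have 1: "1/2 - \<epsilon> \<le> measure (heat_law M W x s) {w. p + w \<in> \<Omega>}" using far \<eta>(2) by linarith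
    have "1/2 - \<eta> * T \<le> measure (heat_law M W x s) {z. \<eta> * T * sqrt s < z \<bullet> (- e)}"
      using half_space_prob[OF s(1) _ \<eta>T, of "- e"] e by simp
    also have "\<dots> \<le> measure (heat_law M W x s) {w. p + w \<notin> \<Omega>} + measure (heat_law M W x s) {z. T * sqrt s \<le> norm z}"
      by (rule sub) (use near in \<open>fastforce simp: not_le\<close>, measurable)
    finally have 2: "1/2 - \<epsilon> \<le> measure (heat_law M W x s) {w. p + w \<notin> \<Omega>}" using far \<eta>(2) by linarith
    show ?thesis using 1 2 by simp
  qed
  show thesis
  proof (rule that[OF u0])
    fix p s assume p: "p \<in> frontier \<Omega>" and s: "0 \<le> s" "s \<le> u0"
    have pF: "p \<in> - \<Omega>" "p \<in> closure \<Omega>" using p op by (auto simp: frontier_def interior_open)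
    show "1/2 - \<epsilon> \<le> measure (heat_law M W x s) {w. p + w \<in> - \<Omega>}"
    proof (cases "s = 0")
      case True then show ?thesis using heat_law_0[of "- \<Omega>" p] op pF \<epsilon> by (simp add: closed_def)
    next
      case False then show ?thesis using core[OF p _ s(2)] s by simp
    qed
    show "1/2 - \<epsilon> \<le> measure (heat_law M W x s) {w. p + w \<in> closure \<Omega>}"
    proof (cases "s = 0")
      case True then show ?thesis using heat_law_0[of "closure \<Omega>" p] pF \<epsilon> by simp
    next
      case False
      then interpret H: prob_space "heat_law M W x s" using s by (intro heat.prob) simp
      have "measure (heat_law M W x s) {w. p + w \<in> \<Omega>} \<le> measure (heat_law M W x s) {w. p + w \<in> closure \<Omega>}"
        using closure_subset[of \<Omega>] by (intro H.finite_measure_mono) auto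
      then show ?thesis using core[OF p _ s(2)] s False by simp
    qed
  qed
qed

end

locale std_brownian = brownian M W 0 for M :: "'w measure" and W :: "real \<Rightarrow> 'w \<Rightarrow> 'a::euclidean_space"
begin

text \<open>The starting points inside \<open>\<Omega>\<close> are charged with the probability of reaching the boundary by time \<open>u\<close>; for continuous
paths this is the probability of having left \<open>\<Omega>\<close>.\<close>

definition exit_loss :: "'a set \<Rightarrow> real \<Rightarrow> ennreal" where
  "exit_loss \<Omega> u = (\<integral>\<^sup>+y. emeasure M {\<omega>\<in>space M. hits (\<lambda>s. y + W s \<omega>) u (frontier \<Omega>)} * indicator \<Omega> y \<partial>lborel)"

lemma hits_emeasure_measurable:
  assumes u: "u > 0" and K: "closed K"
  shows "(\<lambda>y. emeasure M {\<omega>\<in>space M. hits (\<lambda>s. y + W s \<omega>) u K}) \<in> borel_measurable lborel"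
proof -
  have "{p\<in>space (lborel \<Otimes>\<^sub>M M). hits (\<lambda>s. fst p + W s (snd p)) u K} \<in> sets (lborel \<Otimes>\<^sub>M M)"
    by (rule hits_measurable[OF _ u _ K])
       (auto simp: space_pair_measure intro!: continuous_intros continuous_on_subset[OF paths])
  from measurable_emeasure_Pair[OF this] show ?thesis
    by (rule measurable_cong[THEN iffD1, rotated]) (auto simp: space_pair_measure intro!: arg_cong[where f="emeasure M"])
qed

lemma out_emeasure_measurable:
  assumes u: "u \<ge> 0" and [measurable]: "A \<in> sets borel"
  shows "(\<lambda>y. emeasure M {\<omega>\<in>space M. y + W u \<omega> \<in> A}) \<in> borel_measurable lborel"
proof -
  have "{p\<in>space (lborel \<Otimes>\<^sub>M M). fst p + W u (snd p) \<in> A} \<in> sets (lborel \<Otimes>\<^sub>M M)"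
    using u by measurable
  from measurable_emeasure_Pair[OF this] show ?thesis
    by (rule measurable_cong[THEN iffD1, rotated]) (auto simp: space_pair_measure intro!: arg_cong[where f="emeasure M"])
qed

lemma lborel_translate: "A \<in> sets borel \<Longrightarrow> emeasure lborel {y. y + z \<in> A} = emeasure lborel (A :: 'a set)"
proof -
  assume [measurable]: "A \<in> sets borel"
  have "emeasure lborel A = emeasure (distr lborel borel ((+) z)) A" by (simp add: lborel_distr_plus)
  also have "\<dots> = emeasure lborel {y. y + z \<in> A}" by (subst emeasure_distr) (auto simp: vimage_def add.commute)
  finally show ?thesis by simp
qed

lemma integral_position:
  assumes u: "u \<ge> 0" and [measurable]: "A \<in> sets borel" "G \<in> sets borel"
  shows "(\<integral>\<^sup>+y. emeasure M {\<omega>\<in>space M. y + W u \<omega> \<in> A} * indicator G y \<partial>lborel) = (\<integral>\<^sup>+z. emeasure lborel {y\<in>G. y + z \<in> A} \<partial>heat_law M W 0 u)"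
proof -
  interpret pair_sigma_finite lborel M ..
  have [measurable]: "W u \<in> borel_measurable M" using u by measurable
  have "(\<integral>\<^sup>+z. emeasure lborel {y\<in>G. y + z \<in> A} \<partial>heat_law M W 0 u) = (\<integral>\<^sup>+\<omega>. emeasure lborel {y\<in>G. y + W u \<omega> \<in> A} \<partial>M)"
  proof -
    have "{p \<in> space (borel \<Otimes>\<^sub>M borel). snd p \<in> G \<and> snd p + fst p \<in> A} \<in> sets ((borel::'a measure) \<Otimes>\<^sub>M borel)" by measurable
    then have "{p \<in> space (borel \<Otimes>\<^sub>M borel). snd p \<in> G \<and> snd p + fst p \<in> A} \<in> sets ((borel::'a measure) \<Otimes>\<^sub>M lborel)"
      by (simp cong: sets_pair_measure_cong)
    from lborel.measurable_emeasure_Pair[OF this] have "(\<lambda>z. emeasure lborel {y\<in>G. y + z \<in> A}) \<in> borel_measurable borel"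
      by (rule measurable_cong[THEN iffD1, rotated]) (auto simp: space_pair_measure intro!: arg_cong[where f="emeasure lborel"])
    then show ?thesis unfolding heat_law_def by (subst nn_integral_distr) auto
  qed
  also have "\<dots> = (\<integral>\<^sup>+\<omega>. \<integral>\<^sup>+y. indicator G y * indicator A (y + W u \<omega>) \<partial>lborel \<partial>M)"
  proof (rule nn_integral_cong)
    fix \<omega>
    have "emeasure lborel {y\<in>G. y + W u \<omega> \<in> A} = (\<integral>\<^sup>+y. indicator {y\<in>G. y + W u \<omega> \<in> A} y \<partial>lborel)"
      by (rule nn_integral_indicator[symmetric]) measurable
    also have "\<dots> = (\<integral>\<^sup>+y. indicator G y * indicator A (y + W u \<omega>) \<partial>lborel)"
      by (rule nn_integral_cong) (auto simp: indicator_def)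
    finally show "emeasure lborel {y\<in>G. y + W u \<omega> \<in> A} = (\<integral>\<^sup>+y. indicator G y * indicator A (y + W u \<omega>) \<partial>lborel)" .
  qed
  also have "\<dots> = (\<integral>\<^sup>+y. \<integral>\<^sup>+\<omega>. indicator G y * indicator A (y + W u \<omega>) \<partial>M \<partial>lborel)"
    by (rule Fubini') measurable
  also have "\<dots> = (\<integral>\<^sup>+y. emeasure M {\<omega>\<in>space M. y + W u \<omega> \<in> A} * indicator G y \<partial>lborel)"
  proof (rule nn_integral_cong)
    fix y :: 'a
    have "(\<integral>\<^sup>+\<omega>. indicator G y * indicator A (y + W u \<omega>) \<partial>M) = indicator G y * (\<integral>\<^sup>+\<omega>. indicator A (y + W u \<omega>) \<partial>M)"
      by (rule nn_integral_cmult) measurable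
    also have "(\<integral>\<^sup>+\<omega>. indicator A (y + W u \<omega>) \<partial>M) = (\<integral>\<^sup>+\<omega>. indicator {\<omega>\<in>space M. y + W u \<omega> \<in> A} \<omega> \<partial>M)"
      by (rule nn_integral_cong) (auto simp: indicator_def)
    also have "\<dots> = emeasure M {\<omega>\<in>space M. y + W u \<omega> \<in> A}" by (rule nn_integral_indicator) measurable
    finally show "(\<integral>\<^sup>+\<omega>. indicator G y * indicator A (y + W u \<omega>) \<partial>M) = emeasure M {\<omega>\<in>space M. y + W u \<omega> \<in> A} * indicator G y"
      by (simp add: mult.commute)
  qed
  finally show ?thesis ..
qed

lemma heat_loss_eq:
  assumes u: "u > 0" and op: "open \<Omega>"
  shows "heat.heat_loss \<Omega> u = (\<integral>\<^sup>+y. emeasure M {\<omega>\<in>space M. y + W u \<omega> \<notin> \<Omega>} * indicator \<Omega> y \<partial>lborel)"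
proof -
  have b: "- \<Omega> \<in> sets borel" "\<Omega> \<in> sets borel" using op by auto
  show ?thesis
    using integral_position[OF _ b, of u] u unfolding heat.heat_loss_def crossing_def by simp
qed

text \<open>A path from \<open>y\<close> that ends outside has hit the boundary, and one that has hit it ends outside, or in the closure, with
conditional probability at least \<open>1/2 - \<epsilon>\<close> each. Ending outside and ending in the closure overlap only in the boundary
itself.\<close>

lemma hitting_vs_position:
  fixes \<Omega> :: "'a set"
  assumes op: "open \<Omega>" and y: "y \<in> \<Omega>" and ne: "frontier \<Omega> \<noteq> {}" and u: "u > 0" and \<epsilon>: "0 \<le> 1/2 - \<epsilon>"
    and h1: "\<And>p s. p \<in> frontier \<Omega> \<Longrightarrow> 0 \<le> s \<Longrightarrow> s \<le> u \<Longrightarrow> 1/2 - \<epsilon> \<le> measure (heat_law M W 0 s) {w. p + w \<in> - \<Omega>}"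
    and h2: "\<And>p s. p \<in> frontier \<Omega> \<Longrightarrow> 0 \<le> s \<Longrightarrow> s \<le> u \<Longrightarrow> 1/2 - \<epsilon> \<le> measure (heat_law M W 0 s) {w. p + w \<in> closure \<Omega>}"
  shows "(1/2 - \<epsilon>) * measure M {\<omega>\<in>space M. hits (\<lambda>s. y + W s \<omega>) u (frontier \<Omega>)} \<le> measure M {\<omega>\<in>space M. y + W u \<omega> \<notin> \<Omega>}"
    "measure M {\<omega>\<in>space M. y + W u \<omega> \<notin> \<Omega>} \<le> (1/2 + \<epsilon>) * measure M {\<omega>\<in>space M. hits (\<lambda>s. y + W s \<omega>) u (frontier \<Omega>)}
       + measure M {\<omega>\<in>space M. y + W u \<omega> \<in> frontier \<Omega>}"
proof -
  have [measurable]: "W u \<in> borel_measurable M" "\<Omega> \<in> sets borel" "closure \<Omega> \<in> sets borel" "frontier \<Omega> \<in> sets borel"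
    using u op by auto
  have clF: "closed (- \<Omega>)" "- \<Omega> \<noteq> {}" "closed (closure \<Omega>)" "closure \<Omega> \<noteq> {}"
  proof -
    have "\<Omega> \<noteq> UNIV" using ne by auto
    then show "- \<Omega> \<noteq> {}" by auto
  qed (use op y in auto)
  let ?H = "{\<omega>\<in>space M. hits (\<lambda>s. y + W s \<omega>) u (frontier \<Omega>)}"
  have H[measurable]: "?H \<in> sets M" 
    by (rule hits_measurable[OF shifted_path(1) u shifted_path(2)]) auto
  have "(1/2 - \<epsilon>) * measure M ?H \<le> measure M {\<omega>\<in>space M. hits (\<lambda>s. y + W s \<omega>) u (frontier \<Omega>) \<and> y + W u \<omega> \<in> - \<Omega>}"
    by (rule hitting_markov[OF u frontier_closed ne clF(1,2) \<epsilon> h1])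
  also have "\<dots> \<le> measure M {\<omega>\<in>space M. y + W u \<omega> \<notin> \<Omega>}" by (intro finite_measure_mono) auto
  finally show "(1/2 - \<epsilon>) * measure M ?H \<le> measure M {\<omega>\<in>space M. y + W u \<omega> \<notin> \<Omega>}" .
  have out: "measure M {\<omega>\<in>space M. y + W u \<omega> \<notin> \<Omega>} = measure M (?H \<inter> {\<omega>\<in>space M. y + W u \<omega> \<notin> \<Omega>})"
  proof (rule finite_measure_eq_AE)
    show "AE \<omega> in M. \<omega> \<in> {\<omega>\<in>space M. y + W u \<omega> \<notin> \<Omega>} \<longleftrightarrow> \<omega> \<in> ?H \<inter> {\<omega>\<in>space M. y + W u \<omega> \<notin> \<Omega>}"
      using start AE_space
    proof eventually_elim
      fix \<omega> assume 0: "W 0 \<omega> = 0" and \<omega>: "\<omega> \<in> space M"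
      have "hits (\<lambda>s. y + W s \<omega>) u (frontier \<Omega>)" if o: "y + W u \<omega> \<notin> \<Omega>"
      proof -
        have "connected ((\<lambda>s. y + W s \<omega>) ` {0..u})"
          by (intro connected_continuous_image shifted_path(2)[OF \<omega>]) simp
        moreover have "(\<lambda>s. y + W s \<omega>) ` {0..u} \<inter> \<Omega> \<noteq> {}" using y 0 u by (auto intro!: image_eqI[of _ _ 0])
        moreover have "(\<lambda>s. y + W s \<omega>) ` {0..u} - \<Omega> \<noteq> {}" using o u by (auto intro!: image_eqI[of _ _ u])
        ultimately have "(\<lambda>s. y + W s \<omega>) ` {0..u} \<inter> frontier \<Omega> \<noteq> {}" by (rule connected_Int_frontier)
        then show ?thesis by (auto simp: hits_def)
      qed
      then show "\<omega> \<in> {\<omega>\<in>space M. y + W u \<omega> \<notin> \<Omega>} \<longleftrightarrow> \<omega> \<in> ?H \<inter> {\<omega>\<in>space M. y + W u \<omega> \<notin> \<Omega>}" using \<omega> by blast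
    qed
  qed measurable
  have "(1/2 - \<epsilon>) * measure M ?H \<le> measure M {\<omega>\<in>space M. hits (\<lambda>s. y + W s \<omega>) u (frontier \<Omega>) \<and> y + W u \<omega> \<in> closure \<Omega>}"
    by (rule hitting_markov[OF u frontier_closed ne clF(3,4) \<epsilon> h2])
  also have "\<dots> \<le> measure M ((?H - {\<omega>\<in>space M. y + W u \<omega> \<notin> \<Omega>}) \<union> {\<omega>\<in>space M. y + W u \<omega> \<in> frontier \<Omega>})"
  proof (rule finite_measure_mono)
    show "(?H - {\<omega>\<in>space M. y + W u \<omega> \<notin> \<Omega>}) \<union> {\<omega>\<in>space M. y + W u \<omega> \<in> frontier \<Omega>} \<in> sets M"
      by (intro sets.Un sets.Diff H) measurable
  qed (use op in \<open>auto simp: frontier_def interior_open\<close>)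
  also have "\<dots> \<le> measure M (?H - {\<omega>\<in>space M. y + W u \<omega> \<notin> \<Omega>}) + measure M {\<omega>\<in>space M. y + W u \<omega> \<in> frontier \<Omega>}"
    by (intro measure_Un_le sets.Diff H) measurable
  also have "measure M (?H - {\<omega>\<in>space M. y + W u \<omega> \<notin> \<Omega>}) = measure M ?H - measure M (?H \<inter> {\<omega>\<in>space M. y + W u \<omega> \<notin> \<Omega>})"
    by (rule finite_measure_Diff') auto
  finally show "measure M {\<omega>\<in>space M. y + W u \<omega> \<notin> \<Omega>} \<le> (1/2 + \<epsilon>) * measure M ?H + measure M {\<omega>\<in>space M. y + W u \<omega> \<in> frontier \<Omega>}"
    unfolding out[symmetric] by (simp add: algebra_simps)
qed

text \<open>Integrated over the starting point, the overlap contributes nothing since the boundary is a null set.\<close>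

lemma exit_loss_vs_heat_loss:
  fixes \<Omega> :: "'a set"
  assumes flat: "flat_boundary \<Omega>" and bd: "bounded \<Omega>" and \<epsilon>: "0 < \<epsilon>" "\<epsilon> < 1/2"
  shows "\<forall>\<^sub>F u in at_right 0. ennreal (1/2 - \<epsilon>) * exit_loss \<Omega> u \<le> heat.heat_loss \<Omega> u \<and> heat.heat_loss \<Omega> u \<le> ennreal (1/2 + \<epsilon>) * exit_loss \<Omega> u"
proof -
  have op: "open \<Omega>" using flat by (simp add: flat_boundary_def)
  have b: "\<Omega> \<in> sets borel" "frontier \<Omega> \<in> sets borel" using op by auto
  note b[measurable]
  show ?thesis
  proof (cases "frontier \<Omega> = {}")
    case True
    then have "\<Omega> = {}" using bd not_bounded_UNIV frontier_eq_empty[of \<Omega>] by auto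
    then show ?thesis by (simp add: exit_loss_def heat.heat_loss_def crossing_def)
  next
    case ne: False
    obtain u0 where u0: "u0 > 0" and h1: "\<And>p s. p \<in> frontier \<Omega> \<Longrightarrow> 0 \<le> s \<Longrightarrow> s \<le> u0 \<Longrightarrow> 1/2 - \<epsilon> \<le> measure (heat_law M W 0 s) {w. p + w \<in> - \<Omega>}"
      and h2: "\<And>p s. p \<in> frontier \<Omega> \<Longrightarrow> 0 \<le> s \<Longrightarrow> s \<le> u0 \<Longrightarrow> 1/2 - \<epsilon> \<le> measure (heat_law M W 0 s) {w. p + w \<in> closure \<Omega>}"
      using half_mass_at_boundary[OF flat \<epsilon>(1)] by blast
    have "\<forall>\<^sub>F u in at_right 0. u < u0" using u0 by (intro order_tendstoD(2)[OF tendsto_ident_at]) auto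
    then show ?thesis using eventually_at_right_less[of 0]
    proof eventually_elim
      fix u :: real assume u: "u < u0" "0 < u"
      let ?H = "\<lambda>y. {\<omega>\<in>space M. hits (\<lambda>s. y + W s \<omega>) u (frontier \<Omega>)}" and ?O = "\<lambda>y. {\<omega>\<in>space M. y + W u \<omega> \<notin> \<Omega>}"
        and ?F = "\<lambda>y. {\<omega>\<in>space M. y + W u \<omega> \<in> frontier \<Omega>}"
      have Hm: "(\<lambda>y. emeasure M (?H y)) \<in> borel_measurable lborel" by (rule hits_emeasure_measurable[OF u(2)]) simp
      have Fm: "(\<lambda>y. emeasure M (?F y)) \<in> borel_measurable lborel" using u by (intro out_emeasure_measurable) auto
      note Hm[measurable] Fm[measurable]
      have e: "0 \<le> 1/2 - \<epsilon>" using \<epsilon> by simp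
      note hb = hitting_vs_position[OF op _ ne u(2) e h1 h2]
      have 1: "ennreal (1/2 - \<epsilon>) * emeasure M (?H y) \<le> emeasure M (?O y)" if "y \<in> \<Omega>" for y
      proof -
        have "(1/2 - \<epsilon>) * measure M (?H y) \<le> measure M (?O y)" by (rule hb(1)[OF that]) (use u in auto)
        then show ?thesis using \<epsilon> by (simp add: emeasure_eq_measure ennreal_mult[symmetric] ennreal_leI)
      qed
      have 2: "emeasure M (?O y) \<le> ennreal (1/2 + \<epsilon>) * emeasure M (?H y) + emeasure M (?F y)" if "y \<in> \<Omega>" for y
      proof -
        have "measure M (?O y) \<le> (1/2 + \<epsilon>) * measure M (?H y) + measure M (?F y)" by (rule hb(2)[OF that]) (use u in auto)
        then show ?thesis using \<epsilon> by (simp add: emeasure_eq_measure ennreal_mult[symmetric] ennreal_plus[symmetric] ennreal_leI del: ennreal_plus)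
      qed
      have "ennreal (1/2 - \<epsilon>) * exit_loss \<Omega> u = (\<integral>\<^sup>+y. ennreal (1/2 - \<epsilon>) * (emeasure M (?H y) * indicator \<Omega> y) \<partial>lborel)"
        unfolding exit_loss_def by (rule nn_integral_cmult[symmetric]) measurable
      also have "\<dots> \<le> (\<integral>\<^sup>+y. emeasure M (?O y) * indicator \<Omega> y \<partial>lborel)"
        using 1 by (intro nn_integral_mono) (auto simp: indicator_def)
      finally have A: "ennreal (1/2 - \<epsilon>) * exit_loss \<Omega> u \<le> heat.heat_loss \<Omega> u" unfolding heat_loss_eq[OF u(2) op] .
      have "heat.heat_loss \<Omega> u \<le> (\<integral>\<^sup>+y. ennreal (1/2 + \<epsilon>) * (emeasure M (?H y) * indicator \<Omega> y) + emeasure M (?F y) * indicator \<Omega> y \<partial>lborel)"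
        unfolding heat_loss_eq[OF u(2) op] using 2 by (intro nn_integral_mono) (auto simp: indicator_def)
      also have "\<dots> = (\<integral>\<^sup>+y. ennreal (1/2 + \<epsilon>) * (emeasure M (?H y) * indicator \<Omega> y) \<partial>lborel) + (\<integral>\<^sup>+y. emeasure M (?F y) * indicator \<Omega> y \<partial>lborel)"
        by (rule nn_integral_add) measurable
      also have "(\<integral>\<^sup>+y. ennreal (1/2 + \<epsilon>) * (emeasure M (?H y) * indicator \<Omega> y) \<partial>lborel) = ennreal (1/2 + \<epsilon>) * exit_loss \<Omega> u"
        unfolding exit_loss_def by (rule nn_integral_cmult) measurable
      also have "(\<integral>\<^sup>+y. emeasure M (?F y) * indicator \<Omega> y \<partial>lborel) = (\<integral>\<^sup>+z. emeasure lborel {y\<in>\<Omega>. y + z \<in> frontier \<Omega>} \<partial>heat_law M W 0 u)"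
        using u by (intro integral_position) auto
      also have "\<dots> = (\<integral>\<^sup>+z. 0 \<partial>heat_law M W 0 u)"
      proof (rule nn_integral_cong)
        fix z
        have "emeasure lborel {y\<in>\<Omega>. y + z \<in> frontier \<Omega>} \<le> emeasure lborel {y. y + z \<in> frontier \<Omega>}"
          by (rule emeasure_mono) auto
        also have "\<dots> = 0" using lborel_translate[OF b(2)] flat_frontier_null[OF flat bd] by simp
        finally show "emeasure lborel {y\<in>\<Omega>. y + z \<in> frontier \<Omega>} = 0" by simp
      qed
      finally show "ennreal (1/2 - \<epsilon>) * exit_loss \<Omega> u \<le> heat.heat_loss \<Omega> u \<and> heat.heat_loss \<Omega> u \<le> ennreal (1/2 + \<epsilon>) * exit_loss \<Omega> u"
        using A by simp
    qed
  qed
qed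

lemma exit_loss_le: "open \<Omega> \<Longrightarrow> exit_loss \<Omega> u \<le> emeasure lborel \<Omega>"
proof -
  assume "open \<Omega>"
  have "exit_loss \<Omega> u \<le> (\<integral>\<^sup>+y. indicator \<Omega> y \<partial>lborel)"
    unfolding exit_loss_def by (intro nn_integral_mono) (auto simp: indicator_def emeasure_le_1)
  then show ?thesis using \<open>open \<Omega>\<close> by simp
qed

theorem exit_loss_asymptotics:
  fixes \<Omega> :: "'a set"
  assumes flat: "flat_boundary \<Omega>" and bd: "bounded \<Omega>"
  shows "((\<lambda>u. enn2real (exit_loss \<Omega> u) / sqrt u) \<longlongrightarrow> 2 * enn2real (hausdorff_measure (DIM('a) - 1) (frontier \<Omega>)) / sqrt pi) (at_right 0)"
proof -
  have op: "open \<Omega>" using flat by (simp add: flat_boundary_def)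
  define c where "c = enn2real (hausdorff_measure (DIM('a) - 1) (frontier \<Omega>)) / sqrt pi"
  have c0: "c \<ge> 0" by (simp add: c_def)
  have h: "((\<lambda>u. enn2real (heat.heat_loss \<Omega> u) / sqrt u) \<longlongrightarrow> c) (at_right 0)"
    unfolding c_def by (rule heat.heat_loss_asymptotics[OF flat bd])
  have efin: "exit_loss \<Omega> u < \<infinity>" for u
    by (rule le_less_trans[OF exit_loss_le[OF op] emeasure_bounded_finite[OF bd]])
  have bounds: "\<forall>\<^sub>F u in at_right 0. enn2real (heat.heat_loss \<Omega> u) / sqrt u / (1/2 + \<epsilon>) \<le> enn2real (exit_loss \<Omega> u) / sqrt u \<and>
      enn2real (exit_loss \<Omega> u) / sqrt u \<le> enn2real (heat.heat_loss \<Omega> u) / sqrt u / (1/2 - \<epsilon>)" if \<epsilon>: "0 < \<epsilon>" "\<epsilon> < 1/2" for \<epsilon>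
    using exit_loss_vs_heat_loss[OF flat bd \<epsilon>] eventually_at_right_less[of 0]
  proof eventually_elim
    fix u :: real assume eh: "ennreal (1/2 - \<epsilon>) * exit_loss \<Omega> u \<le> heat.heat_loss \<Omega> u \<and> heat.heat_loss \<Omega> u \<le> ennreal (1/2 + \<epsilon>) * exit_loss \<Omega> u" and u: "0 < u"
    obtain g where g: "g \<ge> 0" "exit_loss \<Omega> u = ennreal g" using efin[of u] by (cases "exit_loss \<Omega> u") auto
    have "heat.heat_loss \<Omega> u \<le> ennreal ((1/2 + \<epsilon>) * g)" using eh g \<epsilon> by (simp add: ennreal_mult)
    then obtain k where k: "k \<ge> 0" "heat.heat_loss \<Omega> u = ennreal k" by (cases "heat.heat_loss \<Omega> u") (auto simp: top_unique)
    have "(1/2 - \<epsilon>) * g \<le> k" "k \<le> (1/2 + \<epsilon>) * g"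
      using eh g k \<epsilon> by (simp_all add: ennreal_mult[symmetric] ennreal_le_iff del: ennreal_plus)
    then have "k / (1/2 + \<epsilon>) \<le> g" "g \<le> k / (1/2 - \<epsilon>)" using \<epsilon> by (simp_all add: pos_divide_le_eq pos_le_divide_eq mult.commute)
    then have "k / (1/2 + \<epsilon>) / sqrt u \<le> g / sqrt u" "g / sqrt u \<le> k / (1/2 - \<epsilon>) / sqrt u"
      using u by ((intro divide_right_mono; simp)+)
    then show "enn2real (heat.heat_loss \<Omega> u) / sqrt u / (1/2 + \<epsilon>) \<le> enn2real (exit_loss \<Omega> u) / sqrt u \<and>
      enn2real (exit_loss \<Omega> u) / sqrt u \<le> enn2real (heat.heat_loss \<Omega> u) / sqrt u / (1/2 - \<epsilon>)"
      using g k by (simp add: divide_divide_eq_left mult.commute)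
  qed
  have "((\<lambda>u. enn2real (exit_loss \<Omega> u) / sqrt u) \<longlongrightarrow> 2 * c) (at_right 0)"
  proof (rule order_tendstoI)
    fix a assume a: "a < 2 * c"
    have "((\<lambda>\<epsilon>. c / (1/2 + \<epsilon>)) \<longlongrightarrow> c / (1/2 + 0)) (at_right 0)" by (intro tendsto_intros) auto
    then have "\<forall>\<^sub>F \<epsilon> in at_right 0. a < c / (1/2 + \<epsilon>)" by (rule order_tendstoD(1)) (use a in simp)
    moreover have "\<forall>\<^sub>F \<epsilon> in at_right (0::real). \<epsilon> < 1/2" by (intro order_tendstoD(2)[OF tendsto_ident_at]) auto
    ultimately have "\<forall>\<^sub>F \<epsilon> in at_right 0. a < c / (1/2 + \<epsilon>) \<and> \<epsilon> < 1/2 \<and> 0 < \<epsilon>"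
      using eventually_at_right_less[of "0::real"] by eventually_elim auto
    from eventually_happens'[OF _ this] obtain \<epsilon> where \<epsilon>: "a < c / (1/2 + \<epsilon>)" "\<epsilon> < 1/2" "0 < \<epsilon>" by auto
    have "((\<lambda>u. enn2real (heat.heat_loss \<Omega> u) / sqrt u / (1/2 + \<epsilon>)) \<longlongrightarrow> c / (1/2 + \<epsilon>)) (at_right 0)"
      using \<epsilon> by (intro tendsto_divide h tendsto_const) auto
    from order_tendstoD(1)[OF this \<epsilon>(1)] bounds[OF \<epsilon>(3,2)]
    show "\<forall>\<^sub>F u in at_right 0. a < enn2real (exit_loss \<Omega> u) / sqrt u" by eventually_elim linarith
  next
    fix a assume a: "2 * c < a"
    have "((\<lambda>\<epsilon>. c / (1/2 - \<epsilon>)) \<longlongrightarrow> c / (1/2 - 0)) (at_right 0)" by (intro tendsto_intros) auto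
    then have "\<forall>\<^sub>F \<epsilon> in at_right 0. c / (1/2 - \<epsilon>) < a" by (rule order_tendstoD(2)) (use a in simp)
    moreover have "\<forall>\<^sub>F \<epsilon> in at_right (0::real). \<epsilon> < 1/2" by (intro order_tendstoD(2)[OF tendsto_ident_at]) auto
    ultimately have "\<forall>\<^sub>F \<epsilon> in at_right 0. c / (1/2 - \<epsilon>) < a \<and> \<epsilon> < 1/2 \<and> 0 < \<epsilon>"
      using eventually_at_right_less[of "0::real"] by eventually_elim auto
    from eventually_happens'[OF _ this] obtain \<epsilon> where \<epsilon>: "c / (1/2 - \<epsilon>) < a" "\<epsilon> < 1/2" "0 < \<epsilon>" by auto
    have "((\<lambda>u. enn2real (heat.heat_loss \<Omega> u) / sqrt u / (1/2 - \<epsilon>)) \<longlongrightarrow> c / (1/2 - \<epsilon>)) (at_right 0)"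
      using \<epsilon> by (intro tendsto_divide h tendsto_const) auto
    from order_tendstoD(2)[OF this \<epsilon>(1)] bounds[OF \<epsilon>(3,2)]
    show "\<forall>\<^sub>F u in at_right 0. enn2real (exit_loss \<Omega> u) / sqrt u < a" by eventually_elim linarith
  qed
  then show ?thesis by (simp add: c_def)
qed

end

section \<open>Time change by an independent subordinator\<close>

text \<open>Rounding the time down to dyadic values leaves countably many cases, and path continuity removes the rounding.\<close>

lemma measurable_random_time:
  fixes Z :: "real \<Rightarrow> 'z \<Rightarrow> 'a::euclidean_space"
  assumes Z: "\<And>s. s \<ge> 0 \<Longrightarrow> Z s \<in> borel_measurable N" and cont: "\<And>z. z \<in> space N \<Longrightarrow> continuous_on {0..} (\<lambda>s. Z s z)"
    and g[measurable]: "g \<in> borel_measurable N" and g0: "\<And>z. z \<in> space N \<Longrightarrow> g z \<ge> 0"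
  shows "(\<lambda>z. Z (g z) z) \<in> borel_measurable N"
proof (rule borel_measurable_LIMSEQ_metric)
  let ?g = "\<lambda>n z. real (nat \<lfloor>2 ^ n * g z\<rfloor>) / 2 ^ n"
  show "(\<lambda>z. Z (?g n z) z) \<in> borel_measurable N" for n :: nat
  proof (rule measurable_compose_countable[where f="\<lambda>k z. Z (real k / 2 ^ n) z" and g="\<lambda>z. nat \<lfloor>2 ^ n * g z\<rfloor>"])
    show "(\<lambda>z. Z (real k / 2 ^ n) z) \<in> borel_measurable N" for k by (rule Z) simp
    show "(\<lambda>z. nat \<lfloor>2 ^ n * g z\<rfloor>) \<in> N \<rightarrow>\<^sub>M count_space UNIV" by measurable
  qed
  fix z assume z: "z \<in> space N"
  have lim: "(\<lambda>n. ?g n z) \<longlonglongrightarrow> g z"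
  proof (rule real_tendsto_sandwich[where f="\<lambda>n. g z - 1 / 2 ^ n" and h="\<lambda>_. g z"])
    have b: "g z - 1 / 2 ^ n \<le> ?g n z \<and> ?g n z \<le> g z" for n
    proof -
      have "0 \<le> 2 ^ n * g z" using g0[OF z] by simp
      then have r: "2 ^ n * g z - 1 \<le> real (nat \<lfloor>2 ^ n * g z\<rfloor>)" "real (nat \<lfloor>2 ^ n * g z\<rfloor>) \<le> 2 ^ n * g z" by linarith+
      have "(2 ^ n * g z - 1) / 2 ^ n \<le> ?g n z" by (rule divide_right_mono[OF r(1)]) simp
      moreover have "?g n z \<le> 2 ^ n * g z / 2 ^ n" by (rule divide_right_mono[OF r(2)]) simp
      moreover have "(2 ^ n * g z - 1) / 2 ^ n = g z - 1 / 2 ^ n" "2 ^ n * g z / 2 ^ n = g z" by (simp_all add: diff_divide_distrib)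
      ultimately show ?thesis by simp
    qed
    show "\<forall>\<^sub>F n in sequentially. g z - 1 / 2 ^ n \<le> ?g n z" "\<forall>\<^sub>F n in sequentially. ?g n z \<le> g z" using b by auto
    have "(\<lambda>n. g z - (1 / 2) ^ n) \<longlonglongrightarrow> g z - 0" by (intro tendsto_intros LIMSEQ_power_zero) auto
    then show "(\<lambda>n. g z - 1 / 2 ^ n) \<longlonglongrightarrow> g z" by (simp add: power_one_over)
  qed simp
  show "(\<lambda>n. Z (?g n z) z) \<longlonglongrightarrow> Z (g z) z"
    using continuous_on_tendsto_compose[OF cont[OF z] lim] g0[OF z] by simp
qed

text \<open>The information carried by a process, as a measurable space on the sample space itself. The process and the time change
live on one space, and independence is a statement about these two algebras.\<close>

definition path_algebra :: "'w measure \<Rightarrow> (real \<Rightarrow> 'w \<Rightarrow> 'b::topological_space) \<Rightarrow> 'w measure" where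
  "path_algebra M X = vimage_algebra (space M) (\<lambda>\<omega>. \<lambda>t\<in>{0..}. X t \<omega>) (Pi\<^sub>M {0..} (\<lambda>_. borel))"

lemma space_path_algebra [simp]: "space (path_algebra M X) = space M"
  by (simp add: path_algebra_def)

lemma path_algebra_component:
  assumes "t \<ge> 0" shows "X t \<in> borel_measurable (path_algebra M X)"
proof -
  have "(\<lambda>\<omega>. \<lambda>t\<in>{0..}. X t \<omega>) \<in> path_algebra M X \<rightarrow>\<^sub>M Pi\<^sub>M {0..} (\<lambda>_. borel)"
    unfolding path_algebra_def by (rule measurable_vimage_algebra1) (auto simp: space_PiM)
  from measurable_compose[OF this measurable_component_singleton[of t]] show ?thesis
    using assms by simp
qed

lemma path_algebra_id:
  assumes "\<And>t. t \<ge> 0 \<Longrightarrow> X t \<in> borel_measurable M"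
  shows "(\<lambda>\<omega>. \<omega>) \<in> M \<rightarrow>\<^sub>M path_algebra M X"
  unfolding path_algebra_def
  by (rule measurable_vimage_algebra2) (use assms in \<open>auto intro!: measurable_restrict\<close>)

text \<open>Independence says that \<open>\<omega> \<mapsto> (\<omega>, \<omega>)\<close> sends \<open>M\<close> to the product of its restrictions to the two path algebras, so the
diagonal event can be computed by Fubini with the two arguments decoupled.\<close>

lemma indep_processes_decouple:
  assumes "prob_space M" and ind: "indep_processes M X Y"
    and X: "\<And>t. t \<ge> 0 \<Longrightarrow> X t \<in> borel_measurable M" and Y: "\<And>t. t \<ge> 0 \<Longrightarrow> Y t \<in> borel_measurable M"
    and Q: "{p \<in> space (path_algebra M X \<Otimes>\<^sub>M path_algebra M Y). Q (fst p) (snd p)} \<in> sets (path_algebra M X \<Otimes>\<^sub>M path_algebra M Y)"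
  shows "{\<omega>\<in>space M. Q \<omega> \<omega>} \<in> sets M"
    "emeasure M {\<omega>\<in>space M. Q \<omega> \<omega>} = (\<integral>\<^sup>+\<omega>'. emeasure M {\<omega>\<in>space M. Q \<omega> \<omega>'} \<partial>M)"
proof -
  interpret prob_space M by fact
  let ?S = "path_algebra M X" and ?T = "path_algebra M Y"
  let ?id = "\<lambda>\<omega>. \<omega>"
  let ?Q = "{p \<in> space (?S \<Otimes>\<^sub>M ?T). Q (fst p) (snd p)}"
  have S: "?id \<in> M \<rightarrow>\<^sub>M ?S" and T: "?id \<in> M \<rightarrow>\<^sub>M ?T" using path_algebra_id X Y by auto
  have gen: "sigma_sets (space M) {?id -` A \<inter> space M |A. A \<in> sets (path_algebra M Z)} = path_sigma M Z"
    for Z :: "real \<Rightarrow> 'a \<Rightarrow> 'd::topological_space"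
  proof -
    have "{?id -` A \<inter> space M |A. A \<in> sets (path_algebra M Z)} = sets (path_algebra M Z)"
    proof -
      have "?id -` A \<inter> space M = A" if "A \<in> sets (path_algebra M Z)" for A
        using sets.sets_into_space[OF that] by auto
      note e = this
      show ?thesis
      proof (intro equalityI subsetI)
        fix B assume "B \<in> {?id -` A \<inter> space M |A. A \<in> sets (path_algebra M Z)}"
        then obtain A where A: "A \<in> sets (path_algebra M Z)" "B = ?id -` A \<inter> space M" by blast
        then show "B \<in> sets (path_algebra M Z)" using e[OF A(1)] by simp
      next
        fix B assume B: "B \<in> sets (path_algebra M Z)"
        show "B \<in> {?id -` A \<inter> space M |A. A \<in> sets (path_algebra M Z)}"
          by (intro CollectI exI[of _ B] conjI e[OF B, symmetric] B)
      qed
    qed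
    then show ?thesis
      using sets.sigma_sets_eq[of "path_algebra M Z"] by (simp add: path_sigma_def path_algebra_def)
  qed
  have "indep_var ?S ?id ?T ?id"
    unfolding indep_var_eq gen using S T ind by (simp add: indep_processes_def)
  then have J: "distr M ?S ?id \<Otimes>\<^sub>M distr M ?T ?id = distr M (?S \<Otimes>\<^sub>M ?T) (\<lambda>\<omega>. (\<omega>, \<omega>))"
    unfolding indep_var_distribution_eq by auto
  have diag: "(\<lambda>\<omega>. (\<omega>, \<omega>)) \<in> M \<rightarrow>\<^sub>M ?S \<Otimes>\<^sub>M ?T" using S T by (rule measurable_Pair)
  have vim: "(\<lambda>\<omega>. (\<omega>, \<omega>)) -` ?Q \<inter> space M = {\<omega>\<in>space M. Q \<omega> \<omega>}" by (auto simp: space_pair_measure)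
  show "{\<omega>\<in>space M. Q \<omega> \<omega>} \<in> sets M" using measurable_sets[OF diag Q] unfolding vim .
  interpret D1: prob_space "distr M ?S ?id" by (rule prob_space_distr[OF S])
  interpret D2: prob_space "distr M ?T ?id" by (rule prob_space_distr[OF T])
  interpret D: pair_prob_space "distr M ?S ?id" "distr M ?T ?id" ..
  have Q': "?Q \<in> sets (distr M ?S ?id \<Otimes>\<^sub>M distr M ?T ?id)" using Q by simp
  have sec: "emeasure (distr M ?S ?id) ((\<lambda>\<omega>. (\<omega>, \<omega>')) -` ?Q) = emeasure M {\<omega>\<in>space M. Q \<omega> \<omega>'}" if "\<omega>' \<in> space M" for \<omega>'
  proof -
    have "(\<lambda>\<omega>. (\<omega>, \<omega>')) -` ?Q \<in> sets ?S" using sets_Pair2[OF Q] .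
    then have "emeasure (distr M ?S ?id) ((\<lambda>\<omega>. (\<omega>, \<omega>')) -` ?Q) = emeasure M (?id -` ((\<lambda>\<omega>. (\<omega>, \<omega>')) -` ?Q) \<inter> space M)"
      by (rule emeasure_distr[OF S])
    also have "?id -` ((\<lambda>\<omega>. (\<omega>, \<omega>')) -` ?Q) \<inter> space M = {\<omega>\<in>space M. Q \<omega> \<omega>'}" using that by (auto simp: space_pair_measure)
    finally show ?thesis .
  qed
  have "emeasure M {\<omega>\<in>space M. Q \<omega> \<omega>} = emeasure (distr M (?S \<Otimes>\<^sub>M ?T) (\<lambda>\<omega>. (\<omega>, \<omega>))) ?Q"
    unfolding vim[symmetric] by (rule emeasure_distr[OF diag Q, symmetric])
  also have "\<dots> = (\<integral>\<^sup>+\<omega>'. emeasure (distr M ?S ?id) ((\<lambda>\<omega>. (\<omega>, \<omega>')) -` ?Q) \<partial>distr M ?T ?id)"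
    unfolding J[symmetric] by (rule D.emeasure_pair_measure_alt2[OF Q'])
  also have "\<dots> = (\<integral>\<^sup>+\<omega>'. emeasure (distr M ?S ?id) ((\<lambda>\<omega>. (\<omega>, \<omega>')) -` ?Q) \<partial>M)"
  proof (rule nn_integral_distr[OF T])
    show "(\<lambda>\<omega>'. emeasure (distr M ?S ?id) ((\<lambda>\<omega>. (\<omega>, \<omega>')) -` ?Q)) \<in> borel_measurable (distr M ?T ?id)"
      by (rule D.measurable_emeasure_Pair2[OF Q'])
  qed
  also have "\<dots> = (\<integral>\<^sup>+\<omega>'. emeasure M {\<omega>\<in>space M. Q \<omega> \<omega>'} \<partial>M)"
    by (rule nn_integral_cong) (rule sec)
  finally show "emeasure M {\<omega>\<in>space M. Q \<omega> \<omega>} = (\<integral>\<^sup>+\<omega>'. emeasure M {\<omega>\<in>space M. Q \<omega> \<omega>'} \<partial>M)" .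
qed

text \<open>Time \<open>0\<close> is excluded, as in the exit time.\<close>

definition exits :: "(real \<Rightarrow> 'a) \<Rightarrow> real \<Rightarrow> 'a set \<Rightarrow> bool" where
  "exits f u \<Omega> \<longleftrightarrow> (\<exists>s\<in>{0<..u}. f s \<notin> \<Omega>)"

text \<open>The half-open interval of times is the union of the closed intervals that start at \<open>u / (n + 1)\<close>; each is rescaled to
the unit interval so that the measurability of hitting events applies with a random \<open>u\<close>.\<close>

lemma exits_iff_hits_rescaled:
  assumes u: "u > 0"
  shows "exits f u \<Omega> \<longleftrightarrow> (\<exists>n. hits (\<lambda>s. f ((1 / real (Suc n) + (1 - 1 / real (Suc n)) * s) * u)) 1 (- \<Omega>))"
proof
  assume "exits f u \<Omega>"
  then obtain s where s: "0 < s" "s \<le> u" "f s \<notin> \<Omega>" by (auto simp: exits_def)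
  define r where "r = s / u"
  have r: "0 < r" "r \<le> 1" "r * u = s" using s u by (auto simp: r_def)
  obtain n where n: "1 / real (Suc n) < r" using reals_Archimedean[OF r(1)] by (auto simp: inverse_eq_divide)
  have d: "1 - 1 / real (Suc n) > 0" using n r by linarith
  define s' where "s' = (r - 1 / real (Suc n)) / (1 - 1 / real (Suc n))"
  have s': "s' \<in> {0..1}" using n r d by (auto simp: s'_def)
  have "(1 - 1 / real (Suc n)) * s' = r - 1 / real (Suc n)" unfolding s'_def using d by (metis nonzero_mult_div_cancel_left times_divide_eq_right less_irrefl)
  then have "(1 / real (Suc n) + (1 - 1 / real (Suc n)) * s') * u = s" using r(3) by simp
  then show "\<exists>n. hits (\<lambda>s. f ((1 / real (Suc n) + (1 - 1 / real (Suc n)) * s) * u)) 1 (- \<Omega>)"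
    using s(3) s' unfolding hits_def by (intro exI[of _ n] bexI[of _ s']) auto
next
  assume "\<exists>n. hits (\<lambda>s. f ((1 / real (Suc n) + (1 - 1 / real (Suc n)) * s) * u)) 1 (- \<Omega>)"
  then obtain n s where s: "s \<in> {0..1}" "f ((1 / real (Suc n) + (1 - 1 / real (Suc n)) * s) * u) \<notin> \<Omega>" by (auto simp: hits_def)
  define c where "c = 1 / real (Suc n)"
  define r where "r = c + (1 - c) * s"
  have c: "0 < c" "c \<le> 1" by (simp_all add: c_def)
  have "0 \<le> (1 - c) * s" using c s by (intro mult_nonneg_nonneg) auto
  moreover have "(1 - c) * s \<le> (1 - c) * 1" using c s by (intro mult_left_mono) auto
  ultimately have r: "0 < r \<and> r \<le> 1" using c unfolding r_def by auto
  have "r * u \<in> {0<..u}" using r u by (simp add: mult_left_le_one_le)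
  then show "exits f u \<Omega>" using s(2) unfolding exits_def c_def[symmetric] r_def[symmetric] by blast
qed

text \<open>Since \<open>\<Omega>\<close> is open, a path inside it at time \<open>u\<close> stays inside for a while, so the exit time exceeds \<open>u\<close> strictly.\<close>

lemma less_exit_time_iff:
  assumes cont: "continuous_on {0..} (\<lambda>s. X s \<omega>)" and op: "open \<Omega>" and u: "u > 0"
  shows "ereal u < exit_time X \<Omega> \<omega> \<longleftrightarrow> \<not> exits (\<lambda>s. X s \<omega>) u \<Omega>"
proof
  assume l: "ereal u < exit_time X \<Omega> \<omega>"
  show "\<not> exits (\<lambda>s. X s \<omega>) u \<Omega>"
  proof
    assume "exits (\<lambda>s. X s \<omega>) u \<Omega>"
    then obtain s where s: "0 < s" "s \<le> u" "X s \<omega> \<notin> \<Omega>" by (auto simp: exits_def)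
    have "exit_time X \<Omega> \<omega> \<le> ereal s" unfolding exit_time_def by (rule Inf_lower) (use s in auto)
    then show False using l s(2) by (metis ereal_less_eq(3) le_less_trans not_le order_trans)
  qed
next
  assume ne: "\<not> exits (\<lambda>s. X s \<omega>) u \<Omega>"
  then have inside: "X s \<omega> \<in> \<Omega>" if "0 < s" "s \<le> u" for s using that by (auto simp: exits_def)
  have "((\<lambda>s. X s \<omega>) \<longlongrightarrow> X u \<omega>) (at u within {0..})" using cont u by (simp add: continuous_on_def)
  then have "\<forall>\<^sub>F s in at u within {0..}. X s \<omega> \<in> \<Omega>" using topological_tendstoD op inside[of u] u by blast
  then obtain d where d: "d > 0" "\<And>s. s \<in> {0..} \<Longrightarrow> s \<noteq> u \<Longrightarrow> dist s u < d \<Longrightarrow> X s \<omega> \<in> \<Omega>"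
    unfolding eventually_at by auto
  have "ereal (u + d) \<le> exit_time X \<Omega> \<omega>"
    unfolding exit_time_def
  proof (rule Inf_greatest)
    fix z assume "z \<in> ereal ` {t. 0 < t \<and> X t \<omega> \<notin> \<Omega>}"
    then obtain s where s: "z = ereal s" "0 < s" "X s \<omega> \<notin> \<Omega>" by auto
    have "s > u" using inside[of s] s by force
    then have "\<not> dist s u < d" using d(2)[of s] s by auto
    then show "ereal (u + d) \<le> z" using s \<open>s > u\<close> by (simp add: dist_real_def)
  qed
  moreover have "ereal u < ereal (u + d)" using d by simp
  ultimately show "ereal u < exit_time X \<Omega> \<omega>" by (rule less_le_trans[rotated])
qed

lemma exits_iff_hits_frontier:
  fixes f :: "real \<Rightarrow> 'a::euclidean_space"
  assumes cont: "continuous_on {0..} f" and op: "open \<Omega>" and f0: "f 0 \<in> \<Omega>"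
  shows "exits f u \<Omega> \<longleftrightarrow> hits f u (frontier \<Omega>)"
proof
  assume "exits f u \<Omega>"
  then obtain s where s: "0 < s" "s \<le> u" "f s \<notin> \<Omega>" by (auto simp: exits_def)
  have "connected (f ` {0..s})"
    by (intro connected_continuous_image continuous_on_subset[OF cont]) auto
  moreover have "f ` {0..s} \<inter> \<Omega> \<noteq> {}" using f0 s by (auto intro!: image_eqI[of _ _ 0])
  moreover have "f ` {0..s} - \<Omega> \<noteq> {}" using s by (auto intro!: image_eqI[of _ _ s])
  ultimately have "f ` {0..s} \<inter> frontier \<Omega> \<noteq> {}" by (rule connected_Int_frontier)
  then show "hits f u (frontier \<Omega>)" using s by (auto simp: hits_def)
next
  assume "hits f u (frontier \<Omega>)"
  then obtain s where s: "0 \<le> s" "s \<le> u" "f s \<in> frontier \<Omega>" by (auto simp: hits_def)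
  then have "f s \<notin> \<Omega>" using op by (auto simp: frontier_def interior_open)
  moreover then have "s \<noteq> 0" using f0 by auto
  ultimately show "exits f u \<Omega>" using s by (auto simp: exits_def)
qed

text \<open>If \<open>D t\<close> is before the exit time, right-continuity keeps \<open>D\<close> before it on some \<open>[t, b)\<close> and monotonicity on \<open>[0, t]\<close>, so
the killed process is inside up to \<open>b > t\<close>. Conversely the killed process is in the cemetery at time \<open>t\<close> once \<open>D t\<close> has
reached the exit time.\<close>

lemma subordinate_killed_exit:
  assumes op: "open \<Omega>" and D0: "D 0 \<omega> = 0" and mono: "strict_mono_on {0..} (\<lambda>t. D t \<omega>)" and cad: "cadlag (\<lambda>t. D t \<omega>)"
    and t: "t > 0"
  shows "ereal t < exit_time (time_changed (killed W \<Omega>) D) (Some ` \<Omega>) \<omega> \<longleftrightarrow> ereal (D t \<omega>) < exit_time W \<Omega> \<omega>"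
proof
  let ?Y = "time_changed (killed W \<Omega>) D"
  assume l: "ereal t < exit_time ?Y (Some ` \<Omega>) \<omega>"
  show "ereal (D t \<omega>) < exit_time W \<Omega> \<omega>"
  proof (rule ccontr)
    assume "\<not> ereal (D t \<omega>) < exit_time W \<Omega> \<omega>"
    then have "?Y t \<omega> \<notin> Some ` \<Omega>" by (auto simp: time_changed_def killed_def)
    then have "exit_time ?Y (Some ` \<Omega>) \<omega> \<le> ereal t" unfolding exit_time_def by (intro Inf_lower) (use t in auto)
    then show False using l by simp
  qed
next
  let ?Y = "time_changed (killed W \<Omega>) D"
  assume l: "ereal (D t \<omega>) < exit_time W \<Omega> \<omega>"
  have "((\<lambda>s. ereal (D s \<omega>)) \<longlongrightarrow> ereal (D t \<omega>)) (at_right t)"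
    using cad t by (intro tendsto_ereal) (simp add: cadlag_def)
  from order_tendstoD(2)[OF this l] obtain b where b: "b > t" "\<And>s. t < s \<Longrightarrow> s < b \<Longrightarrow> ereal (D s \<omega>) < exit_time W \<Omega> \<omega>"
    unfolding eventually_at_right_field by auto
  have "ereal b \<le> exit_time ?Y (Some ` \<Omega>) \<omega>"
    unfolding exit_time_def[of ?Y]
  proof (rule Inf_greatest)
    fix z assume "z \<in> ereal ` {t. 0 < t \<and> ?Y t \<omega> \<notin> Some ` \<Omega>}"
    then obtain s where s: "z = ereal s" "0 < s" "?Y s \<omega> \<notin> Some ` \<Omega>" by auto
    have "\<not> s < b"
    proof
      assume sb: "s < b"
      have Ds: "ereal (D s \<omega>) < exit_time W \<Omega> \<omega>"
      proof (cases "s \<le> t")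
        case True
        then have "D s \<omega> \<le> D t \<omega>" using strict_mono_on_leD[OF mono, of s t] s by simp
        then show ?thesis using l by (metis ereal_less_eq(3) le_less_trans)
      qed (use b sb in auto)
      have "D s \<omega> > 0" using strict_mono_onD[OF mono, of 0 s] s D0 by simp
      moreover have "W (D s \<omega>) \<omega> \<notin> \<Omega>" using s(3) Ds by (auto simp: time_changed_def killed_def)
      ultimately have "exit_time W \<Omega> \<omega> \<le> ereal (D s \<omega>)" unfolding exit_time_def by (intro Inf_lower) auto
      then show False using Ds by simp
    qed
    then show "ereal b \<le> z" using s by simp
  qed
  moreover have "ereal t < ereal b" using b by simp
  ultimately show "ereal t < exit_time ?Y (Some ` \<Omega>) \<omega>" by (rule less_le_trans[rotated])
qed

context std_brownian
begin

text \<open>The time interval is rescaled to the unit interval, which makes the event jointly measurable in the starting point and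
in \<open>u\<close>; \<open>max 0\<close> keeps it meaningful for all real \<open>u\<close>.\<close>

definition hit_prob :: "'a set \<Rightarrow> 'a \<Rightarrow> real \<Rightarrow> ennreal" where
  "hit_prob \<Omega> y u = emeasure M {\<omega>\<in>space M. hits (\<lambda>s. y + W (s * max 0 u) \<omega>) 1 (frontier \<Omega>)}"

definition out_prob :: "'a set \<Rightarrow> 'a \<Rightarrow> real \<Rightarrow> ennreal" where
  "out_prob \<Omega> y u = emeasure M {\<omega>\<in>space M. y + W (max 0 u) \<omega> \<notin> \<Omega>}"

lemma hits_rescale: "u > 0 \<Longrightarrow> hits (\<lambda>s. f (s * u)) 1 K \<longleftrightarrow> hits f u K"
proof
  assume u: "u > 0"
  show "hits (\<lambda>s. f (s * u)) 1 K" if "hits f u K"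
  proof -
    from that obtain s where "s \<in> {0..u}" "f s \<in> K" by (auto simp: hits_def)
    then show ?thesis using u unfolding hits_def by (intro bexI[of _ "s / u"]) auto
  qed
  show "hits f u K" if "hits (\<lambda>s. f (s * u)) 1 K"
  proof -
    from that obtain s where "s \<in> {0..1}" "f (s * u) \<in> K" by (auto simp: hits_def)
    then show ?thesis using u unfolding hits_def by (intro bexI[of _ "s * u"]) (auto simp: mult_left_le_one_le)
  qed
qed

lemma hit_prob_pos: "u > 0 \<Longrightarrow> hit_prob \<Omega> y u = emeasure M {\<omega>\<in>space M. hits (\<lambda>s. y + W s \<omega>) u (frontier \<Omega>)}"
  unfolding hit_prob_def using hits_rescale[of u "\<lambda>s. y + W s _"] by (simp add: max_def)

lemma W_joint: "(\<lambda>p. W (max 0 (fst p)) (snd p)) \<in> borel_measurable ((borel::real measure) \<Otimes>\<^sub>M M)"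
proof (rule measurable_random_time)
  show "(\<lambda>p. W s (snd p)) \<in> borel_measurable (borel \<Otimes>\<^sub>M M)" if "s \<ge> 0" for s using that by measurable
qed (auto simp: space_pair_measure paths)

lemma hit_prob_measurable: "(\<lambda>(y, u). hit_prob \<Omega> y u) \<in> borel_measurable (borel \<Otimes>\<^sub>M borel)"
proof -
  let ?N = "((borel::'a measure) \<Otimes>\<^sub>M (borel::real measure)) \<Otimes>\<^sub>M M"
  have "{p\<in>space ?N. hits (\<lambda>s. fst (fst p) + W (s * max 0 (snd (fst p))) (snd p)) 1 (frontier \<Omega>)} \<in> sets ?N"
  proof (rule hits_measurable)
    fix s :: real assume s: "0 \<le> s"
    have "(\<lambda>p. (s * max 0 (snd (fst p)), snd p)) \<in> ?N \<rightarrow>\<^sub>M borel \<Otimes>\<^sub>M M" by measurable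
    from measurable_compose[OF this W_joint] have "(\<lambda>p. W (s * max 0 (snd (fst p))) (snd p)) \<in> borel_measurable ?N"
      using s by (simp add: max_absorb2)
    then show "(\<lambda>p. fst (fst p) + W (s * max 0 (snd (fst p))) (snd p)) \<in> borel_measurable ?N" by measurable
  next
    fix p assume "p \<in> space ?N"
    then have "snd p \<in> space M" by (auto simp: space_pair_measure)
    from paths[OF this] have "continuous_on {0..1} (\<lambda>s. W (s * max 0 (snd (fst p))) (snd p))"
      by (rule continuous_on_compose2) (auto intro!: continuous_intros)
    then show "continuous_on {0..1} (\<lambda>s. fst (fst p) + W (s * max 0 (snd (fst p))) (snd p))"
      by (intro continuous_intros)
  qed auto
  from measurable_emeasure_Pair[OF this] show ?thesis
    by (rule measurable_cong[THEN iffD1, rotated]) (auto simp: hit_prob_def space_pair_measure intro!: arg_cong[where f="emeasure M"])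
qed

lemma out_prob_measurable:
  assumes [measurable]: "\<Omega> \<in> sets borel"
  shows "(\<lambda>(y, u). out_prob \<Omega> y u) \<in> borel_measurable (borel \<Otimes>\<^sub>M borel)"
proof -
  let ?N = "((borel::'a measure) \<Otimes>\<^sub>M (borel::real measure)) \<Otimes>\<^sub>M M"
  have "(\<lambda>p. (snd (fst p), snd p)) \<in> ?N \<rightarrow>\<^sub>M borel \<Otimes>\<^sub>M M" by measurable
  from measurable_compose[OF this W_joint] have [measurable]: "(\<lambda>p. W (max 0 (snd (fst p))) (snd p)) \<in> borel_measurable ?N" by simp
  have "{p\<in>space ?N. fst (fst p) + W (max 0 (snd (fst p))) (snd p) \<notin> \<Omega>} \<in> sets ?N" by measurable
  from measurable_emeasure_Pair[OF this] show ?thesis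
    by (rule measurable_cong[THEN iffD1, rotated]) (auto simp: out_prob_def space_pair_measure intro!: arg_cong[where f="emeasure M"])
qed

end

locale subordinated = brownian M W x for M :: "'w measure" and W :: "real \<Rightarrow> 'w \<Rightarrow> 'a::euclidean_space" and x :: 'a +
  fixes D :: "real \<Rightarrow> 'w \<Rightarrow> real" and \<phi> :: "real \<Rightarrow> real" and \<nu> :: "real measure"
  assumes sub: "subordinator M D \<phi> \<nu>" and indep: "indep_processes M W D"
begin

lemma D_measurable [measurable]: "t \<ge> 0 \<Longrightarrow> D t \<in> borel_measurable M"
  using sub by (simp add: subordinator_def levy_process_def)

lemma D_path: "\<omega> \<in> space M \<Longrightarrow> D 0 \<omega> = 0" "\<omega> \<in> space M \<Longrightarrow> strict_mono_on {0..} (\<lambda>t. D t \<omega>)" "\<omega> \<in> space M \<Longrightarrow> cadlag (\<lambda>t. D t \<omega>)"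
  using sub by (auto simp: subordinator_def levy_process_def)

lemma D_pos: "\<omega> \<in> space M \<Longrightarrow> t > 0 \<Longrightarrow> D t \<omega> > 0"
  using strict_mono_onD[OF D_path(2), of \<omega> 0 t] D_path(1)[of \<omega>] by simp

lemma D_laplace: "t \<ge> 0 \<Longrightarrow> s > 0 \<Longrightarrow> (\<integral>\<omega>. exp (- s * D t \<omega>) \<partial>M) = exp (- t * \<phi> s)"
  using sub by (simp add: subordinator_def)

lemma W_random_time_measurable:
  assumes t: "t > 0" and g: "\<And>p. p \<in> space (path_algebra M W \<Otimes>\<^sub>M path_algebra M D) \<Longrightarrow> 0 \<le> g p"
    "g \<in> borel_measurable (path_algebra M W \<Otimes>\<^sub>M path_algebra M D)"
  shows "(\<lambda>p. W (g p) (fst p)) \<in> borel_measurable (path_algebra M W \<Otimes>\<^sub>M path_algebra M D)"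
proof (rule measurable_random_time[OF _ _ g(2,1)])
  show "(\<lambda>p. W s (fst p)) \<in> borel_measurable (path_algebra M W \<Otimes>\<^sub>M path_algebra M D)" if "s \<ge> 0" for s
    by (rule measurable_compose[OF measurable_fst path_algebra_component[OF that]])
qed (auto simp: space_pair_measure paths)

lemma D_snd_measurable: "t \<ge> 0 \<Longrightarrow> (\<lambda>p. D t (snd p)) \<in> borel_measurable (path_algebra M W \<Otimes>\<^sub>M path_algebra M D)"
  by (rule measurable_compose[OF measurable_snd path_algebra_component])

lemma exits_event_measurable:
  assumes t: "t > 0" and op: "open \<Omega>"
  shows "{p \<in> space (path_algebra M W \<Otimes>\<^sub>M path_algebra M D). exits (\<lambda>s. W s (fst p)) (D t (snd p)) \<Omega>} \<in> sets (path_algebra M W \<Otimes>\<^sub>M path_algebra M D)"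
proof -
  let ?N = "path_algebra M W \<Otimes>\<^sub>M path_algebra M D"
  have Dm[measurable]: "(\<lambda>p. D t (snd p)) \<in> borel_measurable ?N" using t by (intro D_snd_measurable) simp
  have Dp: "D t (snd p) > 0" if "p \<in> space ?N" for p using that D_pos[OF _ t] by (auto simp: space_pair_measure)
  define h where "h n s = 1 / real (Suc n) + (1 - 1 / real (Suc n)) * s" for n s
  have h0: "h n s \<ge> 0" if "s \<ge> 0" for n s using that by (auto simp: h_def intro!: add_nonneg_nonneg mult_nonneg_nonneg)
  have "{p \<in> space ?N. exits (\<lambda>s. W s (fst p)) (D t (snd p)) \<Omega>}
     = (\<Union>n. {p \<in> space ?N. hits (\<lambda>s. W (h n s * D t (snd p)) (fst p)) 1 (- \<Omega>)})"
  proof -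
    have "exits (\<lambda>s. W s (fst p)) (D t (snd p)) \<Omega> \<longleftrightarrow> (\<exists>n. hits (\<lambda>s. W (h n s * D t (snd p)) (fst p)) 1 (- \<Omega>))"
      if "p \<in> space ?N" for p unfolding h_def by (rule exits_iff_hits_rescaled[OF Dp[OF that]])
    then show ?thesis by blast
  qed
  also have "\<dots> \<in> sets ?N"
  proof (rule sets.countable_nat_UN, rule image_subsetI)
    fix n :: nat
    show "{p \<in> space ?N. hits (\<lambda>s. W (h n s * D t (snd p)) (fst p)) 1 (- \<Omega>)} \<in> sets ?N"
    proof (rule hits_measurable)
      fix s :: real assume s: "0 \<le> s"
      show "(\<lambda>p. W (h n s * D t (snd p)) (fst p)) \<in> borel_measurable ?N"
      proof (rule W_random_time_measurable[OF t])
        show "0 \<le> h n s * D t (snd p)" if "p \<in> space ?N" for p using h0[OF s, of n] Dp[OF that] by simp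
      qed measurable
    next
      fix p assume p: "p \<in> space ?N"
      then have "fst p \<in> space M" by (auto simp: space_pair_measure)
      from paths[OF this] show "continuous_on {0..1} (\<lambda>s. W (h n s * D t (snd p)) (fst p))"
        by (rule continuous_on_compose2) (use h0 Dp[OF p] in \<open>auto simp: h_def intro!: continuous_intros mult_nonneg_nonneg add_nonneg_nonneg\<close>)
    qed (use op in \<open>auto simp: closed_def\<close>)
  qed
  finally show ?thesis .
qed

text \<open>Given \<open>D t = u\<close>, survival of the subordinate killed path means that the path has not left \<open>\<Omega>\<close> by time \<open>u\<close>. The
probability is transferred to one fixed standard Brownian motion \<open>W0\<close>, because for each starting point the process
lives under a different measure.\<close>

lemma spectral_probability:
  assumes M0: "std_brownian M0 W0" and op: "open \<Omega>" and xin: "x \<in> \<Omega>" and t: "t > 0"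
  shows "measure M {\<omega>\<in>space M. ereal t < exit_time (time_changed (killed W \<Omega>) D) (Some ` \<Omega>) \<omega>}
    = 1 - enn2real (\<integral>\<^sup>+u. std_brownian.hit_prob M0 W0 \<Omega> x u \<partial>distr M borel (D t))"
proof -
  interpret S: std_brownian M0 W0 by fact
  let ?Q = "\<lambda>\<omega> \<omega>'. exits (\<lambda>s. W s \<omega>) (D t \<omega>') \<Omega>"
  note dec = indep_processes_decouple[OF prob_space_axioms indep W_measurable D_measurable, of ?Q, OF _ _ exits_event_measurable[OF t op]]
  have Q: "{\<omega>\<in>space M. ?Q \<omega> \<omega>} \<in> sets M" by (rule dec(1))
  have eq: "{\<omega>\<in>space M. ereal t < exit_time (time_changed (killed W \<Omega>) D) (Some ` \<Omega>) \<omega>} = space M - {\<omega>\<in>space M. ?Q \<omega> \<omega>}"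
  proof -
    have "ereal t < exit_time (time_changed (killed W \<Omega>) D) (Some ` \<Omega>) \<omega> \<longleftrightarrow> \<not> ?Q \<omega> \<omega>" if "\<omega> \<in> space M" for \<omega>
      unfolding subordinate_killed_exit[where D=D and \<omega>=\<omega>, OF op D_path[OF that] t]
      by (rule less_exit_time_iff[where X=W and \<omega>=\<omega>, OF paths[OF that] op D_pos[OF that t]])
    then show ?thesis by blast
  qed
  have "emeasure M {\<omega>\<in>space M. ?Q \<omega> \<omega>} = (\<integral>\<^sup>+\<omega>'. emeasure M {\<omega>\<in>space M. ?Q \<omega> \<omega>'} \<partial>M)" by (rule dec(2))
  also have "\<dots> = (\<integral>\<^sup>+\<omega>'. S.hit_prob \<Omega> x (D t \<omega>') \<partial>M)"
  proof (rule nn_integral_cong)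
    fix \<omega>' assume "\<omega>' \<in> space M"
    define u where "u = D t \<omega>'"
    have u: "u > 0" using D_pos[OF \<open>\<omega>' \<in> space M\<close> t] by (simp add: u_def)
    have Hm: "{\<omega>\<in>space M. hits (\<lambda>s. W s \<omega>) u (frontier \<Omega>)} \<in> sets M"
      by (rule hits_measurable[OF _ u]) (auto intro: continuous_on_subset[OF paths])
    have Em: "{\<omega>\<in>space M. exits (\<lambda>s. W s \<omega>) u \<Omega>} \<in> sets M"
    proof -
      define h where "h n s = 1 / real (Suc n) + (1 - 1 / real (Suc n)) * s" for n s
      have h0: "h n s \<ge> 0" if "s \<ge> 0" for n s using that by (auto simp: h_def intro!: add_nonneg_nonneg mult_nonneg_nonneg)
      have "{\<omega>\<in>space M. exits (\<lambda>s. W s \<omega>) u \<Omega>} = (\<Union>n. {\<omega>\<in>space M. hits (\<lambda>s. W (h n s * u) \<omega>) 1 (- \<Omega>)})"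
      proof -
        have "exits (\<lambda>s. W s \<omega>) u \<Omega> \<longleftrightarrow> (\<exists>n. hits (\<lambda>s. W (h n s * u) \<omega>) 1 (- \<Omega>))" for \<omega>
          unfolding h_def by (rule exits_iff_hits_rescaled[OF u])
        then show ?thesis by blast
      qed
      also have "\<dots> \<in> sets M"
      proof (rule sets.countable_nat_UN, rule image_subsetI, rule hits_measurable)
        show "W (h n s * u) \<in> borel_measurable M" if "0 \<le> s" for n s using h0[OF that, of n] u by (intro W_measurable) simp
        show "continuous_on {0..1} (\<lambda>s. W (h n s * u) \<omega>)" if "\<omega> \<in> space M" for n \<omega>
          using paths[OF that] by (rule continuous_on_compose2) (use h0 u in \<open>auto simp: h_def intro!: continuous_intros mult_nonneg_nonneg add_nonneg_nonneg\<close>)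
      qed (use op in \<open>auto simp: closed_def\<close>)
      finally show ?thesis .
    qed
    have "emeasure M {\<omega>\<in>space M. exits (\<lambda>s. W s \<omega>) u \<Omega>} = emeasure M {\<omega>\<in>space M. hits (\<lambda>s. W s \<omega>) u (frontier \<Omega>)}"
    proof (rule emeasure_eq_AE[OF _ Em Hm])
      show "AE \<omega> in M. \<omega> \<in> {\<omega>\<in>space M. exits (\<lambda>s. W s \<omega>) u \<Omega>} \<longleftrightarrow> \<omega> \<in> {\<omega>\<in>space M. hits (\<lambda>s. W s \<omega>) u (frontier \<Omega>)}"
        using start AE_space by eventually_elim (use exits_iff_hits_frontier[OF paths op] xin in auto)
    qed
    also have "\<dots> = ennreal (measure M {\<omega>\<in>space M. hits (\<lambda>s. W s \<omega>) u (frontier \<Omega>)})" by (rule emeasure_eq_measure)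
    also have "measure M {\<omega>\<in>space M. hits (\<lambda>s. W s \<omega>) u (frontier \<Omega>)} = measure M0 {\<omega>\<in>space M0. hits (\<lambda>s. x + W0 s \<omega>) u (frontier \<Omega>)}"
      by (rule hits_prob_transfer[OF brownian_axioms S.brownian_axioms u]) simp
    also have "ennreal \<dots> = S.hit_prob \<Omega> x u" unfolding S.hit_prob_pos[OF u] by (rule S.emeasure_eq_measure[symmetric])
    finally show "emeasure M {\<omega>\<in>space M. ?Q \<omega> \<omega>'} = S.hit_prob \<Omega> x (D t \<omega>')" by (simp add: u_def)
  qed
  also have "\<dots> = (\<integral>\<^sup>+u. S.hit_prob \<Omega> x u \<partial>distr M borel (D t))"
  proof (rule nn_integral_distr[symmetric])
    show "S.hit_prob \<Omega> x \<in> borel_measurable (distr M borel (D t))"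
      using measurable_compose[OF measurable_Pair1'[of x borel borel] S.hit_prob_measurable[of \<Omega>]] by simp
  qed (rule D_measurable[OF less_imp_le[OF t]])
  finally have "measure M {\<omega>\<in>space M. ?Q \<omega> \<omega>} = enn2real (\<integral>\<^sup>+u. S.hit_prob \<Omega> x u \<partial>distr M borel (D t))"
    by (simp add: measure_def)
  then show ?thesis unfolding eq using prob_compl[OF Q] by simp
qed

lemma regular_probability:
  assumes M0: "std_brownian M0 W0" and op: "open \<Omega>" and t: "t > 0"
  shows "measure M {\<omega>\<in>space M. time_changed W D t \<omega> \<in> \<Omega>}
    = 1 - enn2real (\<integral>\<^sup>+u. std_brownian.out_prob M0 W0 \<Omega> x u \<partial>distr M borel (D t))"
proof -
  interpret S: std_brownian M0 W0 by fact
  let ?N = "path_algebra M W \<Otimes>\<^sub>M path_algebra M D"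
  let ?Q = "\<lambda>\<omega> \<omega>'. W (D t \<omega>') \<omega> \<notin> \<Omega>"
  have \<Omega>[measurable]: "\<Omega> \<in> sets borel" using op by simp
  have [measurable]: "(\<lambda>p. W (D t (snd p)) (fst p)) \<in> borel_measurable ?N"
    by (rule W_random_time_measurable[OF t]) (use t D_pos in \<open>auto simp: space_pair_measure intro: less_imp_le D_snd_measurable\<close>)
  have "{p\<in>space ?N. ?Q (fst p) (snd p)} \<in> sets ?N" by measurable
  note dec = indep_processes_decouple[OF prob_space_axioms indep W_measurable D_measurable, of ?Q, OF _ _ this]
  have Q: "{\<omega>\<in>space M. ?Q \<omega> \<omega>} \<in> sets M" by (rule dec(1))
  have eq: "{\<omega>\<in>space M. time_changed W D t \<omega> \<in> \<Omega>} = space M - {\<omega>\<in>space M. ?Q \<omega> \<omega>}" by (auto simp: time_changed_def)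
  have "emeasure M {\<omega>\<in>space M. ?Q \<omega> \<omega>} = (\<integral>\<^sup>+\<omega>'. emeasure M {\<omega>\<in>space M. ?Q \<omega> \<omega>'} \<partial>M)" by (rule dec(2))
  also have "\<dots> = (\<integral>\<^sup>+\<omega>'. S.out_prob \<Omega> x (D t \<omega>') \<partial>M)"
  proof (rule nn_integral_cong)
    fix \<omega>' assume "\<omega>' \<in> space M"
    define u where "u = D t \<omega>'"
    have u: "u > 0" using D_pos[OF \<open>\<omega>' \<in> space M\<close> t] by (simp add: u_def)
    have [measurable]: "W u \<in> borel_measurable M" "W0 u \<in> borel_measurable M0" using u by auto
    have "emeasure M {\<omega>\<in>space M. W u \<omega> \<notin> \<Omega>} = emeasure (heat_law M W x u) {z. x + z \<notin> \<Omega>}"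
      unfolding heat_law_def by (subst emeasure_distr) (auto intro!: arg_cong[where f="emeasure M"])
    also have "heat_law M W x u = heat_law M0 W0 0 u"
      using u by (intro heat_law_unique brownian_axioms S.brownian_axioms) simp
    also have "emeasure (heat_law M0 W0 0 u) {z. x + z \<notin> \<Omega>} = emeasure M0 {\<omega>\<in>space M0. x + W0 u \<omega> \<notin> \<Omega>}"
      unfolding heat_law_def by (subst emeasure_distr) (auto intro!: arg_cong[where f="emeasure M0"])
    finally show "emeasure M {\<omega>\<in>space M. ?Q \<omega> \<omega>'} = S.out_prob \<Omega> x (D t \<omega>')" using u by (simp add: S.out_prob_def u_def[symmetric])
  qed
  also have "\<dots> = (\<integral>\<^sup>+u. S.out_prob \<Omega> x u \<partial>distr M borel (D t))"
  proof (rule nn_integral_distr[symmetric])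
    show "S.out_prob \<Omega> x \<in> borel_measurable (distr M borel (D t))"
      using measurable_compose[OF measurable_Pair1'[of x borel borel] S.out_prob_measurable[OF \<Omega>]] by simp
  qed (rule D_measurable[OF less_imp_le[OF t]])
  finally have "measure M {\<omega>\<in>space M. ?Q \<omega> \<omega>} = enn2real (\<integral>\<^sup>+u. S.out_prob \<Omega> x u \<partial>distr M borel (D t))"
    by (simp add: measure_def)
  then show ?thesis unfolding eq using prob_compl[OF Q] by simp
qed

end

text \<open>Integrating over the starting points and averaging over the random time may be interchanged.\<close>

lemma content_loss_eq:
  fixes \<Omega> :: "'a::euclidean_space set" and p :: "'a \<Rightarrow> real \<Rightarrow> ennreal"
  assumes pm: "(\<lambda>(x, u). p x u) \<in> borel_measurable (borel \<Otimes>\<^sub>M borel)" and p1: "\<And>x u. p x u \<le> 1"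
    and R: "prob_space R" "sets R = sets borel" and \<Omega>[measurable]: "\<Omega> \<in> sets borel" and fin: "emeasure lborel \<Omega> < \<infinity>"
    and c: "\<And>x. x \<in> \<Omega> \<Longrightarrow> c x = 1 - enn2real (\<integral>\<^sup>+u. p x u \<partial>R)"
  shows "measure lborel \<Omega> - (LINT x:\<Omega>|lborel. c x) = (\<integral>u. enn2real (\<integral>\<^sup>+x. p x u * indicator \<Omega> x \<partial>lborel) \<partial>R)"
proof -
  interpret R: prob_space R by fact
  interpret pair_sigma_finite lborel R ..
  note [measurable_cong] = R(2)
  have pm'[measurable]: "(\<lambda>q. p (fst q) (snd q)) \<in> borel_measurable (lborel \<Otimes>\<^sub>M R)"
    using pm by (simp add: case_prod_beta' cong: measurable_cong_sets sets_pair_measure_cong)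
  define F where "F x = (\<integral>\<^sup>+u. p x u \<partial>R)" for x
  have Fm[measurable]: "F \<in> borel_measurable borel"
  proof -
    have "(\<lambda>x. \<integral>\<^sup>+u. (\<lambda>q. p (fst q) (snd q)) (x, u) \<partial>R) \<in> borel_measurable lborel"
      by (rule R.borel_measurable_nn_integral_fst[OF pm'])
    then show ?thesis by (simp add: F_def[abs_def])
  qed
  have F1: "F x \<le> 1" for x
  proof -
    have "F x \<le> (\<integral>\<^sup>+u. 1 \<partial>R)" unfolding F_def by (intro nn_integral_mono p1)
    then show ?thesis by (simp add: R.emeasure_space_1)
  qed
  have Ff: "ennreal (enn2real (F x)) = F x" for x using le_less_trans[OF F1[of x] ennreal_one_less_top] by simp
  have F01: "0 \<le> enn2real (F x) \<and> enn2real (F x) \<le> 1" for x using enn2real_mono[OF F1[of x]] by simp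
  have i1: "integrable lborel (\<lambda>x. indicator \<Omega> x :: real)" using fin by simp
  have i2: "integrable lborel (\<lambda>x. enn2real (F x) * indicator \<Omega> x)"
    by (rule Bochner_Integration.integrable_bound[OF i1]) (use F01 in \<open>auto simp: indicator_def\<close>)
  have "(LINT x:\<Omega>|lborel. c x) = (\<integral>x. indicator \<Omega> x - enn2real (F x) * indicator \<Omega> x \<partial>lborel)"
    unfolding set_lebesgue_integral_def by (rule Bochner_Integration.integral_cong) (auto simp: c F_def indicator_def)
  also have "\<dots> = measure lborel \<Omega> - (\<integral>x. enn2real (F x) * indicator \<Omega> x \<partial>lborel)"
    using i1 i2 by simp
  finally have "measure lborel \<Omega> - (LINT x:\<Omega>|lborel. c x) = (\<integral>x. enn2real (F x) * indicator \<Omega> x \<partial>lborel)" by simp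
  also have "\<dots> = enn2real (\<integral>\<^sup>+x. ennreal (enn2real (F x) * indicator \<Omega> x) \<partial>lborel)"
    by (rule integral_eq_nn_integral) (use F01 in auto)
  also have "(\<integral>\<^sup>+x. ennreal (enn2real (F x) * indicator \<Omega> x) \<partial>lborel) = (\<integral>\<^sup>+x. \<integral>\<^sup>+u. p x u * indicator \<Omega> x \<partial>R \<partial>lborel)"
  proof (rule nn_integral_cong)
    fix x
    have "(\<lambda>u. p x u) \<in> borel_measurable R"
      using measurable_compose[OF measurable_Pair1'[of x lborel R] pm'] by simp
    then have "(\<integral>\<^sup>+u. p x u * indicator \<Omega> x \<partial>R) = F x * indicator \<Omega> x" unfolding F_def by (rule nn_integral_multc)
    then show "ennreal (enn2real (F x) * indicator \<Omega> x) = (\<integral>\<^sup>+u. p x u * indicator \<Omega> x \<partial>R)"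
      using Ff[of x] by (auto simp: indicator_def)
  qed
  also have "\<dots> = (\<integral>\<^sup>+u. \<integral>\<^sup>+x. p x u * indicator \<Omega> x \<partial>lborel \<partial>R)"
    by (rule Fubini'[symmetric]) (simp add: case_prod_beta', measurable)
  also have "enn2real \<dots> = (\<integral>u. enn2real (\<integral>\<^sup>+x. p x u * indicator \<Omega> x \<partial>lborel) \<partial>R)"
  proof -
    let ?G = "\<lambda>u. \<integral>\<^sup>+x. p x u * indicator \<Omega> x \<partial>lborel"
    have "?G u \<le> (\<integral>\<^sup>+x. indicator \<Omega> x \<partial>lborel)" for u by (intro nn_integral_mono) (auto simp: indicator_def p1)
    then have "?G u < \<infinity>" for u by (rule le_less_trans) (use fin in simp)
    then have "ennreal (enn2real (?G u)) = ?G u" for u by simp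
    moreover have "?G \<in> borel_measurable R"
    proof -
      have [measurable]: "(\<lambda>q. p (snd q) (fst q)) \<in> borel_measurable (R \<Otimes>\<^sub>M lborel)"
        using measurable_compose[OF measurable_pair_swap' pm'] by (simp add: case_prod_beta')
      show ?thesis by measurable
    qed
    ultimately show ?thesis by (subst integral_eq_nn_integral) auto
  qed
  finally show ?thesis .
qed

section \<open>Admissible domains\<close>

text \<open>Singletons show that the content is at most the number of points; sets of diameter below the smallest distance
between two points contain at most one point each.\<close>

lemma hausdorff_measure_0_finite:
  fixes F :: "'a::euclidean_space set"
  assumes F: "finite F" shows "hausdorff_measure 0 F = ennreal (real (card F))"
proof (rule antisym)
  have hterm: "(if U = {} then 0 else ennreal (unit_ball_vol (real 0) * (diameter U / 2) ^ 0)) = (if U = {} then 0 else 1)" for U :: "'a set"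
    by simp
  show "hausdorff_measure 0 F \<le> ennreal (real (card F))"
    unfolding hausdorff_measure_eq_SUP
  proof (rule SUP_least)
    fix \<delta> :: real assume "\<delta> \<in> {0<..}"
    obtain xs where xs: "set xs = F" "length xs = card F" "distinct xs" using F by (metis finite_distinct_list distinct_card)
    define U where "U i = (if i < length xs then {xs ! i} else {})" for i
    have "F \<subseteq> (\<Union>i. U i)" using xs(1) by (force simp: U_def in_set_conv_nth)
    moreover have "bounded (U i) \<and> diameter (U i) \<le> \<delta>" for i using \<open>\<delta> \<in> {0<..}\<close> by (simp add: U_def)
    ultimately have "hausdorff_content 0 \<delta> F \<le> (\<Sum>i. if U i = {} then 0 else ennreal (unit_ball_vol (real 0) * (diameter (U i) / 2) ^ 0))"
      unfolding hausdorff_content_def by (intro INF_lower) auto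
    also have "\<dots> = (\<Sum>i. if U i = {} then 0 else 1)" unfolding hterm ..
    also have "\<dots> = (\<Sum>i<length xs. if U i = {} then 0 else 1)" by (rule suminf_finite) (auto simp: U_def)
    also have "\<dots> = (\<Sum>i<length xs. 1)" by (intro sum.cong) (auto simp: U_def)
    also have "\<dots> = ennreal (real (card F))" using xs(2) by (simp add: ennreal_of_nat_eq_real_of_nat)
    finally show "hausdorff_content 0 \<delta> F \<le> ennreal (real (card F))" .
  qed
  define S where "S = insert 1 ((\<lambda>(x, y). dist x y) ` {(x, y). x \<in> F \<and> y \<in> F \<and> x \<noteq> y})"
  have "finite {(x, y). x \<in> F \<and> y \<in> F \<and> x \<noteq> y}" by (rule finite_subset[of _ "F \<times> F"]) (use F in auto)
  then have S: "finite S" "S \<noteq> {}" "\<And>s. s \<in> S \<Longrightarrow> s > 0" by (auto simp: S_def)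
  define \<delta> where "\<delta> = Min S / 2"
  have Mp: "Min S > 0" using S Min_in by blast
  have sep: "\<delta> < dist x y" if "x \<in> F" "y \<in> F" "x \<noteq> y" for x y
  proof -
    have "dist x y \<in> S" using that by (auto simp: S_def)
    from Min_le[OF S(1) this] show ?thesis using Mp by (simp add: \<delta>_def)
  qed
  have "ennreal (real (card F)) \<le> hausdorff_content 0 \<delta> F"
    unfolding hausdorff_content_def
  proof (rule INF_greatest)
    fix U assume "U \<in> {U :: nat \<Rightarrow> 'a set. F \<subseteq> (\<Union>i. U i) \<and> (\<forall>i. bounded (U i) \<and> diameter (U i) \<le> \<delta>)}"
    then have U: "F \<subseteq> (\<Union>i. U i)" "\<And>i. bounded (U i)" "\<And>i. diameter (U i) \<le> \<delta>" by auto
    have "\<forall>x\<in>F. \<exists>i. x \<in> U i" using U(1) by blast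
    then obtain f where f: "\<And>x. x \<in> F \<Longrightarrow> x \<in> U (f x)" by metis
    have inj: "inj_on f F"
    proof (rule inj_onI, rule ccontr)
      fix x y assume xy: "x \<in> F" "y \<in> F" "f x = f y" "x \<noteq> y"
      have "dist x y \<le> diameter (U (f x))" using f[OF xy(1)] f[OF xy(2)] xy(3) by (intro diameter_bounded_bound U(2)) auto
      then show False using sep[OF xy(1,2,4)] U(3)[of "f x"] by linarith
    qed
    have "ennreal (real (card F)) = (\<Sum>i\<in>f ` F. 1)" using card_image[OF inj] by (simp add: ennreal_of_nat_eq_real_of_nat)
    also have "\<dots> = (\<Sum>i\<in>f ` F. if U i = {} then 0 else 1)" using f by (intro sum.cong) auto
    also have "\<dots> \<le> (\<Sum>i. if U i = {} then 0 else (1::ennreal))" using F by (intro sum_le_suminf) auto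
    finally show "ennreal (real (card F)) \<le> (\<Sum>i. if U i = {} then 0 else ennreal (unit_ball_vol (real 0) * (diameter (U i) / 2) ^ 0))"
      unfolding hterm .
  qed
  also have "\<dots> \<le> hausdorff_measure 0 F"
    unfolding hausdorff_measure_eq_SUP using Mp by (intro SUP_upper) (simp add: \<delta>_def)
  finally show "ennreal (real (card F)) \<le> hausdorff_measure 0 F" .
qed

lemma interval_flat_boundary:
  fixes a b :: "'a::euclidean_space"
  assumes dim: "DIM('a) = 1"
  shows "flat_boundary (box a b)" "finite (frontier (box a b))"
proof -
  obtain i :: 'a where i: "Basis = {i}" using dim by (auto simp: card_1_singleton_iff)
  have i1: "norm i = 1" "i \<bullet> i = 1" using norm_Basis[of i] inner_same_Basis[of i] by (simp_all add: i)
  have rep: "y = (y \<bullet> i) *\<^sub>R i" for y using euclidean_representation[of y] by (simp add: i)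
  have nrm: "norm y = \<bar>y \<bullet> i\<bar>" for y by (subst rep) (simp add: i1 del: rep)
  have box: "y \<in> box a b \<longleftrightarrow> a \<bullet> i < y \<bullet> i \<and> y \<bullet> i < b \<bullet> i" for y by (simp add: mem_box i)
  have fr: "frontier (box a b) \<subseteq> {a, b}"
  proof (cases "box a b = {}")
    case False
    show ?thesis
    proof
      fix p assume "p \<in> frontier (box a b)"
      then have "p \<in> cbox a b - box a b" using False by (simp add: frontier_box)
      then have "p \<bullet> i = a \<bullet> i \<or> p \<bullet> i = b \<bullet> i" by (auto simp: mem_box i)
      then show "p \<in> {a, b}" using rep[of p] rep[of a] rep[of b] by auto
    qed
  qed simp
  then show "finite (frontier (box a b))" by (rule finite_subset) simp
  show "flat_boundary (box a b)"
    unfolding flat_boundary_def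
  proof (intro conjI allI impI)
    fix \<eta> :: real assume "\<eta> > 0"
    show "\<exists>\<rho>>0. \<forall>p\<in>frontier (box a b). \<exists>e. flat_at (box a b) \<eta> \<rho> p e"
    proof (cases "box a b = {}")
      case True then show ?thesis by (intro exI[of _ 1]) simp
    next
      case False
      define \<rho> where "\<rho> = b \<bullet> i - a \<bullet> i"
      have \<rho>: "\<rho> > 0" using False box by (fastforce simp: \<rho>_def)
      have lip: "\<eta>-lipschitz_on X (\<lambda>_::'a. 0::real)" for X using \<open>\<eta> > 0\<close> by (intro lipschitz_onI) auto
      have fa: "flat_at (box a b) \<eta> \<rho> a i"
        unfolding flat_at_def
      proof (intro conjI i1 exI[of _ "\<lambda>_. 0"] lip refl ballI)
        fix y assume "y \<in> ball a \<rho>"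
        then have "\<bar>(y - a) \<bullet> i\<bar> < \<rho>" using nrm[of "y - a"] by (simp add: dist_norm norm_minus_commute)
        then show "(y \<in> box a b) = (0 < (y - a) \<bullet> i)" by (auto simp: box \<rho>_def inner_diff_left)
      qed
      have fb: "flat_at (box a b) \<eta> \<rho> b (- i)"
        unfolding flat_at_def
      proof (intro conjI exI[of _ "\<lambda>_. 0"] lip refl ballI)
        show "norm (- i) = 1" using i1 by simp
        fix y assume "y \<in> ball b \<rho>"
        then have "\<bar>(y - b) \<bullet> i\<bar> < \<rho>" using nrm[of "y - b"] by (simp add: dist_norm norm_minus_commute)
        then show "(y \<in> box a b) = (0 < (y - b) \<bullet> - i)" by (auto simp: box \<rho>_def inner_diff_left)
      qed
      show ?thesis using \<rho> fa fb fr by blast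
    qed
  qed (rule open_box)
qed

lemma domain_regularity:
  fixes \<Omega> :: "'a::euclidean_space set"
  assumes domain: "(DIM('a) = 1 \<and> (\<exists>a b. \<Omega> = box a b)) \<or>
      (DIM('a) \<ge> 2 \<and> bounded \<Omega> \<and> connected \<Omega> \<and> C11_open_set \<Omega>)"
  shows "flat_boundary \<Omega>" "bounded \<Omega>" "enn2real (hausdorff_measure (DIM('a) - 1) (frontier \<Omega>)) = boundary_measure \<Omega>"
proof -
  consider (1) a b where "DIM('a) = 1" "\<Omega> = box a b" | (2) "DIM('a) \<ge> 2" "bounded \<Omega>" "C11_open_set \<Omega>"
    using domain by blast
  then have "flat_boundary \<Omega> \<and> bounded \<Omega> \<and> enn2real (hausdorff_measure (DIM('a) - 1) (frontier \<Omega>)) = boundary_measure \<Omega>"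
  proof cases
    case 1
    then show ?thesis
      using interval_flat_boundary[OF 1(1), of a b] hausdorff_measure_0_finite[of "frontier (box a b)"]
      by (simp add: boundary_measure_def bounded_box)
  next
    case 2
    then show ?thesis using C11_imp_flat[OF 2(3)] by (simp add: boundary_measure_def)
  qed
  then show "flat_boundary \<Omega>" "bounded \<Omega>" "enn2real (hausdorff_measure (DIM('a) - 1) (frontier \<Omega>)) = boundary_measure \<Omega>"
    by auto
qed

section \<open>Spectral and regular heat content\<close>

theorem theorem3p6:
  fixes \<Omega> :: "'a::euclidean_space set"
    and P :: "'a \<Rightarrow> 'w measure"
    and W :: "real \<Rightarrow> 'w \<Rightarrow> 'a"
    and D :: "real \<Rightarrow> 'w \<Rightarrow> real"
    and \<phi> :: "real \<Rightarrow> real"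
    and \<nu> :: "real measure"
    and N :: "'v measure"
    and S :: "real \<Rightarrow> 'v \<Rightarrow> real"
    and \<beta> :: real
  assumes domain: "(DIM('a) = 1 \<and> (\<exists>a b. \<Omega> = box a b)) \<or>
      (DIM('a) \<ge> 2 \<and> bounded \<Omega> \<and> connected \<Omega> \<and> C11_open_set \<Omega>)"
    and beta: "1 / 2 < \<beta>" "\<beta> < 1"
    and W: "\<And>x. brownian_motion (P x) x W"
    and D: "\<And>x. subordinator (P x) D \<phi> \<nu>"
    and indep: "\<And>x. indep_processes (P x) W D"
    and rv: "regularly_varying \<phi> \<beta>"
    and amd: "almost_monotone_density \<nu>"
    and S: "stable_subordinator N S \<beta>"
  shows "((\<lambda>t. (measure lborel \<Omega> - spectral_heat_content P W D \<Omega> t)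
                / (inv_into {0<..} \<phi> (1 / t)) powr (- 1 / 2))
          \<longlongrightarrow> (LINT \<omega>|N. S 1 \<omega> powr (1 / 2)) * (2 * boundary_measure \<Omega> / sqrt pi)) (at_right 0)
       \<and> ((\<lambda>t. (measure lborel \<Omega> - regular_heat_content P W D \<Omega> t)
                / (inv_into {0<..} \<phi> (1 / t)) powr (- 1 / 2))
          \<longlongrightarrow> (LINT \<omega>|N. S 1 \<omega> powr (1 / 2)) * (boundary_measure \<Omega> / sqrt pi)) (at_right 0)"
proof -
  have flat: "flat_boundary \<Omega>" and bd: "bounded \<Omega>"
    and bm: "enn2real (hausdorff_measure (DIM('a) - 1) (frontier \<Omega>)) = boundary_measure \<Omega>"
    using domain_regularity[OF domain] by auto
  have op: "open \<Omega>" using flat by (simp add: flat_boundary_def)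
  have \<Omega>b: "\<Omega> \<in> sets borel" using op by simp
  have fin: "emeasure lborel \<Omega> < \<infinity>" using emeasure_bounded_finite[OF bd] by (simp add: less_top[symmetric])
  have pr: "prob_space (P x)" for x using W[of x] by (simp add: brownian_motion_def levy_process_def)
  have br: "brownian (P x) W x" for x by (intro brownian.intro brownian_axioms.intro pr W)
  have sb: "subordinated (P x) W x D \<phi> \<nu>" for x
    by (intro subordinated.intro subordinated_axioms.intro br D indep)
  have std: "std_brownian (P 0) W" by (rule std_brownian.intro[OF br])
  interpret B: std_brownian "P 0" W by (rule std)
  interpret Z: subordinated "P 0" W 0 D \<phi> \<nu> by (rule sb)
  define \<rho> where "\<rho> t = distr (P 0) borel (D t)" for t
  have Dlaw: "prob_space (distr (P x) borel (D t))" "AE u in distr (P x) borel (D t). 0 < u"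
    "\<And>s. s > 0 \<Longrightarrow> (\<integral>u. exp (- s * u) \<partial>distr (P x) borel (D t)) = exp (- t * \<phi> s)" if t: "t > 0" for x t
  proof -
    interpret X: subordinated "P x" W x D \<phi> \<nu> by (rule sb)
    have m[measurable]: "D t \<in> borel_measurable (P x)" using t by (intro X.D_measurable) simp
    show "prob_space (distr (P x) borel (D t))" by (rule X.prob_space_distr) measurable
    show "AE u in distr (P x) borel (D t). 0 < u"
      by (subst AE_distr_iff) (use X.D_pos[OF _ t] in auto)
    show "(\<integral>u. exp (- s * u) \<partial>distr (P x) borel (D t)) = exp (- t * \<phi> s)" if "s > 0" for s
    proof -
      have "(\<integral>u. exp (- s * u) \<partial>distr (P x) borel (D t)) = (\<integral>\<omega>. exp (- s * D t \<omega>) \<partial>P x)"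
        by (rule integral_distr) measurable
      also have "\<dots> = exp (- t * \<phi> s)" using t that by (intro X.D_laplace) auto
      finally show ?thesis .
    qed
  qed
  \<comment> \<open>The law of the random time is the same under all \<open>P x\<close>, being determined by its Laplace transform.\<close>
  have law: "distr (P x) borel (D t) = \<rho> t" if t: "t > 0" for x t
    unfolding \<rho>_def
  proof (rule measure_eqI_laplace)
    show "AE u in distr (P x) borel (D t). 0 \<le> u" "AE u in distr (P 0) borel (D t). 0 \<le> u"
      by (rule eventually_mono[OF Dlaw(2)[OF t]], simp)+
  qed (use Dlaw[OF t] in auto)
  define g where "g u = enn2real (\<integral>\<^sup>+x. B.hit_prob \<Omega> x u * indicator \<Omega> x \<partial>lborel)" for u
  define h where "h u = enn2real (\<integral>\<^sup>+x. B.out_prob \<Omega> x u * indicator \<Omega> x \<partial>lborel)" for u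
  have hit1: "B.hit_prob \<Omega> x u \<le> 1" and out1: "B.out_prob \<Omega> x u \<le> 1" for x u
    by (simp_all add: B.hit_prob_def B.out_prob_def B.emeasure_le_1)
  have spectral: "measure lborel \<Omega> - spectral_heat_content P W D \<Omega> t = (\<integral>u. g u \<partial>\<rho> t)" if t: "t > 0" for t
    unfolding spectral_heat_content_def g_def
  proof (rule content_loss_eq[OF B.hit_prob_measurable hit1 _ _ \<Omega>b fin])
    show "prob_space (\<rho> t)" "sets (\<rho> t) = sets borel" using Dlaw(1)[OF t] by (simp_all add: \<rho>_def)
    show "measure (P x) {\<omega> \<in> space (P x). ereal t < exit_time (time_changed (killed W \<Omega>) D) (Some ` \<Omega>) \<omega>} = 1 - enn2real (\<integral>\<^sup>+u. B.hit_prob \<Omega> x u \<partial>\<rho> t)"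
      if "x \<in> \<Omega>" for x
      using subordinated.spectral_probability[OF sb std op that t] unfolding law[OF t] .
  qed
  have regular: "measure lborel \<Omega> - regular_heat_content P W D \<Omega> t = (\<integral>u. h u \<partial>\<rho> t)" if t: "t > 0" for t
    unfolding regular_heat_content_def h_def
  proof (rule content_loss_eq[OF B.out_prob_measurable[OF \<Omega>b] out1 _ _ \<Omega>b fin])
    show "prob_space (\<rho> t)" "sets (\<rho> t) = sets borel" using Dlaw(1)[OF t] by (simp_all add: \<rho>_def)
    show "measure (P x) {\<omega> \<in> space (P x). time_changed W D t \<omega> \<in> \<Omega>} = 1 - enn2real (\<integral>\<^sup>+u. B.out_prob \<Omega> x u \<partial>\<rho> t)" for x
      using subordinated.regular_probability[OF sb std op t] unfolding law[OF t] .
  qed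
  have le: "enn2real (\<integral>\<^sup>+x. p x * indicator \<Omega> x \<partial>lborel) \<le> measure lborel \<Omega>" if "\<And>x. p x \<le> 1" for p :: "'a \<Rightarrow> ennreal"
  proof -
    have "(\<integral>\<^sup>+x. p x * indicator \<Omega> x \<partial>lborel) \<le> (\<integral>\<^sup>+x. indicator \<Omega> x \<partial>lborel)"
      using that by (intro nn_integral_mono) (auto simp: indicator_def)
    also have "\<dots> = emeasure lborel \<Omega>" using \<Omega>b by simp
    finally show ?thesis using fin unfolding measure_def by (intro enn2real_mono) auto
  qed
  have g01: "0 \<le> g u \<and> g u \<le> measure lborel \<Omega>" for u unfolding g_def using le[OF hit1] by simp
  have h01: "0 \<le> h u \<and> h u \<le> measure lborel \<Omega>" for u unfolding h_def using le[OF out1] by simp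
  have meas: "(\<lambda>u. enn2real (\<integral>\<^sup>+x. p x u * indicator \<Omega> x \<partial>lborel)) \<in> borel_measurable borel"
    if pm: "(\<lambda>(x, u). p x u) \<in> borel_measurable (borel \<Otimes>\<^sub>M borel)" for p :: "'a \<Rightarrow> real \<Rightarrow> ennreal"
  proof -
    have [measurable]: "(\<lambda>q. p (fst q) (snd q)) \<in> borel_measurable (borel \<Otimes>\<^sub>M borel)" using pm by (simp add: case_prod_beta')
    note \<Omega>b[measurable]
    have [measurable]: "(\<lambda>q. p (snd q) (fst q)) \<in> borel_measurable (borel \<Otimes>\<^sub>M lborel)"
    proof -
      have "(\<lambda>q. (snd q, fst q)) \<in> (borel::real measure) \<Otimes>\<^sub>M (lborel::'a measure) \<rightarrow>\<^sub>M borel \<Otimes>\<^sub>M borel" by measurable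
      from measurable_compose[OF this \<open>(\<lambda>q. p (fst q) (snd q)) \<in> borel_measurable (borel \<Otimes>\<^sub>M borel)\<close>] show ?thesis by simp
    qed
    show ?thesis by measurable
  qed
  have gm: "g \<in> borel_measurable borel" unfolding g_def[abs_def] by (rule meas[OF B.hit_prob_measurable])
  have hm: "h \<in> borel_measurable borel" unfolding h_def[abs_def] by (rule meas[OF B.out_prob_measurable[OF \<Omega>b]])
  have glim: "((\<lambda>u. g u / sqrt u) \<longlongrightarrow> 2 * boundary_measure \<Omega> / sqrt pi) (at_right 0)"
    unfolding bm[symmetric]
  proof (rule Lim_transform_eventually[OF B.exit_loss_asymptotics[OF flat bd]])
    show "\<forall>\<^sub>F u in at_right 0. enn2real (B.exit_loss \<Omega> u) / sqrt u = g u / sqrt u"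
      using eventually_at_right_less[of 0] by eventually_elim (simp add: g_def B.exit_loss_def B.hit_prob_pos)
  qed
  have hlim: "((\<lambda>u. h u / sqrt u) \<longlongrightarrow> boundary_measure \<Omega> / sqrt pi) (at_right 0)"
    unfolding bm[symmetric]
  proof (rule Lim_transform_eventually[OF B.heat.heat_loss_asymptotics[OF flat bd]])
    show "\<forall>\<^sub>F u in at_right 0. enn2real (B.heat.heat_loss \<Omega> u) / sqrt u = h u / sqrt u"
      using eventually_at_right_less[of 0]
      by eventually_elim (simp add: h_def B.heat_loss_eq[OF _ op] B.out_prob_def max_def)
  qed
  obtain \<nu>' where S': "subordinator N S (\<lambda>s. s powr \<beta>) \<nu>'" using S by (auto simp: stable_subordinator_def)
  have N: "prob_space N" and S1: "S 1 \<in> borel_measurable N" using S' by (simp_all add: subordinator_def levy_process_def)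
  have S1pos: "0 \<le> S 1 \<omega>" if "\<omega> \<in> space N" for \<omega>
  proof -
    have "S 0 \<omega> = 0" "strict_mono_on {0..} (\<lambda>t. S t \<omega>)" using S' that by (auto simp: subordinator_def)
    then show ?thesis using strict_mono_onD[of "{0..}" "\<lambda>t. S t \<omega>" 0 1] by simp
  qed
  have SL: "(\<integral>\<omega>. exp (- s * S 1 \<omega>) \<partial>N) = exp (- (s powr \<beta>))" if "s > 0" for s
  proof -
    have "\<forall>t\<ge>0. \<forall>s>0. (\<integral>\<omega>. exp (- s * S t \<omega>) \<partial>N) = exp (- t * (s powr \<beta>))" using S' by (simp add: subordinator_def)
    then have "(\<integral>\<omega>. exp (- s * S 1 \<omega>) \<partial>N) = exp (- 1 * (s powr \<beta>))" using that zero_le_one by blast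
    then show ?thesis by simp
  qed
  have half: "(LINT \<omega>|N. S 1 \<omega> powr (1 / 2)) = (\<integral>\<omega>. sqrt (S 1 \<omega>) \<partial>N)"
    by (rule Bochner_Integration.integral_cong[OF refl]) (simp add: S1pos powr_half_sqrt)
  \<comment> \<open>Both losses are averages over the same laws, so one limit theorem serves for \<open>g\<close> and for \<open>h\<close>.\<close>
  have taub: "((\<lambda>t. (\<integral>u. f u \<partial>\<rho> t) / (inv_into {0<..} \<phi> (1 / t)) powr (- 1 / 2)) \<longlongrightarrow> (LINT \<omega>|N. S 1 \<omega> powr (1 / 2)) * c) (at_right 0)"
    if "f \<in> borel_measurable borel" "\<And>u. 0 \<le> f u \<and> f u \<le> measure lborel \<Omega>" "((\<lambda>u. f u / sqrt u) \<longlongrightarrow> c) (at_right 0)" for f c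
    unfolding half
  proof (rule subordination_tauberian[OF rv beta(1) _ _ _ _ N S1 _ SL that])
    fix t :: real assume t: "t > 0"
    show "prob_space (\<rho> t)" "sets (\<rho> t) = sets borel" "AE u in \<rho> t. 0 < u"
      unfolding \<rho>_def by (rule Dlaw[OF t] sets_distr)+
    show "(\<integral>u. exp (- s * u) \<partial>\<rho> t) = exp (- t * \<phi> s)" if "s > 0" for s
      using Dlaw(3)[OF t that] by (simp only: \<rho>_def)
  qed (use S1pos in auto)
  show ?thesis
  proof
    show "((\<lambda>t. (measure lborel \<Omega> - spectral_heat_content P W D \<Omega> t) / (inv_into {0<..} \<phi> (1 / t)) powr (- 1 / 2))
          \<longlongrightarrow> (LINT \<omega>|N. S 1 \<omega> powr (1 / 2)) * (2 * boundary_measure \<Omega> / sqrt pi)) (at_right 0)"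
      by (rule Lim_transform_eventually[OF taub[OF gm g01 glim]])
         (use eventually_at_right_less[of 0] in \<open>eventually_elim, simp add: spectral\<close>)
    show "((\<lambda>t. (measure lborel \<Omega> - regular_heat_content P W D \<Omega> t) / (inv_into {0<..} \<phi> (1 / t)) powr (- 1 / 2))
          \<longlongrightarrow> (LINT \<omega>|N. S 1 \<omega> powr (1 / 2)) * (boundary_measure \<Omega> / sqrt pi)) (at_right 0)"
      by (rule Lim_transform_eventually[OF taub[OF hm h01 hlim]])
         (use eventually_at_right_less[of 0] in \<open>eventually_elim, simp add: regular\<close>)
  qed
qed

end
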